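(* Let $1\le p_0<\infty$ and let $f$ and $g$ be two positive measurable functions on $\mathbb R^n$ such that, for every $w\in A_{p_0}$, $$\|g\|_{L^{p_0,\infty}(w)}\le \varphi(\|w\|_{A_{p_0}})\,\|f\|_{L^{p_0}(w)},$$ where $\varphi$ is a locally bounded function. Then, for every rearrangement invariant Banach function space $X$ on $\mathbb R^n$ such that $1<p_X\le q_X<\infty$, and every $w\in A_{p_X}$, $$\|g\|_{M_X(w)}\le C\|f\|_{X(w)},$$ with constant $C$ depending on $\|w\|_{A_{p_X}}$ (and not on $f,g$).
   Context: $\|g\|_{L^{p,\infty}(w)}=\sup_{y>0}y\,w(\{|g|>y\})^{1/p}$. $A_p$ is the Muckenhoupt class with $\|w\|_{A_p}=\sup_Q\big(\frac1{|Q|}\int_Qw\big)\big(\frac1{|Q|}\int_Qw^{-1/(p-1)}\big)^{p-1}$ for $1<p<\infty$ and $\|w\|_{A_1}=\sup_Q\big(\frac1{|Q|}\int_Qw\big)\|w^{-1}\|_{L^\infty(Q)}$. A function $\varphi$ on $(0,\infty)$ is locally bounded if $\sup_{0<t<K}\varphi(t)<\infty$ for every $K>0$. Rearrangement invariant Banach function spaces are in the sense of Bennett–Sharpley. $\bar X$ is the representation space of $X$ on $(0,\infty)$, so $\|f\|_X=\|f^*\|_{\bar X}$ with $f^*$ the decreasing rearrangement; $\varphi_X(t)=\|\chi_E\|_X$ with $|E|=t$ is the fundamental function. The Boyd indices are $p_X=\lim_{t\to\infty}\frac{\log t}{\log h_X(t)}$ and $q_X=\lim_{t\to0^+}\frac{\log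 t}{\log h_X(t)}$, where $h_X(t)$ is the norm on $\bar X$ of the dilation operator $D_tf(s)=f(s/t)$. $f_w^*$ denotes the decreasing rearrangement of $f$ with respect to $w(x)\,dx$; $X(w)=\{f: f^*_w\in\bar X\}$ with $\|f\|_{X(w)}=\|f_w^*\|_{\bar X}$. The Marcinkiewicz space $M_X$ has norm $\|f\|_{M_X}=\sup_{t>0}f^{**}(t)\varphi_X(t)$, $f^{**}(t)=\frac1t\int_0^tf^*(s)\,ds$; accordingly $\|g\|_{M_X(w)}=\sup_{t>0}\varphi_X(t)\frac1t\int_0^tg_w^*(s)\,ds$. *)

theory Defs
  imports "HOL-Analysis.Analysis" "HOL-Probability.Essential_Supremum"
begin

text \<open>Positive measurable functions take values in \<open>[0,\<infinity>]\<close> and are modelled by type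
  \<^typ>\<open>ennreal\<close>; in products the usual convention \<open>0 * \<infinity> = 0\<close> of measure theory applies.\<close>

definition enn_powr :: "ennreal \<Rightarrow> real \<Rightarrow> ennreal"  \<comment> \<open>only used for positive exponents\<close>
  where "enn_powr x a = (if x = \<infinity> then \<infinity> else ennreal (enn2real x powr a))"


section \<open>Weights\<close>

definition cubes :: "(real ^ 'n) set set"
  where "cubes = {cbox a (\<chi> i. a $ i + l) | a l. l > 0}"

definition avg :: "(real ^ 'n) set \<Rightarrow> (real ^ 'n \<Rightarrow> ennreal) \<Rightarrow> ennreal"
  where "avg Q h = (\<integral>\<^sup>+x\<in>Q. h x \<partial>lebesgue) / emeasure lebesgue Q"

text \<open>Since a weight is positive almost everywhere, the values \<open>0 powr _ = 0\<close> are immaterial below.\<close>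

definition weight :: "(real ^ 'n \<Rightarrow> real) \<Rightarrow> bool"
  where "weight w \<longleftrightarrow> w \<in> borel_measurable lebesgue \<and> (AE x in lebesgue. 0 < w x) \<and>
    (\<forall>Q\<in>cubes. (\<integral>\<^sup>+x\<in>Q. ennreal (w x) \<partial>lebesgue) < \<infinity>)"

definition Ap_norm :: "real \<Rightarrow> (real ^ 'n \<Rightarrow> real) \<Rightarrow> ennreal"
  where "Ap_norm p w =
    (if p = 1 then
       SUP Q\<in>cubes. avg Q (\<lambda>x. ennreal (w x)) * esssup (lebesgue_on Q) (\<lambda>x. inverse (ennreal (w x)))
     else
       SUP Q\<in>cubes. avg Q (\<lambda>x. ennreal (w x)) *
         enn_powr (avg Q (\<lambda>x. ennreal (w x powr (- 1 / (p - 1))))) (p - 1))"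

definition Ap :: "real \<Rightarrow> (real ^ 'n \<Rightarrow> real) set"
  where "Ap p = {w. weight w \<and> Ap_norm p w < \<infinity>}"

definition weighted :: "(real ^ 'n \<Rightarrow> real) \<Rightarrow> (real ^ 'n) measure"
  where "weighted w = density lebesgue (\<lambda>x. ennreal (w x))"


section \<open>Lebesgue norms and rearrangements\<close>

definition Lp_norm :: "'a measure \<Rightarrow> real \<Rightarrow> ('a \<Rightarrow> ennreal) \<Rightarrow> ennreal"
  where "Lp_norm M p f = enn_powr (\<integral>\<^sup>+x. enn_powr (f x) p \<partial>M) (1 / p)"

definition distr_fun :: "'a measure \<Rightarrow> ('a \<Rightarrow> ennreal) \<Rightarrow> ennreal \<Rightarrow> ennreal"
  where "distr_fun M f y = emeasure M {x \<in> space M. y < f x}"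

definition weak_Lp_norm :: "'a measure \<Rightarrow> real \<Rightarrow> ('a \<Rightarrow> ennreal) \<Rightarrow> ennreal"
  where "weak_Lp_norm M p f =
    (SUP y\<in>{0::real<..}. ennreal y * enn_powr (distr_fun M f (ennreal y)) (1 / p))"

text \<open>The decreasing rearrangement is meaningful for arguments \<open>t > 0\<close> (or \<open>t \<ge> 0\<close>) only.\<close>

definition rearr :: "'a measure \<Rightarrow> ('a \<Rightarrow> ennreal) \<Rightarrow> real \<Rightarrow> ennreal"
  where "rearr M f t = Inf {y. distr_fun M f y \<le> ennreal t}"

definition rearr_avg :: "'a measure \<Rightarrow> ('a \<Rightarrow> ennreal) \<Rightarrow> real \<Rightarrow> ennreal"
  where "rearr_avg M f t = ennreal (1 / t) * (\<integral>\<^sup>+s\<in>{0<..<t}. rearr M f s \<partial>lebesgue)"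


section \<open>Rearrangement invariant Banach function spaces\<close>

text \<open>As in Bennett and Sharpley, a Banach function space is given by its function norm \<open>\<rho>\<close>,
  defined on the cone of positive measurable functions: the space is the set of all measurable
  \<open>f\<close> with \<open>\<rho> \<bar>f\<bar> < \<infinity>\<close>, normed by \<open>\<rho> \<bar>f\<bar>\<close>.  The values of \<open>\<rho>\<close> at non-measurable arguments
  are irrelevant.\<close>

definition function_norm :: "'a measure \<Rightarrow> (('a \<Rightarrow> ennreal) \<Rightarrow> ennreal) \<Rightarrow> bool"
  where "function_norm M \<rho> \<longleftrightarrow>
    (\<forall>f\<in>borel_measurable M. \<rho> f = 0 \<longleftrightarrow> (AE x in M. f x = 0)) \<and>
    (\<forall>f\<in>borel_measurable M. \<forall>a::real. a \<ge> 0 \<longrightarrow> \<rho> (\<lambda>x. ennreal a * f x) = ennreal a * \<rho> f) \<and>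
    (\<forall>f\<in>borel_measurable M. \<forall>g\<in>borel_measurable M. \<rho> (\<lambda>x. f x + g x) \<le> \<rho> f + \<rho> g) \<and>
    (\<forall>f\<in>borel_measurable M. \<forall>g\<in>borel_measurable M. (AE x in M. g x \<le> f x) \<longrightarrow> \<rho> g \<le> \<rho> f) \<and>
    (\<forall>F f. (\<forall>k::nat. F k \<in> borel_measurable M) \<longrightarrow> f \<in> borel_measurable M \<longrightarrow>
       (AE x in M. incseq (\<lambda>k. F k x) \<and> (\<lambda>k. F k x) \<longlonglongrightarrow> f x) \<longrightarrow>
       incseq (\<lambda>k. \<rho> (F k)) \<and> (\<lambda>k. \<rho> (F k)) \<longlonglongrightarrow> \<rho> f) \<and>
    (\<forall>E\<in>sets M. emeasure M E < \<infinity> \<longrightarrow> \<rho> (indicator E) < \<infinity>) \<and>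
    (\<forall>E\<in>sets M. emeasure M E < \<infinity> \<longrightarrow>
       (\<exists>C>0::real. \<forall>f\<in>borel_measurable M. (\<integral>\<^sup>+x\<in>E. f x \<partial>M) \<le> ennreal C * \<rho> f))"

definition ae_finite_measurable :: "'a measure \<Rightarrow> ('a \<Rightarrow> ennreal) set"
  where "ae_finite_measurable M = {f \<in> borel_measurable M. AE x in M. f x < \<infinity>}"

definition ri_norm :: "'a measure \<Rightarrow> (('a \<Rightarrow> ennreal) \<Rightarrow> ennreal) \<Rightarrow> bool"
  where "ri_norm M \<rho> \<longleftrightarrow> function_norm M \<rho> \<and>
    (\<forall>f\<in>ae_finite_measurable M. \<forall>g\<in>ae_finite_measurable M.
       (\<forall>y::real. y \<ge> 0 \<longrightarrow> distr_fun M f (ennreal y) = distr_fun M g (ennreal y)) \<longrightarrow> \<rho> f = \<rho> g)"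

text \<open>The norm of the representation space.  By the Luxemburg representation theorem such an r.i.
  norm on \<open>(0,\<infinity>)\<close> exists, and, as Lebesgue measure on \<open>\<real>\<^sup>n\<close> is nonatomic and infinite, its values at
  measurable functions are uniquely determined.  Only these values (which depend only on the
  restriction of the argument to \<open>(0,\<infinity>)\<close>) are used.\<close>

definition rep_norm :: "((real ^ 'n \<Rightarrow> ennreal) \<Rightarrow> ennreal) \<Rightarrow> (real \<Rightarrow> ennreal) \<Rightarrow> ennreal"
  where "rep_norm \<rho> = (SOME \<sigma>. ri_norm (lebesgue_on {0<..}) \<sigma> \<and>
    (\<forall>f\<in>ae_finite_measurable lebesgue. \<rho> f = \<sigma> (rearr lebesgue f)))"

text \<open>By rearrangement invariance the choice of \<open>E\<close> is irrelevant.\<close>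

definition fundamental_fun :: "((real ^ 'n \<Rightarrow> ennreal) \<Rightarrow> ennreal) \<Rightarrow> real \<Rightarrow> ennreal"
  where "fundamental_fun \<rho> t =
    \<rho> (indicator (SOME E. E \<in> sets lebesgue \<and> emeasure lebesgue E = ennreal t))"

definition dilation_norm :: "((real ^ 'n \<Rightarrow> ennreal) \<Rightarrow> ennreal) \<Rightarrow> real \<Rightarrow> ennreal"
  where "dilation_norm \<rho> t =
    (SUP f\<in>{f \<in> borel_measurable (lebesgue_on {0<..}). rep_norm \<rho> f \<le> 1}.
       rep_norm \<rho> (\<lambda>s. f (s / t)))"

text \<open>\<open>log h\<^sub>X(t)\<close> has the same sign as \<open>log t\<close> or vanishes, and it may vanish even if \<open>t \<noteq> 1\<close>
  (for \<open>L\<^sup>\<infinity>\<close>, say); the quotient is then \<open>+\<infinity>\<close>.\<close>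

definition boyd_quotient :: "((real ^ 'n \<Rightarrow> ennreal) \<Rightarrow> ennreal) \<Rightarrow> real \<Rightarrow> ereal"
  where "boyd_quotient \<rho> t =
    (let h = enn2real (dilation_norm \<rho> t) in if ln h = 0 then \<infinity> else ereal (ln t / ln h))"

definition boyd_p :: "((real ^ 'n \<Rightarrow> ennreal) \<Rightarrow> ennreal) \<Rightarrow> ereal"
  where "boyd_p \<rho> = Lim at_top (boyd_quotient \<rho>)"

definition boyd_q :: "((real ^ 'n \<Rightarrow> ennreal) \<Rightarrow> ennreal) \<Rightarrow> ereal"
  where "boyd_q \<rho> = Lim (at_right 0) (boyd_quotient \<rho>)"

definition X_norm ::
    "((real ^ 'n \<Rightarrow> ennreal) \<Rightarrow> ennreal) \<Rightarrow> (real ^ 'n \<Rightarrow> real) \<Rightarrow> (real ^ 'n \<Rightarrow> ennreal) \<Rightarrow> ennreal"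
  where "X_norm \<rho> w f = rep_norm \<rho> (rearr (weighted w) f)"

definition Marcinkiewicz_norm ::
    "((real ^ 'n \<Rightarrow> ennreal) \<Rightarrow> ennreal) \<Rightarrow> (real ^ 'n \<Rightarrow> real) \<Rightarrow> (real ^ 'n \<Rightarrow> ennreal) \<Rightarrow> ennreal"
  where "Marcinkiewicz_norm \<rho> w g =
    (SUP t\<in>{0<..}. fundamental_fun \<rho> t * rearr_avg (weighted w) g t)"

definition locally_bounded :: "(real \<Rightarrow> ennreal) \<Rightarrow> bool"
  where "locally_bounded \<phi> \<longleftrightarrow> (\<forall>K>0. (SUP t\<in>{0<..<K}. \<phi> t) < \<infinity>)"

end

theory Submission
  imports Defs
begin

text \<open>It suffices to bound \<open>y\<close> when \<open>g > y\<close> on a set \<open>E\<close> with \<open>0 < w(E) < \<infinity>\<close>.  Since \<open>p\<^sub>X > 1\<close> and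
  \<open>q\<^sub>X < \<infinity>\<close>, a bound on the norm of \<open>f\<close> in \<open>X(w)\<close> gives, after normalisation,
  \<open>w(f > z) \<le> w(E) (z\<^sup>-\<^sup>p + z\<^sup>-\<^sup>q)\<close> for some \<open>p < p\<^sub>X\<close> and \<open>q > q\<^sub>X\<close> with \<open>w\<close> still in \<open>A\<^sub>p\<close>, because the
  Muckenhoupt classes are open.  Let \<open>F = (M((max f \<chi>\<^sub>E)\<^sup>s))\<^sup>1\<^sup>/\<^sup>s\<close> and \<open>V = (M((w \<chi>\<^sub>E)\<^sup>s))\<^sup>1\<^sup>/\<^sup>s\<close> with
  \<open>s > 1\<close> close to 1.  By Coifman and Rochberg both are \<open>A\<^sub>1\<close> weights with constants depending on \<open>s\<close> and
  the dimension only, so that \<open>v = F\<^sup>1\<^sup>-\<^sup>p\<^sup>0 V\<close> is an admissible weight in the hypothesis.  There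
  \<open>\<integral> f\<^sup>p\<^sup>0 v \<le> \<integral> F V\<close> is at most a multiple of \<open>w(E)\<close>, by Hoelder's inequality and strong type
  estimates for \<open>M\<close>, whereas \<open>v(E)\<close> is at least a multiple of \<open>w(E)\<close>, because \<open>V \<ge> w\<close> on \<open>E\<close> and \<open>F\<close> is
  bounded by a constant on half of \<open>E\<close>.  Hence \<open>y\<close> is bounded.  The resulting weak type estimate can be
  integrated to the Marcinkiewicz norm because \<open>p\<^sub>X > 1\<close>.\<close>

text \<open>Taking the maximum of f with the indicator of E makes F positive everywhere even if f
  vanishes, so that the negative power of F is a genuine weight; in the distribution function it
  costs only a multiple of w(E). The power s inside the maximal functions makes their A_1 constants
  forget w and f, so \<phi> is evaluated on a bounded range only.

  As X is controlled merely through two powers, no single L^r norm of F is under control. The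
  product F V is therefore split by Young's inequality with an exponent r1 < p where F > 1 and
  another one r2 > q where F <= 1. On the side of V the conjugate exponents b produce the dual
  weight w^(1-b), and handling the power s there takes the A_(b/s) condition instead of the A_b
  condition. Reverse Hoelder for w supplies this gain, while reverse Hoelder for the dual weight
  supplies the openness in p. Normalising f by the ratio of the fundamental function at w(E) to the
  norm turns every integral into a multiple of w(E), which cancels at the end.\<close>

section \<open>Powers, Young's and Hoelder's inequality with values in [0, infinity]\<close>

lemma enn_powr_top [simp]: "enn_powr \<infinity> a = \<infinity>" "enn_powr top a = top"
  by (auto simp: enn_powr_def)

lemma enn_powr_0 [simp]: "enn_powr 0 a = 0"
  by (auto simp: enn_powr_def)

lemma enn_powr_one [simp]: "enn_powr 1 a = 1"
  by (auto simp: enn_powr_def)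

lemma enn_powr_ennreal: "0 \<le> r \<Longrightarrow> enn_powr (ennreal r) a = ennreal (r powr a)"
  by (auto simp: enn_powr_def)

lemma enn_powr_one_right [simp]: "enn_powr x 1 = x"
  by (cases x) (auto simp: enn_powr_def)

lemma enn_powr_eq_top_iff [simp]: "enn_powr x a = top \<longleftrightarrow> x = top"
  by (cases x) (auto simp: enn_powr_def)

lemma enn_powr_eq_0_iff [simp]: "enn_powr x a = 0 \<longleftrightarrow> x = 0"
  by (cases x) (auto simp: enn_powr_def)

lemma enn_powr_pos_iff [simp]: "0 < enn_powr x a \<longleftrightarrow> 0 < x"
  by (simp add: zero_less_iff_neq_zero)

lemma enn_powr_mono: "0 \<le> a \<Longrightarrow> x \<le> y \<Longrightarrow> enn_powr x a \<le> enn_powr y a"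
  by (cases x; cases y) (auto simp: enn_powr_ennreal top_unique intro!: ennreal_leI powr_mono2)

lemma enn_powr_le_iff: "0 < a \<Longrightarrow> enn_powr x a \<le> enn_powr y a \<longleftrightarrow> x \<le> y"
proof (cases x; cases y)
  fix r s :: real assume "0 < a" "0 \<le> r" "x = ennreal r" "0 \<le> s" "y = ennreal s"
  then show ?thesis
    using powr_less_mono2[of a s r] powr_mono2[of a r s] by (auto simp: enn_powr_ennreal not_le[symmetric])
qed (auto simp: top_unique enn_powr_ennreal)

lemma enn_powr_less_iff: "0 < a \<Longrightarrow> enn_powr x a < enn_powr y a \<longleftrightarrow> x < y"
  using enn_powr_le_iff[of a y x] by (auto simp: not_le[symmetric])

lemma enn_powr_mult: "0 < a \<Longrightarrow> enn_powr (x * y) a = enn_powr x a * enn_powr y a"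
proof (cases x; cases y)
  fix r s :: real assume "0 < a" "0 \<le> r" "x = ennreal r" "0 \<le> s" "y = ennreal s"
  then show ?thesis
    by (simp add: enn_powr_ennreal ennreal_mult[symmetric] powr_mult)
qed (auto simp: ennreal_mult_top ennreal_top_mult enn_powr_ennreal)

lemma enn_powr_powr: "enn_powr (enn_powr x a) b = enn_powr x (a * b)"
  by (cases x) (auto simp: enn_powr_ennreal powr_powr)

lemma enn_powr_add: "0 < a \<Longrightarrow> 0 < b \<Longrightarrow> enn_powr x (a + b) = enn_powr x a * enn_powr x b"
  by (cases x) (auto simp: enn_powr_ennreal powr_add ennreal_mult)

lemma enn_powr_measurable [measurable]:
  assumes "f \<in> borel_measurable M"
  shows "(\<lambda>x. enn_powr (f x) a) \<in> borel_measurable M"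
proof -
  note assms [measurable]
  show ?thesis unfolding enn_powr_def by measurable
qed

lemma enn_powr_sum_le:
  assumes "0 < a"
  shows "enn_powr (x + y) a \<le> ennreal (2 powr a) * (enn_powr x a + enn_powr y a)"
proof -
  have "x + y \<le> 2 * max x y"
    unfolding mult_2 by (rule add_mono) auto
  then have "enn_powr (x + y) a \<le> enn_powr (2 * max x y) a"
    using assms by (intro enn_powr_mono) auto
  also have "\<dots> = ennreal (2 powr a) * enn_powr (max x y) a"
    using assms enn_powr_ennreal[of 2 a] by (simp add: enn_powr_mult)
  also have "\<dots> \<le> ennreal (2 powr a) * (enn_powr x a + enn_powr y a)"
    by (intro mult_left_mono) (auto simp: max_def)
  finally show ?thesis .
qed

text \<open>The cases are separated by the curve y = x^(a-1), on which both terms on the right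
  coincide with the product. Omitting the sharp factors 1/a and 1/a' reduces each side of the curve
  to one monotonicity step, at the price of a constant in all later estimates.\<close>

lemma young_ennreal:
  assumes "1 < a"
  shows "x * y \<le> enn_powr x a + enn_powr y (a / (a - 1))"
proof (cases "y \<le> enn_powr x (a - 1)")
  case True
  have "x * y \<le> enn_powr x 1 * enn_powr x (a - 1)"
    using True by (auto intro: mult_left_mono)
  also have "\<dots> = enn_powr x a"
    using assms enn_powr_add[of 1 "a - 1" x] by simp
  finally show ?thesis by (simp add: add_increasing2)
next
  case False
  have "enn_powr x (a - 1) \<le> enn_powr (enn_powr y (1 / (a - 1))) (a - 1)"
    using False assms by (simp add: enn_powr_powr)
  then have "x \<le> enn_powr y (1 / (a - 1))"
    using assms by (subst (asm) enn_powr_le_iff) auto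
  then have "x * y \<le> enn_powr y (1 / (a - 1)) * enn_powr y 1"
    by (auto intro: mult_right_mono)
  also have "\<dots> = enn_powr y (1 / (a - 1) + 1)"
    using assms by (intro enn_powr_add[symmetric]) auto
  also have "1 / (a - 1) + 1 = a / (a - 1)"
    using assms by (simp add: field_simps)
  finally show ?thesis by (simp add: add_increasing)
qed

text \<open>Young's inequality for c f and g / c, with the scaling c chosen optimally. The
  inequality is raised to the power a so that it can be combined with A_p quantities without
  extracting roots; the factor 2^a stems from the unsharp form of Young's inequality.\<close>

lemma holder_nn_integral:
  assumes a: "1 < a" and [measurable]: "f \<in> borel_measurable M" "g \<in> borel_measurable M"
  shows "enn_powr (\<integral>\<^sup>+x. f x * g x \<partial>M) a \<le>
    ennreal (2 powr a) * (\<integral>\<^sup>+x. enn_powr (f x) a \<partial>M) *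
      enn_powr (\<integral>\<^sup>+x. enn_powr (g x) (a / (a - 1)) \<partial>M) (a - 1)"
proof -
  define b where "b = a / (a - 1)"
  define A where "A = (\<integral>\<^sup>+x. enn_powr (f x) a \<partial>M)"
  define B where "B = (\<integral>\<^sup>+x. enn_powr (g x) b \<partial>M)"
  have b: "1 < b" using a by (simp add: b_def field_simps)
  \<comment> \<open>If one integral vanishes, the product vanishes almost everywhere, in accordance
    with 0 * infinity = 0. Otherwise an infinite integral makes the bound infinite. Only the
    remaining case admits a scaling.\<close>
  consider "A = 0 \<or> B = 0" | "A \<noteq> 0" "B \<noteq> 0" "A = top \<or> B = top"
    | "A \<noteq> 0" "B \<noteq> 0" "A \<noteq> top" "B \<noteq> top" by blast
  then have "enn_powr (\<integral>\<^sup>+x. f x * g x \<partial>M) a \<le> ennreal (2 powr a) * A * enn_powr B (a - 1)"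
  proof cases
    case 1
    then have "(AE x in M. f x = 0) \<or> (AE x in M. g x = 0)"
      unfolding A_def B_def by (subst (asm) (1 2) nn_integral_0_iff_AE) auto
    then have "AE x in M. f x * g x = 0" by auto
    then have "(\<integral>\<^sup>+x. f x * g x \<partial>M) = 0"
      by (subst nn_integral_0_iff_AE) auto
    then show ?thesis by simp
  next
    case 2
    then have "ennreal (2 powr a) * A * enn_powr B (a - 1) = top"
      using a by (auto simp: ennreal_mult_eq_top_iff ennreal_eq_0_iff)
    then show ?thesis by simp
  next
    case 3
    then obtain A' B' where AB: "A = ennreal A'" "B = ennreal B'" "0 < A'" "0 < B'"
      by (cases A; cases B) (auto simp: ennreal_eq_0_iff less_le)
    \<comment> \<open>This c balances the two terms: c^a A' = c^(-b) B' means c^(a+b) = B' / A', and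
      a + b = a b for conjugate exponents.\<close>
    define c where "c = (B' / A') powr (1 / (a * b))"
    have c: "0 < c" using AB by (simp add: c_def)
    have le: "f x * g x \<le> ennreal (c powr a) * enn_powr (f x) a + ennreal (c powr - b) * enn_powr (g x) b" for x
    proof -
      have "f x * g x = (ennreal c * f x) * (ennreal (1 / c) * g x)"
      proof -
        have "ennreal c * ennreal (1 / c) = 1"
          using c by (subst ennreal_mult[symmetric]) auto
        then show ?thesis by (metis mult.assoc mult.commute mult.left_neutral)
      qed
      also have "\<dots> \<le> enn_powr (ennreal c * f x) a + enn_powr (ennreal (1 / c) * g x) b"
        unfolding b_def by (rule young_ennreal[OF a])
      finally show ?thesis
        using c a b by (simp add: enn_powr_mult enn_powr_ennreal powr_minus_divide powr_divide)
    qed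
    have "(\<integral>\<^sup>+x. f x * g x \<partial>M) \<le> (\<integral>\<^sup>+x. ennreal (c powr a) * enn_powr (f x) a + ennreal (c powr - b) * enn_powr (g x) b \<partial>M)"
      by (intro nn_integral_mono le)
    also have "\<dots> = ennreal (c powr a) * A + ennreal (c powr - b) * B"
      by (simp add: nn_integral_add nn_integral_cmult A_def B_def)
    also have "\<dots> = ennreal (c powr a * A' + c powr - b * B')"
      using AB by (simp add: ennreal_mult)
    also have "c powr a * A' + c powr - b * B' = 2 * (A' powr (1 / a) * B' powr (1 / b))"
    proof -
      have ab: "1 / a + 1 / b = 1" using a by (simp add: b_def field_simps)
      have "c powr a * A' = A' powr (1 / a) * B' powr (1 / b)"
      proof -
        have "c powr a = (B' / A') powr (1 / b)"
          using a b by (simp add: c_def powr_powr)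
        then have "c powr a * A' = B' powr (1 / b) * (A' powr 1 / A' powr (1 / b))"
          using AB by (simp add: powr_divide)
        also have "A' powr 1 / A' powr (1 / b) = A' powr (1 - 1 / b)"
          using AB by (subst powr_diff) auto
        also have "1 - 1 / b = 1 / a" using ab by simp
        finally show ?thesis by simp
      qed
      moreover have "c powr - b * B' = A' powr (1 / a) * B' powr (1 / b)"
      proof -
        have "c powr - b = (B' / A') powr - (1 / a)"
          using a b by (simp add: c_def powr_powr)
        also have "\<dots> = (A' / B') powr (1 / a)"
          using AB by (simp add: powr_minus powr_divide)
        finally have "c powr - b * B' = A' powr (1 / a) * (B' powr 1 / B' powr (1 / a))"
          using AB by (simp add: powr_divide)
        also have "B' powr 1 / B' powr (1 / a) = B' powr (1 - 1 / a)"
          using AB by (subst powr_diff) auto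
        also have "1 - 1 / a = 1 / b" using ab by simp
        finally show ?thesis .
      qed
      ultimately show ?thesis by simp
    qed
    finally have "enn_powr (\<integral>\<^sup>+x. f x * g x \<partial>M) a \<le> enn_powr (ennreal (2 * (A' powr (1 / a) * B' powr (1 / b)))) a"
      using a by (intro enn_powr_mono) auto
    also have "\<dots> = ennreal (2 powr a * (A' * B' powr (a / b)))"
      using a AB by (simp add: enn_powr_ennreal powr_mult powr_powr)
    also have "a / b = a - 1" using a by (simp add: b_def)
    finally show ?thesis
      using AB by (simp add: enn_powr_ennreal ennreal_mult mult.assoc)
  qed
  then show ?thesis by (simp add: A_def B_def b_def)
qed

section \<open>Dyadic layer sums and Marcinkiewicz interpolation\<close>

lemma suminf_ennreal_ge_term: "f k \<le> (\<Sum>k. f k :: ennreal)"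
  using sum_le_suminf[of f "{k}"] by auto

lemma ennreal_ge_nat_imp_top:
  fixes x :: ennreal
  assumes "\<And>n. of_nat n \<le> x"
  shows "x = top"
proof (cases x)
  case (real r)
  obtain n where "r < real n" using reals_Archimedean2 by blast
  then show ?thesis using assms[of n] real by (auto simp: ennreal_of_nat_eq_real_of_nat ennreal_le_iff2)
qed

lemma exists_dyadic_scale:
  fixes z r :: real
  assumes "0 < z" "z < r"
  obtains k where "2 ^ k * z < r" "r \<le> 2 ^ (k + 1) * z"
proof -
  obtain n where n: "r / z < 2 ^ n" using real_arch_pow[of 2 "r / z"] by auto
  define m where "m = (LEAST n. r \<le> 2 ^ n * z)"
  have ex: "r \<le> 2 ^ n * z" using n assms by (simp add: field_simps)
  have m: "r \<le> 2 ^ m * z" unfolding m_def by (rule LeastI[where P="\<lambda>n. r \<le> 2 ^ n * z", OF ex])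
  have "m \<noteq> 0" using m assms by (cases m) auto
  then obtain k where k: "m = Suc k" by (cases m) auto
  have "\<not> r \<le> 2 ^ k * z" using not_less_Least[of k "\<lambda>n. r \<le> 2 ^ n * z"] k m_def by simp
  then show ?thesis using that m k by (auto simp: not_le)
qed

text \<open>A discrete substitute for the layer cake formula: the term whose dyadic interval
  contains h already dominates h^a, and integrating the sum produces values of the distribution
  function. For infinite h the terms are unbounded, so the sum is infinite as well.\<close>

lemma enn_powr_le_dyadic_up:
  fixes h :: ennreal
  assumes "0 < z" "0 < a" "ennreal z < h"
  shows "enn_powr h a \<le> (\<Sum>k. ennreal ((2 ^ (k + 1) * z) powr a) * (if ennreal (2 ^ k * z) < h then 1 else 0))"
    (is "_ \<le> (\<Sum>k. ?t k)")
proof (cases h)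
  case (real r)
  with assms have "z < r" by (simp add: ennreal_less_iff)
  with assms obtain k where k: "2 ^ k * z < r" "r \<le> 2 ^ (k + 1) * z"
    using exists_dyadic_scale by blast
  have "enn_powr h a \<le> ?t k"
    using k real assms by (auto simp: enn_powr_ennreal ennreal_less_iff intro!: ennreal_leI powr_mono2)
  then show ?thesis using suminf_ennreal_ge_term[of ?t k] by (rule order_trans)
next
  case top
  have "of_nat n \<le> (\<Sum>k. ?t k)" for n
  proof -
    obtain k where "real n powr (1 / a) / z < 2 ^ k"
      using real_arch_pow[of 2 "real n powr (1 / a) / z"] by auto
    then have "real n powr (1 / a) \<le> 2 ^ k * z" using assms by (simp add: field_simps)
    also have "\<dots> \<le> 2 ^ (k + 1) * z" using assms by simp
    finally have "(real n powr (1 / a)) powr a \<le> (2 ^ (k + 1) * z) powr a"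
      using assms by (intro powr_mono2) auto
    then have "real n \<le> (2 ^ (k + 1) * z) powr a" using assms by (simp add: powr_powr)
    then have "of_nat n \<le> ?t k" using top by (simp add: ennreal_of_nat_eq_real_of_nat)
    then show ?thesis using suminf_ennreal_ge_term[of ?t k] by order
  qed
  then have "(\<Sum>k. ?t k) = top"
    by (rule ennreal_ge_nat_imp_top)
  then show ?thesis by simp
qed

lemma enn_powr_le_dyadic_down:
  fixes h :: ennreal
  assumes "0 < z" "0 < a" "h \<le> ennreal z"
  shows "enn_powr h a \<le> (\<Sum>k. ennreal ((z / 2 ^ k) powr a) * (if ennreal (z / 2 ^ (k + 1)) < h then 1 else 0))"
    (is "_ \<le> (\<Sum>k. ?t k)")
proof (cases "h = 0")
  case False
  with assms obtain r where r: "h = ennreal r" "0 < r" "r \<le> z"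
    by (cases h) (auto simp: ennreal_le_iff2 top_unique ennreal_eq_0_iff less_le)
  define m where "m = (LEAST n. z / 2 ^ n < r)"
  obtain n where "z / r < 2 ^ n" using real_arch_pow[of 2 "z / r"] by auto
  then have ex: "z / 2 ^ n < r" using r by (simp add: field_simps)
  have m: "z / 2 ^ m < r" unfolding m_def by (rule LeastI[where P="\<lambda>n. z / 2 ^ n < r", OF ex])
  have "m \<noteq> 0" using m r by (cases m) auto
  then obtain k where k: "m = Suc k" by (cases m) auto
  have "\<not> z / 2 ^ k < r" using not_less_Least[of k "\<lambda>n. z / 2 ^ n < r"] k m_def by simp
  then have "enn_powr h a \<le> ?t k"
    using m k r assms by (auto simp: enn_powr_ennreal ennreal_less_iff intro!: ennreal_leI powr_mono2)
  then show ?thesis using suminf_ennreal_ge_term[of ?t k] by (rule order_trans)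
qed auto

text \<open>The last active term dominates the geometric sum before it. Induction on partial sums
  treats finite and infinite h alike, since each active level is below h.\<close>

lemma dyadic_sum_le_enn_powr:
  fixes h :: ennreal
  assumes "0 < z" "0 < d"
  shows "(\<Sum>k. ennreal ((2 ^ k * z) powr d) * (if ennreal (2 ^ k * z) < h then 1 else 0))
    \<le> ennreal (2 powr d / (2 powr d - 1)) * enn_powr h d"
    (is "(\<Sum>k. ?t k) \<le> ennreal ?C * _")
proof -
  have d1: "1 < 2 powr d" "1 \<le> 2 powr d" using assms ge_one_powr_ge_zero[of 2 d] by simp_all
  have "(\<Sum>k<n. ?t k) \<le> ennreal ?C * enn_powr h d" for n
  proof (induction n)
    case (Suc n)
    show ?case
    proof (cases "ennreal (2 ^ n * z) < h")
      case False
      then show ?thesis using Suc by simp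
    next
      case True
      have eq: "(2 ^ k * z) powr d = z powr d * (2 powr d) ^ k" for k
        using assms by (simp add: powr_mult powr_power mult.commute powr_realpow[symmetric] powr_powr)
      have "(\<Sum>k<Suc n. ?t k) \<le> (\<Sum>k<Suc n. ennreal ((2 ^ k * z) powr d))"
        by (intro sum_mono) auto
      also have "\<dots> = ennreal (\<Sum>k<Suc n. z powr d * (2 powr d) ^ k)"
        by (subst sum_ennreal) (auto simp: eq)
      also have "(\<Sum>k<Suc n. z powr d * (2 powr d) ^ k) = z powr d * (((2 powr d) ^ Suc n - 1) / (2 powr d - 1))"
        using d1 by (subst sum_distrib_left[symmetric], subst geometric_sum) auto
      also have "ennreal \<dots> \<le> ennreal (?C * (2 ^ n * z) powr d)"
        using d1 unfolding eq by (intro ennreal_leI) (simp add: divide_simps mult.commute mult.left_commute)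
      also have "\<dots> = ennreal ?C * enn_powr (ennreal (2 ^ n * z)) d"
        using d1 assms enn_powr_ennreal[of "2 ^ n * z" d] by (subst ennreal_mult) (auto intro!: divide_nonneg_nonneg)
      also have "\<dots> \<le> ennreal ?C * enn_powr h d"
        using True assms by (intro mult_left_mono enn_powr_mono) auto
      finally show ?thesis .
    qed
  qed auto
  then show ?thesis
    by (simp add: suminf_eq_SUP SUP_le_iff)
qed

lemma nn_integral_if_one:
  assumes "{x \<in> space M. P x} \<in> sets M"
  shows "(\<integral>\<^sup>+x. (if P x then 1 else 0) \<partial>M) = emeasure M {x \<in> space M. P x}"
proof -
  have "(\<integral>\<^sup>+x. (if P x then 1 else 0) \<partial>M) = (\<integral>\<^sup>+x. indicator {x \<in> space M. P x} x \<partial>M)"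
    by (intro nn_integral_cong) (auto simp: indicator_def)
  then show ?thesis using assms by simp
qed

lemma suminf_ennreal_geometric:
  assumes "0 \<le> c" "0 \<le> r" "r < 1"
  shows "(\<Sum>k. ennreal (c * r ^ k)) = ennreal (c / (1 - r))"
  using assms by (subst suminf_ennreal2) (auto simp: suminf_mult suminf_geometric intro!: summable_mult summable_geometric)

text \<open>A tail decaying like y^(-b) makes the dyadic terms of h^a shrink by the factor 2^(a-b) <
  1, so the level z alone determines the size of the integral.\<close>

lemma tail_integral_above:
  assumes [measurable]: "h \<in> borel_measurable M" and z: "0 < z" and ab: "0 < a" "a < b"
    and tail: "\<And>y. z \<le> y \<Longrightarrow> emeasure M {x \<in> space M. ennreal y < h x} \<le> T * ennreal ((z / y) powr b)"
  shows "(\<integral>\<^sup>+x. (if ennreal z < h x then enn_powr (h x) a else 0) \<partial>M)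
    \<le> ennreal (2 powr a / (1 - 2 powr (a - b))) * T * ennreal (z powr a)"
proof -
  define c where "c k = (2 ^ (k + 1) * z) powr a" for k :: nat
  have "(\<integral>\<^sup>+x. (if ennreal z < h x then enn_powr (h x) a else 0) \<partial>M)
      \<le> (\<integral>\<^sup>+x. (\<Sum>k. ennreal (c k) * (if ennreal (2 ^ k * z) < h x then 1 else 0)) \<partial>M)"
    using enn_powr_le_dyadic_up[OF z ab(1)] unfolding c_def by (intro nn_integral_mono) auto
  also have "\<dots> = (\<Sum>k. ennreal (c k) * emeasure M {x \<in> space M. ennreal (2 ^ k * z) < h x})"
    by (subst nn_integral_suminf) (auto simp: nn_integral_cmult nn_integral_if_one)
  also have "\<dots> \<le> (\<Sum>k. T * ennreal ((2 * z) powr a * (2 powr (a - b)) ^ k))"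
  proof (intro suminf_le allI)
    fix k
    have z1: "1 * z \<le> 2 ^ k * z" using z by (intro mult_right_mono) auto
    have "ennreal (c k) * emeasure M {x \<in> space M. ennreal (2 ^ k * z) < h x}
      \<le> ennreal (c k) * (T * ennreal ((z / (2 ^ k * z)) powr b))"
      using z1 by (intro mult_left_mono tail) auto
    also have "\<dots> = T * ennreal (c k * (z / (2 ^ k * z)) powr b)"
      by (simp add: ennreal_mult c_def mult.left_commute)
    also have "c k * (z / (2 ^ k * z)) powr b = (2 * z) powr a * (2 powr (a - b)) ^ k"
    proof -
      have "c k = (2 * z) powr a * (2 powr a) ^ k"
        using z by (simp add: c_def powr_mult powr_power powr_realpow[symmetric] powr_powr mult.commute)
      moreover have "(z / (2 ^ k * z)) powr b = 1 / (2 powr b) ^ k"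
        using z by (simp add: powr_divide powr_power powr_realpow[symmetric] powr_powr mult.commute)
      ultimately show ?thesis by (simp add: powr_diff power_divide)
    qed
    finally show "ennreal (c k) * emeasure M {x \<in> space M. ennreal (2 ^ k * z) < h x}
      \<le> T * ennreal ((2 * z) powr a * (2 powr (a - b)) ^ k)" .
  qed auto
  also have "\<dots> = T * ennreal ((2 * z) powr a / (1 - 2 powr (a - b)))"
    using ab powr_less_one[of 2 "a - b"] by (subst ennreal_suminf_cmult, subst suminf_ennreal_geometric) auto
  also have "\<dots> = ennreal (2 powr a / (1 - 2 powr (a - b))) * T * ennreal (z powr a)"
  proof -
    have "2 powr (a - b) < 1" using ab powr_less_one[of 2 "a - b"] by simp
    then have "ennreal ((2 * z) powr a / (1 - 2 powr (a - b))) = ennreal (2 powr a / (1 - 2 powr (a - b))) * ennreal (z powr a)"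
      using z by (subst ennreal_mult[symmetric]) (auto simp: powr_mult)
    then show ?thesis by (simp add: mult_ac)
  qed
  finally show ?thesis .
qed

text \<open>The mirror image towards level 0: now b < a, and halving the level gains the factor
  2^(b-a) < 1.\<close>

lemma tail_integral_below:
  assumes [measurable]: "h \<in> borel_measurable M" and z: "0 < z" and ab: "0 < b" "b < a"
    and tail: "\<And>y. 0 < y \<Longrightarrow> y \<le> z \<Longrightarrow> emeasure M {x \<in> space M. ennreal y < h x} \<le> T * ennreal ((z / y) powr b)"
  shows "(\<integral>\<^sup>+x. (if h x \<le> ennreal z then enn_powr (h x) a else 0) \<partial>M)
    \<le> ennreal (2 powr b / (1 - 2 powr (b - a))) * T * ennreal (z powr a)"
proof -
  define c where "c k = (z / 2 ^ k) powr a" for k :: nat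
  have "(\<integral>\<^sup>+x. (if h x \<le> ennreal z then enn_powr (h x) a else 0) \<partial>M)
      \<le> (\<integral>\<^sup>+x. (\<Sum>k. ennreal (c k) * (if ennreal (z / 2 ^ (k + 1)) < h x then 1 else 0)) \<partial>M)"
    using enn_powr_le_dyadic_down[OF z, of a] ab unfolding c_def by (intro nn_integral_mono) auto
  also have "\<dots> = (\<Sum>k. ennreal (c k) * emeasure M {x \<in> space M. ennreal (z / 2 ^ (k + 1)) < h x})"
    by (subst nn_integral_suminf) (auto simp: nn_integral_cmult nn_integral_if_one)
  also have "\<dots> \<le> (\<Sum>k. T * ennreal (2 powr b * z powr a * (2 powr (b - a)) ^ k))"
  proof (intro suminf_le allI)
    fix k
    have "(1::real) \<le> 2 ^ (k + 1)" by (rule one_le_power) auto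
    then have z1: "z / 2 ^ (k + 1) \<le> z" using z by (simp add: field_simps del: power_Suc)
    have "ennreal (c k) * emeasure M {x \<in> space M. ennreal (z / 2 ^ (k + 1)) < h x}
      \<le> ennreal (c k) * (T * ennreal ((z / (z / 2 ^ (k + 1))) powr b))"
      using z1 z by (intro mult_left_mono tail) auto
    also have "\<dots> = T * ennreal (c k * (z / (z / 2 ^ (k + 1))) powr b)"
      by (simp add: ennreal_mult c_def mult.left_commute)
    also have "c k * (z / (z / 2 ^ (k + 1))) powr b = 2 powr b * z powr a * (2 powr (b - a)) ^ k"
    proof -
      have "c k = z powr a / (2 powr a) ^ k"
        using z by (simp add: c_def powr_divide powr_power powr_realpow[symmetric] powr_powr mult.commute)
      moreover have "(z / (z / 2 ^ (k + 1))) powr b = 2 powr b * (2 powr b) ^ k"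
        using z by (simp add: powr_mult powr_power powr_realpow[symmetric] powr_powr mult.commute)
      ultimately show ?thesis by (simp add: powr_diff power_divide)
    qed
    finally show "ennreal (c k) * emeasure M {x \<in> space M. ennreal (z / 2 ^ (k + 1)) < h x}
      \<le> T * ennreal (2 powr b * z powr a * (2 powr (b - a)) ^ k)" .
  qed auto
  also have "\<dots> = T * ennreal (2 powr b * z powr a / (1 - 2 powr (b - a)))"
    using ab powr_less_one[of 2 "b - a"] by (subst ennreal_suminf_cmult, subst suminf_ennreal_geometric) auto
  also have "\<dots> = ennreal (2 powr b / (1 - 2 powr (b - a))) * T * ennreal (z powr a)"
  proof -
    have "2 powr (b - a) < 1" using ab powr_less_one[of 2 "b - a"] by simp
    then have "ennreal (2 powr b * z powr a / (1 - 2 powr (b - a))) = ennreal (2 powr b / (1 - 2 powr (b - a))) * ennreal (z powr a)"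
      using z by (subst ennreal_mult[symmetric]) auto
    then show ?thesis by (simp add: mult_ac)
  qed
  finally show ?thesis .
qed

text \<open>The hypothesis is a weak type bound for G at level 2c in terms of the part of h above c,
  so the bounded endpoint is already built in. Summing it over dyadic levels and exchanging sum and
  integral leaves a geometric sum in the levels below h, which is of size h^(b-a).\<close>

lemma marcinkiewicz_interpolation:
  assumes [measurable]: "h \<in> borel_measurable M" "G \<in> borel_measurable M" and ab: "0 < a" "a < b"
    and weak: "\<And>c::real. 0 < c \<Longrightarrow> ennreal (c powr a) * emeasure M {x \<in> space M. ennreal (2 * c) < G x}
      \<le> D * (\<integral>\<^sup>+x. (if ennreal c < h x then enn_powr (h x) a else 0) \<partial>M)"
  shows "(\<integral>\<^sup>+x. enn_powr (G x) b \<partial>M)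
    \<le> ennreal (4 powr b * (2 powr (b - a) / (2 powr (b - a) - 1))) * D * (\<integral>\<^sup>+x. enn_powr (h x) b \<partial>M)"
    (is "_ \<le> ?R")
proof -
  define K where "K = 2 powr (b - a) / (2 powr (b - a) - 1)"
  have K: "0 \<le> K" using ab ge_one_powr_ge_zero[of 2 "b - a"] by (simp add: K_def)
  have trunc: "(\<integral>\<^sup>+x. (if ennreal (2 * z) < G x then enn_powr (G x) b else 0) \<partial>M) \<le> ?R" if z: "0 < z" for z
  proof -
    define c where "c k = (2 ^ (k + 1) * (2 * z)) powr b" for k :: nat
    have "(\<integral>\<^sup>+x. (if ennreal (2 * z) < G x then enn_powr (G x) b else 0) \<partial>M)
      \<le> (\<integral>\<^sup>+x. (\<Sum>k. ennreal (c k) * (if ennreal (2 ^ k * (2 * z)) < G x then 1 else 0)) \<partial>M)"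
      using enn_powr_le_dyadic_up[of "2 * z" b] z ab unfolding c_def by (intro nn_integral_mono) auto
    also have "\<dots> = (\<Sum>k. ennreal (c k) * emeasure M {x \<in> space M. ennreal (2 ^ k * (2 * z)) < G x})"
      by (subst nn_integral_suminf) (auto simp: nn_integral_cmult nn_integral_if_one)
    also have "\<dots> \<le> (\<Sum>k. ennreal (4 powr b) * D * (\<integral>\<^sup>+x. enn_powr (h x) a *
        (ennreal ((2 ^ k * z) powr (b - a)) * (if ennreal (2 ^ k * z) < h x then 1 else 0)) \<partial>M))"
    proof (intro suminf_le allI)
      fix k
      have pos: "0 < 2 ^ k * z" using z by simp
      \<comment> \<open>One factor 2 comes from the upper end of the dyadic interval, the other from
        the passage between level 2c for G and level c for h.\<close>
      have "c k = (4 * (2 ^ k * z)) powr b" unfolding c_def by (simp add: mult_ac)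
      also have "\<dots> = 4 powr b * ((2 ^ k * z) powr (b - a) * (2 ^ k * z) powr a)"
        using pos by (subst powr_add[symmetric]) (simp add: powr_mult)
      finally have "ennreal (c k) = ennreal (4 powr b) * (ennreal ((2 ^ k * z) powr (b - a)) * ennreal ((2 ^ k * z) powr a))"
        by (simp add: ennreal_mult)
      then have "ennreal (c k) * emeasure M {x \<in> space M. ennreal (2 ^ k * (2 * z)) < G x}
        = ennreal (4 powr b) * ennreal ((2 ^ k * z) powr (b - a)) * (ennreal ((2 ^ k * z) powr a) * emeasure M {x \<in> space M. ennreal (2 * (2 ^ k * z)) < G x})"
        by (simp add: mult_ac)
      also have "\<dots> \<le> ennreal (4 powr b) * ennreal ((2 ^ k * z) powr (b - a)) * (D * (\<integral>\<^sup>+x. (if ennreal (2 ^ k * z) < h x then enn_powr (h x) a else 0) \<partial>M))"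
        by (intro mult_left_mono weak pos) auto
      also have "\<dots> = ennreal (4 powr b) * D * (ennreal ((2 ^ k * z) powr (b - a)) * (\<integral>\<^sup>+x. (if ennreal (2 ^ k * z) < h x then enn_powr (h x) a else 0) \<partial>M))"
        by (simp add: mult_ac)
      also have "ennreal ((2 ^ k * z) powr (b - a)) * (\<integral>\<^sup>+x. (if ennreal (2 ^ k * z) < h x then enn_powr (h x) a else 0) \<partial>M)
        = (\<integral>\<^sup>+x. ennreal ((2 ^ k * z) powr (b - a)) * (if ennreal (2 ^ k * z) < h x then enn_powr (h x) a else 0) \<partial>M)"
        by (rule nn_integral_cmult[symmetric]) measurable
      also have "\<dots> = (\<integral>\<^sup>+x. enn_powr (h x) a *
        (ennreal ((2 ^ k * z) powr (b - a)) * (if ennreal (2 ^ k * z) < h x then 1 else 0)) \<partial>M)"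
        by (intro nn_integral_cong) (auto simp: mult.commute)
      finally show "ennreal (c k) * emeasure M {x \<in> space M. ennreal (2 ^ k * (2 * z)) < G x} \<le>
        ennreal (4 powr b) * D * (\<integral>\<^sup>+x. enn_powr (h x) a *
        (ennreal ((2 ^ k * z) powr (b - a)) * (if ennreal (2 ^ k * z) < h x then 1 else 0)) \<partial>M)" .
    qed auto
    also have "\<dots> = ennreal (4 powr b) * D * (\<integral>\<^sup>+x. enn_powr (h x) a *
        (\<Sum>k. ennreal ((2 ^ k * z) powr (b - a)) * (if ennreal (2 ^ k * z) < h x then 1 else 0)) \<partial>M)"
      by (subst ennreal_suminf_cmult, subst nn_integral_suminf[symmetric]) (auto simp: ennreal_suminf_cmult)
    also have "\<dots> \<le> ennreal (4 powr b) * D * (\<integral>\<^sup>+x. ennreal K * enn_powr (h x) b \<partial>M)"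
    proof (intro mult_left_mono nn_integral_mono)
      fix x
      have "enn_powr (h x) a * (\<Sum>k. ennreal ((2 ^ k * z) powr (b - a)) * (if ennreal (2 ^ k * z) < h x then 1 else 0))
        \<le> enn_powr (h x) a * (ennreal K * enn_powr (h x) (b - a))"
        unfolding K_def using z ab by (intro mult_left_mono dyadic_sum_le_enn_powr) auto
      also have "\<dots> = ennreal K * enn_powr (h x) b"
        using enn_powr_add[of a "b - a" "h x"] ab by (simp add: mult_ac)
      finally show "enn_powr (h x) a * (\<Sum>k. ennreal ((2 ^ k * z) powr (b - a)) * (if ennreal (2 ^ k * z) < h x then 1 else 0))
        \<le> ennreal K * enn_powr (h x) b" .
    qed auto
    also have "\<dots> = ennreal (4 powr b * K) * D * (\<integral>\<^sup>+x. enn_powr (h x) b \<partial>M)"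
      using K by (subst nn_integral_cmult) (auto simp: ennreal_mult mult_ac)
    finally show ?thesis unfolding K_def .
  qed
  \<comment> \<open>The truncated bound is uniform in the cutoff, and these cutoffs decrease to 0;
    monotone convergence recovers the whole integral.\<close>
  define \<Phi> where "\<Phi> n x = (if ennreal (2 * (1 / 2 ^ n)) < G x then enn_powr (G x) b else 0)" for n :: nat and x
  have inc: "incseq \<Phi>"
  proof (intro incseq_SucI le_funI)
    fix n x
    have "2 * (1 / 2 ^ Suc n) \<le> 2 * (1 / 2 ^ n :: real)" by (simp add: field_simps)
    then have "ennreal (2 * (1 / 2 ^ Suc n)) \<le> ennreal (2 * (1 / 2 ^ n))" by (rule ennreal_leI)
    then show "\<Phi> n x \<le> \<Phi> (Suc n) x"
      using le_less_trans[of _ "ennreal (2 * (1 / 2 ^ n))" "G x"] unfolding \<Phi>_def by (simp del: power_Suc)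
  qed
  have "(SUP n. \<Phi> n x) = enn_powr (G x) b" for x
  proof (rule antisym)
    show "(SUP n. \<Phi> n x) \<le> enn_powr (G x) b" by (rule SUP_least) (simp add: \<Phi>_def)
    show "enn_powr (G x) b \<le> (SUP n. \<Phi> n x)"
    proof (cases "G x = 0")
      case False
      have "\<exists>n. ennreal (2 * (1 / 2 ^ n)) < G x"
      proof (cases "G x")
        case (real r)
        with False have "0 < r" by (auto simp: less_le)
        obtain n where "2 / r < 2 ^ n" using real_arch_pow[of 2 "2 / r"] by auto
        then have "2 * (1 / 2 ^ n) < r" using \<open>0 < r\<close> by (simp add: field_simps)
        then show ?thesis using real by (auto simp: ennreal_less_iff)
      qed auto
      then obtain n where "ennreal (2 * (1 / 2 ^ n)) < G x" ..
      then have "\<Phi> n x = enn_powr (G x) b" by (simp add: \<Phi>_def)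
      then show ?thesis by (metis SUP_upper UNIV_I)
    qed auto
  qed
  then have "(\<integral>\<^sup>+x. enn_powr (G x) b \<partial>M) = (\<integral>\<^sup>+x. (SUP n. \<Phi> n x) \<partial>M)" by simp
  also have "\<dots> = (SUP n. \<integral>\<^sup>+x. \<Phi> n x \<partial>M)"
    by (intro nn_integral_monotone_convergence_SUP inc) (auto simp: \<Phi>_def)
  also have "\<dots> \<le> ?R"
    unfolding \<Phi>_def by (intro SUP_least trunc) auto
  finally show ?thesis .
qed

section \<open>Cubes and dyadic cells\<close>

declare emeasure_completion [simp del]

definition cube :: "real ^ 'n \<Rightarrow> real \<Rightarrow> (real ^ 'n) set"
  where "cube a l = cbox a (\<chi> i. a $ i + l)"

lemma cubes_iff: "Q \<in> cubes \<longleftrightarrow> (\<exists>a l. 0 < l \<and> Q = cube a l)"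
  by (auto simp: cubes_def cube_def)

lemma cube_in_cubes [intro]: "0 < l \<Longrightarrow> cube a l \<in> cubes"
  by (auto simp: cubes_iff)

lemma mem_cube: "x \<in> cube a l \<longleftrightarrow> (\<forall>i. a $ i \<le> x $ i \<and> x $ i \<le> a $ i + l)"
  by (simp add: cube_def mem_box_cart)

lemma mem_interior_cube: "x \<in> interior (cube a l) \<longleftrightarrow> (\<forall>i. a $ i < x $ i \<and> x $ i < a $ i + l)"
  by (simp add: cube_def interior_cbox mem_box_cart)

lemma sets_cube [measurable, simp]: "cube a l \<in> sets lebesgue"
  by (simp add: cube_def)

lemma sets_cubes [simp]: "Q \<in> cubes \<Longrightarrow> Q \<in> sets lebesgue"
  by (auto simp: cubes_iff)

lemma emeasure_cube:
  fixes a :: "real ^ 'n"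
  assumes "0 \<le> l"
  shows "emeasure lebesgue (cube a l) = ennreal (l ^ CARD('n))"
proof -
  have ne: "cbox a (\<chi> i. a $ i + l) \<noteq> {}"
    using assms by (auto simp: interval_ne_empty_cart)
  have "emeasure lebesgue (cube a l) = emeasure lborel (cube a l)"
    by (simp add: cube_def emeasure_completion)
  also have "\<dots> = ennreal (measure lborel (cube a l))"
    by (intro emeasure_eq_ennreal_measure) (simp add: cube_def emeasure_lborel_cbox_eq)
  also have "measure lborel (cube a l) = l ^ CARD('n)"
    using ne by (simp add: cube_def content_cbox_cart)
  finally show ?thesis .
qed

lemma emeasure_cubes_pos: "Q \<in> cubes \<Longrightarrow> 0 < emeasure lebesgue Q"
  by (auto simp: cubes_iff emeasure_cube)

lemma emeasure_cubes_finite: "Q \<in> cubes \<Longrightarrow> emeasure lebesgue Q < \<infinity>"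
  by (auto simp: cubes_iff emeasure_cube)

lemma cube_boundary_null: "cube a l - interior (cube a l) \<in> null_sets lebesgue"
  unfolding cube_def interior_cbox negligible_iff_null_sets[symmetric]
  by (rule negligible_frontier_interval)

lemma set_integral_eq_avg:
  assumes "0 < emeasure lebesgue Q" "emeasure lebesgue Q < \<infinity>"
  shows "(\<integral>\<^sup>+x\<in>Q. h x \<partial>lebesgue) = avg Q h * emeasure lebesgue Q"
  using assms unfolding avg_def by (simp add: ennreal_divide_times)

lemma avg_le_iff:
  assumes "0 < emeasure lebesgue Q" "emeasure lebesgue Q < \<infinity>"
  shows "avg Q h \<le> c \<longleftrightarrow> (\<integral>\<^sup>+x\<in>Q. h x \<partial>lebesgue) \<le> c * emeasure lebesgue Q"
proof
  assume "avg Q h \<le> c"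
  then show "(\<integral>\<^sup>+x\<in>Q. h x \<partial>lebesgue) \<le> c * emeasure lebesgue Q"
    unfolding set_integral_eq_avg[OF assms] by (rule mult_right_mono) simp
next
  assume "(\<integral>\<^sup>+x\<in>Q. h x \<partial>lebesgue) \<le> c * emeasure lebesgue Q"
  then show "avg Q h \<le> c"
    unfolding avg_def by (intro divide_le_posI_ennreal assms) (simp add: mult.commute)
qed

lemma less_avg_iff:
  assumes "0 < emeasure lebesgue Q" "emeasure lebesgue Q < \<infinity>"
  shows "c < avg Q h \<longleftrightarrow> c * emeasure lebesgue Q < (\<integral>\<^sup>+x\<in>Q. h x \<partial>lebesgue)"
  using avg_le_iff[OF assms] by (auto simp: not_le[symmetric])

lemma avg_mono_AE: "(AE x in lebesgue. x \<in> Q \<longrightarrow> f x \<le> g x) \<Longrightarrow> avg Q f \<le> avg Q g"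
  unfolding avg_def by (intro divide_right_mono_ennreal nn_integral_mono_AE) (auto simp: indicator_def)

lemma avg_cong_AE: "(AE x in lebesgue. x \<in> Q \<longrightarrow> f x = g x) \<Longrightarrow> avg Q f = avg Q g"
  by (intro antisym avg_mono_AE) auto

lemma avg_cmult:
  assumes [measurable]: "h \<in> borel_measurable lebesgue" "Q \<in> sets lebesgue"
  shows "avg Q (\<lambda>x. c * h x) = c * avg Q h"
  unfolding avg_def by (simp add: nn_integral_cmult mult.assoc ennreal_times_divide)

lemma avg_add:
  assumes [measurable]: "f \<in> borel_measurable lebesgue" "h \<in> borel_measurable lebesgue" "Q \<in> sets lebesgue"
  shows "avg Q (\<lambda>x. f x + h x) = avg Q f + avg Q h"
  unfolding avg_def by (simp add: nn_integral_add distrib_right add_divide_distrib_ennreal)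

lemma avg_const:
  assumes "0 < emeasure lebesgue Q" "emeasure lebesgue Q < \<infinity>"
  shows "avg Q (\<lambda>x. c) = c"
proof -
  have [measurable]: "Q \<in> sets lebesgue" using assms(1) emeasure_notin_sets[of Q lebesgue] by (metis less_irrefl)
  show ?thesis using assms unfolding avg_def
    by (simp add: nn_integral_cmult ennreal_mult_divide_eq)
qed

text \<open>This sums a comparison of two measures over the pieces of a stopping time decomposition;
  the measures are densities of one and the same Lebesgue measure in the applications.\<close>

lemma emeasure_Union_le_countable_disjoint:
  assumes "countable \<S>" "disjoint \<S>" "\<And>S. S \<in> \<S> \<Longrightarrow> S \<in> sets M" "sets N = sets M"
    and "\<And>S. S \<in> \<S> \<Longrightarrow> emeasure M S \<le> c * emeasure N S"
  shows "emeasure M (\<Union>\<S>) \<le> c * emeasure N (\<Union>\<S>)"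
proof -
  have d: "disjoint_family_on (\<lambda>S. S) \<S>"
    using assms(2) by (auto simp: disjoint_family_on_def disjoint_def)
  have "emeasure M (\<Union>\<S>) = (\<integral>\<^sup>+S. emeasure M S \<partial>count_space \<S>)"
    using emeasure_UN_countable[of \<S> "\<lambda>S. S" M] assms(1,3) d by simp
  also have "\<dots> \<le> (\<integral>\<^sup>+S. c * emeasure N S \<partial>count_space \<S>)"
    using assms(5) by (intro nn_integral_mono) auto
  also have "\<dots> = c * (\<integral>\<^sup>+S. emeasure N S \<partial>count_space \<S>)"
    by (rule nn_integral_cmult) auto
  also have "(\<integral>\<^sup>+S. emeasure N S \<partial>count_space \<S>) = emeasure N (\<Union>\<S>)"
    using emeasure_UN_countable[of \<S> "\<lambda>S. S" N] assms(1,3,4) d by simp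
  finally show ?thesis .
qed

section \<open>Dyadic cells and stopping times\<close>

text \<open>The half-open dyadic cell of generation k through x in the grid with corner a and side
  l. As a fibre of a floor map it is an equivalence class, which makes disjointness and nesting
  purely algebraic.\<close>

definition cell :: "real ^ 'n \<Rightarrow> real \<Rightarrow> nat \<Rightarrow> real ^ 'n \<Rightarrow> (real ^ 'n) set"
  where "cell a l k x = {y. \<forall>i. \<lfloor>2 ^ k * (y $ i - a $ i) / l\<rfloor> = \<lfloor>2 ^ k * (x $ i - a $ i) / l\<rfloor>}"

lemma cell_refl [simp]: "x \<in> cell a l k x"
  by (simp add: cell_def)

lemma cell_eq: "y \<in> cell a l k x \<Longrightarrow> cell a l k y = cell a l k x"
  by (auto simp: cell_def)

lemma floor_half_div: "\<lfloor>t :: real\<rfloor> = \<lfloor>2 * t\<rfloor> div 2"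
proof -
  have "\<lfloor>2 * t\<rfloor> div 2 = \<lfloor>of_int \<lfloor>2 * t\<rfloor> / 2 :: real\<rfloor>"
    using floor_divide_of_int_eq[of "\<lfloor>2 * t\<rfloor>" 2, where ?'a = real] by simp
  also have "\<dots> = \<lfloor>t\<rfloor>"
    using floor_divide_real_eq_div[of 2 "2 * t"] floor_divide_of_int_eq[of "\<lfloor>2 * t\<rfloor>" 2, where ?'a = real] by simp
  finally show ?thesis ..
qed

lemma cell_Suc: "cell a l (Suc k) x \<subseteq> cell a l k x"
proof -
  have "\<lfloor>2 ^ k * t / l\<rfloor> = \<lfloor>2 ^ Suc k * t / l\<rfloor> div 2" for t :: real
    using floor_half_div[of "2 ^ k * t / l"] by (simp add: mult.assoc)
  then show ?thesis unfolding cell_def by auto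
qed

lemma cell_antimono: "j \<le> k \<Longrightarrow> cell a l k x \<subseteq> cell a l j x"
  by (induction k rule: dec_induct) (use cell_Suc in blast)+

lemma cell_eq_le: "y \<in> cell a l k x \<Longrightarrow> j \<le> k \<Longrightarrow> cell a l j y = cell a l j x"
  using cell_antimono cell_eq by blast

lemma countable_cells: "countable (range (case_prod (cell a l)))"
proof -
  define G where "G k m = {y. \<forall>i. \<lfloor>2 ^ k * (y $ i - a $ i) / l\<rfloor> = m i}" for k :: nat and m :: "'a \<Rightarrow> int"
  have "range (case_prod (cell a l)) \<subseteq> range (case_prod G)"
  proof safe
    fix k x
    have "cell a l k x = case_prod G (k, \<lambda>i. \<lfloor>2 ^ k * (x $ i - a $ i) / l\<rfloor>)"
      by (simp add: cell_def G_def)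
    then show "cell a l k x \<in> range (case_prod G)" by blast
  qed
  then show ?thesis
    by (rule countable_subset) simp
qed

locale dyadic_grid =
  fixes a :: "real ^ 'n" and l :: real
  assumes l_pos: "0 < l"
begin

abbreviation "D \<equiv> cell a l"

text \<open>Cells partition space but averages in the A_p condition run over closed cubes.
  Sandwiching a cell between a cube and its interior identifies the two up to a null set.\<close>

lemma cell_sandwich:
  defines "b \<equiv> \<lambda>k x. \<chi> i. a $ i + l / 2 ^ k * of_int \<lfloor>2 ^ k * (x $ i - a $ i) / l\<rfloor>"
  shows "D k x \<subseteq> cube (b k x) (l / 2 ^ k)" "interior (cube (b k x) (l / 2 ^ k)) \<subseteq> D k x"
proof -
  have *: "(\<lfloor>2 ^ k * t / l\<rfloor> = m) \<longleftrightarrow> l / 2 ^ k * of_int m \<le> t \<and> t < l / 2 ^ k * of_int m + l / 2 ^ k" for t m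
    unfolding floor_eq_iff using l_pos by (auto simp: field_simps)
  show "D k x \<subseteq> cube (b k x) (l / 2 ^ k)"
    unfolding cell_def * mem_cube subset_iff by (auto simp: b_def algebra_simps)
      (smt (verit, ccfv_SIG))+
  show "interior (cube (b k x) (l / 2 ^ k)) \<subseteq> D k x"
    unfolding cell_def * mem_interior_cube subset_iff by (auto simp: b_def algebra_simps)
      (smt (verit, ccfv_SIG))+
qed

lemma cell_cube:
  obtains c where "D k x \<subseteq> cube c (l / 2 ^ k)" "cube c (l / 2 ^ k) - D k x \<in> null_sets lebesgue"
    "D k x \<in> sets lebesgue"
proof -
  obtain c where c: "D k x \<subseteq> cube c (l / 2 ^ k)" "interior (cube c (l / 2 ^ k)) \<subseteq> D k x"
    using cell_sandwich by blast
  have "cube c (l / 2 ^ k) - D k x \<subseteq> cube c (l / 2 ^ k) - interior (cube c (l / 2 ^ k))"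
    using c by auto
  then have n: "cube c (l / 2 ^ k) - D k x \<in> null_sets lebesgue"
    using cube_boundary_null negligible_subset unfolding negligible_iff_null_sets[symmetric] by blast
  have "D k x = cube c (l / 2 ^ k) - (cube c (l / 2 ^ k) - D k x)" using c by auto
  then have "D k x \<in> sets lebesgue" using n by (metis null_setsD2 sets.Diff sets_cube)
  then show ?thesis using that c n by blast
qed

lemma sets_cell [measurable, simp]: "D k x \<in> sets lebesgue"
  using cell_cube by blast

lemma emeasure_cell: "emeasure lebesgue (D k x) = ennreal ((l / 2 ^ k) ^ CARD('n))"
proof -
  obtain c where c: "D k x \<subseteq> cube c (l / 2 ^ k)" "cube c (l / 2 ^ k) - D k x \<in> null_sets lebesgue"
    by (rule cell_cube)
  then have "emeasure lebesgue (cube c (l / 2 ^ k)) = emeasure lebesgue (D k x)"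
    by (metis Un_Diff_cancel2 emeasure_Un_null_set sets_cell sup.orderE sup_commute)
  then show ?thesis using l_pos by (simp add: emeasure_cube)
qed

lemma emeasure_cell_pos: "0 < emeasure lebesgue (D k x)"
  and emeasure_cell_finite: "emeasure lebesgue (D k x) < \<infinity>"
  using l_pos by (auto simp: emeasure_cell)

lemma emeasure_cell_parent:
  "emeasure lebesgue (D k x) = ennreal (2 ^ CARD('n)) * emeasure lebesgue (D (Suc k) x)"
  using l_pos by (simp add: emeasure_cell ennreal_mult[symmetric] power_divide power_mult_distrib)

lemma cell_set_integral:
  obtains Q where "Q \<in> cubes" "D k x \<subseteq> Q" "emeasure lebesgue Q = emeasure lebesgue (D k x)"
    "\<And>h. (\<integral>\<^sup>+y\<in>Q. h y \<partial>lebesgue) = (\<integral>\<^sup>+y\<in>D k x. h y \<partial>lebesgue)"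
    "\<And>h. avg Q h = avg (D k x) h"
proof -
  obtain c where c: "D k x \<subseteq> cube c (l / 2 ^ k)" "cube c (l / 2 ^ k) - D k x \<in> null_sets lebesgue"
    by (rule cell_cube)
  let ?Q = "cube c (l / 2 ^ k)"
  have ae: "AE y in lebesgue. y \<notin> ?Q - D k x" using c(2) by (rule AE_not_in)
  have 1: "(\<integral>\<^sup>+y\<in>?Q. h y \<partial>lebesgue) = (\<integral>\<^sup>+y\<in>D k x. h y \<partial>lebesgue)" for h
    using ae c(1) by (intro nn_integral_cong_AE) (auto simp: indicator_def)
  have 2: "emeasure lebesgue ?Q = emeasure lebesgue (D k x)"
    using l_pos by (simp add: emeasure_cell emeasure_cube)
  show ?thesis
    by (rule that[of ?Q]) (use c(1) 1 2 l_pos in \<open>auto simp: avg_def\<close>)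
qed

text \<open>The set is a union of members of the countable family of all cells, whatever the
  predicate is. All measurability questions about dyadic constructions reduce to this.\<close>

lemma sets_cell_pred: "{x. P (D k x)} \<in> sets lebesgue"
proof -
  have "{x. P (D k x)} = \<Union>{S \<in> range (case_prod D). P S \<and> (\<exists>x. S = D k x)}" (is "?L = ?R")
  proof
    show "?L \<subseteq> ?R"
    proof
      fix x assume "x \<in> ?L"
      moreover have "D k x = case_prod D (k, x)" by simp
      ultimately show "x \<in> ?R" using cell_refl[of x a l k] by blast
    qed
    show "?R \<subseteq> ?L" using cell_eq by fastforce
  qed
  moreover have "?R \<in> sets lebesgue"
    using countable_cells[of a l] by (intro sets.countable_Union) (auto intro: countable_subset)
  ultimately show ?thesis by simp
qed

lemma measurable_avg_cell [measurable]: "(\<lambda>x. avg (D k x) h) \<in> borel_measurable lebesgue"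
proof (rule measurableI)
  fix A :: "ennreal set"
  show "(\<lambda>x. avg (D k x) h) -` A \<inter> space lebesgue \<in> sets lebesgue"
    using sets_cell_pred[of "\<lambda>S. avg S h \<in> A" k] by (simp add: vimage_def)
qed auto

text \<open>Calderon-Zygmund selection: each point with a good cell chooses its coarsest one. The
  conclusion that the earlier ancestors fail \<open>P\<close> is what later bounds the average over
  the parent.\<close>

lemma stopping_cells:
  obtains \<S> where "countable \<S>" "disjoint \<S>" "\<Union>\<S> = {x. \<exists>k. P (D k x)}"
    "\<forall>S\<in>\<S>. \<exists>k x. S = D k x \<and> P S \<and> (\<forall>j<k. \<not> P (D j x))"
proof -
  define K where "K x = (LEAST k. P (D k x))" for x
  define A where "A = {x. \<exists>k. P (D k x)}"
  define \<S> where "\<S> = (\<lambda>x. D (K x) x) ` A"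
  have PK: "P (D (K x) x)" if "x \<in> A" for x
    using that unfolding A_def K_def by (auto intro: LeastI)
  have nP: "\<not> P (D j x)" if "j < K x" for j x
    using that not_less_Least unfolding K_def by blast
  \<comment> \<open>If two chosen cells meet, the coarser one is an ancestor cell of both base
    points; minimality of the finer generation then forces the generations to agree.\<close>
  have same: "D (K x) x = D (K y) y" if "x \<in> A" "y \<in> A" "z \<in> D (K x) x" "z \<in> D (K y) y" "K x \<le> K y" for x y z
  proof -
    have "D (K x) x = D (K x) y"
      using cell_eq[OF that(3)] cell_eq_le[OF that(4,5)] by simp
    with PK[OF that(1)] have "P (D (K x) y)" by simp
    with nP[of "K x" y] that(5) have "K x = K y" by (meson le_neq_implies_less)
    with \<open>D (K x) x = D (K x) y\<close> show ?thesis by simp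
  qed
  show ?thesis
  proof
    show "countable \<S>"
      by (rule countable_subset[OF _ countable_cells[of a l]]) (auto simp: \<S>_def)
    show "disjoint \<S>"
    proof (rule disjointI)
      fix S T assume "S \<in> \<S>" "T \<in> \<S>" "S \<noteq> T"
      then obtain x y where xy: "x \<in> A" "y \<in> A" "S = D (K x) x" "T = D (K y) y" by (auto simp: \<S>_def)
      show "S \<inter> T = {}"
      proof (rule ccontr)
        assume "S \<inter> T \<noteq> {}"
        then obtain z where "z \<in> S" "z \<in> T" by auto
        then have "S = T"
          using same[of x y z] same[of y x z] xy by (cases "K x \<le> K y") auto
        with \<open>S \<noteq> T\<close> show False by simp
      qed
    qed
    have "D (K x) x \<subseteq> A" if "x \<in> A" for x
    proof
      fix y assume "y \<in> D (K x) x"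
      then have "D (K x) y = D (K x) x" by (rule cell_eq)
      then have "P (D (K x) y)" using PK[OF that] by simp
      then show "y \<in> A" unfolding A_def by blast
    qed
    then have "\<Union>\<S> \<subseteq> A" by (auto simp: \<S>_def)
    moreover have "x \<in> \<Union>\<S>" if "x \<in> A" for x
      using that cell_refl[of x a l "K x"] unfolding \<S>_def by blast
    ultimately show "\<Union>\<S> = {x. \<exists>k. P (D k x)}"
      unfolding A_def[symmetric] by blast
    show "\<forall>S\<in>\<S>. \<exists>k x. S = D k x \<and> P S \<and> (\<forall>j<k. \<not> P (D j x))"
    proof
      fix S assume S: "S \<in> \<S>"
      obtain x where x: "x \<in> A" "S = D (K x) x" using S by (auto simp: \<S>_def)
      show "\<exists>k x. S = D k x \<and> P S \<and> (\<forall>j<k. \<not> P (D j x))"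
        by (rule exI[of _ "K x"], rule exI[of _ x]) (use x PK nP in simp)
    qed
  qed
qed

lemma cell_within_ball:
  assumes "0 < e"
  obtains k where "D k x \<subseteq> ball x e"
proof -
  obtain k where k: "real CARD('n) * l / e < 2 ^ k" using real_arch_pow[of 2 "real CARD('n) * l / e"] by auto
  have "y \<in> ball x e" if y: "y \<in> D k x" for y
  proof -
    obtain c where c: "D k x \<subseteq> cube c (l / 2 ^ k)" by (rule cell_cube)
    have "dist x y \<le> (\<Sum>i\<in>UNIV. \<bar>(x - y) $ i\<bar>)"
      unfolding dist_norm by (rule norm_le_l1_cart)
    also have "\<dots> \<le> (\<Sum>i\<in>(UNIV::'n set). l / 2 ^ k)"
    proof (intro sum_mono)
      fix i
      have "x \<in> cube c (l / 2 ^ k)" "y \<in> cube c (l / 2 ^ k)" using c y by auto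
      then have "c $ i \<le> x $ i" "x $ i \<le> c $ i + l / 2 ^ k" "c $ i \<le> y $ i" "y $ i \<le> c $ i + l / 2 ^ k"
        by (auto simp: mem_cube)
      then show "\<bar>(x - y) $ i\<bar> \<le> l / 2 ^ k" by simp
    qed
    also have "\<dots> < e" using k assms by (simp add: field_simps)
    finally show ?thesis by simp
  qed
  then show ?thesis using that by blast
qed

text \<open>Stopping at the first cell contained in U, a Whitney type decomposition; cells around a
  point shrink into every ball.\<close>

lemma open_eq_Union_cells:
  assumes "open U"
  obtains \<S> where "countable \<S>" "disjoint \<S>" "\<Union>\<S> = U" "\<And>S. S \<in> \<S> \<Longrightarrow> \<exists>k x. S = D k x"
proof -
  obtain \<S> where *: "countable \<S>" "disjoint \<S>" "\<Union>\<S> = {x. \<exists>k. D k x \<subseteq> U}"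
    "\<forall>S\<in>\<S>. \<exists>k x. S = D k x \<and> S \<subseteq> U \<and> (\<forall>j<k. \<not> D j x \<subseteq> U)"
    by (rule stopping_cells[of "\<lambda>S. S \<subseteq> U"])
  have "{x. \<exists>k. D k x \<subseteq> U} = U"
  proof safe
    fix x assume "x \<in> U"
    then obtain e where "0 < e" "ball x e \<subseteq> U" using assms open_contains_ball by blast
    then show "\<exists>k. D k x \<subseteq> U" using cell_within_ball by (metis order_trans)
  qed (use cell_refl in blast)
  then show ?thesis using * that by metis
qed

text \<open>The half of Lebesgue differentiation that is required, valid for every measurable h with
  values in [0, infinity]. On a bounded set A where h > c while all cell averages are at most c,
  covering A by cells inside a slightly larger open set gives a bound c |A| for the integral of h
  over A, hence A is null. Rational c and balls of integer radius exhaust the exceptional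
  set.\<close>

lemma AE_le_SUP_avg_cell:
  assumes [measurable]: "h \<in> borel_measurable lebesgue"
  shows "AE x in lebesgue. h x \<le> (SUP k. avg (D k x) h)"
proof -
  have null: "{x. ennreal c < h x \<and> (\<forall>k. avg (D k x) h \<le> ennreal c)} \<inter> ball 0 r \<in> null_sets lebesgue"
    (is "?A \<in> _") for c r
  proof -
    define A where "A = ?A"
    have "{x \<in> space lebesgue. ennreal c < h x \<and> (\<forall>k. avg (D k x) h \<le> ennreal c)} \<in> sets lebesgue" by measurable
    then have A [measurable]: "A \<in> sets lebesgue" unfolding A_def by (intro sets.Int) auto
    have mem: "ennreal c < h x" "avg (D k x) h \<le> ennreal c" if "x \<in> A" for x k
      using that by (auto simp: A_def)
    have "emeasure lebesgue A \<le> emeasure lebesgue (ball (0 :: real ^ 'n) r)" unfolding A_def by (intro emeasure_mono) auto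
    also have "\<dots> < \<infinity>" using emeasure_lborel_ball_finite[of "0 :: real ^ 'n" r] by (simp add: emeasure_completion)
    finally have fin: "emeasure lebesgue A < \<infinity>" .
    have le: "(\<integral>\<^sup>+x\<in>A. h x \<partial>lebesgue) \<le> ennreal c * emeasure lebesgue A"
    proof (rule ennreal_le_epsilon)
      fix e :: real assume "0 < e"
      \<comment> \<open>The measure tolerance is scaled so that its product with c stays below e;
        the summand 1 and the maximum with 0 cover c <= 0.\<close>
      define e' where "e' = e / (1 + max 0 c)"
      have e': "0 < e'" "max 0 c * e' \<le> e" using \<open>0 < e\<close> by (auto simp: e'_def field_simps add_pos_nonneg)
      obtain U where U: "open U" "A \<subseteq> U" "emeasure lebesgue (U - A) < ennreal e'"
        using sets_lebesgue_outer_open[OF A e'(1)] by blast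
      have [measurable]: "U \<in> sets lebesgue" using U(1) by auto
      obtain \<S> where S: "countable \<S>" "disjoint \<S>" "\<Union>\<S> = U" "\<And>S. S \<in> \<S> \<Longrightarrow> \<exists>k x. S = D k x"
        using open_eq_Union_cells[OF U(1)] by blast
      \<comment> \<open>Only cells meeting A are kept: such a cell is the cell of a point of A, so
        its average is at most c.\<close>
      define \<T> where "\<T> = {S \<in> \<S>. S \<inter> A \<noteq> {}}"
      have T: "countable \<T>" "disjoint \<T>" "\<Union>\<T> \<subseteq> U"
        using S(1-3) by (auto simp: \<T>_def disjoint_def intro: countable_subset)
      have TA: "A \<subseteq> \<Union>\<T>"
      proof
        fix x assume x: "x \<in> A"
        then obtain S where "S \<in> \<S>" "x \<in> S" using U(2) S(3) by blast
        with x show "x \<in> \<Union>\<T>" unfolding \<T>_def by blast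
      qed
      have T_sets: "S \<in> sets lebesgue" if "S \<in> \<T>" for S
        using that S(4)[of S] by (auto simp: \<T>_def)
      then have [measurable]: "\<Union>\<T> \<in> sets lebesgue" using T(1) by blast
      have "emeasure (density lebesgue h) (\<Union>\<T>) \<le> ennreal c * emeasure lebesgue (\<Union>\<T>)"
      proof (rule emeasure_Union_le_countable_disjoint[OF T(1,2)])
        fix S assume ST: "S \<in> \<T>"
        then obtain k x where "S = D k x" using S(4)[of S] unfolding \<T>_def by blast
        moreover obtain z where z: "z \<in> S" "z \<in> A" using ST unfolding \<T>_def by blast
        ultimately have Sz: "S = D k z" using cell_eq by metis
        then have "avg S h \<le> ennreal c" using z mem by simp
        then show "emeasure (density lebesgue h) S \<le> ennreal c * emeasure lebesgue S"
          using avg_le_iff[of S h "ennreal c"] emeasure_cell_pos emeasure_cell_finite Sz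
          by (simp add: emeasure_density)
      qed (use T_sets in auto)
      also have "\<dots> \<le> ennreal c * emeasure lebesgue U"
        using T by (intro mult_left_mono emeasure_mono) auto
      also have "emeasure lebesgue U = emeasure lebesgue A + emeasure lebesgue (U - A)"
        using U(2) by (subst plus_emeasure) (auto simp: Un_absorb1)
      also have "ennreal c * (emeasure lebesgue A + emeasure lebesgue (U - A))
        \<le> ennreal c * emeasure lebesgue A + ennreal e"
      proof -
        have "ennreal c * emeasure lebesgue (U - A) \<le> ennreal (max 0 c) * ennreal e'"
          using U(3) by (intro mult_mono ennreal_leI) auto
        also have "\<dots> \<le> ennreal e"
          using e' by (subst ennreal_mult[symmetric]) (auto intro: ennreal_leI)
        finally show ?thesis by (simp add: distrib_left)
      qed
      finally have "emeasure (density lebesgue h) (\<Union>\<T>) \<le> ennreal c * emeasure lebesgue A + ennreal e" .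
      moreover have "emeasure (density lebesgue h) A \<le> emeasure (density lebesgue h) (\<Union>\<T>)"
        using TA by (intro emeasure_mono) auto
      ultimately show "(\<integral>\<^sup>+x\<in>A. h x \<partial>lebesgue) \<le> ennreal c * emeasure lebesgue A + ennreal e"
        by (simp add: emeasure_density)
    qed
    have "emeasure lebesgue A = 0"
    proof (rule ccontr)
      assume "emeasure lebesgue A \<noteq> 0"
      then have "\<not> (AE x in lebesgue. x \<notin> A)" using AE_iff_null_sets[OF A] by auto
      then have n: "\<not> (AE x in lebesgue. h x * indicator A x \<le> ennreal c * indicator A x)"
      proof (rule contrapos_nn)
        assume "AE x in lebesgue. h x * indicator A x \<le> ennreal c * indicator A x"
        then show "AE x in lebesgue. x \<notin> A"
        proof eventually_elim
          case (elim x)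
          then show ?case using mem(1)[of x] by (cases "x \<in> A") auto
        qed
      qed
      have "(\<integral>\<^sup>+x. ennreal c * indicator A x \<partial>lebesgue) < (\<integral>\<^sup>+x. h x * indicator A x \<partial>lebesgue)"
      proof (rule nn_integral_less)
        show "(\<integral>\<^sup>+x. ennreal c * indicator A x \<partial>lebesgue) \<noteq> \<infinity>"
          using fin by (simp add: nn_integral_cmult_indicator ennreal_mult_eq_top_iff less_top)
        show "AE x in lebesgue. ennreal c * indicator A x \<le> h x * indicator A x"
          using mem(1) by (auto simp: indicator_def less_imp_le)
      qed (use n in auto)
      then show False using le by (simp add: nn_integral_cmult_indicator)
    qed
    then show ?thesis using A unfolding A_def by auto
  qed
  have "AE x in lebesgue. \<forall>q\<in>\<rat>. \<forall>r::nat. x \<notin> {x. ennreal q < h x \<and> (\<forall>k. avg (D k x) h \<le> ennreal q)} \<inter> ball 0 (real r)"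
    by (intro AE_ball_countable' countable_rat iffD2[OF AE_all_countable] allI AE_not_in null)
  then show ?thesis
  proof eventually_elim
    case (elim x)
    show ?case
    proof (rule ccontr)
      assume "\<not> ?thesis"
      then have "(SUP k. avg (D k x) h) < h x" by simp
      then obtain q where q: "(SUP k. avg (D k x) h) < ennreal (real_of_rat q)" "ennreal (real_of_rat q) < h x"
        using ennreal_rat_dense by blast
      obtain r :: nat where "norm x < real r" using reals_Archimedean2 by blast
      moreover have "avg (D k x) h \<le> ennreal (real_of_rat q)" for k
        using q(1) SUP_upper[of k UNIV "\<lambda>k. avg (D k x) h"] by (simp add: order.strict_implies_order order.strict_trans1)
      ultimately show False using elim q(2) Rats_of_rat[of q] by (auto simp: dist_norm)
    qed
  qed
qed

text \<open>The weak (1,1) bound for the dyadic maximal function localised to C. Disjointness of the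
  stopping cells gives constant 1, from which the exact factor 1/2 in the later decay estimate
  results.\<close>

lemma dyadic_weak_type:
  assumes [measurable]: "h \<in> borel_measurable lebesgue" and "C \<in> sets lebesgue"
  shows "c * emeasure lebesgue {x. \<exists>k. D k x \<subseteq> C \<and> c < avg (D k x) h} \<le> (\<integral>\<^sup>+x\<in>C. h x \<partial>lebesgue)"
proof -
  note assms(2) [measurable]
  obtain \<S> where S: "countable \<S>" "disjoint \<S>" "\<Union>\<S> = {x. \<exists>k. D k x \<subseteq> C \<and> c < avg (D k x) h}"
    "\<forall>S\<in>\<S>. \<exists>k x. S = D k x \<and> (S \<subseteq> C \<and> c < avg S h) \<and> (\<forall>j<k. \<not> (D j x \<subseteq> C \<and> c < avg (D j x) h))"
    by (rule stopping_cells[of "\<lambda>S. S \<subseteq> C \<and> c < avg S h"])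
  have "emeasure (density lebesgue (\<lambda>x. c)) (\<Union>\<S>) \<le> 1 * emeasure (density lebesgue h) (\<Union>\<S>)"
  proof (rule emeasure_Union_le_countable_disjoint[OF S(1,2)])
    fix S assume "S \<in> \<S>"
    then obtain k x where kx: "S = D k x" "c < avg S h" using S(4) by blast
    then show "emeasure (density lebesgue (\<lambda>x. c)) S \<le> 1 * emeasure (density lebesgue h) S"
      using less_avg_iff[of S c h] emeasure_cell_pos emeasure_cell_finite by (simp add: emeasure_density nn_integral_cmult_indicator)
  qed (use S(4) in fastforce)+
  moreover have "\<S> \<subseteq> sets lebesgue" using S(4) by (metis sets_cell subsetI)
  moreover from this have "\<Union>\<S> \<in> sets lebesgue" using S(1) by (rule sets.countable_Union[rotated])
  moreover have "emeasure (density lebesgue h) (\<Union>\<S>) \<le> emeasure (density lebesgue h) C"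
    using S(4) by (intro emeasure_mono) (blast, simp)
  ultimately have "c * emeasure lebesgue (\<Union>\<S>) \<le> emeasure (density lebesgue h) C"
    by (simp add: emeasure_density nn_integral_cmult_indicator)
  then show ?thesis by (simp add: S(3) emeasure_density)
qed

end

section \<open>The Hardy-Littlewood maximal function\<close>

lemma integral_cube_eq_avg: "Q \<in> cubes \<Longrightarrow> (\<integral>\<^sup>+x\<in>Q. h x \<partial>lebesgue) = avg Q h * emeasure lebesgue Q"
  by (intro set_integral_eq_avg emeasure_cubes_pos emeasure_cubes_finite)

text \<open>Requiring x to lie in the interior makes superlevel sets open, hence measurable for
  every h; closed cubes give the same supremum by \<open>avg_le_maximal\<close>.\<close>

definition maximal :: "(real ^ 'n \<Rightarrow> ennreal) \<Rightarrow> real ^ 'n \<Rightarrow> ennreal"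
  where "maximal h x = (SUP Q\<in>{Q \<in> cubes. x \<in> interior Q}. avg Q h)"

lemma avg_le_maximal_interior: "Q \<in> cubes \<Longrightarrow> x \<in> interior Q \<Longrightarrow> avg Q h \<le> maximal h x"
  unfolding maximal_def by (intro SUP_upper) auto

lemma maximal_leI: "(\<And>Q. Q \<in> cubes \<Longrightarrow> x \<in> interior Q \<Longrightarrow> avg Q h \<le> c) \<Longrightarrow> maximal h x \<le> c"
  unfolding maximal_def by (intro SUP_least) auto

lemma maximal_superlevel: "{x. c < maximal h x} = \<Union>(interior ` {Q \<in> cubes. c < avg Q h})"
  by (auto simp: maximal_def less_SUP_iff)

lemma measurable_maximal [measurable]: "maximal h \<in> borel_measurable lebesgue"
proof (rule borel_measurableI_greater)
  fix c :: ennreal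
  have "open {x. c < maximal h x}" unfolding maximal_superlevel by auto
  then show "{x \<in> space lebesgue. c < maximal h x} \<in> sets lebesgue" by simp
qed

lemma maximal_mono_AE: "(AE x in lebesgue. f x \<le> g x) \<Longrightarrow> maximal f x \<le> maximal g x"
  unfolding maximal_def by (intro SUP_mono) (auto intro!: bexI avg_mono_AE elim: eventually_mono)

lemma maximal_add_le:
  assumes [measurable]: "f \<in> borel_measurable lebesgue" "g \<in> borel_measurable lebesgue"
  shows "maximal (\<lambda>x. f x + g x) x \<le> maximal f x + maximal g x"
  by (intro maximal_leI) (auto simp: avg_add intro!: add_mono avg_le_maximal_interior)

lemma maximal_const_le: "maximal (\<lambda>x. c) x \<le> c"
  by (intro maximal_leI) (simp add: avg_const[OF emeasure_cubes_pos emeasure_cubes_finite])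

text \<open>A closed cube lies in the interior of a slightly larger concentric one. Enlarging the
  volume by 1/r costs the factor r in the average, and r may be taken arbitrarily close to
  1.\<close>

lemma avg_le_maximal:
  fixes Q :: "(real ^ 'n) set"
  assumes "Q \<in> cubes" "x \<in> Q"
  shows "avg Q h \<le> maximal h x"
proof -
  obtain a l where Q: "0 < l" "Q = cube a l" using assms(1) by (auto simp: cubes_iff)
  define N where "N = CARD('n)"
  have N: "0 < N" by (simp add: N_def)
  have *: "ennreal r * avg Q h \<le> maximal h x" if r: "0 < r" "r < 1" for r
  proof -
    \<comment> \<open>Dividing the side by this root multiplies the volume by exactly 1/r.\<close>
    define s where "s = root N r"
    have s: "0 < s" "s < 1" "s ^ N = r" using r N by (auto simp: s_def)
    define L where "L = l / s"
    have L: "l < L" using Q s by (simp add: L_def field_simps)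
    define b where "b = (\<chi> i. a $ i - (L - l) / 2)"
    have sub: "Q \<subseteq> interior (cube b L)"
    proof
      fix y assume "y \<in> Q"
      then have y: "a $ i \<le> y $ i" "y $ i \<le> a $ i + l" for i using Q by (auto simp: mem_cube)
      show "y \<in> interior (cube b L)"
        unfolding mem_interior_cube b_def
      proof
        fix i show "(\<chi> i. a $ i - (L - l) / 2) $ i < y $ i \<and> y $ i < (\<chi> i. a $ i - (L - l) / 2) $ i + L"
          using y[of i] L by (simp add: field_simps)
      qed
    qed
    have cb: "cube b L \<in> cubes" using L Q by auto
    have "r * L ^ N = l ^ N" using s by (simp add: L_def power_divide power_mult_distrib flip: s(3))
    then have em: "emeasure lebesgue Q = ennreal r * emeasure lebesgue (cube b L)"
      using Q L r by (simp add: emeasure_cube ennreal_mult[symmetric] N_def)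
    have "ennreal r * avg Q h \<le> avg (cube b L) h"
    proof -
      have "ennreal r * avg Q h * emeasure lebesgue (cube b L) = avg Q h * emeasure lebesgue Q"
        by (simp add: em mult_ac)
      also have "\<dots> = (\<integral>\<^sup>+x\<in>Q. h x \<partial>lebesgue)"
        using assms(1) by (simp add: integral_cube_eq_avg)
      also have "\<dots> \<le> (\<integral>\<^sup>+x\<in>cube b L. h x \<partial>lebesgue)"
        using sub interior_subset by (intro nn_integral_mono) (fastforce simp: indicator_def)
      also have "\<dots> = avg (cube b L) h * emeasure lebesgue (cube b L)"
        using cb by (simp add: integral_cube_eq_avg)
      finally show ?thesis
        using emeasure_cubes_pos[OF cb] emeasure_cubes_finite[OF cb]
          ennreal_mult_le_mult_iff[of "emeasure lebesgue (cube b L)" "ennreal r * avg Q h" "avg (cube b L) h"]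
        by (simp add: mult_ac less_top)
    qed
    also have "\<dots> \<le> maximal h x"
      using sub assms cb by (intro avg_le_maximal_interior) auto
    finally show ?thesis .
  qed
  show ?thesis
  proof (cases "avg Q h"; cases "maximal h x")
    fix c m assume cm: "avg Q h = ennreal c" "0 \<le> c" "maximal h x = ennreal m" "0 \<le> m"
    have "c \<le> m"
    proof (rule field_le_mult_one_interval)
      fix r :: real assume "0 < r" "r < 1"
      then show "r * c \<le> m" using *[of r] cm by (simp add: ennreal_mult[symmetric])
    qed
    then show ?thesis using cm by (simp add: ennreal_leI)
  next
    assume "avg Q h = top"
    then show ?thesis using *[of "1/2"] by (simp add: ennreal_mult_top)
  qed (auto simp: top_unique)
qed

lemma AE_le_maximal:
  fixes h :: "real ^ 'n \<Rightarrow> ennreal"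
  assumes "h \<in> borel_measurable lebesgue"
  shows "AE x in lebesgue. h x \<le> maximal h x"
proof -
  interpret dyadic_grid "0 :: real ^ 'n" 1 by unfold_locales simp
  have "avg (D k x) h \<le> maximal h x" for k x
  proof -
    obtain Q where Q: "Q \<in> cubes" "D k x \<subseteq> Q" "avg Q h = avg (D k x) h"
      by (metis cell_set_integral)
    then show ?thesis using avg_le_maximal[of Q x h] cell_refl by fastforce
  qed
  then have "(SUP k. avg (D k x) h) \<le> maximal h x" for x by (intro SUP_least)
  then show ?thesis
    using AE_le_SUP_avg_cell[OF assms] by (auto elim!: eventually_mono intro: order_trans)
qed

lemma exists_cube_superset:
  fixes Q :: "(real ^ 'n) set"
  assumes "Q \<in> cubes"
  obtains Q' where "Q' \<in> cubes" "Q \<subseteq> Q'" "x \<in> Q'"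
proof -
  obtain a l where Q: "0 < l" "Q = cube a l" using assms by (auto simp: cubes_iff)
  define R where "R = norm x + norm a + l"
  have R: "0 < R" using Q by (simp add: R_def add_nonneg_pos)
  have "- R \<le> a $ i" "a $ i + l \<le> R" "- R \<le> x $ i" "x $ i \<le> R" for i
    using component_le_norm_cart[of a i] component_le_norm_cart[of x i] Q(1) norm_ge_zero[of a] norm_ge_zero[of x]
    unfolding R_def abs_le_iff by linarith+
  then have "Q \<subseteq> cube (\<chi> i. - R) (2 * R)" "x \<in> cube (\<chi> i. - R) (2 * R)"
    unfolding Q(2) subset_iff mem_cube by (auto, (meson order_trans)+)
  moreover have "cube (\<chi> i. - R) (2 * R) \<in> (cubes :: (real ^ 'n) set set)" using R by auto
  ultimately show ?thesis using that by metis
qed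

text \<open>Any cube can be enlarged to contain x, so vanishing at a single point annihilates all
  averages. Consequently maximal functions of nonzero functions are positive at every point, not
  just almost everywhere.\<close>

lemma maximal_eq_0_imp:
  assumes "maximal h x = 0"
  shows "maximal h y = 0"
proof -
  have "avg Q h = 0" if Q: "Q \<in> cubes" for Q
  proof -
    obtain Q' where Q': "Q' \<in> cubes" "Q \<subseteq> Q'" "x \<in> Q'" by (rule exists_cube_superset[OF Q])
    then have "avg Q' h = 0" using avg_le_maximal[of Q' x h] assms by simp
    then have "(\<integral>\<^sup>+x\<in>Q'. h x \<partial>lebesgue) = 0"
      using Q' by (simp add: integral_cube_eq_avg)
    moreover have "(\<integral>\<^sup>+x\<in>Q. h x \<partial>lebesgue) \<le> (\<integral>\<^sup>+x\<in>Q'. h x \<partial>lebesgue)"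
      using Q'(2) by (intro nn_integral_mono) (auto simp: indicator_def)
    ultimately show ?thesis by (simp add: avg_def)
  qed
  then have "maximal h y \<le> 0" by (intro maximal_leI) simp
  then show ?thesis by simp
qed

lemma maximal_pos:
  assumes "h \<in> borel_measurable lebesgue" "\<not> (AE x in lebesgue. h x = 0)"
  shows "0 < maximal h x"
proof (rule ccontr)
  assume "\<not> ?thesis"
  then have "maximal h y = 0" for y using maximal_eq_0_imp[of h x y] by (simp add: zero_less_iff_neq_zero)
  then have "AE x in lebesgue. h x = 0" using AE_le_maximal[OF assms(1)] by simp
  with assms(2) show False by simp
qed

section \<open>Vitali covering and weak type estimates\<close>

definition triple :: "(real ^ 'n) \<times> real \<Rightarrow> (real ^ 'n) set"
  where "triple = (\<lambda>(a, l). cube (\<chi> i. a $ i - l) (3 * l))"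

lemma triple_in_cubes: "0 < l \<Longrightarrow> triple (a, l) \<in> cubes"
  by (auto simp: triple_def)

lemma cube_subset_triple: "0 < l \<Longrightarrow> cube a l \<subseteq> triple (a, l)"
  unfolding triple_def by (auto simp: mem_cube) (smt (verit))+

lemma emeasure_triple:
  fixes a :: "real ^ 'n"
  assumes "0 < l"
  shows "emeasure lebesgue (triple (a, l)) = ennreal (3 ^ CARD('n)) * emeasure lebesgue (cube a l)"
  using assms by (simp add: triple_def emeasure_cube power_mult_distrib ennreal_mult)

lemma cube_subset_triple_of_meets:
  assumes "cube a l \<inter> cube b m \<noteq> {}" "l \<le> m"
  shows "cube a l \<subseteq> triple (b, m)"
proof
  fix x assume x: "x \<in> cube a l"
  obtain z where z: "z \<in> cube a l" "z \<in> cube b m" using assms(1) by auto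
  show "x \<in> triple (b, m)"
    unfolding triple_def prod.case mem_cube
  proof
    fix i
    have "a $ i \<le> x $ i" "x $ i \<le> a $ i + l" "a $ i \<le> z $ i" "z $ i \<le> a $ i + l" "b $ i \<le> z $ i" "z $ i \<le> b $ i + m"
      using x z by (auto simp: mem_cube)
    then show "(\<chi> i. b $ i - m) $ i \<le> x $ i \<and> x $ i \<le> (\<chi> i. b $ i - m) $ i + 3 * m"
      using assms(2) by simp
  qed
qed

text \<open>Greedy selection: a cube of largest side is taken and all cubes meeting it are
  discarded. A discarded cube is no larger, hence is swallowed by the triple of the selected
  one.\<close>

lemma vitali_finite_cubes:
  fixes F :: "((real ^ 'n) \<times> real) set"
  assumes "finite F" "\<And>a l. (a, l) \<in> F \<Longrightarrow> 0 < l"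
  obtains G where "G \<subseteq> F" "disjoint_family_on (case_prod cube) G"
    "\<Union>(case_prod cube ` F) \<subseteq> \<Union>(triple ` G)"
  using assms
proof (induction "card F" arbitrary: F thesis rule: less_induct)
  case less
  show ?case
  proof (cases "F = {}")
    case True
    then show ?thesis using less.prems(1)[of "{}"] by (simp add: disjoint_family_on_def)
  next
    case False
    then have "Max (snd ` F) \<in> snd ` F" using less.prems(2) by (intro Max_in) auto
    then obtain b m where bm: "(b, m) \<in> F" "m = Max (snd ` F)" by auto
    have le: "l \<le> m" if "(a, l) \<in> F" for a l
      using that less.prems(2) unfolding bm(2) by (intro Max_ge) force+
    define F' where "F' = {c \<in> F. case_prod cube c \<inter> cube b m = {}}"
    have "0 < m" using bm less.prems(3) by blast
    then have "b \<in> cube b m" by (simp add: mem_cube)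
    then have "F' \<subset> F" using bm by (auto simp: F'_def)
    then have "card F' < card F" using less.prems(2) by (intro psubset_card_mono)
    moreover have "finite F'" "\<And>a l. (a, l) \<in> F' \<Longrightarrow> 0 < l" using less.prems(2,3) by (auto simp: F'_def)
    ultimately obtain G where G: "G \<subseteq> F'" "disjoint_family_on (case_prod cube) G"
      "\<Union>(case_prod cube ` F') \<subseteq> \<Union>(triple ` G)"
      using less.hyps[of F'] by blast
    show ?thesis
    proof (rule less.prems(1))
      show "insert (b, m) G \<subseteq> F" using G bm by (auto simp: F'_def)
      show "disjoint_family_on (case_prod cube) (insert (b, m) G)"
        using G(1,2) unfolding disjoint_family_on_def F'_def by (auto simp: Int_commute)
      show "\<Union>(case_prod cube ` F) \<subseteq> \<Union>(triple ` insert (b, m) G)"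
      proof safe
        fix x a l assume al: "(a, l) \<in> F" "x \<in> cube a l"
        show "x \<in> \<Union>(triple ` insert (b, m) G)"
        proof (cases "cube a l \<inter> cube b m = {}")
          case True
          then have "(a, l) \<in> F'" using al by (simp add: F'_def)
          then show ?thesis using al G(3) by fastforce
        next
          case False
          then show ?thesis using cube_subset_triple_of_meets[OF False le[OF al(1)]] al by auto
        qed
      qed
    qed
  qed
qed

text \<open>For \<open>a > 1\<close> this is the \<open>A\<^sub>a\<close> condition on \<open>u\<close>, and it implies the \<open>A\<^sub>\<infinity>\<close> condition by testing on
  indicators.\<close>

definition averaging_bound :: "real \<Rightarrow> ennreal \<Rightarrow> (real ^ 'n \<Rightarrow> ennreal) \<Rightarrow> bool"
  where "averaging_bound a K u \<longleftrightarrow> (\<forall>Q\<in>cubes. \<forall>h\<in>borel_measurable lebesgue.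
    enn_powr (avg Q h) a * (\<integral>\<^sup>+x\<in>Q. u x \<partial>lebesgue) \<le> K * (\<integral>\<^sup>+x\<in>Q. enn_powr (h x) a * u x \<partial>lebesgue))"

lemma averaging_bound_one: "averaging_bound 1 1 (\<lambda>x. 1)"
  unfolding averaging_bound_def
  by (simp add: integral_cube_eq_avg)

text \<open>Testing the averaging bound on the indicator of the cube inside its triple, where the
  average is 3^(-n).\<close>

lemma doubling_of_averaging_bound:
  fixes u :: "real ^ 'n \<Rightarrow> ennreal"
  assumes "averaging_bound a K u" "0 < a" "0 < l" and [measurable]: "u \<in> borel_measurable lebesgue"
  shows "emeasure (density lebesgue u) (triple (b, l))
    \<le> ennreal ((3 ^ CARD('n)) powr a) * K * emeasure (density lebesgue u) (cube b l)"
proof -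
  define N where "N = CARD('n)"
  let ?Q = "cube b l" and ?T = "triple (b, l)"
  have T: "?T \<in> cubes" using assms by (simp add: triple_in_cubes)
  have sT [measurable]: "?T \<in> sets lebesgue" using T by simp
  have "avg ?T (indicator ?Q) * emeasure lebesgue ?T = emeasure lebesgue ?Q"
  proof -
    have "avg ?T (indicator ?Q) * emeasure lebesgue ?T = (\<integral>\<^sup>+x\<in>?T. indicator ?Q x \<partial>lebesgue)"
      using T by (simp add: integral_cube_eq_avg)
    also have "\<dots> = (\<integral>\<^sup>+x. indicator ?Q x \<partial>lebesgue)"
      using cube_subset_triple[OF assms(3), of b] by (intro nn_integral_cong) (auto simp: indicator_def)
    finally show ?thesis by simp
  qed
  then have "ennreal (3 ^ N) * avg ?T (indicator ?Q) * emeasure lebesgue ?Q = 1 * emeasure lebesgue ?Q"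
    using assms by (simp add: emeasure_triple N_def mult_ac)
  moreover have "emeasure lebesgue ?Q \<noteq> 0" "emeasure lebesgue ?Q \<noteq> top"
    using emeasure_cubes_pos[OF cube_in_cubes[OF assms(3)], of b] emeasure_cubes_finite[OF cube_in_cubes[OF assms(3)], of b] by auto
  ultimately have av: "ennreal (3 ^ N) * avg ?T (indicator ?Q) = 1"
    by (metis mult_divide_eq_ennreal)
  have "emeasure (density lebesgue u) ?T
    = enn_powr (ennreal (3 ^ N) * avg ?T (indicator ?Q)) a * (\<integral>\<^sup>+x\<in>?T. u x \<partial>lebesgue)"
    by (simp add: av emeasure_density)
  also have "\<dots> = ennreal ((3 ^ N) powr a) * (enn_powr (avg ?T (indicator ?Q)) a * (\<integral>\<^sup>+x\<in>?T. u x \<partial>lebesgue))"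
    using assms(2) by (subst enn_powr_mult) (auto simp: enn_powr_ennreal mult.assoc)
  also have "\<dots> \<le> ennreal ((3 ^ N) powr a) * (K * (\<integral>\<^sup>+x\<in>?T. enn_powr (indicator ?Q x) a * u x \<partial>lebesgue))"
    using assms(1) T unfolding averaging_bound_def by (intro mult_left_mono) auto
  also have "(\<integral>\<^sup>+x\<in>?T. enn_powr (indicator ?Q x) a * u x \<partial>lebesgue) = (\<integral>\<^sup>+x\<in>?Q. u x \<partial>lebesgue)"
    using cube_subset_triple[OF assms(3), of b] by (intro nn_integral_cong) (auto simp: indicator_def)
  finally show ?thesis by (simp add: emeasure_density N_def mult.assoc)
qed

text \<open>The constant K enters squared: once through doubling, when triples are replaced by the
  selected cubes, and once through the averaging bound on each selected cube.\<close>

lemma weak_type_finite_cover: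
  fixes u :: "real ^ 'n \<Rightarrow> ennreal"
  assumes ab: "averaging_bound a K u" "0 < a" and [measurable]: "u \<in> borel_measurable lebesgue" "h \<in> borel_measurable lebesgue"
    and F: "finite F" "\<And>b l. (b, l) \<in> F \<Longrightarrow> 0 < l \<and> c < avg (cube b l) h"
  shows "enn_powr c a * emeasure (density lebesgue u) (\<Union>(case_prod cube ` F))
    \<le> ennreal ((3 ^ CARD('n)) powr a) * K\<^sup>2 * (\<integral>\<^sup>+x. enn_powr (h x) a * u x \<partial>lebesgue)"
proof -
  define \<mu> where "\<mu> = density lebesgue u"
  define \<nu> where "\<nu> = density lebesgue (\<lambda>x. enn_powr (h x) a * u x)"
  define B where "B = ennreal ((3 ^ CARD('n)) powr a) * K"
  obtain G where G: "G \<subseteq> F" "disjoint_family_on (case_prod cube) G" "\<Union>(case_prod cube ` F) \<subseteq> \<Union>(triple ` G)"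
    using vitali_finite_cubes[of F] F by metis
  have fG: "finite G" using G F finite_subset by blast
  have pos: "0 < l" "c < avg (cube b l) h" if "(b, l) \<in> G" for b l using that G F by blast+
  have [measurable]: "triple c \<in> sets lebesgue" if "c \<in> G" for c
    using pos(1)[of "fst c" "snd c"] that sets_cubes[OF triple_in_cubes[of "snd c" "fst c"]] by simp
  have "emeasure \<mu> (\<Union>(case_prod cube ` F)) \<le> emeasure \<mu> (\<Union>(triple ` G))"
    using G(3) fG by (intro emeasure_mono) (auto simp: \<mu>_def)
  also have "\<dots> \<le> (\<Sum>c\<in>G. emeasure \<mu> (triple c))"
    using fG by (intro emeasure_subadditive_finite) (auto simp: \<mu>_def)
  also have "\<dots> \<le> (\<Sum>c\<in>G. B * emeasure \<mu> (case_prod cube c))"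
    using doubling_of_averaging_bound[OF ab] pos(1) unfolding B_def \<mu>_def
    by (intro sum_mono) (auto simp: split_beta)
  finally have "enn_powr c a * emeasure \<mu> (\<Union>(case_prod cube ` F))
    \<le> enn_powr c a * (\<Sum>c\<in>G. B * emeasure \<mu> (case_prod cube c))"
    by (rule mult_left_mono) simp
  also have "\<dots> = (\<Sum>d\<in>G. B * (enn_powr c a * emeasure \<mu> (case_prod cube d)))"
    by (simp add: sum_distrib_left mult_ac)
  also have "\<dots> \<le> (\<Sum>d\<in>G. B * (K * emeasure \<nu> (case_prod cube d)))"
  proof (intro sum_mono mult_left_mono)
    fix d assume d: "d \<in> G"
    then have dQ: "case_prod cube d \<in> cubes" using pos(1)[of "fst d" "snd d"] by (auto simp: split_beta)
    have "enn_powr c a * emeasure \<mu> (case_prod cube d) \<le> enn_powr (avg (case_prod cube d) h) a * emeasure \<mu> (case_prod cube d)"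
      using pos(2)[of "fst d" "snd d"] d ab(2) by (intro mult_right_mono enn_powr_mono) (auto simp: split_beta)
    also have "\<dots> \<le> K * emeasure \<nu> (case_prod cube d)"
      using ab(1) dQ unfolding averaging_bound_def by (simp add: \<mu>_def \<nu>_def emeasure_density)
    finally show "enn_powr c a * emeasure \<mu> (case_prod cube d) \<le> K * emeasure \<nu> (case_prod cube d)" .
  qed auto
  also have "\<dots> = B * K * (\<Sum>d\<in>G. emeasure \<nu> (case_prod cube d))"
    by (simp add: sum_distrib_left mult_ac)
  also have "(\<Sum>d\<in>G. emeasure \<nu> (case_prod cube d)) = emeasure \<nu> (\<Union>(case_prod cube ` G))"
    using G fG by (intro sum_emeasure) (auto simp: \<nu>_def)
  also have "\<dots> \<le> emeasure \<nu> (space \<nu>)"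
    by (rule emeasure_space)
  also have "\<dots> = (\<integral>\<^sup>+x. enn_powr (h x) a * u x \<partial>lebesgue)"
    by (simp add: \<nu>_def emeasure_density)
  finally show ?thesis
    by (simp add: B_def \<mu>_def power2_eq_square mult.assoc mult_left_mono)
qed

lemma weak_type_maximal:
  fixes u :: "real ^ 'n \<Rightarrow> ennreal"
  assumes ab: "averaging_bound a K u" "0 < a" and [measurable]: "u \<in> borel_measurable lebesgue" "h \<in> borel_measurable lebesgue"
  shows "enn_powr c a * emeasure (density lebesgue u) {x. c < maximal h x}
    \<le> ennreal ((3 ^ CARD('n)) powr a) * K\<^sup>2 * (\<integral>\<^sup>+x. enn_powr (h x) a * u x \<partial>lebesgue)"
    (is "_ \<le> ?R")
proof -
  define \<F> where "\<F> = {(b, l). 0 < l \<and> c < avg (cube b l) h}"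
  have U: "{x. c < maximal h x} = (\<Union>d\<in>\<F>. interior (case_prod cube d))"
    unfolding maximal_superlevel \<F>_def by (auto simp: cubes_iff)
  \<comment> \<open>The superlevel set is a union of open interiors, so Lindelof leaves countably
    many cubes; their finite unions increase to a set containing it, and the finite bound is
    uniform.\<close>
  obtain \<G> where G: "\<G> \<subseteq> (\<lambda>d. interior (case_prod cube d)) ` \<F>" "countable \<G>" "\<Union>\<G> = (\<Union>d\<in>\<F>. interior (case_prod cube d))"
    using Lindelof[of "(\<lambda>d. interior (case_prod cube d)) ` \<F>"] by auto
  obtain C where C: "countable C" "C \<subseteq> \<F>" "\<G> = (\<lambda>d. interior (case_prod cube d)) ` C"
    using G(1,2) by (meson countable_subset_image)
  show ?thesis
  proof (cases "C = {}")
    case True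
    then have "{x. c < maximal h x} = {}" using U G C by auto
    then show ?thesis by simp
  next
    case False
    define A where "A k = (\<Union>d\<in>from_nat_into C ` {..k}. case_prod cube d)" for k :: nat
    have "{x. c < maximal h x} \<subseteq> (\<Union>k. A k)"
    proof
      fix x assume "x \<in> {x. c < maximal h x}"
      then have "x \<in> \<Union>\<G>" unfolding U G(3) .
      then obtain d where d: "d \<in> C" "x \<in> interior (case_prod cube d)" unfolding C(3) by blast
      then obtain k where k: "d = from_nat_into C k" using from_nat_into_surj[OF C(1)] by metis
      have "x \<in> case_prod cube d" using d(2) interior_subset by blast
      then have "x \<in> A k" unfolding A_def k by (rule UN_I[rotated]) simp
      then show "x \<in> (\<Union>k. A k)" by blast
    qed
    moreover have [measurable]: "A k \<in> sets lebesgue" for k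
      unfolding A_def by (intro sets.finite_UN) (auto simp: split_beta)
    ultimately have "emeasure (density lebesgue u) {x. c < maximal h x} \<le> emeasure (density lebesgue u) (\<Union>k. A k)"
      by (intro emeasure_mono) auto
    also have "\<dots> = (SUP k. emeasure (density lebesgue u) (A k))"
    proof (rule SUP_emeasure_incseq[symmetric])
      show "incseq A" unfolding A_def incseq_def by (intro allI impI UN_mono image_mono) auto
    qed (auto simp: \<open>\<And>k. A k \<in> sets lebesgue\<close>)
    finally have "enn_powr c a * emeasure (density lebesgue u) {x. c < maximal h x}
      \<le> enn_powr c a * (SUP k. emeasure (density lebesgue u) (A k))" by (rule mult_left_mono) simp
    also have "\<dots> = (SUP k. enn_powr c a * emeasure (density lebesgue u) (A k))"
      by (simp add: SUP_mult_left_ennreal)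
    also have "\<dots> \<le> ?R"
    proof (rule SUP_least)
      fix k
      have "from_nat_into C ` {..k} \<subseteq> \<F>" using C(2) from_nat_into[OF False] by blast
      then show "enn_powr c a * emeasure (density lebesgue u) (A k) \<le> ?R"
        unfolding A_def by (intro weak_type_finite_cover[OF ab]) (auto simp: \<F>_def)
    qed
    finally show ?thesis .
  qed
qed

text \<open>Values of h up to c contribute at most c to the maximal function. Level 2c for h
  therefore forces level c for the part of h above c, which is the form that interpolation asks
  for.\<close>

lemma weak_type_maximal_truncated:
  fixes u :: "real ^ 'n \<Rightarrow> ennreal"
  assumes ab: "averaging_bound a K u" "0 < a" and [measurable]: "u \<in> borel_measurable lebesgue" "h \<in> borel_measurable lebesgue"
    and "0 < c"
  shows "ennreal (c powr a) * emeasure (density lebesgue u) {x \<in> space (density lebesgue u). ennreal (2 * c) < maximal h x}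
    \<le> ennreal ((3 ^ CARD('n)) powr a) * K\<^sup>2 * (\<integral>\<^sup>+x. (if ennreal c < h x then enn_powr (h x) a else 0) \<partial>density lebesgue u)"
proof -
  define g where "g x = (if ennreal c < h x then h x else 0)" for x
  have [measurable]: "g \<in> borel_measurable lebesgue" unfolding g_def by measurable
  have "maximal h x \<le> maximal g x + ennreal c" for x
  proof -
    have "maximal h x \<le> maximal (\<lambda>x. g x + ennreal c) x"
      by (intro maximal_mono_AE) (auto simp: g_def not_less)
    also have "\<dots> \<le> maximal g x + maximal (\<lambda>x. ennreal c) x" by (intro maximal_add_le) auto
    also have "\<dots> \<le> maximal g x + ennreal c" by (intro add_left_mono maximal_const_le)
    finally show ?thesis .
  qed
  then have sub: "{x. ennreal (2 * c) < maximal h x} \<subseteq> {x. ennreal c < maximal g x}"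
  proof (intro subsetI CollectI)
    fix x assume "x \<in> {x. ennreal (2 * c) < maximal h x}"
    then have "ennreal c + ennreal c < maximal g x + ennreal c"
      using \<open>maximal h x \<le> maximal g x + ennreal c\<close> assms(5) by (auto simp: ennreal_plus[symmetric] simp del: ennreal_plus)
    then show "ennreal c < maximal g x"
      by (metis add_right_mono linorder_not_le)
  qed
  have "{x \<in> space lebesgue. ennreal c < maximal g x} \<in> sets lebesgue" by measurable
  then have sup: "{x. ennreal c < maximal g x} \<in> sets (density lebesgue u)" by simp
  have "ennreal (c powr a) * emeasure (density lebesgue u) {x. ennreal (2 * c) < maximal h x}
    \<le> enn_powr (ennreal c) a * emeasure (density lebesgue u) {x. ennreal c < maximal g x}"
    using sub assms(5) sup by (intro mult_mono emeasure_mono) (auto simp: enn_powr_ennreal)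
  also have "\<dots> \<le> ennreal ((3 ^ CARD('n)) powr a) * K\<^sup>2 * (\<integral>\<^sup>+x. enn_powr (g x) a * u x \<partial>lebesgue)"
    by (rule weak_type_maximal[OF ab]) auto
  also have "(\<integral>\<^sup>+x. enn_powr (g x) a * u x \<partial>lebesgue) = (\<integral>\<^sup>+x. (if ennreal c < h x then enn_powr (h x) a else 0) \<partial>density lebesgue u)"
    by (subst nn_integral_density) (auto simp: g_def mult.commute intro!: nn_integral_cong)
  finally show ?thesis by simp
qed

lemma strong_type_maximal:
  fixes u :: "real ^ 'n \<Rightarrow> ennreal"
  assumes ab: "averaging_bound a K u" "0 < a" "a < b" and [measurable]: "u \<in> borel_measurable lebesgue" "h \<in> borel_measurable lebesgue"
  shows "(\<integral>\<^sup>+x. enn_powr (maximal h x) b \<partial>density lebesgue u)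
    \<le> ennreal (4 powr b * (2 powr (b - a) / (2 powr (b - a) - 1))) * (ennreal ((3 ^ CARD('n)) powr a) * K\<^sup>2)
      * (\<integral>\<^sup>+x. enn_powr (h x) b \<partial>density lebesgue u)"
  by (intro marcinkiewicz_interpolation ab weak_type_maximal_truncated) auto

section \<open>Kolmogorov's inequality and A_1 weights from maximal functions\<close>

text \<open>Kolmogorov's inequality: for d < 1 the weak L^1 tail is integrable to the power d on a
  set of finite measure. The cut is made at z, below which the trivial bound z^d is used.\<close>

lemma kolmogorov_avg:
  assumes d: "0 < d" "d < 1" and z: "0 < z" and [measurable]: "G \<in> borel_measurable lebesgue" and Q: "Q \<in> cubes"
    and weak: "\<And>c::real. 0 < c \<Longrightarrow> ennreal c * emeasure lebesgue {x. ennreal c < G x} \<le> ennreal z * emeasure lebesgue Q"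
  shows "avg Q (\<lambda>x. enn_powr (G x) d) \<le> ennreal ((1 + 2 powr d / (1 - 2 powr (d - 1))) * z powr d)"
proof -
  define M where "M = density lebesgue (indicator Q)"
  define C where "C = 2 powr d / (1 - 2 powr (d - 1))"
  have C: "0 \<le> C" using d powr_less_one[of 2 "d - 1"] by (simp add: C_def)
  have [measurable]: "Q \<in> sets lebesgue" using Q by simp
  have sM: "sets M = sets lebesgue" "space M = UNIV" by (auto simp: M_def)
  have [measurable]: "G \<in> borel_measurable M" by (simp add: M_def)
  have I: "(\<integral>\<^sup>+x. f x \<partial>M) = (\<integral>\<^sup>+x\<in>Q. f x \<partial>lebesgue)" if "f \<in> borel_measurable lebesgue" for f
    unfolding M_def by (subst nn_integral_density) (use that in \<open>auto simp: mult.commute\<close>)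
  have above: "(\<integral>\<^sup>+x. (if ennreal z < G x then enn_powr (G x) d else 0) \<partial>M)
    \<le> ennreal (2 powr d / (1 - 2 powr (d - 1))) * emeasure lebesgue Q * ennreal (z powr d)"
  proof (intro tail_integral_above z d)
    fix y assume y: "z \<le> y"
    have m: "{x. ennreal y < G x} \<in> sets lebesgue" using measurable_sets[of G lebesgue borel "{ennreal y<..}"] by (simp add: vimage_def)
    have "emeasure M {x \<in> space M. ennreal y < G x} \<le> emeasure lebesgue {x. ennreal y < G x}"
      using m unfolding M_def by (subst emeasure_density) (auto simp: sM M_def intro!: nn_integral_mono order_trans[OF _ eq_refl[OF nn_integral_indicator]] simp: indicator_def)
    also have "\<dots> = ennreal (1 / y) * (ennreal y * emeasure lebesgue {x. ennreal y < G x})"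
      using y z by (simp add: mult.assoc[symmetric] ennreal_mult[symmetric])
    also have "\<dots> \<le> ennreal (1 / y) * (ennreal z * emeasure lebesgue Q)"
      using y z by (intro mult_left_mono weak) auto
    also have "\<dots> = emeasure lebesgue Q * ennreal ((z / y) powr 1)"
      using y z by (simp add: mult_ac ennreal_mult[symmetric] mult.assoc[symmetric])
    finally show "emeasure M {x \<in> space M. ennreal y < G x} \<le> emeasure lebesgue Q * ennreal ((z / y) powr 1)" .
  qed auto
  have "(\<integral>\<^sup>+x\<in>Q. enn_powr (G x) d \<partial>lebesgue) = (\<integral>\<^sup>+x. enn_powr (G x) d \<partial>M)"
    by (rule I[symmetric]) simp
  also have "\<dots> \<le> (\<integral>\<^sup>+x. ennreal (z powr d) + (if ennreal z < G x then enn_powr (G x) d else 0) \<partial>M)"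
  proof (intro nn_integral_mono)
    fix x
    show "enn_powr (G x) d \<le> ennreal (z powr d) + (if ennreal z < G x then enn_powr (G x) d else 0)"
      using enn_powr_mono[of d "G x" "ennreal z"] d z by (auto simp: not_less enn_powr_ennreal)
  qed
  also have "\<dots> = (\<integral>\<^sup>+x. ennreal (z powr d) \<partial>M) + (\<integral>\<^sup>+x. (if ennreal z < G x then enn_powr (G x) d else 0) \<partial>M)"
    by (rule nn_integral_add) auto
  also have "(\<integral>\<^sup>+x. ennreal (z powr d) \<partial>M) = ennreal (z powr d) * emeasure lebesgue Q"
    by (subst I) (auto simp: nn_integral_cmult_indicator)
  also have "ennreal (z powr d) * emeasure lebesgue Q + (\<integral>\<^sup>+x. (if ennreal z < G x then enn_powr (G x) d else 0) \<partial>M)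
    \<le> ennreal (z powr d) * emeasure lebesgue Q + ennreal C * emeasure lebesgue Q * ennreal (z powr d)"
    using above by (intro add_left_mono) (simp add: C_def)
  also have "\<dots> = ennreal ((1 + C) * z powr d) * emeasure lebesgue Q"
    using C by (simp add: ennreal_mult distrib_right distrib_left mult_ac)
  finally show ?thesis
    using Q by (subst avg_le_iff[OF emeasure_cubes_pos emeasure_cubes_finite]) (auto simp: C_def)
qed

text \<open>A cube through y of side at most l stays inside the triple and sees nothing. A larger
  one has a triple containing the whole cube, hence x, and this costs the volume factor 3^n.\<close>

lemma maximal_off_triple_le:
  fixes h :: "real ^ 'n \<Rightarrow> ennreal"
  assumes "0 < l" "x \<in> cube a l" "y \<in> cube a l"
  shows "maximal (\<lambda>z. h z * indicator (- triple (a, l)) z) y \<le> ennreal (3 ^ CARD('n)) * maximal h x"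
proof (rule maximal_leI)
  fix Q :: "(real ^ 'n) set" assume Q: "Q \<in> cubes" "y \<in> interior Q"
  then obtain b m where bm: "0 < m" "Q = cube b m" by (auto simp: cubes_iff)
  have yQ: "y \<in> Q" using Q(2) interior_subset by blast
  have meet: "cube a l \<inter> cube b m \<noteq> {}" using assms(3) yQ bm by blast
  show "avg Q (\<lambda>z. h z * indicator (- triple (a, l)) z) \<le> ennreal (3 ^ CARD('n)) * maximal h x"
  proof (cases "m \<le> l")
    case True
    then have sub: "Q \<subseteq> triple (a, l)"
      unfolding bm(2) using meet by (intro cube_subset_triple_of_meets) blast+
    have "(\<integral>\<^sup>+z\<in>Q. (h z * indicator (- triple (a, l)) z) \<partial>lebesgue) = (\<integral>\<^sup>+z. 0 \<partial>(lebesgue :: (real ^ 'n) measure))"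
      using sub by (intro nn_integral_cong) (auto simp: indicator_def)
    then show ?thesis by (simp add: avg_def)
  next
    case False
    let ?T = "triple (b, m)"
    have T: "?T \<in> cubes" using bm by (simp add: triple_in_cubes)
    have xT: "x \<in> ?T" using cube_subset_triple_of_meets[OF meet] False assms(2) by auto
    have "avg Q (\<lambda>z. h z * indicator (- triple (a, l)) z) * emeasure lebesgue Q
      = (\<integral>\<^sup>+z\<in>Q. (h z * indicator (- triple (a, l)) z) \<partial>lebesgue)"
      using Q by (simp add: integral_cube_eq_avg)
    also have "\<dots> \<le> (\<integral>\<^sup>+z\<in>?T. h z \<partial>lebesgue)"
      using cube_subset_triple[OF bm(1), of b] bm(2) by (intro nn_integral_mono) (auto simp: indicator_def)
    also have "\<dots> = avg ?T h * (ennreal (3 ^ CARD('n)) * emeasure lebesgue Q)"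
      using T bm by (simp add: integral_cube_eq_avg emeasure_triple)
    also have "\<dots> \<le> maximal h x * (ennreal (3 ^ CARD('n)) * emeasure lebesgue Q)"
      by (intro mult_right_mono avg_le_maximal T xT) simp
    finally have le: "emeasure lebesgue Q * avg Q (\<lambda>z. h z * indicator (- triple (a, l)) z)
      \<le> emeasure lebesgue Q * (ennreal (3 ^ CARD('n)) * maximal h x)" by (simp add: mult_ac)
    have "emeasure lebesgue Q \<noteq> 0" "emeasure lebesgue Q \<noteq> top"
      using emeasure_cubes_pos[OF Q(1)] emeasure_cubes_finite[OF Q(1)] by auto
    then show ?thesis using le by (subst (asm) ennreal_mult_le_mult_iff)
  qed
qed

text \<open>The function is split along the triple of Q. The local part is handled by Kolmogorov's
  inequality and weak (1,1), the far part has a nearly constant maximal function on Q. The constant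
  is chosen before h, which is what makes the test weights uniformly admissible.\<close>

theorem coifman_rochberg:
  assumes s: "1 < s"
  obtains C where "0 < C"
    "\<And>h Q (x :: real ^ 'n). h \<in> borel_measurable lebesgue \<Longrightarrow> Q \<in> cubes \<Longrightarrow> x \<in> Q \<Longrightarrow>
      avg Q (\<lambda>y. enn_powr (maximal h y) (1 / s)) \<le> ennreal C * enn_powr (maximal h x) (1 / s)"
proof -
  define d where "d = 1 / s"
  have d: "0 < d" "d < 1" using s by (auto simp: d_def)
  define N where "N = CARD('n)"
  \<comment> \<open>The base 9^N is 3^N from the weak (1,1) constant times 3^N from the volume of
    the triple.\<close>
  define C1 where "C1 = (1 + 2 powr d / (1 - 2 powr (d - 1))) * (9 ^ N) powr d"
  define C2 where "C2 = (3 ^ N :: real) powr d"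
  have C12: "0 \<le> C1" "0 < C2" using d powr_less_one[of 2 "d - 1"] by (auto simp: C1_def C2_def)
  define C where "C = 2 powr d * (C1 + C2)"
  have C: "0 < C" using C12 by (simp add: C_def add_nonneg_pos)
  show ?thesis
  proof (rule that[OF C])
    fix h :: "real ^ 'n \<Rightarrow> ennreal" and Q and x :: "real ^ 'n"
    assume h [measurable]: "h \<in> borel_measurable lebesgue" and Q: "Q \<in> cubes" "x \<in> Q"
    obtain a l where al: "0 < l" "Q = cube a l" using Q by (auto simp: cubes_iff)
    have "avg Q (\<lambda>y. enn_powr (maximal h y) d) \<le> ennreal C * enn_powr (maximal h x) d"
    proof (cases "maximal h x = 0 \<or> maximal h x = top")
      case True
      then show ?thesis
      proof
        assume "maximal h x = 0"
        then have "maximal h y = 0" for y by (rule maximal_eq_0_imp)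
        then show ?thesis by (simp add: avg_def)
      next
        assume "maximal h x = top"
        then show ?thesis using C by (simp add: ennreal_mult_top)
      qed
    next
      case False
      then obtain z where z: "maximal h x = ennreal z" "0 < z"
        by (cases "maximal h x") (auto simp: less_le)
      let ?T = "triple (a, l)"
      have T: "?T \<in> cubes" using al by (simp add: triple_in_cubes)
      then have [measurable]: "?T \<in> sets lebesgue" by simp
      have QT: "Q \<subseteq> ?T" using al cube_subset_triple by simp
      define h1 where "h1 y = h y * indicator ?T y" for y
      define h2 where "h2 y = h y * indicator (- ?T) y" for y
      have [measurable]: "h1 \<in> borel_measurable lebesgue" "h2 \<in> borel_measurable lebesgue"
        unfolding h1_def h2_def by measurable
      have hsum: "h y = h1 y + h2 y" for y by (simp add: h1_def h2_def indicator_def)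
      have avg1: "avg Q (\<lambda>y. enn_powr (maximal h1 y) d) \<le> ennreal (C1 * z powr d)"
      proof -
        have "avg Q (\<lambda>y. enn_powr (maximal h1 y) d) \<le> ennreal ((1 + 2 powr d / (1 - 2 powr (d - 1))) * (9 ^ N * z) powr d)"
        proof (rule kolmogorov_avg[OF d])
          fix c :: real assume "0 < c"
          have "ennreal c * emeasure lebesgue {y. ennreal c < maximal h1 y}
            = enn_powr (ennreal c) 1 * emeasure (density lebesgue (\<lambda>x. 1)) {y. ennreal c < maximal h1 y}"
            by (simp add: density_1)
          also have "\<dots> \<le> ennreal ((3 ^ N) powr 1) * 1\<^sup>2 * (\<integral>\<^sup>+y. enn_powr (h1 y) 1 * 1 \<partial>lebesgue)"
            unfolding N_def by (rule weak_type_maximal[OF averaging_bound_one]) auto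
          also have "\<dots> = ennreal (3 ^ N) * (\<integral>\<^sup>+y\<in>?T. h y \<partial>lebesgue)"
            by (simp add: h1_def)
          also have "\<dots> = ennreal (3 ^ N) * (avg ?T h * (ennreal (3 ^ N) * emeasure lebesgue Q))"
            using T al by (simp add: integral_cube_eq_avg emeasure_triple N_def)
          also have "\<dots> \<le> ennreal (3 ^ N) * (maximal h x * (ennreal (3 ^ N) * emeasure lebesgue Q))"
            using Q QT by (intro mult_left_mono mult_right_mono avg_le_maximal T) auto
          also have "\<dots> = ennreal (3 ^ N * 3 ^ N * z) * emeasure lebesgue Q"
            using z by (simp add: ennreal_mult mult_ac)
          also have "(3::real) ^ N * 3 ^ N = 9 ^ N" by (simp flip: power_mult_distrib)
          finally show "ennreal c * emeasure lebesgue {y. ennreal c < maximal h1 y} \<le> ennreal (9 ^ N * z) * emeasure lebesgue Q" .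
        qed (use z Q in auto)
        also have "(1 + 2 powr d / (1 - 2 powr (d - 1))) * (9 ^ N * z) powr d = C1 * z powr d"
          using z by (simp add: C1_def powr_mult)
        finally show ?thesis .
      qed
      have avg2: "avg Q (\<lambda>y. enn_powr (maximal h2 y) d) \<le> ennreal (C2 * z powr d)"
      proof -
        have "enn_powr (maximal h2 y) d \<le> ennreal (C2 * z powr d)" if "y \<in> Q" for y
        proof -
          have "maximal h2 y \<le> ennreal (3 ^ N) * maximal h x"
            using maximal_off_triple_le[of l x a y h] that Q al unfolding h2_def N_def by simp
          then have "enn_powr (maximal h2 y) d \<le> enn_powr (ennreal (3 ^ N * z)) d"
            using d z by (intro enn_powr_mono) (auto simp: ennreal_mult)
          then show ?thesis using z by (simp add: enn_powr_ennreal powr_mult C2_def)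
        qed
        then have "avg Q (\<lambda>y. enn_powr (maximal h2 y) d) \<le> avg Q (\<lambda>y. ennreal (C2 * z powr d))"
          by (intro avg_mono_AE) auto
        also have "\<dots> = ennreal (C2 * z powr d)"
          using Q by (intro avg_const emeasure_cubes_pos emeasure_cubes_finite)
        finally show ?thesis .
      qed
      have "avg Q (\<lambda>y. enn_powr (maximal h y) d)
        \<le> avg Q (\<lambda>y. ennreal (2 powr d) * (enn_powr (maximal h1 y) d + enn_powr (maximal h2 y) d))"
      proof (intro avg_mono_AE always_eventually allI impI)
        fix y
        have "maximal h y \<le> maximal h1 y + maximal h2 y"
          unfolding hsum[abs_def] by (rule maximal_add_le) auto
        then have "enn_powr (maximal h y) d \<le> enn_powr (maximal h1 y + maximal h2 y) d"
          using d by (intro enn_powr_mono) auto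
        also have "\<dots> \<le> ennreal (2 powr d) * (enn_powr (maximal h1 y) d + enn_powr (maximal h2 y) d)"
          using d by (intro enn_powr_sum_le)
        finally show "enn_powr (maximal h y) d \<le> ennreal (2 powr d) * (enn_powr (maximal h1 y) d + enn_powr (maximal h2 y) d)" .
      qed
      also have "\<dots> = ennreal (2 powr d) * (avg Q (\<lambda>y. enn_powr (maximal h1 y) d) + avg Q (\<lambda>y. enn_powr (maximal h2 y) d))"
        using Q by (subst avg_cmult, measurable) (auto simp: avg_add)
      also have "\<dots> \<le> ennreal (2 powr d) * (ennreal (C1 * z powr d) + ennreal (C2 * z powr d))"
        by (intro mult_left_mono add_mono avg1 avg2) simp
      also have "\<dots> = ennreal C * enn_powr (maximal h x) d"
        using z C12 by (simp add: C_def enn_powr_ennreal ennreal_mult[symmetric] ennreal_plus[symmetric] algebra_simps del: ennreal_plus)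
      finally show ?thesis .
    qed
    then show "avg Q (\<lambda>y. enn_powr (maximal h y) (1 / s)) \<le> ennreal C * enn_powr (maximal h x) (1 / s)"
      by (simp add: d_def)
  qed
qed

section \<open>Muckenhoupt weights\<close>

text \<open>The quantity under the supremum is that of \<open>Ap_norm\<close> for p different from
  1. Detaching the constant from the weight allows statements that are uniform over all weights with
  the same bound.\<close>

definition ap_bound :: "real \<Rightarrow> ennreal \<Rightarrow> (real ^ 'n \<Rightarrow> real) \<Rightarrow> bool"
  where "ap_bound p K w \<longleftrightarrow> (\<forall>Q\<in>cubes. avg Q (\<lambda>x. ennreal (w x)) *
    enn_powr (avg Q (\<lambda>x. ennreal (w x powr (- 1 / (p - 1))))) (p - 1) \<le> K)"

text \<open>Hoelder's inequality on Q for the factors h w^(1/a) and w^(-1/a); the second one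
  produces the dual average. Powers of |Q| are compared only at the end, where they are finite and
  nonzero.\<close>

lemma averaging_bound_of_ap_bound:
  fixes w :: "real ^ 'n \<Rightarrow> real"
  assumes a: "1 < a" and [measurable]: "w \<in> borel_measurable lebesgue" and pos: "AE x in lebesgue. 0 < w x"
    and ap: "ap_bound a K w"
  shows "averaging_bound a (ennreal (2 powr a) * K) (\<lambda>x. ennreal (w x))"
  unfolding averaging_bound_def
proof (intro ballI)
  fix Q :: "(real ^ 'n) set" and h :: "real ^ 'n \<Rightarrow> ennreal"
  assume Q: "Q \<in> cubes" and [measurable]: "h \<in> borel_measurable lebesgue"
  have [measurable]: "Q \<in> sets lebesgue" using Q by simp
  define m where "m = emeasure lebesgue Q"
  have m: "m \<noteq> 0" "m \<noteq> top" using emeasure_cubes_pos[OF Q] emeasure_cubes_finite[OF Q] by (auto simp: m_def)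
  define A where "A = avg Q (\<lambda>x. ennreal (w x powr (- 1 / (a - 1))))"
  define I where "I = (\<integral>\<^sup>+x\<in>Q. enn_powr (h x) a * ennreal (w x) \<partial>lebesgue)"
  define f where "f x = h x * ennreal (w x powr (1 / a)) * indicator Q x" for x
  define g where "g x = ennreal (w x powr (- 1 / a)) * indicator Q x" for x
  have [measurable]: "f \<in> borel_measurable lebesgue" "g \<in> borel_measurable lebesgue" unfolding f_def g_def by measurable
  have "(\<integral>\<^sup>+x\<in>Q. h x \<partial>lebesgue) = (\<integral>\<^sup>+x. f x * g x \<partial>lebesgue)"
  proof (rule nn_integral_cong_AE, use pos in eventually_elim)
    case (elim x)
    have "ennreal (w x powr (1 / a)) * ennreal (w x powr (- 1 / a)) = 1"
      using elim a by (simp add: ennreal_mult[symmetric] powr_add[symmetric])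
    then show ?case by (simp add: f_def g_def indicator_def mult_ac)
  qed
  moreover have "(\<integral>\<^sup>+x. enn_powr (f x) a \<partial>lebesgue) = I"
    unfolding I_def
  proof (rule nn_integral_cong_AE, use pos in eventually_elim)
    case (elim x)
    then show ?case using a by (auto simp: f_def indicator_def enn_powr_mult enn_powr_ennreal powr_powr)
  qed
  moreover have "(\<integral>\<^sup>+x. enn_powr (g x) (a / (a - 1)) \<partial>lebesgue) = A * m"
    unfolding A_def m_def integral_cube_eq_avg[OF Q, symmetric]
    using a by (intro nn_integral_cong) (auto simp: g_def indicator_def enn_powr_ennreal powr_powr)
  ultimately have "enn_powr (\<integral>\<^sup>+x\<in>Q. h x \<partial>lebesgue) a \<le> ennreal (2 powr a) * I * enn_powr (A * m) (a - 1)"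
    using holder_nn_integral[OF a, of f lebesgue g] by simp
  then have le: "enn_powr (avg Q h) a * enn_powr m a \<le> ennreal (2 powr a) * I * (enn_powr A (a - 1) * enn_powr m (a - 1))"
    using a by (simp add: integral_cube_eq_avg[OF Q] enn_powr_mult m_def)
  have mm: "enn_powr m (a - 1) * m = enn_powr m a"
    using enn_powr_add[of "a - 1" 1 m] a by simp
  have "enn_powr m a * (enn_powr (avg Q h) a * (\<integral>\<^sup>+x\<in>Q. ennreal (w x) \<partial>lebesgue))
    = (enn_powr (avg Q h) a * enn_powr m a) * (avg Q (\<lambda>x. ennreal (w x)) * m)"
    by (simp add: integral_cube_eq_avg[OF Q] m_def mult_ac)
  also have "\<dots> \<le> (ennreal (2 powr a) * I * (enn_powr A (a - 1) * enn_powr m (a - 1))) * (avg Q (\<lambda>x. ennreal (w x)) * m)"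
    by (intro mult_right_mono le) simp
  also have "\<dots> = ennreal (2 powr a) * I * (avg Q (\<lambda>x. ennreal (w x)) * enn_powr A (a - 1)) * (enn_powr m (a - 1) * m)"
    by (simp add: mult_ac)
  also have "\<dots> \<le> ennreal (2 powr a) * I * K * (enn_powr m (a - 1) * m)"
    using ap Q unfolding ap_bound_def A_def by (intro mult_left_mono mult_right_mono) auto
  also have "\<dots> = enn_powr m a * (ennreal (2 powr a) * K * I)"
    unfolding mm by (simp only: mult_ac)
  finally have "enn_powr m a * (enn_powr (avg Q h) a * (\<integral>\<^sup>+x\<in>Q. ennreal (w x) \<partial>lebesgue))
    \<le> enn_powr m a * (ennreal (2 powr a) * K * I)" .
  then show "enn_powr (avg Q h) a * (\<integral>\<^sup>+x\<in>Q. ennreal (w x) \<partial>lebesgue) \<le> ennreal (2 powr a) * K * I"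
    using m by (subst (asm) ennreal_mult_le_mult_iff) (auto simp: top_unique)
qed

text \<open>Jensen's inequality up to a constant, read off from the fact that Lebesgue measure
  itself satisfies the A_t condition.\<close>

lemma avg_power_le:
  fixes h :: "real ^ 'n \<Rightarrow> ennreal"
  assumes t: "1 \<le> t" and Q: "Q \<in> cubes" and h: "h \<in> borel_measurable lebesgue"
  shows "enn_powr (avg Q h) t \<le> ennreal (2 powr t) * avg Q (\<lambda>x. enn_powr (h x) t)"
proof (cases "t = 1")
  case True
  have "1 * avg Q h \<le> 2 * avg Q h" by (intro mult_right_mono) auto
  then show ?thesis using True by simp
next
  case False
  have "ap_bound t 1 (\<lambda>x :: real ^ 'n. 1)"
    unfolding ap_bound_def by (auto simp: avg_const[OF emeasure_cubes_pos emeasure_cubes_finite])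
  then have "averaging_bound t (ennreal (2 powr t) * 1) (\<lambda>x :: real ^ 'n. ennreal 1)"
    using False t by (intro averaging_bound_of_ap_bound) auto
  then have "enn_powr (avg Q h) t * (\<integral>\<^sup>+x\<in>Q. ennreal 1 \<partial>lebesgue) \<le> (ennreal (2 powr t) * 1) * (\<integral>\<^sup>+x\<in>Q. enn_powr (h x) t * ennreal 1 \<partial>lebesgue)"
    using Q h unfolding averaging_bound_def by blast
  then have "enn_powr (avg Q h) t * emeasure lebesgue Q \<le> ennreal (2 powr t) * (\<integral>\<^sup>+x\<in>Q. enn_powr (h x) t \<partial>lebesgue)"
    using Q by (simp add: nn_integral_indicator)
  then have "emeasure lebesgue Q * enn_powr (avg Q h) t \<le> emeasure lebesgue Q * (ennreal (2 powr t) * avg Q (\<lambda>x. enn_powr (h x) t))"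
    unfolding integral_cube_eq_avg[OF Q] by (simp add: mult_ac)
  then show ?thesis
    using emeasure_cubes_pos[OF Q] emeasure_cubes_finite[OF Q] by (subst (asm) ennreal_mult_le_mult_iff) auto
qed

text \<open>Jensen's inequality for the dual average with exponent (r-1)/(p-1) >= 1; the constant
  2^(r-1) is its factor 2^t raised to the power p-1.\<close>

lemma ap_bound_mono:
  fixes w :: "real ^ 'n \<Rightarrow> real"
  assumes r: "1 < p" "p \<le> r" and [measurable]: "w \<in> borel_measurable lebesgue" and pos: "AE x in lebesgue. 0 < w x"
    and ap: "ap_bound p K w"
  shows "ap_bound r (ennreal (2 powr (r - 1)) * K) w"
  unfolding ap_bound_def
proof
  fix Q :: "(real ^ 'n) set" assume Q: "Q \<in> cubes"
  define t where "t = (r - 1) / (p - 1)"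
  have t: "1 \<le> t" using r by (simp add: t_def)
  let ?h = "\<lambda>x. ennreal (w x powr (- 1 / (r - 1)))"
  have "enn_powr (avg Q ?h) t \<le> ennreal (2 powr t) * avg Q (\<lambda>x. enn_powr (?h x) t)"
    using Q t by (intro avg_power_le) auto
  also have "(\<lambda>x. enn_powr (?h x) t) = (\<lambda>x. ennreal (w x powr (- 1 / (p - 1))))"
    using r by (auto simp: enn_powr_ennreal powr_powr t_def)
  finally have "enn_powr (enn_powr (avg Q ?h) t) (p - 1) \<le> enn_powr (ennreal (2 powr t) * avg Q (\<lambda>x. ennreal (w x powr (- 1 / (p - 1))))) (p - 1)"
    using r by (intro enn_powr_mono) auto
  then have "enn_powr (avg Q ?h) (r - 1) \<le> ennreal (2 powr (r - 1)) * enn_powr (avg Q (\<lambda>x. ennreal (w x powr (- 1 / (p - 1))))) (p - 1)"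
    using r by (simp add: enn_powr_mult enn_powr_powr enn_powr_ennreal powr_powr t_def)
  then have "avg Q (\<lambda>x. ennreal (w x)) * enn_powr (avg Q ?h) (r - 1)
    \<le> avg Q (\<lambda>x. ennreal (w x)) * (ennreal (2 powr (r - 1)) * enn_powr (avg Q (\<lambda>x. ennreal (w x powr (- 1 / (p - 1))))) (p - 1))"
    by (rule mult_left_mono) simp
  also have "\<dots> = ennreal (2 powr (r - 1)) * (avg Q (\<lambda>x. ennreal (w x)) * enn_powr (avg Q (\<lambda>x. ennreal (w x powr (- 1 / (p - 1))))) (p - 1))"
    by (simp add: mult_ac)
  also have "\<dots> \<le> ennreal (2 powr (r - 1)) * K"
    using ap Q unfolding ap_bound_def by (intro mult_left_mono) auto
  finally show "avg Q (\<lambda>x. ennreal (w x)) * enn_powr (avg Q ?h) (r - 1) \<le> ennreal (2 powr (r - 1)) * K" .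
qed

text \<open>The A_infinity property: testing on the indicator of a set filling half of Q shows that
  this set carries a fixed share of the u-mass of Q.\<close>

lemma averaging_bound_subset:
  fixes u :: "real ^ 'n \<Rightarrow> ennreal"
  assumes ab: "averaging_bound a K u" "0 < a" and Q: "Q \<in> cubes" and [measurable]: "E \<in> sets lebesgue" and E: "E \<subseteq> Q"
    "emeasure lebesgue Q \<le> 2 * emeasure lebesgue E"
  shows "ennreal ((1 / 2) powr a) * (\<integral>\<^sup>+x\<in>Q. u x \<partial>lebesgue) \<le> K * (\<integral>\<^sup>+x\<in>E. u x \<partial>lebesgue)"
proof -
  have "emeasure lebesgue Q * ennreal (1 / 2) \<le> (2 * emeasure lebesgue E) * ennreal (1 / 2)"
    using E by (intro mult_right_mono) auto
  also have "\<dots> = emeasure lebesgue E"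
    using ennreal_mult[of 2 "1 / 2"] by (simp add: mult.commute mult.left_commute) (simp add: mult.assoc[symmetric])
  also have "\<dots> = (\<integral>\<^sup>+x\<in>Q. indicator E x \<partial>lebesgue)"
  proof -
    have "(\<integral>\<^sup>+x\<in>Q. indicator E x \<partial>lebesgue) = (\<integral>\<^sup>+x. indicator E x \<partial>lebesgue)"
      using E by (intro nn_integral_cong) (auto simp: indicator_def)
    then show ?thesis by simp
  qed
  also have "\<dots> = emeasure lebesgue Q * avg Q (indicator E)"
    using Q by (simp add: integral_cube_eq_avg mult.commute)
  finally have half: "ennreal (1 / 2) \<le> avg Q (indicator E)"
    using emeasure_cubes_pos[OF Q] emeasure_cubes_finite[OF Q] by (subst (asm) ennreal_mult_le_mult_iff) auto
  have "ennreal ((1 / 2) powr a) * (\<integral>\<^sup>+x\<in>Q. u x \<partial>lebesgue) \<le> enn_powr (avg Q (indicator E)) a * (\<integral>\<^sup>+x\<in>Q. u x \<partial>lebesgue)"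
  proof (rule mult_right_mono)
    show "ennreal ((1 / 2) powr a) \<le> enn_powr (avg Q (indicator E)) a"
      using ab(2) by (subst enn_powr_ennreal[symmetric], simp) (rule enn_powr_mono[OF _ half], simp)
  qed simp
  also have "\<dots> \<le> K * (\<integral>\<^sup>+x\<in>Q. enn_powr (indicator E x) a * u x \<partial>lebesgue)"
    using ab(1) Q unfolding averaging_bound_def by auto
  also have "(\<integral>\<^sup>+x\<in>Q. enn_powr (indicator E x) a * u x \<partial>lebesgue) = (\<integral>\<^sup>+x\<in>E. u x \<partial>lebesgue)"
    using E by (intro nn_integral_cong) (auto simp: indicator_def)
  finally show ?thesis .
qed

section \<open>The reverse Hoelder inequality\<close>

context dyadic_grid
begin

text \<open>A superlevel set of the dyadic maximal function localised to the top cell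
  \<open>D 0 a\<close>.\<close>

definition stop_set :: "(real ^ 'n \<Rightarrow> ennreal) \<Rightarrow> real \<Rightarrow> (real ^ 'n) set"
  where "stop_set u c = {x. \<exists>j. D j x \<subseteq> D 0 a \<and> ennreal c < avg (D j x) u}"

lemma sets_stop_set [measurable]: "stop_set u c \<in> sets lebesgue"
proof -
  have "stop_set u c = (\<Union>j. {x. D j x \<subseteq> D 0 a \<and> ennreal c < avg (D j x) u})" by (auto simp: stop_set_def)
  also have "\<dots> \<in> sets lebesgue"
    using sets_cell_pred[of "\<lambda>S. S \<subseteq> D 0 a \<and> ennreal c < avg S u"] by (intro sets.countable_UN) auto
  finally show ?thesis .
qed

lemma stop_set_subset: "stop_set u c \<subseteq> D 0 a"
  unfolding stop_set_def using cell_refl by blast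

lemma stop_set_antimono: "c \<le> c' \<Longrightarrow> stop_set u c' \<subseteq> stop_set u c"
  unfolding stop_set_def by (auto intro: le_less_trans ennreal_leI)

text \<open>Raising the level by 2^(n+1) loses a fixed share of the u-mass. A stopping cell S at
  level c has average at most 2^n c, because its parent was not selected, so weak (1,1) inside S
  places at most half of S in the higher set. The other half carries a fixed proportion of u by the
  averaging bound, and the estimates are summed over the stopping cells.\<close>

lemma stop_set_decay:
  assumes ab: "averaging_bound e (ennreal K) u" "0 < e" "1 \<le> K" and [measurable]: "u \<in> borel_measurable lebesgue"
    and c: "0 < c" "avg (D 0 a) u \<le> ennreal c"
  shows "emeasure (density lebesgue u) (stop_set u (2 ^ (CARD('n) + 1) * c))
    \<le> ennreal (1 - (1 / 2) powr e / K) * emeasure (density lebesgue u) (stop_set u c)"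
proof -
  define N where "N = CARD('n)"
  define c' where "c' = 2 ^ (N + 1) * c"
  have "1 * c \<le> 2 ^ (N + 1) * c" using c by (intro mult_right_mono) (auto intro: one_le_power simp del: power_Suc)
  then have c': "c \<le> c'" "0 < c'" using c by (auto simp: c'_def)
  let ?\<Omega> = "stop_set u c'"
  let ?\<mu> = "density lebesgue u"
  have half1: "(1 / 2) powr e \<le> 1" using ab powr_mono2[of e "1/2" "1::real"] by simp
  then have \<theta>: "0 \<le> 1 - (1 / 2) powr e / K" using ab by (simp add: field_simps)
  obtain \<S> where S: "countable \<S>" "disjoint \<S>" "\<Union>\<S> = {x. \<exists>j. D j x \<subseteq> D 0 a \<and> ennreal c < avg (D j x) u}"
    "\<forall>S\<in>\<S>. \<exists>j x. S = D j x \<and> (S \<subseteq> D 0 a \<and> ennreal c < avg S u) \<and> (\<forall>i<j. \<not> (D i x \<subseteq> D 0 a \<and> ennreal c < avg (D i x) u))"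
    by (rule stopping_cells[of "\<lambda>S. S \<subseteq> D 0 a \<and> ennreal c < avg S u"])
  have cell_bound: "emeasure (density lebesgue (\<lambda>x. u x * indicator ?\<Omega> x)) S \<le> ennreal (1 - (1 / 2) powr e / K) * emeasure ?\<mu> S" if Sm: "S \<in> \<S>" for S
  proof -
    obtain j x where jx: "S = D j x" "S \<subseteq> D 0 a" "ennreal c < avg S u" "\<And>i. i < j \<Longrightarrow> \<not> (D i x \<subseteq> D 0 a \<and> ennreal c < avg (D i x) u)"
      using bspec[OF S(4) Sm] by metis
    have [measurable]: "S \<in> sets lebesgue" using jx by simp
    have "x \<in> D 0 a" using jx(1,2) cell_refl by blast
    then have D0: "D 0 x = D 0 a" by (rule cell_eq)
    have low: "avg (D i x) u \<le> ennreal c" if "i < j" for i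
      using jx(4)[OF that] cell_antimono[of 0 i a l x] D0 by auto
    \<comment> \<open>The top cell has average at most c and is never selected, so every selected
      cell has a parent to compare with.\<close>
    have "j \<noteq> 0"
    proof
      assume "j = 0"
      then have "avg S u \<le> ennreal c" using jx(1) c(2) D0 by simp
      with jx(3) show False by simp
    qed
    then obtain i where i: "j = Suc i" by (cases j) auto
    have uS: "(\<integral>\<^sup>+x\<in>S. u x \<partial>lebesgue) \<le> ennreal (2 ^ N * c) * emeasure lebesgue S"
    proof -
      have "(\<integral>\<^sup>+x\<in>S. u x \<partial>lebesgue) \<le> (\<integral>\<^sup>+x\<in>D i x. u x \<partial>lebesgue)"
        using cell_Suc[of a l i x] jx(1) i by (intro nn_integral_mono) (auto simp: indicator_def)
      also have "\<dots> \<le> ennreal c * emeasure lebesgue (D i x)"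
        using low[of i] i by (simp add: avg_le_iff[OF emeasure_cell_pos emeasure_cell_finite])
      also have "\<dots> = ennreal (2 ^ N * c) * emeasure lebesgue S"
        using c jx(1) i by (simp add: emeasure_cell_parent[of i x] N_def ennreal_mult mult_ac)
      finally show ?thesis .
    qed
    \<comment> \<open>A witness coarser than S would be an ancestor of S with average at most c;
      hence membership in the higher set is decided by subcells of S, and the weak type bound may be
      localised to S.\<close>
    have "S \<inter> ?\<Omega> \<subseteq> {y. \<exists>i. D i y \<subseteq> S \<and> ennreal c' < avg (D i y) u}"
    proof
      fix y assume y: "y \<in> S \<inter> ?\<Omega>"
      then obtain i where i: "D i y \<subseteq> D 0 a" "ennreal c' < avg (D i y) u" by (auto simp: stop_set_def)
      have "\<not> i < j"
      proof
        assume "i < j"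
        then have "D i y = D i x" using y jx(1) by (intro cell_eq_le[of y a l j]) auto
        then have "avg (D i y) u \<le> ennreal c" using low[OF \<open>i < j\<close>] by simp
        also have "\<dots> \<le> ennreal c'" using c' by (intro ennreal_leI)
        finally show False using i(2) by simp
      qed
      then have "D i y \<subseteq> D j y" by (intro cell_antimono) simp
      also have "D j y = S" using y jx(1) cell_eq[of y a l j x] by simp
      finally show "y \<in> {y. \<exists>i. D i y \<subseteq> S \<and> ennreal c' < avg (D i y) u}" using i by blast
    qed
    moreover have "{y. \<exists>i. D i y \<subseteq> S \<and> ennreal c' < avg (D i y) u} \<in> sets lebesgue"
    proof -
      have "{y. \<exists>i. D i y \<subseteq> S \<and> ennreal c' < avg (D i y) u} = (\<Union>i. {y. D i y \<subseteq> S \<and> ennreal c' < avg (D i y) u})" by auto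
      also have "\<dots> \<in> sets lebesgue"
        using sets_cell_pred[of "\<lambda>T. T \<subseteq> S \<and> ennreal c' < avg T u"] by (intro sets.countable_UN) auto
      finally show ?thesis .
    qed
    ultimately have "ennreal c' * emeasure lebesgue (S \<inter> ?\<Omega>) \<le> ennreal c' * emeasure lebesgue {y. \<exists>i. D i y \<subseteq> S \<and> ennreal c' < avg (D i y) u}"
      by (intro mult_left_mono emeasure_mono) auto
    also have "\<dots> \<le> (\<integral>\<^sup>+x\<in>S. u x \<partial>lebesgue)" by (rule dyadic_weak_type) auto
    also note uS
    also have "ennreal (2 ^ N * c) * emeasure lebesgue S = ennreal c' * (ennreal (1 / 2) * emeasure lebesgue S)"
    proof -
      have "ennreal (2 ^ N * c) = ennreal c' * ennreal (1 / 2)"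
        using c by (subst ennreal_mult[symmetric]) (auto simp: c'_def)
      then show ?thesis by (simp only: mult.assoc)
    qed
    finally have half: "emeasure lebesgue (S \<inter> ?\<Omega>) \<le> ennreal (1 / 2) * emeasure lebesgue S"
      using c' by (subst (asm) ennreal_mult_le_mult_iff) auto
    \<comment> \<open>The averaging bound speaks of closed cubes, so the cell is exchanged for the
      cube equal to it up to a null set.\<close>
    obtain Q where Q: "Q \<in> cubes" "S \<subseteq> Q" "emeasure lebesgue Q = emeasure lebesgue S"
      "(\<integral>\<^sup>+y\<in>Q. u y \<partial>lebesgue) = (\<integral>\<^sup>+y\<in>S. u y \<partial>lebesgue)"
      unfolding jx(1) by (rule cell_set_integral[of j x]) blast
    define E where "E = S - ?\<Omega>"
    have [measurable]: "E \<in> sets lebesgue" by (simp add: E_def)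
    have split: "emeasure lebesgue S = emeasure lebesgue (S \<inter> ?\<Omega>) + emeasure lebesgue E"
      unfolding E_def by (subst plus_emeasure) (auto intro: arg_cong[where f="emeasure lebesgue"])
    obtain v where v: "emeasure lebesgue S = ennreal v" "0 \<le> v"
      using emeasure_cell_finite[of j x] jx(1) by (cases "emeasure lebesgue S") auto
    have "emeasure lebesgue Q \<le> 2 * emeasure lebesgue E"
    proof -
      obtain v1 v2 where v12: "emeasure lebesgue (S \<inter> ?\<Omega>) = ennreal v1" "0 \<le> v1" "emeasure lebesgue E = ennreal v2" "0 \<le> v2"
        using split v by (cases "emeasure lebesgue (S \<inter> ?\<Omega>)"; cases "emeasure lebesgue E") auto
      have "v = v1 + v2" using split v v12 by (simp add: ennreal_plus[symmetric] del: ennreal_plus)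
      moreover have "ennreal v1 \<le> ennreal (1 / 2 * v)"
        using half v v12 by (subst ennreal_mult) simp_all
      then have "v1 \<le> 1 / 2 * v" using v by simp
      ultimately have "v \<le> 2 * v2" by simp
      then have "ennreal v \<le> ennreal (2 * v2)" by (rule ennreal_leI)
      then show ?thesis using Q(3) v v12 by (simp add: ennreal_mult)
    qed
    then have "ennreal ((1 / 2) powr e) * (\<integral>\<^sup>+x\<in>Q. u x \<partial>lebesgue) \<le> ennreal K * (\<integral>\<^sup>+x\<in>E. u x \<partial>lebesgue)"
      using Q(2) by (intro averaging_bound_subset[OF ab(1,2) Q(1)]) (auto simp: E_def)
    then have uE: "ennreal ((1 / 2) powr e) * emeasure ?\<mu> S \<le> ennreal K * emeasure ?\<mu> E"
      by (simp add: Q(4) emeasure_density)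
    have usplit: "emeasure ?\<mu> S = emeasure ?\<mu> (S \<inter> ?\<Omega>) + emeasure ?\<mu> E"
      unfolding E_def by (subst plus_emeasure) (auto intro: arg_cong[where f="emeasure ?\<mu>"])
    have "emeasure ?\<mu> S \<le> ennreal (2 ^ N * c * v)"
      using uS v c by (simp add: emeasure_density ennreal_mult)
    then have "emeasure ?\<mu> S < top" by (rule le_less_trans) simp
    then have fin: "emeasure ?\<mu> S \<noteq> top" "emeasure ?\<mu> (S \<inter> ?\<Omega>) \<noteq> top" "emeasure ?\<mu> E \<noteq> top"
      using usplit by auto
    obtain V where V0: "emeasure ?\<mu> S = ennreal V" "0 \<le> V" using fin(1) by (cases "emeasure ?\<mu> S") auto
    obtain V1 where V1: "emeasure ?\<mu> (S \<inter> ?\<Omega>) = ennreal V1" "0 \<le> V1" using fin(2) by (cases "emeasure ?\<mu> (S \<inter> ?\<Omega>)") auto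
    obtain V2 where V2: "emeasure ?\<mu> E = ennreal V2" "0 \<le> V2" using fin(3) by (cases "emeasure ?\<mu> E") auto
    note V = V0 V1 V2
    have "V = V1 + V2" using usplit V by (simp add: ennreal_plus[symmetric] del: ennreal_plus)
    moreover have "(1 / 2) powr e * V \<le> K * V2" using uE V ab(3) by (simp add: ennreal_mult[symmetric])
    ultimately have "V1 \<le> (1 - (1 / 2) powr e / K) * V" using ab(3) by (simp add: field_simps)
    then have "emeasure ?\<mu> (S \<inter> ?\<Omega>) \<le> ennreal (1 - (1 / 2) powr e / K) * emeasure ?\<mu> S"
      using V \<theta> by (simp add: ennreal_mult[symmetric] ennreal_leI)
    moreover have "emeasure (density lebesgue (\<lambda>x. u x * indicator ?\<Omega> x)) S = emeasure ?\<mu> (S \<inter> ?\<Omega>)"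
      by (simp add: emeasure_density mult.assoc indicator_inter_arith[symmetric] Int_commute)
    ultimately show ?thesis by simp
  qed
  have US: "\<Union>\<S> = stop_set u c" using S(3) by (simp add: stop_set_def)
  have "emeasure (density lebesgue (\<lambda>x. u x * indicator ?\<Omega> x)) (\<Union>\<S>) \<le> ennreal (1 - (1 / 2) powr e / K) * emeasure ?\<mu> (\<Union>\<S>)"
  proof (rule emeasure_Union_le_countable_disjoint[OF S(1,2)])
    show "S \<in> sets (density lebesgue (\<lambda>x. u x * indicator ?\<Omega> x))" if "S \<in> \<S>" for S
      using S(4) that by force
  qed (use cell_bound in auto)
  moreover have "emeasure (density lebesgue (\<lambda>x. u x * indicator ?\<Omega> x)) (\<Union>\<S>) = emeasure ?\<mu> ?\<Omega>"
    unfolding US using stop_set_antimono[OF c'(1), of u]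
    by (subst (1 2) emeasure_density) (auto intro!: nn_integral_cong simp: indicator_def)
  ultimately show ?thesis by (simp add: US c'_def N_def)
qed

lemma AE_le_of_not_stop_set:
  assumes [measurable]: "u \<in> borel_measurable lebesgue"
  shows "AE x in lebesgue. \<forall>c. x \<in> D 0 a - stop_set u c \<longrightarrow> u x \<le> ennreal c"
  using AE_le_SUP_avg_cell[OF assms]
proof eventually_elim
  case (elim x)
  show ?case
  proof (intro allI impI)
    fix c assume x: "x \<in> D 0 a - stop_set u c"
    then have D0: "D 0 x = D 0 a" using cell_eq[of x a l 0 a] by simp
    have "avg (D j x) u \<le> ennreal c" for j
      using x cell_antimono[of 0 j a l x] D0 by (auto simp: stop_set_def not_less)
    then have "(SUP k. avg (D k x) u) \<le> ennreal c" by (intro SUP_least)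
    with elim show "u x \<le> ennreal c" by (rule order_trans)
  qed
qed

end

text \<open>One factor of u is absorbed into the measure and only u^d is decomposed, over stopping
  sets at the levels R^k c with c the average of u. Their u-mass decays like \<theta>^k while u^d
  grows at most like R^(k d0) up to a factor, so the smallness assumption makes the series
  geometric.\<close>

lemma reverse_holder_aux:
  fixes u :: "real ^ 'n \<Rightarrow> ennreal"
  assumes ab: "averaging_bound e (ennreal K) u" "0 < e" "1 \<le> K" and [measurable]: "u \<in> borel_measurable lebesgue"
    and Q: "Q \<in> cubes" "avg Q u < \<infinity>"
    and d: "0 < d" "d \<le> d0" and small: "(2 ^ (CARD('n) + 1)) powr d0 * (1 - (1 / 2) powr e / K) < 1"
  defines "R \<equiv> 2 ^ (CARD('n) + 1) :: real" and "\<theta> \<equiv> 1 - (1 / 2) powr e / K"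
  shows "avg Q (\<lambda>x. enn_powr (u x) (1 + d)) \<le> ennreal (1 + R powr d0 / (1 - R powr d0 * \<theta>)) * enn_powr (avg Q u) (1 + d)"
proof -
  obtain b l where bl: "0 < l" "Q = cube b l" using Q by (auto simp: cubes_iff)
  interpret dyadic_grid b l using bl by unfold_locales
  have R: "1 < R" unfolding R_def using one_less_power[of "2::real" "CARD('n) + 1"] by simp
  have half1: "(1 / 2) powr e \<le> 1" using ab powr_mono2[of e "1/2" "1::real"] by simp
  then have \<theta>: "0 \<le> \<theta>" using ab by (simp add: \<theta>_def field_simps)
  define r where "r = R powr d0 * \<theta>"
  have r: "0 \<le> r" "r < 1" using small \<theta> R by (auto simp: r_def R_def \<theta>_def)
  let ?Q0 = "D 0 b" and ?\<mu> = "density lebesgue u"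
  \<comment> \<open>The grid is anchored at the corner of Q; its top cell through that corner is Q
    up to the boundary, so averages over Q are averages over a cell.\<close>
  have "(\<chi> i. b $ i + l / 2 ^ 0 * of_int \<lfloor>2 ^ 0 * (b $ i - b $ i) / l\<rfloor>) = b" by (simp add: vec_eq_iff)
  then have sub: "?Q0 \<subseteq> Q" "interior Q \<subseteq> ?Q0" using cell_sandwich[of 0 b] bl by simp_all
  have "AE x in lebesgue. x \<notin> Q - interior Q" using cube_boundary_null[of b l] bl by (intro AE_not_in) simp
  then have ae: "AE x in lebesgue. x \<in> Q \<longleftrightarrow> x \<in> ?Q0" by eventually_elim (use sub in blast)
  have int: "(\<integral>\<^sup>+x\<in>Q. h x \<partial>lebesgue) = (\<integral>\<^sup>+x\<in>?Q0. h x \<partial>lebesgue)" for h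
    by (rule nn_integral_cong_AE) (use ae in eventually_elim, auto simp: indicator_def)
  have em: "emeasure lebesgue Q = emeasure lebesgue ?Q0" using bl by (simp add: emeasure_cube emeasure_cell)
  have av: "avg ?Q0 h = avg Q h" for h by (simp add: avg_def int em)
  obtain c where c: "avg Q u = ennreal c" "0 \<le> c" using Q(2) by (cases "avg Q u") auto
  show ?thesis
  proof (cases "c = 0")
    case True
    then have "(\<integral>\<^sup>+x\<in>Q. u x \<partial>lebesgue) = 0" using c Q by (simp add: integral_cube_eq_avg)
    moreover have [measurable]: "Q \<in> sets lebesgue" using Q(1) by simp
    ultimately have "AE x in lebesgue. u x * indicator Q x = 0" by (subst (asm) nn_integral_0_iff_AE) auto
    then have "AE x in lebesgue. x \<in> Q \<longrightarrow> enn_powr (u x) (1 + d) = 0" by eventually_elim (auto simp: indicator_def)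
    then have "avg Q (\<lambda>x. enn_powr (u x) (1 + d)) = avg Q (\<lambda>x. 0)" by (rule avg_cong_AE)
    moreover have "avg Q (\<lambda>x. 0) = 0" by (simp add: avg_def)
    ultimately show ?thesis by simp
  next
    case False
    then have c0: "0 < c" using c by simp
    define \<Omega> where "\<Omega> k = stop_set u (R ^ k * c)" for k :: nat
    have [measurable]: "\<Omega> k \<in> sets lebesgue" for k by (simp add: \<Omega>_def)
    have decay: "emeasure ?\<mu> (\<Omega> k) \<le> ennreal (\<theta> ^ k) * emeasure ?\<mu> ?Q0" for k
    proof (induction k)
      case 0
      show ?case using stop_set_subset by (auto intro!: emeasure_mono simp: \<Omega>_def)
    next
      case (Suc k)
      have "1 * c \<le> R ^ k * c" using R c0 by (intro mult_right_mono one_le_power) auto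
      then have "avg ?Q0 u \<le> ennreal (R ^ k * c)" "0 < R ^ k * c" using c0 by (auto simp: av c intro!: ennreal_leI)
      then have "emeasure ?\<mu> (\<Omega> (Suc k)) \<le> ennreal \<theta> * emeasure ?\<mu> (\<Omega> k)"
        using stop_set_decay[OF ab, of "R ^ k * c"] unfolding \<Omega>_def \<theta>_def by (simp add: R_def mult.assoc)
      also have "\<dots> \<le> ennreal \<theta> * (ennreal (\<theta> ^ k) * emeasure ?\<mu> ?Q0)" by (intro mult_left_mono Suc) simp
      finally show ?case using \<theta> by (simp add: ennreal_mult mult.assoc)
    qed
    \<comment> \<open>Outside \<Omega> (k + 1) almost everywhere u <= R^(k+1) c, so
      \<open>t k\<close> bounds u^d on the layer between \<Omega> k and \<Omega> (k + 1). The region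
      outside \<Omega> 0 is paid for by c^d.\<close>
    define t where "t k = (R ^ (k + 1) * c) powr d" for k :: nat
    have t_ge: "c powr d \<le> t k" for k
    proof -
      have "1 * c \<le> R ^ (k + 1) * c" using R c0 by (intro mult_right_mono one_le_power) auto
      then show ?thesis unfolding t_def using d c0 by (intro powr_mono2) auto
    qed
    have "AE x in lebesgue. x \<in> ?Q0 \<longrightarrow> enn_powr (u x) d \<le> ennreal (c powr d) + (\<Sum>k. ennreal (t k) * indicator (\<Omega> k) x)"
      using AE_le_of_not_stop_set[OF assms(4)]
    proof eventually_elim
      fix x
      assume le: "\<forall>c. x \<in> ?Q0 - stop_set u c \<longrightarrow> u x \<le> ennreal c"
      show "x \<in> ?Q0 \<longrightarrow> enn_powr (u x) d \<le> ennreal (c powr d) + (\<Sum>k. ennreal (t k) * indicator (\<Omega> k) x)"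
      proof
        assume x: "x \<in> ?Q0"
        show "enn_powr (u x) d \<le> ennreal (c powr d) + (\<Sum>k. ennreal (t k) * indicator (\<Omega> k) x)"
        proof (cases "\<exists>k. x \<notin> \<Omega> k")
          case True
          define k where "k = (LEAST k. x \<notin> \<Omega> k)"
          have k: "x \<notin> \<Omega> k" using True unfolding k_def by (rule LeastI_ex)
          then have ux: "u x \<le> ennreal (R ^ k * c)" using le x by (auto simp: \<Omega>_def)
          have uxd: "enn_powr (u x) d \<le> ennreal ((R ^ k * c) powr d)"
            using enn_powr_mono[OF _ ux, of d] d c0 R by (simp add: enn_powr_ennreal)
          show ?thesis
          proof (cases k)
            case 0
            then show ?thesis using uxd by (simp add: add_increasing2)
          next
            case (Suc m)
            have "x \<in> \<Omega> m" using not_less_Least[of m "\<lambda>k. x \<notin> \<Omega> k"] Suc by (auto simp: k_def)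
            then have "enn_powr (u x) d \<le> ennreal (t m) * indicator (\<Omega> m) x" using uxd Suc by (simp add: t_def)
            also have "\<dots> \<le> (\<Sum>k. ennreal (t k) * indicator (\<Omega> k) x)" by (rule suminf_ennreal_ge_term)
            finally show ?thesis by (simp add: add_increasing)
          qed
        next
          case False
          \<comment> \<open>At a point lying in all stopping sets every term is at least c^d > 0, so
            the right-hand side is infinite and nothing has to be known about u there.\<close>
          have "(\<Sum>k. ennreal (t k) * indicator (\<Omega> k) x) = top"
          proof -
            have "of_nat n * ennreal (c powr d) \<le> (\<Sum>k. ennreal (t k) * indicator (\<Omega> k) x)" for n
            proof -
              have "of_nat n * ennreal (c powr d) = (\<Sum>k<n. ennreal (c powr d))" by simp
              also have "\<dots> \<le> (\<Sum>k<n. ennreal (t k) * indicator (\<Omega> k) x)"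
                using False t_ge by (intro sum_mono) (auto intro: ennreal_leI)
              also have "\<dots> \<le> (\<Sum>k. ennreal (t k) * indicator (\<Omega> k) x)" by (rule sum_le_suminf) auto
              finally show ?thesis .
            qed
            then have "of_nat n * ennreal (c powr d) * ennreal (1 / c powr d) \<le> (\<Sum>k. ennreal (t k) * indicator (\<Omega> k) x) * ennreal (1 / c powr d)" for n
              by (intro mult_right_mono) auto
            moreover have "of_nat n * ennreal (c powr d) * ennreal (1 / c powr d) = of_nat n" for n
              using c0 by (simp add: mult.assoc ennreal_mult[symmetric])
            ultimately have "(\<Sum>k. ennreal (t k) * indicator (\<Omega> k) x) * ennreal (1 / c powr d) = top"
              by (intro ennreal_ge_nat_imp_top) simp
            then show ?thesis using c0 by (auto simp: ennreal_mult_eq_top_iff)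
          qed
          then show ?thesis by simp
        qed
      qed
    qed
    then have "(\<integral>\<^sup>+x\<in>?Q0. enn_powr (u x) (1 + d) \<partial>lebesgue)
      \<le> (\<integral>\<^sup>+x. ennreal (c powr d) * (u x * indicator ?Q0 x) + (\<Sum>k. ennreal (t k) * (u x * indicator (\<Omega> k) x)) \<partial>lebesgue)"
    proof (intro nn_integral_mono_AE, eventually_elim)
      fix x
      assume le: "x \<in> ?Q0 \<longrightarrow> enn_powr (u x) d \<le> ennreal (c powr d) + (\<Sum>k. ennreal (t k) * indicator (\<Omega> k) x)"
      show "enn_powr (u x) (1 + d) * indicator ?Q0 x \<le> ennreal (c powr d) * (u x * indicator ?Q0 x) + (\<Sum>k. ennreal (t k) * (u x * indicator (\<Omega> k) x))"
      proof (cases "x \<in> ?Q0")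
        case True
        have "enn_powr (u x) (1 + d) = u x * enn_powr (u x) d" using d by (simp add: enn_powr_add)
        also have "\<dots> \<le> u x * (ennreal (c powr d) + (\<Sum>k. ennreal (t k) * indicator (\<Omega> k) x))" using le True by (intro mult_left_mono) auto
        also have "\<dots> = ennreal (c powr d) * u x + (\<Sum>k. u x * (ennreal (t k) * indicator (\<Omega> k) x))"
          by (subst ennreal_suminf_cmult) (simp add: distrib_left mult.commute)
        finally show ?thesis using True by (simp add: mult.left_commute)
      qed simp
    qed
    also have "\<dots> = ennreal (c powr d) * emeasure ?\<mu> ?Q0 + (\<Sum>k. ennreal (t k) * emeasure ?\<mu> (\<Omega> k))"
      by (subst nn_integral_add, measurable) (simp add: nn_integral_suminf nn_integral_cmult emeasure_density)
    also have "\<dots> \<le> ennreal (c powr d) * emeasure ?\<mu> ?Q0 + (\<Sum>k. ennreal (c powr d * R powr d0 * r ^ k) * emeasure ?\<mu> ?Q0)"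
    proof (intro add_left_mono suminf_le allI)
      fix k
      have "ennreal (t k) * emeasure ?\<mu> (\<Omega> k) \<le> ennreal (t k) * (ennreal (\<theta> ^ k) * emeasure ?\<mu> ?Q0)"
        by (intro mult_left_mono decay) simp
      also have "\<dots> = ennreal (t k * \<theta> ^ k) * emeasure ?\<mu> ?Q0" using \<theta> by (simp add: ennreal_mult t_def mult.assoc)
      also have "\<dots> \<le> ennreal (c powr d * R powr d0 * r ^ k) * emeasure ?\<mu> ?Q0"
      proof (intro mult_right_mono ennreal_leI)
        have "t k = (R powr d) ^ (k + 1) * c powr d"
          using R c0 by (simp add: t_def powr_mult powr_power powr_realpow[symmetric] powr_powr mult.commute)
        also have "\<dots> \<le> (R powr d0) ^ (k + 1) * c powr d"
          using R d by (intro mult_right_mono power_mono powr_mono) auto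
        finally have "t k * \<theta> ^ k \<le> (R powr d0) ^ (k + 1) * c powr d * \<theta> ^ k" using \<theta> by (intro mult_right_mono) auto
        then show "t k * \<theta> ^ k \<le> c powr d * R powr d0 * r ^ k" by (simp add: r_def power_mult_distrib mult_ac)
      qed simp
      finally show "ennreal (t k) * emeasure ?\<mu> (\<Omega> k) \<le> ennreal (c powr d * R powr d0 * r ^ k) * emeasure ?\<mu> ?Q0" .
    qed auto
    also have "\<dots> = ennreal (c powr d) * emeasure ?\<mu> ?Q0 + ennreal (c powr d * R powr d0 / (1 - r)) * emeasure ?\<mu> ?Q0"
      using r by (simp only: ennreal_suminf_multc) (subst suminf_ennreal_geometric, auto)
    also have "\<dots> = ennreal (c powr d * (1 + R powr d0 / (1 - r))) * emeasure ?\<mu> ?Q0"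
      using r by (simp add: distrib_left ennreal_plus distrib_right)
    also have "emeasure ?\<mu> ?Q0 = ennreal c * emeasure lebesgue Q"
      using c Q by (simp add: emeasure_density int[symmetric] integral_cube_eq_avg)
    also have "ennreal (c powr d * (1 + R powr d0 / (1 - r))) * (ennreal c * emeasure lebesgue Q)
      = ennreal (1 + R powr d0 / (1 - r)) * enn_powr (avg Q u) (1 + d) * emeasure lebesgue Q"
    proof -
      have "enn_powr (avg Q u) (1 + d) = ennreal c * ennreal (c powr d)"
        using c d by (simp add: enn_powr_add enn_powr_ennreal)
      moreover have "ennreal (c powr d * (1 + R powr d0 / (1 - r))) = ennreal (c powr d) * ennreal (1 + R powr d0 / (1 - r))"
        using r by (intro ennreal_mult) auto
      ultimately show ?thesis by (simp only: mult_ac)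
    qed
    finally show ?thesis
      unfolding int[symmetric] r_def by (subst avg_le_iff[OF emeasure_cubes_pos[OF Q(1)] emeasure_cubes_finite[OF Q(1)]])
  qed
qed

text \<open>The exponent gain and the constant are fixed before u and Q and depend on e, K and the
  dimension alone. The whole range of exponents is covered by a single constant, since the exponents
  used later vary with other parameters.\<close>

theorem reverse_holder:
  assumes "0 < e" "1 \<le> K"
  obtains d0 C where "0 < d0" "1 \<le> C"
    "\<And>(u :: real ^ 'n \<Rightarrow> ennreal) Q t. u \<in> borel_measurable lebesgue \<Longrightarrow> averaging_bound e (ennreal K) u \<Longrightarrow> Q \<in> cubes \<Longrightarrow>
      avg Q u < \<infinity> \<Longrightarrow> 1 \<le> t \<Longrightarrow> t \<le> 1 + d0 \<Longrightarrow> avg Q (\<lambda>x. enn_powr (u x) t) \<le> ennreal C * enn_powr (avg Q u) t"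
proof -
  define R where "R = (2 ^ (CARD('n) + 1) :: real)"
  define \<theta> where "\<theta> = 1 - (1 / 2) powr e / K"
  define s where "s = max \<theta> (1 / 2)"
  have R: "1 < R" unfolding R_def using one_less_power[of "2::real" "CARD('n) + 1"] by simp
  have half1: "(1 / 2) powr e \<le> 1" using assms powr_mono2[of e "1/2" "1::real"] by simp
  have \<theta>: "0 \<le> \<theta>" "\<theta> < 1" using half1 assms by (auto simp: \<theta>_def field_simps)
  have s: "0 < s" "s < 1" "\<theta> \<le> s" using \<theta> by (auto simp: s_def)
  \<comment> \<open>Chosen so that R^d0 = s^(-1/2), whence R^d0 \<theta> <= s^(1/2) < 1. The maximum
    with 1/2 in the definition of s keeps its logarithm meaningful.\<close>
  define d0 where "d0 = - ln s / (2 * ln R)"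
  have d0: "0 < d0" using s R unfolding d0_def by (intro divide_pos_pos) auto
  have "R powr d0 = s powr - (1 / 2)"
    using R s by (simp add: powr_def d0_def)
  then have "R powr d0 * \<theta> \<le> s powr - (1 / 2) * s powr 1" using s by (simp add: mult_left_mono)
  also have "\<dots> = s powr (1 / 2)" using s by (subst powr_add[symmetric]) simp
  also have "\<dots> < 1" using powr_less_mono2[of "1 / 2" s 1] s by simp
  finally have small: "R powr d0 * \<theta> < 1" .
  define C where "C = 1 + R powr d0 / (1 - R powr d0 * \<theta>)"
  have C: "1 \<le> C" using small by (simp add: C_def)
  show ?thesis
  proof (rule that[OF d0 C])
    fix u :: "real ^ 'n \<Rightarrow> ennreal" and Q and t :: real
    assume *: "u \<in> borel_measurable lebesgue" "averaging_bound e (ennreal K) u" "Q \<in> cubes" "avg Q u < \<infinity>" "1 \<le> t" "t \<le> 1 + d0"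
    show "avg Q (\<lambda>x. enn_powr (u x) t) \<le> ennreal C * enn_powr (avg Q u) t"
    proof (cases "t = 1")
      case True
      have "1 * avg Q u \<le> ennreal C * avg Q u" using C by (intro mult_right_mono) auto
      then show ?thesis using True by simp
    next
      case False
      then show ?thesis
        using reverse_holder_aux[of e K u Q "t - 1" d0] * assms small unfolding C_def R_def \<theta>_def by simp
    qed
  qed
qed

lemma weight_avg_finite: "weight w \<Longrightarrow> Q \<in> cubes \<Longrightarrow> avg Q (\<lambda>x. ennreal (w x)) < \<infinity>"
  unfolding weight_def avg_def using emeasure_cubes_pos[of Q]
  by (auto simp: ennreal_divide_eq_top_iff less_top[symmetric])

lemma avg_pos:
  assumes "Q \<in> cubes" and [measurable]: "h \<in> borel_measurable lebesgue" and "AE x in lebesgue. 0 < h x"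
  shows "0 < avg Q h"
proof (rule ccontr)
  assume "\<not> ?thesis"
  then have "(\<integral>\<^sup>+x\<in>Q. h x \<partial>lebesgue) = 0" using assms(1) by (simp add: integral_cube_eq_avg not_less)
  moreover have [measurable]: "Q \<in> sets lebesgue" using assms(1) by simp
  ultimately have "AE x in lebesgue. h x * indicator Q x = 0" by (subst (asm) nn_integral_0_iff_AE) auto
  with assms(3) have "AE x in lebesgue. x \<notin> Q" by eventually_elim (auto simp: indicator_def)
  then have "Q \<in> null_sets lebesgue" using AE_iff_null_sets[of Q lebesgue] assms(1) by simp
  then show False using emeasure_cubes_pos[OF assms(1)] by (simp add: null_sets_def)
qed

lemma weight_avg_pos: "weight w \<Longrightarrow> Q \<in> cubes \<Longrightarrow> 0 < avg Q (\<lambda>x. ennreal (w x))"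
  by (rule avg_pos) (auto simp: weight_def)

lemma ap_bound_Ap_norm: "p \<noteq> 1 \<Longrightarrow> ap_bound p (Ap_norm p w) w"
  unfolding ap_bound_def Ap_norm_def by (auto intro: SUP_upper)

lemma ap_bound_le: "ap_bound p K w \<Longrightarrow> K \<le> K' \<Longrightarrow> ap_bound p K' w"
  unfolding ap_bound_def by (meson order_trans)

section \<open>Dual weights, openness in p, and quotients of A_1 weights\<close>

text \<open>For the dual weight \<sigma> with the conjugate exponent the two averages exchange their
  roles, so its A_p' quantity is that of w raised to 1/(p-1).\<close>

lemma ap_bound_dual:
  fixes w :: "real ^ 'n \<Rightarrow> real"
  assumes p: "1 < p" and pos: "AE x in lebesgue. 0 < w x" and ap: "ap_bound p K w"
  shows "ap_bound (p / (p - 1)) (enn_powr K (1 / (p - 1))) (\<lambda>x. w x powr (- 1 / (p - 1)))"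
  unfolding ap_bound_def
proof
  fix Q :: "(real ^ 'n) set" assume Q: "Q \<in> cubes"
  let ?\<sigma> = "\<lambda>x. w x powr (- 1 / (p - 1))"
  have e: "p / (p - 1) - 1 = 1 / (p - 1)" using p by (simp add: field_simps)
  have 1: "avg Q (\<lambda>x. ennreal (?\<sigma> x powr (- 1 / (1 / (p - 1))))) = avg Q (\<lambda>x. ennreal (w x))"
  proof (rule avg_cong_AE, use pos in eventually_elim)
    case (elim x)
    have "- 1 / (p - 1) * (- 1 / (1 / (p - 1))) = 1" using p by (simp add: field_simps)
    then have "?\<sigma> x powr (- 1 / (1 / (p - 1))) = w x" using elim by (simp only: powr_powr powr_one)
    then show ?case by simp
  qed
  have "avg Q (\<lambda>x. ennreal (?\<sigma> x)) * enn_powr (avg Q (\<lambda>x. ennreal (w x))) (1 / (p - 1))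
    = enn_powr (avg Q (\<lambda>x. ennreal (w x)) * enn_powr (avg Q (\<lambda>x. ennreal (?\<sigma> x))) (p - 1)) (1 / (p - 1))"
    using p by (simp add: enn_powr_mult enn_powr_powr mult.commute)
  also have "\<dots> \<le> enn_powr K (1 / (p - 1))"
    using ap p Q unfolding ap_bound_def by (intro enn_powr_mono) auto
  finally show "avg Q (\<lambda>x. ennreal (?\<sigma> x)) * enn_powr (avg Q (\<lambda>x. ennreal (?\<sigma> x powr (- 1 / (p / (p - 1) - 1))))) (p / (p - 1) - 1)
    \<le> enn_powr K (1 / (p - 1))"
    unfolding e 1 .
qed

lemma ap_bound_dual_avg_finite:
  assumes p: "1 < p" and w: "weight w" and ap: "ap_bound p K w" "K < top" and Q: "Q \<in> cubes"
  shows "avg Q (\<lambda>x. ennreal (w x powr (- 1 / (p - 1)))) < top"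
proof (rule ccontr)
  assume "\<not> ?thesis"
  then have "avg Q (\<lambda>x. ennreal (w x powr (- 1 / (p - 1)))) = top" by (simp only: not_less top_unique)
  then have "avg Q (\<lambda>x. ennreal (w x)) * enn_powr (avg Q (\<lambda>x. ennreal (w x powr (- 1 / (p - 1))))) (p - 1) = top"
    using weight_avg_pos[OF w Q] by (simp only: enn_powr_top ennreal_mult_top) simp
  then have "top \<le> K" using ap(1) Q unfolding ap_bound_def by (metis (no_types, lifting))
  with ap(2) show False by simp
qed

text \<open>The reverse Hoelder inequality is applied to the dual weight \<open>w\<^sup>-\<^sup>1\<^sup>/\<^sup>(\<^sup>p\<^sup>-\<^sup>1\<^sup>)\<close>.\<close>

theorem ap_bound_open:
  assumes p: "1 < p" and K: "1 \<le> K"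
  obtains p\<^sub>1 K\<^sub>1 where "1 < p\<^sub>1" "p\<^sub>1 < p" "1 \<le> K\<^sub>1"
    "\<And>w :: real ^ 'n \<Rightarrow> real. weight w \<Longrightarrow> ap_bound p (ennreal K) w \<Longrightarrow> ap_bound p\<^sub>1 (ennreal K\<^sub>1) w"
proof -
  define e where "e = p / (p - 1)"
  define L where "L = 2 powr e * K powr (1 / (p - 1))"
  have e: "1 < e" using p by (simp add: e_def field_simps)
  have "1 * 1 \<le> L" unfolding L_def using p e K by (intro mult_mono ge_one_powr_ge_zero) auto
  then have L: "1 \<le> L" by simp
  show ?thesis
  proof (rule reverse_holder[of e L, where 'n = 'n])
    show "0 < e" "1 \<le> L" using e L by auto
  next
    fix d0 C assume C: "0 < d0" "1 \<le> C"
      "\<And>(u :: real ^ 'n \<Rightarrow> ennreal) Q t. u \<in> borel_measurable lebesgue \<Longrightarrow> averaging_bound e (ennreal L) u \<Longrightarrow> Q \<in> cubes \<Longrightarrow>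
        avg Q u < \<infinity> \<Longrightarrow> 1 \<le> t \<Longrightarrow> t \<le> 1 + d0 \<Longrightarrow> avg Q (\<lambda>x. enn_powr (u x) t) \<le> ennreal C * enn_powr (avg Q u) t"
    \<comment> \<open>With this choice the dual weight belonging to p1 is the power 1 + d0 of the
      one belonging to p, exactly the power that reverse Hoelder controls.\<close>
    define p1 where "p1 = 1 + (p - 1) / (1 + d0)"
    have p1: "1 < p1" "p1 < p" using p C(1) by (auto simp: p1_def field_simps)
    have p1e: "(1 + d0) * (p1 - 1) = p - 1" using C(1) by (simp add: p1_def)
    define K1 where "K1 = C powr (p1 - 1) * K"
    have "1 * 1 \<le> K1" unfolding K1_def using p1 K C by (intro mult_mono ge_one_powr_ge_zero) auto
    then have K1: "1 \<le> K1" by simp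
    show ?thesis
    proof (rule that[OF p1 K1])
      fix w :: "real ^ 'n \<Rightarrow> real" assume w: "weight w" and ap: "ap_bound p (ennreal K) w"
      then have [measurable]: "w \<in> borel_measurable lebesgue" and pos: "AE x in lebesgue. 0 < w x" by (auto simp: weight_def)
      let ?\<sigma> = "\<lambda>x. w x powr (- 1 / (p - 1))"
      have "averaging_bound e (ennreal (2 powr e) * enn_powr (ennreal K) (1 / (p - 1))) (\<lambda>x. ennreal (?\<sigma> x))"
        using e pos ap_bound_dual[OF p pos ap] unfolding e_def by (intro averaging_bound_of_ap_bound) auto
      then have ab: "averaging_bound e (ennreal L) (\<lambda>x. ennreal (?\<sigma> x))"
        using K by (simp add: L_def enn_powr_ennreal ennreal_mult)
      show "ap_bound p1 (ennreal K1) w"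
        unfolding ap_bound_def
      proof
        fix Q :: "(real ^ 'n) set" assume Q: "Q \<in> cubes"
        have "avg Q (\<lambda>x. ennreal (w x powr (- 1 / (p1 - 1)))) = avg Q (\<lambda>x. enn_powr (ennreal (?\<sigma> x)) (1 + d0))"
        proof -
          have "- 1 / (p - 1) * (1 + d0) = - 1 / (p1 - 1)" using p1 p p1e[symmetric] by (simp add: field_simps)
          then show ?thesis by (simp add: enn_powr_ennreal powr_powr)
        qed
        also have "\<dots> \<le> ennreal C * enn_powr (avg Q (\<lambda>x. ennreal (?\<sigma> x))) (1 + d0)"
          using ap_bound_dual_avg_finite[OF p w ap _ Q] C(1) by (intro C(3) ab Q) auto
        finally have "enn_powr (avg Q (\<lambda>x. ennreal (w x powr (- 1 / (p1 - 1))))) (p1 - 1)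
          \<le> enn_powr (ennreal C * enn_powr (avg Q (\<lambda>x. ennreal (?\<sigma> x))) (1 + d0)) (p1 - 1)"
          using p1 by (intro enn_powr_mono) auto
        also have "\<dots> = ennreal (C powr (p1 - 1)) * enn_powr (avg Q (\<lambda>x. ennreal (?\<sigma> x))) (p - 1)"
          using p1 C(2) by (simp add: enn_powr_mult enn_powr_powr enn_powr_ennreal p1e)
        finally have "avg Q (\<lambda>x. ennreal (w x)) * enn_powr (avg Q (\<lambda>x. ennreal (w x powr (- 1 / (p1 - 1))))) (p1 - 1)
          \<le> avg Q (\<lambda>x. ennreal (w x)) * (ennreal (C powr (p1 - 1)) * enn_powr (avg Q (\<lambda>x. ennreal (?\<sigma> x))) (p - 1))"
          by (rule mult_left_mono) simp
        also have "\<dots> = ennreal (C powr (p1 - 1)) * (avg Q (\<lambda>x. ennreal (w x)) * enn_powr (avg Q (\<lambda>x. ennreal (?\<sigma> x))) (p - 1))"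
          by (simp only: mult_ac)
        also have "\<dots> \<le> ennreal (C powr (p1 - 1)) * ennreal K"
          using ap Q unfolding ap_bound_def by (intro mult_left_mono) auto
        also have "\<dots> = ennreal K1" using K by (simp add: K1_def ennreal_mult)
        finally show "avg Q (\<lambda>x. ennreal (w x)) * enn_powr (avg Q (\<lambda>x. ennreal (w x powr (- 1 / (p1 - 1))))) (p1 - 1) \<le> ennreal K1" .
      qed
    qed
  qed
qed

text \<open>The A_(b/s) condition for w^(1-b) involves the average of w^t with t = s(b-1)/(b-s).
  Reverse Hoelder replaces it by a power of the average of w, and what remains is the A_b' condition
  of w raised to b - 1. Thus the exponent b may be lowered to b/s on the dual side.\<close>

lemma averaging_bound_dual_weight:
  fixes w :: "real ^ 'n \<Rightarrow> real"
  assumes s: "1 < s" "s < b" and w: "weight w" and ap: "ap_bound (b / (b - 1)) (ennreal K) w"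
    and rh: "\<And>Q. Q \<in> cubes \<Longrightarrow> avg Q (\<lambda>x. enn_powr (ennreal (w x)) (s * (b - 1) / (b - s)))
      \<le> ennreal C * enn_powr (avg Q (\<lambda>x. ennreal (w x))) (s * (b - 1) / (b - s))" and CK: "0 \<le> C" "0 \<le> K"
  shows "averaging_bound (b / s) (ennreal (2 powr (b / s) * (C powr (b / s - 1) * K powr (b - 1)))) (\<lambda>x. ennreal (w x powr (1 - b)))"
proof -
  have [measurable]: "w \<in> borel_measurable lebesgue" and pos: "AE x in lebesgue. 0 < w x" using w by (auto simp: weight_def)
  define t where "t = s * (b - 1) / (b - s)"
  have b: "1 < b / s" using s by simp
  have e: "b / (b - 1) - 1 = 1 / (b - 1)" using s by (simp add: field_simps)
  have t1: "t * (b / s - 1) = b - 1" using s by (simp add: t_def field_simps)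
  have "ap_bound (b / s) (ennreal (C powr (b / s - 1)) * ennreal (K powr (b - 1))) (\<lambda>x. w x powr (1 - b))"
    unfolding ap_bound_def
  proof
    fix Q :: "(real ^ 'n) set" assume Q: "Q \<in> cubes"
    let ?u = "\<lambda>x. ennreal (w x powr (1 - b))"
    have "avg Q (\<lambda>x. ennreal ((w x powr (1 - b)) powr (- 1 / (b / s - 1)))) = avg Q (\<lambda>x. enn_powr (ennreal (w x)) t)"
    proof (rule avg_cong_AE, use pos in eventually_elim)
      case (elim x)
      have "b / s - 1 \<noteq> 0" using b by linarith
      then have "(b - 1) / (b / s - 1) = t" unfolding t1[symmetric] by (rule nonzero_mult_div_cancel_right)
      moreover have "(1 - b) * (- 1 / (b / s - 1)) = (b - 1) / (b / s - 1)"
        by (simp add: left_diff_distrib diff_divide_distrib)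
      ultimately have "(1 - b) * (- 1 / (b / s - 1)) = t" by simp
      then show ?case using elim by (simp add: powr_powr enn_powr_ennreal)
    qed
    also have "\<dots> \<le> ennreal C * enn_powr (avg Q (\<lambda>x. ennreal (w x))) t" using rh[OF Q] by (simp add: t_def)
    finally have "enn_powr (avg Q (\<lambda>x. ennreal ((w x powr (1 - b)) powr (- 1 / (b / s - 1))))) (b / s - 1)
      \<le> enn_powr (ennreal C * enn_powr (avg Q (\<lambda>x. ennreal (w x))) t) (b / s - 1)"
      using b by (intro enn_powr_mono) auto
    also have "\<dots> = ennreal (C powr (b / s - 1)) * enn_powr (avg Q (\<lambda>x. ennreal (w x))) (b - 1)"
      using b CK by (simp only: enn_powr_mult enn_powr_powr enn_powr_ennreal t1)
    finally have "avg Q ?u * enn_powr (avg Q (\<lambda>x. ennreal ((w x powr (1 - b)) powr (- 1 / (b / s - 1))))) (b / s - 1)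
      \<le> avg Q ?u * (ennreal (C powr (b / s - 1)) * enn_powr (avg Q (\<lambda>x. ennreal (w x))) (b - 1))"
      by (rule mult_left_mono) simp
    also have "\<dots> = ennreal (C powr (b / s - 1)) * enn_powr (avg Q (\<lambda>x. ennreal (w x)) * enn_powr (avg Q ?u) (1 / (b - 1))) (b - 1)"
      using s by (simp add: enn_powr_mult enn_powr_powr mult_ac)
    also have "\<dots> \<le> ennreal (C powr (b / s - 1)) * enn_powr (ennreal K) (b - 1)"
    proof (intro mult_left_mono enn_powr_mono)
      have "- 1 / (b / (b - 1) - 1) = 1 - b" unfolding e using s by (simp add: field_simps)
      then show "avg Q (\<lambda>x. ennreal (w x)) * enn_powr (avg Q ?u) (1 / (b - 1)) \<le> ennreal K"
        using ap Q unfolding ap_bound_def e by auto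
    qed (use s in auto)
    finally show "avg Q ?u * enn_powr (avg Q (\<lambda>x. ennreal ((w x powr (1 - b)) powr (- 1 / (b / s - 1))))) (b / s - 1)
      \<le> ennreal (C powr (b / s - 1)) * ennreal (K powr (b - 1))"
      using CK by (simp add: enn_powr_ennreal)
  qed
  moreover have "AE x in lebesgue. 0 < w x powr (1 - b)" using pos by eventually_elim auto
  ultimately have "averaging_bound (b / s) (ennreal (2 powr (b / s)) * (ennreal (C powr (b / s - 1)) * ennreal (K powr (b - 1)))) (\<lambda>x. ennreal (w x powr (1 - b)))"
    using b by (intro averaging_bound_of_ap_bound) auto
  then show ?thesis by (simp add: ennreal_mult)
qed

text \<open>The easy direction of the Jones factorisation. On a cube an A_1 weight is bounded below
  by a multiple of its average, so negative powers of F and of V may be replaced by constants.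
  Infinite values, which \<open>enn2real\<close> sends to 0, occur on a null set only.\<close>

lemma A1_quotient_in_Ap:
  fixes F V :: "real ^ 'n \<Rightarrow> ennreal"
  assumes p: "1 \<le> p" and C: "0 < C" and [measurable]: "F \<in> borel_measurable lebesgue" "V \<in> borel_measurable lebesgue"
    and A1F: "\<And>Q x. Q \<in> cubes \<Longrightarrow> x \<in> Q \<Longrightarrow> avg Q F \<le> ennreal C * F x"
    and A1V: "\<And>Q x. Q \<in> cubes \<Longrightarrow> x \<in> Q \<Longrightarrow> avg Q V \<le> ennreal C * V x"
    and pos: "\<And>x. 0 < F x" "\<And>x. 0 < V x" and fin: "AE x in lebesgue. F x < top" "AE x in lebesgue. V x < top"
  defines "v \<equiv> \<lambda>x. enn2real (F x) powr (1 - p) * enn2real (V x)"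
  shows "v \<in> Ap p" "Ap_norm p v \<le> ennreal (C powr p)"
proof -
  have [measurable]: "v \<in> borel_measurable lebesgue" unfolding v_def by measurable
  have vpos: "AE x in lebesgue. 0 < v x"
    using fin
  proof eventually_elim
    case (elim x)
    then have "0 < enn2real (F x)" "0 < enn2real (V x)" using pos by (simp_all add: enn2real_positive_iff)
    then show ?case by (simp add: v_def)
  qed
  \<comment> \<open>Evaluating the A_1 condition at one point of Q where G is finite shows that the
    average is finite; dividing it by C yields the lower bound m.\<close>
  have lower: "\<exists>m>0. avg Q G = ennreal (C * m) \<and> (\<forall>x\<in>Q. ennreal m \<le> G x)"
    if Q: "Q \<in> cubes" and [measurable]: "G \<in> borel_measurable lebesgue" and G: "\<And>x. x \<in> Q \<Longrightarrow> avg Q G \<le> ennreal C * G x"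
      "\<And>x. 0 < G x" "AE x in lebesgue. G x < top" for Q and G :: "real ^ 'n \<Rightarrow> ennreal"
  proof -
    have "\<exists>x\<in>Q. G x < top"
    proof (rule ccontr)
      assume "\<not> ?thesis"
      then have "AE x in lebesgue. x \<notin> Q" using G(3) by (auto elim: eventually_mono)
      then have "Q \<in> null_sets lebesgue" using AE_iff_null_sets[of Q lebesgue] Q by simp
      then show False using emeasure_cubes_pos[OF Q] by (simp add: null_sets_def)
    qed
    then obtain x where "x \<in> Q" "G x < top" by blast
    then have "avg Q G < top" using G(1)[of x] by (auto intro: le_less_trans simp: ennreal_mult_less_top)
    moreover have "0 < avg Q G" using G(2) Q by (intro avg_pos) auto
    ultimately obtain c where c: "avg Q G = ennreal c" "0 < c" by (cases "avg Q G") (auto simp: less_le)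
    have "ennreal (c / C) \<le> G x" if "x \<in> Q" for x
    proof -
      have "ennreal C * ennreal (c / C) \<le> ennreal C * G x" using G(1)[OF that] c C by (simp add: ennreal_mult[symmetric])
      then show ?thesis using C by (subst (asm) ennreal_mult_le_mult_iff) auto
    qed
    then show ?thesis using c C by (intro exI[of _ "c / C"]) auto
  qed
  have main: "\<exists>m k. 0 < m \<and> 0 < k \<and> avg Q (\<lambda>x. ennreal (v x)) \<le> ennreal (m powr (1 - p) * C * k) \<and> avg Q F = ennreal (C * m) \<and>
      (\<forall>x\<in>Q. ennreal m \<le> F x \<and> ennreal k \<le> V x)" if Q: "Q \<in> cubes" for Q
  proof -
    obtain m where m: "0 < m" "avg Q F = ennreal (C * m)" "\<forall>x\<in>Q. ennreal m \<le> F x"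
      using lower[OF Q _ A1F[OF Q] pos(1) fin(1)] by auto
    obtain k where k: "0 < k" "avg Q V = ennreal (C * k)" "\<forall>x\<in>Q. ennreal k \<le> V x"
      using lower[OF Q _ A1V[OF Q] pos(2) fin(2)] by auto
    have "avg Q (\<lambda>x. ennreal (v x)) \<le> avg Q (\<lambda>x. ennreal (m powr (1 - p)) * V x)"
    proof (rule avg_mono_AE, use fin in eventually_elim, intro impI)
      fix x assume x: "F x < top" "V x < top" "x \<in> Q"
      have "ennreal m \<le> F x" using m x by blast
      then have "m \<le> enn2real (F x)" using x(1) m(1) by (metis enn2real_ennreal enn2real_mono less_imp_le)
      then have "enn2real (F x) powr (1 - p) \<le> m powr (1 - p)" using m(1) p by (intro powr_mono2') auto
      then have "ennreal (v x) \<le> ennreal (m powr (1 - p) * enn2real (V x))"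
        unfolding v_def by (intro ennreal_leI mult_right_mono) auto
      also have "\<dots> = ennreal (m powr (1 - p)) * V x" using x(2) by (simp add: ennreal_mult)
      finally show "ennreal (v x) \<le> ennreal (m powr (1 - p)) * V x" .
    qed
    also have "\<dots> = ennreal (m powr (1 - p)) * avg Q V" using Q by (intro avg_cmult) auto
    also have "\<dots> = ennreal (m powr (1 - p) * C * k)" using k C by (simp add: ennreal_mult mult.assoc)
    finally show ?thesis using m k by blast
  qed
  have wv: "weight v"
    unfolding weight_def
  proof (intro conjI ballI vpos)
    fix Q :: "(real ^ 'n) set" assume Q: "Q \<in> cubes"
    obtain c where "avg Q (\<lambda>x. ennreal (v x)) \<le> ennreal c" using main[OF Q] by blast
    then have "avg Q (\<lambda>x. ennreal (v x)) < top" by (rule le_less_trans) simp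
    then show "(\<integral>\<^sup>+x\<in>Q. ennreal (v x) \<partial>lebesgue) < \<infinity>"
      using emeasure_cubes_finite[OF Q] by (simp add: integral_cube_eq_avg[OF Q] ennreal_mult_less_top)
  qed simp
  show norm: "Ap_norm p v \<le> ennreal (C powr p)"
  proof (cases "p = 1")
    case True
    have "avg Q (\<lambda>x. ennreal (v x)) * esssup (lebesgue_on Q) (\<lambda>x. inverse (ennreal (v x))) \<le> ennreal (C powr p)" if Q: "Q \<in> cubes" for Q
    proof -
      obtain m k where mk: "0 < m" "0 < k" "avg Q (\<lambda>x. ennreal (v x)) \<le> ennreal (m powr (1 - p) * C * k)" "\<forall>x\<in>Q. ennreal m \<le> F x \<and> ennreal k \<le> V x"
        using main[OF Q] by blast
      have "esssup (lebesgue_on Q) (\<lambda>x. inverse (ennreal (v x))) \<le> inverse (ennreal k)"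
      proof (rule esssup_I)
        show "(\<lambda>x. inverse (ennreal (v x))) \<in> borel_measurable (lebesgue_on Q)"
          by (rule measurable_restrict_space1) measurable
        have "AE x in lebesgue. x \<in> Q \<longrightarrow> inverse (ennreal (v x)) \<le> inverse (ennreal k)"
          using fin
        proof eventually_elim
          case (elim x)
          \<comment> \<open>In the case p = 1 the factor is a power with exponent 0, which equals 1
            only for a nonzero base because \<open>0 powr 0 = 0\<close>.\<close>
          have "enn2real (F x) \<noteq> 0" using elim(1) pos(1)[of x] by (auto simp: enn2real_eq_0_iff)
          then have "ennreal (v x) = V x" using True elim by (simp add: v_def)
          moreover have "inverse (V x) \<le> inverse (ennreal k)" if "ennreal k \<le> V x"
            using that mk(2) elim(2) by (cases "V x") (auto simp: inverse_ennreal ennreal_le_iff2 intro!: ennreal_leI le_imp_inverse_le)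
          ultimately show ?case using mk by auto
        qed
        then show "AE x in lebesgue_on Q. inverse (ennreal (v x)) \<le> inverse (ennreal k)"
          using Q by (subst AE_restrict_space_iff) auto
      qed
      then have "avg Q (\<lambda>x. ennreal (v x)) * esssup (lebesgue_on Q) (\<lambda>x. inverse (ennreal (v x))) \<le> ennreal (m powr (1 - p) * C * k) * inverse (ennreal k)"
        using mk by (intro mult_mono) auto
      also have "\<dots> = ennreal (C powr p)"
        using True mk C by (simp add: inverse_ennreal ennreal_mult[symmetric] field_simps)
      finally show ?thesis .
    qed
    then show ?thesis unfolding Ap_norm_def using True by (auto intro!: SUP_least)
  next
    case False
    then have p1: "1 < p" using p by simp
    have "avg Q (\<lambda>x. ennreal (v x)) * enn_powr (avg Q (\<lambda>x. ennreal (v x powr (- 1 / (p - 1))))) (p - 1) \<le> ennreal (C powr p)" if Q: "Q \<in> cubes" for Q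
    proof -
      obtain m k where mk: "0 < m" "0 < k" "avg Q (\<lambda>x. ennreal (v x)) \<le> ennreal (m powr (1 - p) * C * k)" "avg Q F = ennreal (C * m)" "\<forall>x\<in>Q. ennreal m \<le> F x \<and> ennreal k \<le> V x"
        using main[OF Q] by blast
      have "avg Q (\<lambda>x. ennreal (v x powr (- 1 / (p - 1)))) \<le> avg Q (\<lambda>x. ennreal (k powr (- 1 / (p - 1))) * F x)"
      proof (rule avg_mono_AE, use fin in eventually_elim, intro impI)
        fix x assume x: "F x < top" "V x < top" "x \<in> Q"
        have "ennreal k \<le> V x" using mk x by blast
        then have kV: "k \<le> enn2real (V x)" using x(2) mk(2) by (metis enn2real_ennreal enn2real_mono less_imp_le)
        have Fp: "0 < enn2real (F x)" using x(1) pos(1)[of x] by (simp add: enn2real_positive_iff)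
        have "(1 - p) * (- 1 / (p - 1)) = 1" using p1 by (simp add: field_simps)
        then have "v x powr (- 1 / (p - 1)) = enn2real (F x) * enn2real (V x) powr (- 1 / (p - 1))"
          unfolding v_def using Fp by (simp add: powr_mult powr_powr)
        also have "\<dots> \<le> enn2real (F x) * k powr (- 1 / (p - 1))"
          using kV mk(2) p1 by (intro mult_left_mono powr_mono2') (auto simp: divide_nonpos_pos)
        finally have "ennreal (v x powr (- 1 / (p - 1))) \<le> ennreal (enn2real (F x) * k powr (- 1 / (p - 1)))" by (rule ennreal_leI)
        also have "\<dots> = ennreal (k powr (- 1 / (p - 1))) * F x" using x(1) by (simp add: ennreal_mult mult.commute)
        finally show "ennreal (v x powr (- 1 / (p - 1))) \<le> ennreal (k powr (- 1 / (p - 1))) * F x" .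
      qed
      also have "\<dots> = ennreal (k powr (- 1 / (p - 1))) * avg Q F" using Q by (intro avg_cmult) auto
      also have "\<dots> = ennreal (k powr (- 1 / (p - 1)) * (C * m))" using mk C by (simp add: ennreal_mult)
      finally have "enn_powr (avg Q (\<lambda>x. ennreal (v x powr (- 1 / (p - 1))))) (p - 1) \<le> enn_powr (ennreal (k powr (- 1 / (p - 1)) * (C * m))) (p - 1)"
        using p1 by (intro enn_powr_mono) auto
      also have "\<dots> = ennreal (k powr - 1 * C powr (p - 1) * m powr (p - 1))"
        using p1 mk C by (simp add: enn_powr_ennreal powr_mult powr_powr mult.assoc)
      finally have "avg Q (\<lambda>x. ennreal (v x)) * enn_powr (avg Q (\<lambda>x. ennreal (v x powr (- 1 / (p - 1))))) (p - 1)
        \<le> ennreal (m powr (1 - p) * C * k) * ennreal (k powr - 1 * C powr (p - 1) * m powr (p - 1))"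
        using mk(3) by (intro mult_mono) auto
      also have "\<dots> = ennreal ((m powr (1 - p) * m powr (p - 1)) * (C powr 1 * C powr (p - 1)) * (k powr 1 * k powr - 1))"
        using mk C by (simp add: ennreal_mult[symmetric] mult_ac)
      also have "\<dots> = ennreal (C powr p)" using mk C powr_mult_base[of C "p - 1"] by (simp add: powr_add[symmetric])
      finally show ?thesis .
    qed
    then show ?thesis unfolding Ap_norm_def using False by (auto intro!: SUP_least)
  qed
  show "v \<in> Ap p" using wv norm by (auto simp: Ap_def intro: le_less_trans)
qed

section \<open>The extrapolation estimate\<close>

text \<open>A bound on the norm of \<open>h\<close> in \<open>X(w)\<close> has this form by the definition of the Boyd indices.\<close>

definition two_tail :: "'a measure \<Rightarrow> ('a \<Rightarrow> ennreal) \<Rightarrow> ennreal \<Rightarrow> real \<Rightarrow> real \<Rightarrow> bool"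
  where "two_tail M h T p q \<longleftrightarrow> (\<forall>z>0. distr_fun M h (ennreal z) \<le> T * ennreal (z powr - p + z powr - q))"

text \<open>Upwards from z the slower of the two powers governs both terms, so the sum of powers
  behaves like a pure tail of exponent p.\<close>

lemma two_tail_above:
  assumes "two_tail M h T p q" "0 < z" "z \<le> y" "p \<le> q"
  shows "distr_fun M h (ennreal y) \<le> T * ennreal (z powr - p + z powr - q) * ennreal ((z / y) powr p)"
proof -
  have y: "0 < y" using assms by simp
  have eq: "y powr - r = z powr - r * (z / y) powr r" for r
    using assms y by (simp add: powr_divide powr_minus field_simps)
  have "(z / y) powr q \<le> (z / y) powr p" using assms y by (intro powr_mono') auto
  then have "z powr - q * (z / y) powr q \<le> z powr - q * (z / y) powr p" by (intro mult_left_mono) auto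
  then have "y powr - p + y powr - q \<le> (z powr - p + z powr - q) * (z / y) powr p"
    unfolding eq by (simp add: distrib_right)
  then have "ennreal (y powr - p + y powr - q) \<le> ennreal ((z powr - p + z powr - q) * (z / y) powr p)" by (rule ennreal_leI)
  also have "\<dots> = ennreal (z powr - p + z powr - q) * ennreal ((z / y) powr p)"
    by (rule ennreal_mult) auto
  finally have "T * ennreal (y powr - p + y powr - q) \<le> T * (ennreal (z powr - p + z powr - q) * ennreal ((z / y) powr p))"
    by (rule mult_left_mono) simp
  moreover have "distr_fun M h (ennreal y) \<le> T * ennreal (y powr - p + y powr - q)"
    using assms(1) y by (auto simp: two_tail_def)
  ultimately show ?thesis by (simp add: mult.assoc)
qed

text \<open>Downwards from z the larger exponent q governs both terms.\<close>

lemma two_tail_below: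
  assumes "two_tail M h T p q" "0 < y" "y \<le> z" "p \<le> q"
  shows "distr_fun M h (ennreal y) \<le> T * ennreal (z powr - p + z powr - q) * ennreal ((z / y) powr q)"
proof -
  have z: "0 < z" using assms by simp
  have eq: "y powr - r = z powr - r * (z / y) powr r" for r
    using assms z by (simp add: powr_divide powr_minus field_simps)
  have "(z / y) powr p \<le> (z / y) powr q" using assms z by (intro powr_mono) auto
  then have "z powr - p * (z / y) powr p \<le> z powr - p * (z / y) powr q" by (intro mult_left_mono) auto
  then have "y powr - p + y powr - q \<le> (z powr - p + z powr - q) * (z / y) powr q"
    unfolding eq by (simp add: distrib_right)
  then have "ennreal (y powr - p + y powr - q) \<le> ennreal ((z powr - p + z powr - q) * (z / y) powr q)" by (rule ennreal_leI)
  also have "\<dots> = ennreal (z powr - p + z powr - q) * ennreal ((z / y) powr q)"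
    by (rule ennreal_mult) auto
  finally have "T * ennreal (y powr - p + y powr - q) \<le> T * (ennreal (z powr - p + z powr - q) * ennreal ((z / y) powr q))"
    by (rule mult_left_mono) simp
  moreover have "distr_fun M h (ennreal y) \<le> T * ennreal (y powr - p + y powr - q)"
    using assms(1,2) by (auto simp: two_tail_def)
  ultimately show ?thesis by (simp add: mult.assoc)
qed

lemma two_tail_integral_above:
  assumes "two_tail M h T p q" "0 < z" "p \<le> q" "0 < a" "a < p" "h \<in> borel_measurable M"
  shows "(\<integral>\<^sup>+x. (if ennreal z < h x then enn_powr (h x) a else 0) \<partial>M)
    \<le> ennreal (2 powr a / (1 - 2 powr (a - p))) * (T * ennreal (z powr - p + z powr - q)) * ennreal (z powr a)"
  using assms by (intro tail_integral_above) (auto simp: distr_fun_def[symmetric] simp del: ennreal_plus intro!: two_tail_above)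

lemma two_tail_integral_below:
  assumes "two_tail M h T p q" "0 < z" "p \<le> q" "0 < q" "q < a" "h \<in> borel_measurable M"
  shows "(\<integral>\<^sup>+x. (if h x \<le> ennreal z then enn_powr (h x) a else 0) \<partial>M)
    \<le> ennreal (2 powr q / (1 - 2 powr (q - a))) * (T * ennreal (z powr - p + z powr - q)) * ennreal (z powr a)"
  using assms by (intro tail_integral_below) (auto simp: distr_fun_def[symmetric] simp del: ennreal_plus intro!: two_tail_below)

text \<open>The indicator affects only levels z < 1, and there z^(-q) >= 1 pays for the measure of
  E. Hence the constant grows by 1.\<close>

lemma two_tail_max_indicator:
  assumes "two_tail M f (ennreal B * emeasure M E) p q" "0 < B" "0 < q" and [measurable]: "f \<in> borel_measurable M" "E \<in> sets M"
  shows "two_tail M (\<lambda>x. max (f x) (indicator E x)) (ennreal (B + 1) * emeasure M E) p q"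
  unfolding two_tail_def
proof (intro allI impI)
  fix z :: real assume z: "0 < z"
  let ?X = "ennreal (z powr - p + z powr - q)"
  have f: "distr_fun M f (ennreal z) \<le> ennreal B * emeasure M E * ?X" using assms(1) z by (auto simp: two_tail_def)
  have "distr_fun M (\<lambda>x. max (f x) (indicator E x)) (ennreal z) \<le> ennreal B * emeasure M E * ?X + emeasure M E * ?X"
  proof (cases "z < 1")
    case True
    have "1 powr q \<le> (1 / z) powr q" using z True assms(3) by (intro powr_mono2) auto
    then have "1 \<le> z powr - p + z powr - q" using z by (simp add: powr_divide powr_minus_divide add_increasing)
    then have E: "emeasure M E * 1 \<le> emeasure M E * ?X" by (intro mult_left_mono) (auto simp del: ennreal_plus simp flip: ennreal_1 intro: ennreal_leI)
    have "{x \<in> space M. ennreal z < max (f x) (indicator E x)} \<subseteq> {x \<in> space M. ennreal z < f x} \<union> E"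
      by (auto simp: max_def indicator_def split: if_splits)
    then have "distr_fun M (\<lambda>x. max (f x) (indicator E x)) (ennreal z) \<le> emeasure M ({x \<in> space M. ennreal z < f x} \<union> E)"
      unfolding distr_fun_def by (intro emeasure_mono) auto
    also have "\<dots> \<le> distr_fun M f (ennreal z) + emeasure M E"
      unfolding distr_fun_def by (intro emeasure_subadditive) auto
    also have "\<dots> \<le> ennreal B * emeasure M E * ?X + emeasure M E * ?X"
      using f E by (intro add_mono) auto
    finally show ?thesis .
  next
    case False
    then have "(indicator E x :: ennreal) \<le> ennreal z" for x
      by (auto simp: indicator_def simp flip: ennreal_1 intro: ennreal_leI)
    then have "{x \<in> space M. ennreal z < max (f x) (indicator E x)} = {x \<in> space M. ennreal z < f x}"
      by (auto simp: max_def not_less[symmetric]) (metis not_less order_trans)+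
    then show ?thesis using f unfolding distr_fun_def by (simp add: add_increasing2)
  qed
  also have "\<dots> = ennreal (B + 1) * emeasure M E * ?X"
  proof -
    have "ennreal (B + 1) = ennreal B + 1" using assms(2) by simp
    then show ?thesis by (simp only: distrib_right mult_1_left)
  qed
  finally show "distr_fun M (\<lambda>x. max (f x) (indicator E x)) (ennreal z) \<le> ennreal (B + 1) * emeasure M E * ?X" .
qed

text \<open>The weak type estimate with exponent a is applied to g^s and truncated at the level in
  question. Since s a < p, the integral of g^(s a) above a level is controlled by the tail at that
  level, so both powers survive the passage to the maximal function.\<close>

lemma two_tail_maximal:
  fixes w :: "real ^ 'n \<Rightarrow> real"
  assumes ab: "averaging_bound a (ennreal K) (\<lambda>x. ennreal (w x))" "1 < a" "0 \<le> K" and s: "1 < s" "s * a < p" and pq: "p \<le> q"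
    and [measurable]: "w \<in> borel_measurable lebesgue" "g \<in> borel_measurable lebesgue"
    and tail: "two_tail (weighted w) g T p q"
  shows "two_tail (weighted w) (\<lambda>x. enn_powr (maximal (\<lambda>x. enn_powr (g x) s) x) (1 / s))
    (ennreal ((3 ^ CARD('n)) powr a * K\<^sup>2 * (2 powr (s * a) / (1 - 2 powr (s * a - p))) * 2 powr q) * T) p q"
  unfolding two_tail_def
proof (intro allI impI)
  fix z :: real assume z: "0 < z"
  \<comment> \<open>Level 2c for the maximal function of g^s is level z for its s-th root, and
    \<open>z'\<close> is the level of g itself corresponding to c.\<close>
  define c where "c = z powr s / 2"
  define z' where "z' = c powr (1 / s)"
  have c: "0 < c" using z by (simp add: c_def)
  have z': "0 < z'" "z' powr s = c" using c s by (auto simp: z'_def powr_powr)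
  define D where "D = (3 ^ CARD('n)) powr a * K\<^sup>2"
  define D' where "D' = 2 powr (s * a) / (1 - 2 powr (s * a - p))"
  have D: "0 \<le> D" "0 \<le> D'" using ab(3) s powr_less_one[of 2 "s * a - p"] by (auto simp: D_def D'_def)
  let ?h = "\<lambda>x. enn_powr (g x) s"
  have sp: "0 < s * a" using s ab by simp
  have lev: "{x. ennreal z < enn_powr (maximal ?h x) (1 / s)} = {x. ennreal (2 * c) < maximal ?h x}"
  proof -
    have "ennreal z = enn_powr (ennreal (2 * c)) (1 / s)" using z s by (simp add: c_def enn_powr_ennreal powr_powr)
    then show ?thesis using s by (simp add: enn_powr_less_iff)
  qed
  have "ennreal (c powr a) * emeasure (weighted w) {x. ennreal (2 * c) < maximal ?h x}
    \<le> ennreal ((3 ^ CARD('n)) powr a) * (ennreal K)\<^sup>2 * (\<integral>\<^sup>+x. (if ennreal c < ?h x then enn_powr (?h x) a else 0) \<partial>weighted w)"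
    using weak_type_maximal_truncated[OF ab(1), of ?h c] ab(2) c by (simp add: weighted_def)
  also have "ennreal ((3 ^ CARD('n)) powr a) * (ennreal K)\<^sup>2 = ennreal D"
    using ab(3) by (simp add: D_def ennreal_mult ennreal_power)
  also have "(\<integral>\<^sup>+x. (if ennreal c < ?h x then enn_powr (?h x) a else 0) \<partial>weighted w) = (\<integral>\<^sup>+x. (if ennreal z' < g x then enn_powr (g x) (s * a) else 0) \<partial>weighted w)"
  proof -
    have "ennreal c = enn_powr (ennreal z') s" using z' by (simp add: enn_powr_ennreal)
    then have "(ennreal c < ?h x) = (ennreal z' < g x)" for x using s by (simp add: enn_powr_less_iff)
    then show ?thesis by (simp add: enn_powr_powr cong: if_cong)
  qed
  also have "\<dots> \<le> ennreal D' * (T * ennreal (z' powr - p + z' powr - q)) * ennreal (z' powr (s * a))"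
    unfolding D'_def using s sp by (intro two_tail_integral_above[OF tail z'(1) pq]) (auto simp: weighted_def)
  finally have "ennreal (c powr a) * emeasure (weighted w) {x. ennreal (2 * c) < maximal ?h x}
    \<le> ennreal D * (ennreal D' * (T * ennreal (z' powr - p + z' powr - q)) * ennreal (z' powr (s * a)))"
    by (simp add: mult_left_mono)
  also have "z' powr (s * a) = c powr a" using z' by (simp add: powr_powr[symmetric])
  also have "ennreal D * (ennreal D' * (T * ennreal (z' powr - p + z' powr - q)) * ennreal (c powr a))
    = ennreal (c powr a) * (ennreal D * ennreal D' * T * ennreal (z' powr - p + z' powr - q))" by (simp only: mult_ac)
  finally have "emeasure (weighted w) {x. ennreal (2 * c) < maximal ?h x} \<le> ennreal D * ennreal D' * T * ennreal (z' powr - p + z' powr - q)"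
    using c by (subst (asm) ennreal_mult_le_mult_iff) auto
  also have "\<dots> \<le> ennreal D * ennreal D' * T * ennreal (2 powr q * (z powr - p + z powr - q))"
  proof (intro mult_left_mono ennreal_leI)
    have z'z: "z' = z / 2 powr (1 / s)"
      unfolding z'_def c_def using z s by (subst powr_divide) (auto simp: powr_powr)
    have "z' powr - r \<le> 2 powr q * z powr - r" if "r = p \<or> r = q" for r
    proof -
      have r: "r \<le> q" "0 \<le> r" using that pq sp s by auto
      have "1 / s * r \<le> 1 * r" using s r by (intro mult_right_mono) auto
      then have "2 powr (1 / s * r) \<le> (2 :: real) powr q" using r by (intro powr_mono) auto
      moreover have "z' powr - r = z powr - r * 2 powr (1 / s * r)"
        using z unfolding z'z by (subst powr_divide) (auto simp: powr_powr powr_minus field_simps)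
      ultimately show ?thesis by (simp add: mult.commute mult_left_mono)
    qed
    then show "z' powr - p + z' powr - q \<le> 2 powr q * (z powr - p + z powr - q)"
      by (simp add: distrib_left add_mono)
  qed simp
  also have "\<dots> = ennreal (D * D' * 2 powr q) * T * ennreal (z powr - p + z powr - q)"
    using D by (simp add: ennreal_mult mult_ac)
  finally show "distr_fun (weighted w) (\<lambda>x. enn_powr (maximal ?h x) (1 / s)) (ennreal z)
    \<le> ennreal ((3 ^ CARD('n)) powr a * K\<^sup>2 * (2 powr (s * a) / (1 - 2 powr (s * a - p))) * 2 powr q) * T * ennreal (z powr - p + z powr - q)"
    unfolding distr_fun_def by (simp add: lev weighted_def D_def D'_def)
qed

text \<open>An averaging bound at the smaller exponent b/s1 gives strong type at b/s for the measure
  with density w^(1-b). The computation closes because w^b w^(1-b) = w.\<close>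

lemma dual_maximal_bound:
  fixes w :: "real ^ 'n \<Rightarrow> real"
  assumes b: "1 < b" and s: "1 < s" "s < s1" "s1 < b" and ab: "averaging_bound (b / s1) (ennreal K) (\<lambda>x. ennreal (w x powr (1 - b)))" "0 \<le> K"
    and [measurable]: "w \<in> borel_measurable lebesgue" "E \<in> sets lebesgue" and pos: "AE x in lebesgue. 0 < w x"
  defines "V \<equiv> \<lambda>x. enn_powr (maximal (\<lambda>x. enn_powr (ennreal (w x) * indicator E x) s) x) (1 / s)"
  shows "(\<integral>\<^sup>+x. enn_powr (V x) b * ennreal (w x powr (1 - b)) \<partial>lebesgue)
    \<le> ennreal (4 powr (b / s) * (2 powr (b / s - b / s1) / (2 powr (b / s - b / s1) - 1)) * ((3 ^ CARD('n)) powr (b / s1) * K\<^sup>2)) * emeasure (weighted w) E"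
proof -
  let ?h = "\<lambda>x. enn_powr (ennreal (w x) * indicator E x) s"
  let ?u = "\<lambda>x. ennreal (w x powr (1 - b))"
  have lt: "b / s1 < b / s" using s b by (intro divide_strict_left_mono) auto
  define G where "G = 4 powr (b / s) * (2 powr (b / s - b / s1) / (2 powr (b / s - b / s1) - 1))"
  have G: "0 \<le> G" using lt ge_one_powr_ge_zero[of 2 "b / s - b / s1"] by (simp add: G_def)
  have "(\<integral>\<^sup>+x. enn_powr (V x) b * ?u x \<partial>lebesgue) = (\<integral>\<^sup>+x. enn_powr (maximal ?h x) (b / s) \<partial>density lebesgue ?u)"
    by (subst nn_integral_density) (auto simp: V_def enn_powr_powr mult.commute)
  also have "\<dots> \<le> ennreal G * (ennreal ((3 ^ CARD('n)) powr (b / s1)) * (ennreal K)\<^sup>2) * (\<integral>\<^sup>+x. enn_powr (?h x) (b / s) \<partial>density lebesgue ?u)"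
    unfolding G_def using b s lt by (intro strong_type_maximal[OF ab(1)]) auto
  also have "(\<integral>\<^sup>+x. enn_powr (?h x) (b / s) \<partial>density lebesgue ?u) = (\<integral>\<^sup>+x. ennreal (w x) * indicator E x \<partial>lebesgue)"
  proof (subst nn_integral_density, simp, simp, rule nn_integral_cong_AE, use pos in eventually_elim)
    case (elim x)
    have "w x powr (1 - b) * w x powr b = w x" using elim by (simp add: powr_add[symmetric])
    then have "ennreal (w x powr (1 - b)) * ennreal (w x powr b) = ennreal (w x)" by (simp add: ennreal_mult[symmetric])
    then show ?case using elim s b by (auto simp: indicator_def enn_powr_ennreal enn_powr_powr)
  qed
  also have "\<dots> = emeasure (weighted w) E" by (simp add: weighted_def emeasure_density)
  also have "ennreal G * (ennreal ((3 ^ CARD('n)) powr (b / s1)) * (ennreal K)\<^sup>2) = ennreal (G * ((3 ^ CARD('n)) powr (b / s1) * K\<^sup>2))"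
    using G ab(2) by (simp add: ennreal_mult ennreal_power)
  finally show ?thesis by (simp add: G_def)
qed

lemma exists_reverse_holder_exponent:
  fixes d b :: real
  assumes "0 < d" "1 < b"
  obtains c where "1 < c" "c < b" "\<And>s. 1 < s \<Longrightarrow> s \<le> c \<Longrightarrow> 1 \<le> s * (b - 1) / (b - s) \<and> s * (b - 1) / (b - s) \<le> 1 + d"
proof
  \<comment> \<open>The solution s of s(b-1)/(b-s) = 1 + d; it lies strictly between 1 and
    b.\<close>
  let ?c = "(1 + d) * b / (b + d)"
  have "d * 1 < d * b" using assms by (intro mult_strict_left_mono) auto
  then show "1 < ?c" using assms by (simp add: field_simps)
  have "b * 1 < b * b" using assms by (intro mult_strict_left_mono) auto
  then show c: "?c < b" using assms by (simp add: field_simps)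
  fix s assume s: "1 < s" "s \<le> ?c"
  have sb: "s < b" using s c by simp
  have "s * (b + d) \<le> (1 + d) * b" using s(2) assms by (simp add: pos_le_divide_eq)
  then have "s * (b - 1) \<le> (1 + d) * (b - s)" by (simp add: algebra_simps)
  moreover have "1 * b \<le> s * b" using s assms by (intro mult_right_mono) auto
  then have "1 * (b - s) \<le> s * (b - 1)" by (simp add: algebra_simps)
  ultimately show "1 \<le> s * (b - 1) / (b - s) \<and> s * (b - 1) / (b - s) \<le> 1 + d"
    using sb by (simp add: pos_divide_le_eq pos_le_divide_eq)
qed

lemma AE_weighted_iff:
  assumes "weight w"
  shows "(AE x in weighted w. P x) \<longleftrightarrow> (AE x in lebesgue. P x)"
proof -
  have "w \<in> borel_measurable lebesgue" and pos: "AE x in lebesgue. 0 < w x" using assms by (auto simp: weight_def)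
  then have "(AE x in weighted w. P x) \<longleftrightarrow> (AE x in lebesgue. 0 < ennreal (w x) \<longrightarrow> P x)"
    unfolding weighted_def by (intro AE_density) auto
  also have "\<dots> \<longleftrightarrow> (AE x in lebesgue. P x)"
  proof
    assume "AE x in lebesgue. 0 < ennreal (w x) \<longrightarrow> P x"
    with pos show "AE x in lebesgue. P x" by eventually_elim auto
  next
    assume "AE x in lebesgue. P x"
    then show "AE x in lebesgue. 0 < ennreal (w x) \<longrightarrow> P x" by eventually_elim auto
  qed
  finally show ?thesis .
qed

lemma nn_integral_weighted:
  "w \<in> borel_measurable lebesgue \<Longrightarrow> h \<in> borel_measurable lebesgue \<Longrightarrow>
    (\<integral>\<^sup>+x. h x \<partial>weighted w) = (\<integral>\<^sup>+x. h x * ennreal (w x) \<partial>lebesgue)"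
  unfolding weighted_def by (subst nn_integral_density) (auto simp: mult.commute)

lemma sets_weighted [simp]: "sets (weighted w) = sets lebesgue" and space_weighted [simp]: "space (weighted w) = UNIV"
  by (auto simp: weighted_def)

lemma measurable_weighted [simp]: "measurable (weighted w) N = measurable lebesgue N"
  by (rule measurable_cong_sets) auto

text \<open>Testing the hypothesis on the weight \<open>F\<^sup>1\<^sup>-\<^sup>p\<^sup>0 V\<close>, where \<open>F\<close> and \<open>V\<close> are maximal functions
  dominating \<open>f\<close> and \<open>w \<chi>\<^sub>E\<close>.\<close>

lemma extrapolation_step:
  fixes w :: "real ^ 'n \<Rightarrow> real" and f F V :: "real ^ 'n \<Rightarrow> ennreal"
  assumes w: "weight w" and [measurable]: "f \<in> borel_measurable lebesgue" "F \<in> borel_measurable lebesgue" "V \<in> borel_measurable lebesgue" "E \<in> sets lebesgue"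
    and t: "emeasure (weighted w) E = ennreal t" "0 < t" and p0: "1 \<le> p0" and CR: "0 < Cr"
    and A1: "\<And>Q x. Q \<in> cubes \<Longrightarrow> x \<in> Q \<Longrightarrow> avg Q F \<le> ennreal Cr * F x" "\<And>Q x. Q \<in> cubes \<Longrightarrow> x \<in> Q \<Longrightarrow> avg Q V \<le> ennreal Cr * V x"
    and pos: "\<And>x. 0 < F x" "\<And>x. 0 < V x"
    and fF: "AE x in lebesgue. f x \<le> F x" and wV: "AE x in lebesgue. x \<in> E \<longrightarrow> ennreal (w x) \<le> V x"
    and r: "1 < r1" "1 < r2"
    and F1: "(\<integral>\<^sup>+x. (if ennreal 1 < F x then enn_powr (F x) r1 else 0) \<partial>weighted w) \<le> ennreal (G1 * t)"
    and F2: "(\<integral>\<^sup>+x. (if F x \<le> ennreal 1 then enn_powr (F x) r2 else 0) \<partial>weighted w) \<le> ennreal (G2 * t)"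
    and V1: "(\<integral>\<^sup>+x. enn_powr (V x) (r1 / (r1 - 1)) * ennreal (w x powr (1 - r1 / (r1 - 1))) \<partial>lebesgue) \<le> ennreal (G3 * t)"
    and V2: "(\<integral>\<^sup>+x. enn_powr (V x) (r2 / (r2 - 1)) * ennreal (w x powr (1 - r2 / (r2 - 1))) \<partial>lebesgue) \<le> ennreal (G4 * t)"
    and G: "0 \<le> G1" "0 \<le> G2" "0 \<le> G3" "0 \<le> G4" and z: "0 < z" and half: "distr_fun (weighted w) F (ennreal z) \<le> ennreal (t / 2)"
    and y: "0 < y" and N: "0 \<le> N"
    and hyp: "\<And>v. v \<in> Ap p0 \<Longrightarrow> Ap_norm p0 v \<le> ennreal (Cr powr p0) \<Longrightarrow>
      ennreal (y powr p0) * emeasure (weighted v) E \<le> ennreal N * (\<integral>\<^sup>+x. enn_powr (f x) p0 \<partial>weighted v)"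
  shows "y powr p0 \<le> 2 * N * (G1 + G2 + G3 + G4) * z powr (p0 - 1)"
proof -
  have [measurable]: "w \<in> borel_measurable lebesgue" and wpos: "AE x in lebesgue. 0 < w x" using w by (auto simp: weight_def)
  define b1 where "b1 = r1 / (r1 - 1)"
  define b2 where "b2 = r2 / (r2 - 1)"
  have wb: "ennreal (w x) = ennreal (w x powr (1 - b)) * ennreal (w x powr b)" if "0 < w x" for b x
    using that by (simp add: ennreal_mult[symmetric] powr_add[symmetric])
  have finF: "AE x in lebesgue. F x < top"
  proof -
    have "(\<integral>\<^sup>+x. (if ennreal 1 < F x then enn_powr (F x) r1 else 0) \<partial>weighted w) \<noteq> \<infinity>" using F1 by (auto simp: top_unique)
    then have "AE x in weighted w. (if ennreal 1 < F x then enn_powr (F x) r1 else 0) \<noteq> \<infinity>"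
      by (intro nn_integral_PInf_AE) auto
    then have "AE x in lebesgue. (if ennreal 1 < F x then enn_powr (F x) r1 else 0) \<noteq> \<infinity>" by (simp only: AE_weighted_iff[OF w])
    then show ?thesis by eventually_elim (auto simp: less_top[symmetric] split: if_splits)
  qed
  have finV: "AE x in lebesgue. V x < top"
  proof -
    have "(\<integral>\<^sup>+x. enn_powr (V x) b1 * ennreal (w x powr (1 - b1)) \<partial>lebesgue) \<noteq> \<infinity>" using V1 by (auto simp: top_unique b1_def)
    then have "AE x in lebesgue. enn_powr (V x) b1 * ennreal (w x powr (1 - b1)) \<noteq> \<infinity>"
      by (intro nn_integral_PInf_AE) auto
    with wpos show ?thesis by eventually_elim (auto simp: less_top[symmetric] ennreal_top_mult)
  qed
  define v where "v = (\<lambda>x. enn2real (F x) powr (1 - p0) * enn2real (V x))"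
  have [measurable]: "v \<in> borel_measurable lebesgue" unfolding v_def by measurable
  have v: "v \<in> Ap p0" "Ap_norm p0 v \<le> ennreal (Cr powr p0)"
    unfolding v_def by (rule A1_quotient_in_Ap[OF p0 CR _ _ A1 pos finF finV]; measurable)+
  \<comment> \<open>Both resulting integrals are already multiples of t, so Young's inequality is
    enough and no Hoelder product has to be balanced. The exponent is r1 where F is large and r2
    where it is small, matching the integrability that the two-power tail provides.\<close>
  have young: "F x * V x \<le> ((if ennreal 1 < F x then enn_powr (F x) r1 else 0) * ennreal (w x) + enn_powr (V x) b1 * ennreal (w x powr (1 - b1)))
      + ((if F x \<le> ennreal 1 then enn_powr (F x) r2 else 0) * ennreal (w x) + enn_powr (V x) b2 * ennreal (w x powr (1 - b2)))"
    if wx: "0 < w x" for x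
  proof -
    have gen: "F x * V x \<le> enn_powr (F x) r * ennreal (w x) + enn_powr (V x) (r / (r - 1)) * ennreal (w x powr (1 - r / (r - 1)))" if "1 < r" for r
    proof -
      define b where "b = r / (r - 1)"
      have b: "0 < b" using that by (simp add: b_def)
      \<comment> \<open>Dividing V by w lets Young's inequality act with respect to the measure w
        dx; converting back produces the dual weight w^(1-b).\<close>
      define X where "X = V x * ennreal (1 / w x)"
      have VX: "V x = X * ennreal (w x)" using wx by (simp add: X_def mult.assoc ennreal_mult[symmetric])
      have "F x * V x = (F x * X) * ennreal (w x)" by (simp add: VX mult.assoc)
      also have "\<dots> \<le> (enn_powr (F x) r + enn_powr X b) * ennreal (w x)"
        unfolding b_def by (intro mult_right_mono young_ennreal that) simp
      also have "\<dots> = enn_powr (F x) r * ennreal (w x) + enn_powr X b * ennreal (w x)" by (simp add: distrib_right)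
      also have "enn_powr X b * ennreal (w x) = enn_powr (V x) b * ennreal (w x powr (1 - b))"
      proof -
        have "enn_powr X b * ennreal (w x) = enn_powr X b * (ennreal (w x powr (1 - b)) * ennreal (w x powr b))"
          by (simp only: wb[OF wx, of b, symmetric])
        moreover have "enn_powr (V x) b = enn_powr X b * ennreal (w x powr b)"
          unfolding VX using b wx by (simp add: enn_powr_mult enn_powr_ennreal)
        ultimately show ?thesis by (simp add: mult_ac)
      qed
      finally show ?thesis by (simp add: b_def)
    qed
    show ?thesis
    proof (cases "ennreal 1 < F x")
      case True
      then show ?thesis using gen[OF r(1)] by (simp add: b1_def add_increasing2)
    next
      case False
      then show ?thesis using gen[OF r(2)] by (simp add: b2_def not_less add_increasing)
    qed
  qed
  have FV: "(\<integral>\<^sup>+x. F x * V x \<partial>lebesgue) \<le> ennreal ((G1 + G2 + G3 + G4) * t)"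
  proof -
    have "(\<integral>\<^sup>+x. F x * V x \<partial>lebesgue) \<le> (\<integral>\<^sup>+x. ((if ennreal 1 < F x then enn_powr (F x) r1 else 0) * ennreal (w x) + enn_powr (V x) b1 * ennreal (w x powr (1 - b1)))
      + ((if F x \<le> ennreal 1 then enn_powr (F x) r2 else 0) * ennreal (w x) + enn_powr (V x) b2 * ennreal (w x powr (1 - b2))) \<partial>lebesgue)"
      by (rule nn_integral_mono_AE, use wpos in eventually_elim) (rule young)
    also have "\<dots> = ((\<integral>\<^sup>+x. (if ennreal 1 < F x then enn_powr (F x) r1 else 0) \<partial>weighted w) + (\<integral>\<^sup>+x. enn_powr (V x) b1 * ennreal (w x powr (1 - b1)) \<partial>lebesgue))
      + ((\<integral>\<^sup>+x. (if F x \<le> ennreal 1 then enn_powr (F x) r2 else 0) \<partial>weighted w) + (\<integral>\<^sup>+x. enn_powr (V x) b2 * ennreal (w x powr (1 - b2)) \<partial>lebesgue))"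
      by (simp add: nn_integral_add nn_integral_weighted)
    also have "\<dots> \<le> (ennreal (G1 * t) + ennreal (G3 * t)) + (ennreal (G2 * t) + ennreal (G4 * t))"
      using F1 F2 V1 V2 unfolding b1_def b2_def by (intro add_mono)
    also have "\<dots> = ennreal ((G1 + G2 + G3 + G4) * t)"
      using G t by (simp add: ennreal_plus[symmetric] algebra_simps del: ennreal_plus)
    finally show ?thesis .
  qed
  have upper: "(\<integral>\<^sup>+x. enn_powr (f x) p0 \<partial>weighted v) \<le> ennreal ((G1 + G2 + G3 + G4) * t)"
  proof -
    have "(\<integral>\<^sup>+x. enn_powr (f x) p0 \<partial>weighted v) = (\<integral>\<^sup>+x. enn_powr (f x) p0 * ennreal (v x) \<partial>lebesgue)"
      by (simp add: nn_integral_weighted)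
    also have "\<dots> \<le> (\<integral>\<^sup>+x. F x * V x \<partial>lebesgue)"
    proof (rule nn_integral_mono_AE, use fF finF finV in eventually_elim)
      case (elim x)
      have F0: "0 < enn2real (F x)" using elim pos(1)[of x] by (simp add: enn2real_positive_iff)
      have Fx: "F x = ennreal (enn2real (F x))" "V x = ennreal (enn2real (V x))" using elim by auto
      have "enn_powr (f x) p0 * ennreal (v x) \<le> enn_powr (F x) p0 * ennreal (v x)"
        using elim p0 by (intro mult_right_mono enn_powr_mono) auto
      also have "\<dots> = ennreal (enn2real (F x) powr p0) * ennreal (v x)"
        by (subst Fx(1)) (simp add: enn_powr_ennreal)
      also have "\<dots> = ennreal (enn2real (F x) * enn2real (V x))"
        using F0 by (simp add: v_def ennreal_mult[symmetric] mult.assoc[symmetric] powr_add[symmetric])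
      also have "\<dots> = F x * V x" using Fx by (simp add: ennreal_mult)
      finally show ?case .
    qed
    also note FV
    finally show ?thesis .
  qed
  \<comment> \<open>At least half of E, measured by w, satisfies F <= z. There the nonpositive power
    of F is at least z^(1-p0), and V >= w.\<close>
  have lower: "ennreal (z powr (1 - p0) * (t / 2)) \<le> emeasure (weighted v) E"
  proof -
    define A where "A = E \<inter> {x. F x \<le> ennreal z}"
    have "{x \<in> space lebesgue. F x \<le> ennreal z} \<in> sets lebesgue" "{x \<in> space lebesgue. ennreal z < F x} \<in> sets lebesgue" by measurable
    then have [measurable]: "{x. F x \<le> ennreal z} \<in> sets lebesgue" "{x. ennreal z < F x} \<in> sets lebesgue" by simp_all
    have [measurable]: "A \<in> sets lebesgue" by (simp add: A_def)
    have "ennreal t \<le> emeasure (weighted w) (A \<union> {x. ennreal z < F x})"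
      unfolding t(1)[symmetric] by (intro emeasure_mono) (auto simp: A_def)
    also have "\<dots> \<le> emeasure (weighted w) A + emeasure (weighted w) {x. ennreal z < F x}"
      by (intro emeasure_subadditive) auto
    also have "\<dots> \<le> emeasure (weighted w) A + ennreal (t / 2)"
      using half by (intro add_left_mono) (simp add: distr_fun_def)
    finally have "ennreal t - ennreal (t / 2) \<le> emeasure (weighted w) A"
      by (simp add: ennreal_minus_le_iff add.commute)
    then have wA: "ennreal (t / 2) \<le> emeasure (weighted w) A" using t(2) by (simp add: ennreal_minus)
    have "ennreal (z powr (1 - p0) * (t / 2)) = ennreal (z powr (1 - p0)) * ennreal (t / 2)"
      using t(2) by (intro ennreal_mult) auto
    also have "\<dots> \<le> ennreal (z powr (1 - p0)) * emeasure (weighted w) A"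
      by (intro mult_left_mono wA) simp
    also have "\<dots> = (\<integral>\<^sup>+x. ennreal (z powr (1 - p0)) * (ennreal (w x) * indicator A x) \<partial>lebesgue)"
      by (simp add: weighted_def emeasure_density nn_integral_cmult)
    also have "\<dots> \<le> (\<integral>\<^sup>+x. ennreal (v x) * indicator E x \<partial>lebesgue)"
    proof (rule nn_integral_mono_AE, use wV finF finV in eventually_elim)
      case (elim x)
      show ?case
      proof (cases "x \<in> A")
        case True
        then have x: "x \<in> E" "F x \<le> ennreal z" by (auto simp: A_def)
        have F0: "0 < enn2real (F x)" using elim pos(1)[of x] by (simp add: enn2real_positive_iff)
        have "enn2real (F x) \<le> z" using x(2) z by (simp add: enn2real_leI)
        then have "z powr (1 - p0) \<le> enn2real (F x) powr (1 - p0)" using F0 p0 by (intro powr_mono2') auto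
        then have "ennreal (z powr (1 - p0)) * ennreal (w x) \<le> ennreal (enn2real (F x) powr (1 - p0)) * V x"
          using elim x(1) by (intro mult_mono ennreal_leI) auto
        also have "\<dots> = ennreal (v x)" using elim by (simp add: v_def ennreal_mult)
        finally show ?thesis using True x by (simp add: mult.assoc)
      qed simp
    qed
    also have "\<dots> = emeasure (weighted v) E" by (simp add: weighted_def emeasure_density)
    finally show ?thesis .
  qed
  have "ennreal (y powr p0 * (z powr (1 - p0) * (t / 2))) = ennreal (y powr p0) * ennreal (z powr (1 - p0) * (t / 2))"
    using t by (intro ennreal_mult) auto
  also have "\<dots> \<le> ennreal (y powr p0) * emeasure (weighted v) E"
    by (intro mult_left_mono lower) simp
  also have "\<dots> \<le> ennreal N * (\<integral>\<^sup>+x. enn_powr (f x) p0 \<partial>weighted v)" by (rule hyp[OF v])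
  also have "\<dots> \<le> ennreal N * ennreal ((G1 + G2 + G3 + G4) * t)" by (intro mult_left_mono upper) simp
  also have "\<dots> = ennreal (N * ((G1 + G2 + G3 + G4) * t))" using N G t by (simp add: ennreal_mult)
  finally have "y powr p0 * (z powr (1 - p0) * (t / 2)) \<le> N * ((G1 + G2 + G3 + G4) * t)"
    using N G t by (subst (asm) ennreal_le_iff) auto
  then have "y powr p0 * z powr (1 - p0) * t \<le> (2 * N * (G1 + G2 + G3 + G4)) * t" by (simp add: mult_ac)
  then have le: "y powr p0 * z powr (1 - p0) \<le> 2 * N * (G1 + G2 + G3 + G4)" using t(2) by (rule mult_right_le_imp_le)
  have "y powr p0 = y powr p0 * z powr (1 - p0) * z powr (p0 - 1)"
    using z by (simp add: mult.assoc powr_add[symmetric])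
  also have "\<dots> \<le> 2 * N * (G1 + G2 + G3 + G4) * z powr (p0 - 1)" using le by (intro mult_right_mono) auto
  finally show ?thesis .
qed

text \<open>The order of the quantifiers carries the content. The exponent \<open>p\<^sub>2\<close>
  and the bound \<open>K\<^sub>0\<close> on the test weights come first, since the growth bound N of
  the hypothesis can be determined only once \<open>K\<^sub>0\<close> is known; the final constant
  then precedes w, f, E and y.\<close>

theorem weighted_extrapolation:
  assumes p: "1 < p" "p \<le> q" and p0: "1 \<le> p\<^sub>0" and K: "1 \<le> K"
  obtains p\<^sub>2 K\<^sub>0 where "1 < p\<^sub>2" "p\<^sub>2 < p" "0 < K\<^sub>0"
    "\<And>B N. 0 < B \<Longrightarrow> 0 \<le> N \<Longrightarrow> \<exists>C>0. \<forall>(w :: real ^ 'n \<Rightarrow> real) f E y. weight w \<longrightarrow> ap_bound p (ennreal K) w \<longrightarrow>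
      f \<in> borel_measurable lebesgue \<longrightarrow> E \<in> sets lebesgue \<longrightarrow>
      0 < emeasure (weighted w) E \<longrightarrow> emeasure (weighted w) E < top \<longrightarrow>
      two_tail (weighted w) f (ennreal B * emeasure (weighted w) E) p\<^sub>2 q \<longrightarrow> 0 < y \<longrightarrow>
      (\<forall>v\<in>Ap p\<^sub>0. Ap_norm p\<^sub>0 v \<le> ennreal K\<^sub>0 \<longrightarrow>
        ennreal (y powr p\<^sub>0) * emeasure (weighted v) E \<le> ennreal N * (\<integral>\<^sup>+x. enn_powr (f x) p\<^sub>0 \<partial>weighted v)) \<longrightarrow>
      y \<le> C"
proof (rule ap_bound_open[OF p(1) K, where 'n = 'n])
  fix p1 K1 assume p1: "1 < p1" "p1 < p" "1 \<le> K1"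
    and open1: "\<And>w :: real ^ 'n \<Rightarrow> real. weight w \<Longrightarrow> ap_bound p (ennreal K) w \<Longrightarrow> ap_bound p1 (ennreal K1) w"
  have "1 * 1 \<le> 2 powr p * K" using p K by (intro mult_mono ge_one_powr_ge_zero) auto
  then have K2: "1 \<le> 2 powr p * K" by simp
  have p_pos: "0 < p" using p by simp
  show thesis
  proof (rule reverse_holder[OF p_pos K2, where 'n = 'n])
    fix d C1 assume d: "0 < d" "1 \<le> C1"
      and rh: "\<And>(u :: real ^ 'n \<Rightarrow> ennreal) Q t. u \<in> borel_measurable lebesgue \<Longrightarrow> averaging_bound p (ennreal (2 powr p * K)) u \<Longrightarrow> Q \<in> cubes \<Longrightarrow>
        avg Q u < \<infinity> \<Longrightarrow> 1 \<le> t \<Longrightarrow> t \<le> 1 + d \<Longrightarrow> avg Q (\<lambda>x. enn_powr (u x) t) \<le> ennreal C1 * enn_powr (avg Q u) t"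
    \<comment> \<open>The tail exponent sits strictly between p1, where w is still a Muckenhoupt
      weight, and p, so that there is room for s on one side and for the Boyd index on the
      other.\<close>
    define p2 where "p2 = (p1 + p) / 2"
    have p2: "1 < p2" "p1 < p2" "p2 < p" "p2 \<le> q" using p p1 by (auto simp: p2_def)
    define q2 where "q2 = q + 1"
    have q2: "1 < q2" "q < q2" "p \<le> q2" using p by (auto simp: q2_def)
    define b1 where "b1 = p1 / (p1 - 1)"
    define b2 where "b2 = q2 / (q2 - 1)"
    have b: "1 < b1" "1 < b2" using p1 q2 by (auto simp: b1_def b2_def field_simps)
    have bb: "b1 / (b1 - 1) = p1" "b2 / (b2 - 1) = q2" using p1 q2 by (auto simp: b1_def b2_def field_simps)
    obtain c1 where c1: "1 < c1" "c1 < b1" "\<And>s. 1 < s \<Longrightarrow> s \<le> c1 \<Longrightarrow> 1 \<le> s * (b1 - 1) / (b1 - s) \<and> s * (b1 - 1) / (b1 - s) \<le> 1 + d"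
      by (rule exists_reverse_holder_exponent[OF d(1) b(1)]) blast
    obtain c2 where c2: "1 < c2" "c2 < b2" "\<And>s. 1 < s \<Longrightarrow> s \<le> c2 \<Longrightarrow> 1 \<le> s * (b2 - 1) / (b2 - s) \<and> s * (b2 - 1) / (b2 - s) \<le> 1 + d"
      by (rule exists_reverse_holder_exponent[OF d(1) b(2)]) blast
    \<comment> \<open>One exponent has to serve both conjugate pairs: with it, reverse Hoelder for w
      applies to the powers of w that arise from b1 and from b2.\<close>
    define s1 where "s1 = min c1 c2"
    have s1: "1 < s1" "s1 \<le> c1" "s1 \<le> c2" "s1 < b1" "s1 < b2" using c1(1,2) c2(1,2) by (auto simp: s1_def)
    define e where "e = p2 / p1"
    have e: "1 < e" using p2 p1 by (simp add: e_def)
    \<comment> \<open>The inequality s < s1 opens the gap between b/s1 and b/s for the strong type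
      bound on V, and s < p2/p1 gives s p1 < p2 for the tail of F.\<close>
    define s where "s = (1 + min s1 e) / 2"
    have s: "1 < s" "s < s1" "s < e" using s1 e by (auto simp: s_def min_def)
    have sp: "s * p1 < p2" using s(3) p1 by (simp add: e_def pos_less_divide_eq)
    show thesis
    proof (rule coifman_rochberg[OF s(1), where 'n = 'n])
      fix Cr assume Cr: "0 < Cr"
        and CR: "\<And>h Q (x :: real ^ 'n). h \<in> borel_measurable lebesgue \<Longrightarrow> Q \<in> cubes \<Longrightarrow> x \<in> Q \<Longrightarrow>
          avg Q (\<lambda>y. enn_powr (maximal h y) (1 / s)) \<le> ennreal Cr * enn_powr (maximal h x) (1 / s)"
      show thesis
      proof (rule that[OF p2(1,3)])
        show "0 < Cr powr p\<^sub>0" using Cr by simp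
        fix B N :: real assume B: "0 < B" and N: "0 \<le> N"
        define Ka where "Ka = 2 powr p1 * K1"
        define D0 where "D0 = (3 ^ CARD('n)) powr p1 * Ka\<^sup>2 * (2 powr (s * p1) / (1 - 2 powr (s * p1 - p2))) * 2 powr q"
        have Ka: "0 \<le> Ka" using p1 by (simp add: Ka_def)
        have D0: "0 \<le> D0" using sp powr_less_one[of 2 "s * p1 - p2"] by (simp add: D0_def)
        define BT where "BT = D0 * (B + 1)"
        have BT: "0 \<le> BT" using D0 B by (simp add: BT_def)
        define G1 where "G1 = 2 powr p1 / (1 - 2 powr (p1 - p2)) * (BT * 2)"
        define G2 where "G2 = 2 powr q / (1 - 2 powr (q - q2)) * (BT * 2)"
        define L where "L b Kr = 2 powr (b / s1) * (C1 powr (b / s1 - 1) * Kr powr (b - 1))" for b Kr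
        define G where "G b Kr = 4 powr (b / s) * (2 powr (b / s - b / s1) / (2 powr (b / s - b / s1) - 1)) * ((3 ^ CARD('n)) powr (b / s1) * (L b Kr)\<^sup>2)" for b Kr
        define G3 where "G3 = G b1 K1"
        define G4 where "G4 = G b2 (2 powr (q2 - 1) * K)"
        have G12: "0 \<le> G1" "0 \<le> G2" using BT p2 q2 powr_less_one[of 2 "p1 - p2"] powr_less_one[of 2 "q - q2"] by (auto simp: G1_def G2_def)
        have G_pos: "0 \<le> G b Kr" if "1 < b" for b Kr
        proof -
          have "b / s1 < b / s" using s b that by (intro divide_strict_left_mono) auto
          then show ?thesis using ge_one_powr_ge_zero[of 2 "b / s - b / s1"] by (simp add: G_def)
        qed
        have G34: "0 \<le> G3" "0 \<le> G4" using b by (auto simp: G3_def G4_def G_pos)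
        have L_pos: "0 \<le> L b Kr" for b Kr by (simp add: L_def)
        \<comment> \<open>For z >= 1 the q-term is dominated by the p2-term, and 4 BT <= z^p2 then
          brings the tail of F at level z down to half of w(E).\<close>
        define z where "z = max 1 ((4 * BT) powr (1 / p2))"
        have z: "1 \<le> z" by (simp add: z_def)
        have zBT: "BT * (z powr - p2 + z powr - q) \<le> 1 / 2"
        proof (cases "BT = 0")
          case False
          have "z powr - q \<le> z powr - p2" using z p2 by (intro powr_mono) auto
          then have "BT * (z powr - p2 + z powr - q) \<le> BT * (2 * z powr - p2)" using BT by (intro mult_left_mono) auto
          also have "4 * BT = ((4 * BT) powr (1 / p2)) powr p2" using BT p2 by (simp add: powr_powr)
          then have "4 * BT \<le> z powr p2" using p2 by (metis max.cobounded2 powr_ge_zero powr_mono2 z_def less_eq_real_def less_trans zero_less_one)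
          then have "BT * (2 * z powr - p2) \<le> 1 / 2" using z by (simp add: powr_minus field_simps)
          finally show ?thesis .
        qed simp
        define C where "C = (2 * N * (G1 + G2 + G3 + G4) * z powr (p\<^sub>0 - 1)) powr (1 / p\<^sub>0) + 1"
        have C: "0 < C" by (simp add: C_def add_nonneg_pos)
        have "y \<le> C" if w: "weight w" and ap: "ap_bound p (ennreal K) w" and [measurable]: "f \<in> borel_measurable lebesgue" "E \<in> sets lebesgue"
          and E: "0 < emeasure (weighted w) E" "emeasure (weighted w) E < top"
          and tail: "two_tail (weighted w) f (ennreal B * emeasure (weighted w) E) p2 q" and y: "0 < y"
          and hyp: "\<forall>v\<in>Ap p\<^sub>0. Ap_norm p\<^sub>0 v \<le> ennreal (Cr powr p\<^sub>0) \<longrightarrow>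
            ennreal (y powr p\<^sub>0) * emeasure (weighted v) E \<le> ennreal N * (\<integral>\<^sup>+x. enn_powr (f x) p\<^sub>0 \<partial>weighted v)"
          for w :: "real ^ 'n \<Rightarrow> real" and f E y
        proof -
          have wm [measurable]: "w \<in> borel_measurable lebesgue" and wpos: "AE x in lebesgue. 0 < w x" using w by (auto simp: weight_def)
          obtain t where t: "emeasure (weighted w) E = ennreal t" "0 < t" using E by (cases "emeasure (weighted w) E") auto
          define g where "g x = max (f x) (indicator E x)" for x
          have [measurable]: "g \<in> borel_measurable lebesgue" unfolding g_def by measurable
          have gE: "1 \<le> g x" if "x \<in> E" for x using that by (simp add: g_def)
          have Enull: "\<not> (AE x in lebesgue. x \<notin> E)"
          proof
            assume "AE x in lebesgue. x \<notin> E"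
            then have "AE x in weighted w. x \<notin> E" by (simp only: AE_weighted_iff[OF w])
            then have "emeasure (weighted w) E = 0" using AE_iff_null_sets[of E "weighted w"] by auto
            then show False using E by simp
          qed
          define F where "F = (\<lambda>x. enn_powr (maximal (\<lambda>x. enn_powr (g x) s) x) (1 / s))"
          define V where "V = (\<lambda>x. enn_powr (maximal (\<lambda>x. enn_powr (ennreal (w x) * indicator E x) s) x) (1 / s))"
          have [measurable]: "F \<in> borel_measurable lebesgue" "V \<in> borel_measurable lebesgue" unfolding F_def V_def by measurable
          have le_root: "AE x in lebesgue. h x \<le> enn_powr (maximal (\<lambda>x. enn_powr (h x) s) x) (1 / s)"
            if [measurable]: "h \<in> borel_measurable lebesgue" for h :: "real ^ 'n \<Rightarrow> ennreal"
          proof -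
            have "AE x in lebesgue. enn_powr (h x) s \<le> maximal (\<lambda>x. enn_powr (h x) s) x" by (rule AE_le_maximal) measurable
            then show ?thesis
            proof eventually_elim
              case (elim x)
              then have "enn_powr (enn_powr (h x) s) (1 / s) \<le> enn_powr (maximal (\<lambda>x. enn_powr (h x) s) x) (1 / s)"
                using s by (intro enn_powr_mono) auto
              then show ?case using s by (simp add: enn_powr_powr)
            qed
          qed
          have F_pos: "0 < F x" for x
          proof -
            have "\<not> (AE x in lebesgue. enn_powr (g x) s = 0)"
              using Enull by (rule contrapos_nn) (auto elim!: eventually_mono dest: gE)
            then show ?thesis unfolding F_def by (simp add: maximal_pos)
          qed
          have V_pos: "0 < V x" for x
          proof -
            have "\<not> (AE x in lebesgue. enn_powr (ennreal (w x) * indicator E x) s = 0)"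
            proof
              assume "AE x in lebesgue. enn_powr (ennreal (w x) * indicator E x) s = 0"
              with wpos have "AE x in lebesgue. x \<notin> E" by eventually_elim (auto simp: ennreal_eq_0_iff)
              with Enull show False ..
            qed
            then show ?thesis unfolding V_def by (simp add: maximal_pos)
          qed
          have ab1: "averaging_bound p1 (ennreal Ka) (\<lambda>x. ennreal (w x))"
            using averaging_bound_of_ap_bound[OF p1(1) wm wpos open1[OF w ap]] p1 by (simp add: Ka_def ennreal_mult)
          have abp: "averaging_bound p (ennreal (2 powr p * K)) (\<lambda>x. ennreal (w x))"
            using averaging_bound_of_ap_bound[OF p(1) wm wpos ap] K by (simp add: ennreal_mult)
          have tailF: "two_tail (weighted w) F (ennreal (BT * t)) p2 q"
          proof -
            have "two_tail (weighted w) g (ennreal (B + 1) * emeasure (weighted w) E) p2 q"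
              unfolding g_def using tail B p by (intro two_tail_max_indicator) auto
            then have "two_tail (weighted w) F (ennreal D0 * (ennreal (B + 1) * emeasure (weighted w) E)) p2 q"
              unfolding F_def D0_def using ab1 p1 Ka s sp p2 by (intro two_tail_maximal) auto
            also have "ennreal D0 * (ennreal (B + 1) * emeasure (weighted w) E) = ennreal (BT * t)"
              using t D0 B by (simp add: BT_def ennreal_mult[symmetric] mult.assoc del: ennreal_plus)
            finally show ?thesis .
          qed
          have two: "ennreal (BT * t) * ennreal (1 powr - p2 + 1 powr - q) = ennreal (BT * 2 * t)"
            using BT t by (subst ennreal_mult[symmetric]) auto
          have F1: "(\<integral>\<^sup>+x. (if ennreal 1 < F x then enn_powr (F x) p1 else 0) \<partial>weighted w) \<le> ennreal (G1 * t)"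
          proof -
            have "(\<integral>\<^sup>+x. (if ennreal 1 < F x then enn_powr (F x) p1 else 0) \<partial>weighted w)
              \<le> ennreal (2 powr p1 / (1 - 2 powr (p1 - p2))) * (ennreal (BT * t) * ennreal (1 powr - p2 + 1 powr - q)) * ennreal (1 powr p1)"
              using p1 p2 by (intro two_tail_integral_above tailF) auto
            also have "\<dots> = ennreal (G1 * t)"
              unfolding two using BT t p2 powr_less_one[of 2 "p1 - p2"] by (simp add: ennreal_mult[symmetric] G1_def mult.assoc)
            finally show ?thesis .
          qed
          have F2: "(\<integral>\<^sup>+x. (if F x \<le> ennreal 1 then enn_powr (F x) q2 else 0) \<partial>weighted w) \<le> ennreal (G2 * t)"
          proof -
            have "(\<integral>\<^sup>+x. (if F x \<le> ennreal 1 then enn_powr (F x) q2 else 0) \<partial>weighted w)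
              \<le> ennreal (2 powr q / (1 - 2 powr (q - q2))) * (ennreal (BT * t) * ennreal (1 powr - p2 + 1 powr - q)) * ennreal (1 powr q2)"
              using p p2 q2 by (intro two_tail_integral_below tailF) auto
            also have "\<dots> = ennreal (G2 * t)"
              unfolding two using BT t q2 powr_less_one[of 2 "q - q2"] by (simp add: ennreal_mult[symmetric] G2_def mult.assoc)
            finally show ?thesis .
          qed
          have Vb: "(\<integral>\<^sup>+x. enn_powr (V x) b * ennreal (w x powr (1 - b)) \<partial>lebesgue) \<le> ennreal (G b Kr * t)"
            if b: "1 < b" "s1 < b" and apb: "ap_bound (b / (b - 1)) (ennreal Kr) w" and Kr: "0 \<le> Kr"
              and ex: "1 \<le> s1 * (b - 1) / (b - s1) \<and> s1 * (b - 1) / (b - s1) \<le> 1 + d" for b Kr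
          proof -
            have "averaging_bound (b / s1) (ennreal (L b Kr)) (\<lambda>x. ennreal (w x powr (1 - b)))"
              unfolding L_def
            proof (intro averaging_bound_dual_weight s1(1) b w apb Kr)
              fix Q :: "(real ^ 'n) set" assume Q: "Q \<in> cubes"
              show "avg Q (\<lambda>x. enn_powr (ennreal (w x)) (s1 * (b - 1) / (b - s1)))
                \<le> ennreal C1 * enn_powr (avg Q (\<lambda>x. ennreal (w x))) (s1 * (b - 1) / (b - s1))"
                using ex by (intro rh abp Q weight_avg_finite[OF w]) auto
            qed (use d in auto)
            then have "(\<integral>\<^sup>+x. enn_powr (V x) b * ennreal (w x powr (1 - b)) \<partial>lebesgue) \<le> ennreal (G b Kr) * emeasure (weighted w) E"
              unfolding V_def G_def using b s L_pos wpos by (intro dual_maximal_bound) auto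
            also have "\<dots> = ennreal (G b Kr * t)" using t G_pos[OF b(1)] by (simp add: ennreal_mult)
            finally show ?thesis .
          qed
          have "y powr p\<^sub>0 \<le> 2 * N * (G1 + G2 + G3 + G4) * z powr (p\<^sub>0 - 1)"
          proof (rule extrapolation_step[OF w _ _ _ _ t p0 Cr _ _ F_pos V_pos, where f = f])
            show "avg Q F \<le> ennreal Cr * F x" "avg Q V \<le> ennreal Cr * V x" if "Q \<in> cubes" "x \<in> Q" for Q x
              unfolding F_def V_def by (rule CR[OF _ that]; measurable)+
            show "AE x in lebesgue. f x \<le> F x"
              using le_root[of g] unfolding F_def by (auto simp: g_def elim!: eventually_mono)
            show "AE x in lebesgue. x \<in> E \<longrightarrow> ennreal (w x) \<le> V x"
              using le_root[of "\<lambda>x. ennreal (w x) * indicator E x"] unfolding V_def by (auto elim!: eventually_mono)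
            show "(\<integral>\<^sup>+x. enn_powr (V x) (p1 / (p1 - 1)) * ennreal (w x powr (1 - p1 / (p1 - 1))) \<partial>lebesgue) \<le> ennreal (G3 * t)"
              using Vb[OF b(1) s1(4), of K1] open1[OF w ap] p1 c1(3)[OF s1(1,2)] by (simp add: bb G3_def b1_def[symmetric])
            have "ap_bound q2 (ennreal (2 powr (q2 - 1)) * ennreal K) w"
              using p q2 wpos ap by (intro ap_bound_mono[of p]) auto
            then show "(\<integral>\<^sup>+x. enn_powr (V x) (q2 / (q2 - 1)) * ennreal (w x powr (1 - q2 / (q2 - 1))) \<partial>lebesgue) \<le> ennreal (G4 * t)"
              using Vb[OF b(2) s1(5), of "2 powr (q2 - 1) * K"] K c2(3)[OF s1(1,3)] by (simp add: bb G4_def b2_def[symmetric] ennreal_mult)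
            have "distr_fun (weighted w) F (ennreal z) \<le> ennreal (BT * t) * ennreal (z powr - p2 + z powr - q)"
              using tailF z by (auto simp: two_tail_def)
            also have "\<dots> = ennreal (BT * (z powr - p2 + z powr - q) * t)"
              using BT t by (subst ennreal_mult[symmetric]) (auto simp: mult_ac)
            also have "\<dots> \<le> ennreal (1 / 2 * t)"
              using zBT t by (intro ennreal_leI mult_right_mono) auto
            finally show "distr_fun (weighted w) F (ennreal z) \<le> ennreal (t / 2)" by simp
          qed (use p1 q2 F1 F2 G12 G34 z y N hyp in auto)
          then have "(y powr p\<^sub>0) powr (1 / p\<^sub>0) \<le> (2 * N * (G1 + G2 + G3 + G4) * z powr (p\<^sub>0 - 1)) powr (1 / p\<^sub>0)"
            using p0 by (intro powr_mono2) auto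
          then show "y \<le> C" using y p0 by (simp add: powr_powr C_def)
        qed
        then show "\<exists>C>0. \<forall>(w :: real ^ 'n \<Rightarrow> real) f E y. weight w \<longrightarrow> ap_bound p (ennreal K) w \<longrightarrow>
          f \<in> borel_measurable lebesgue \<longrightarrow> E \<in> sets lebesgue \<longrightarrow>
          0 < emeasure (weighted w) E \<longrightarrow> emeasure (weighted w) E < top \<longrightarrow>
          two_tail (weighted w) f (ennreal B * emeasure (weighted w) E) p2 q \<longrightarrow> 0 < y \<longrightarrow>
          (\<forall>v\<in>Ap p\<^sub>0. Ap_norm p\<^sub>0 v \<le> ennreal (Cr powr p\<^sub>0) \<longrightarrow>
            ennreal (y powr p\<^sub>0) * emeasure (weighted v) E \<le> ennreal N * (\<integral>\<^sup>+x. enn_powr (f x) p\<^sub>0 \<partial>weighted v)) \<longrightarrow>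
          y \<le> C"
          using C by blast
      qed
    qed
  qed
qed

section \<open>Rearrangements and the representation space\<close>

lemma distr_fun_antimono: "f \<in> borel_measurable M \<Longrightarrow> y \<le> z \<Longrightarrow> distr_fun M f z \<le> distr_fun M f y"
  unfolding distr_fun_def by (intro emeasure_mono) (auto intro: le_less_trans)

text \<open>The Galois connection between distribution function and rearrangement. One direction is
  the right-continuity of the distribution function, that is, continuity of the measure from
  below.\<close>

lemma rearr_less_iff:
  assumes [measurable]: "f \<in> borel_measurable M"
  shows "y < rearr M f t \<longleftrightarrow> ennreal t < distr_fun M f y"
proof -
  have "rearr M f t \<le> y \<longleftrightarrow> distr_fun M f y \<le> ennreal t"
  proof
    assume "distr_fun M f y \<le> ennreal t"
    then show "rearr M f t \<le> y" unfolding rearr_def by (intro Inf_lower) auto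
  next
    assume le: "rearr M f t \<le> y"
    show "distr_fun M f y \<le> ennreal t"
    proof (cases y)
      case top
      then show ?thesis by (simp add: distr_fun_def)
    next
      case (real r)
      define A where "A k = {x \<in> space M. ennreal (r + 1 / (Suc k)) < f x}" for k
      have [measurable]: "A k \<in> sets M" for k unfolding A_def by measurable
      have "{x \<in> space M. y < f x} \<subseteq> (\<Union>k. A k)"
      proof
        fix x assume "x \<in> {x \<in> space M. y < f x}"
        then have x: "x \<in> space M" "ennreal r < f x" using real by auto
        then obtain s where s: "r < s" "ennreal s < f x"
        proof (cases "f x")
          case (real u)
          then show ?thesis using x that[of "(r + u) / 2"] \<open>y = ennreal r\<close> \<open>0 \<le> r\<close> by (auto simp: ennreal_less_iff)
        next
          case top
          then show ?thesis using that[of "r + 1"] by auto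
        qed
        obtain k where "1 / (Suc k) < s - r" using nat_approx_posE[of "s - r"] s(1) by (auto simp: inverse_eq_divide)
        then have "ennreal (r + 1 / (Suc k)) \<le> ennreal s" by (intro ennreal_leI) simp
        then have "x \<in> A k" using x(1) s(2) by (auto simp: A_def)
        then show "x \<in> (\<Union>k. A k)" by blast
      qed
      then have "distr_fun M f y \<le> emeasure M (\<Union>k. A k)" unfolding distr_fun_def by (intro emeasure_mono) auto
      also have "\<dots> = (SUP k. emeasure M (A k))"
      proof (rule SUP_emeasure_incseq[symmetric])
        show "incseq A"
        proof (intro incseq_SucI subsetI)
          fix k x assume "x \<in> A k"
          moreover have "ennreal (r + 1 / (Suc (Suc k))) \<le> ennreal (r + 1 / (Suc k))"
            by (intro ennreal_leI add_left_mono divide_left_mono) auto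
          ultimately show "x \<in> A (Suc k)" by (auto simp: A_def)
        qed
      qed auto
      also have "\<dots> \<le> ennreal t"
      proof (rule SUP_least)
        fix k
        have "y < ennreal (r + 1 / (Suc k))" using real by (simp add: ennreal_less_iff)
        then have "rearr M f t < ennreal (r + 1 / (Suc k))" using le by order
        then obtain z where z: "distr_fun M f z \<le> ennreal t" "z < ennreal (r + 1 / (Suc k))"
          unfolding rearr_def Inf_less_iff by blast
        have "emeasure M (A k) \<le> distr_fun M f z"
          using distr_fun_antimono[OF assms, of z "ennreal (r + 1 / (Suc k))"] z(2) by (simp add: distr_fun_def A_def)
        then show "emeasure M (A k) \<le> ennreal t" using z(1) by order
      qed
      finally show ?thesis .
    qed
  qed
  then show ?thesis by (auto simp: not_le[symmetric])
qed

lemma rearr_antimono: "s \<le> t \<Longrightarrow> rearr M f t \<le> rearr M f s"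
  unfolding rearr_def by (intro Inf_superset_mono) (auto intro: order_trans ennreal_leI)

lemma rearr_cong: "(\<And>y. distr_fun M f y = distr_fun N g y) \<Longrightarrow> rearr M f = rearr N g"
  by (simp add: rearr_def fun_eq_iff)

abbreviation halfline :: "real measure" where "halfline \<equiv> lebesgue_on {0<..}"

lemma emeasure_halfline: "A \<subseteq> {0<..} \<Longrightarrow> emeasure halfline A = emeasure lebesgue A"
  by (rule emeasure_restrict_space) auto

lemma sets_halfline: "A \<in> sets halfline \<longleftrightarrow> A \<in> sets lebesgue \<and> A \<subseteq> {0<..}"
  by (subst sets_restrict_space_iff) auto

lemma emeasure_halfline_initial: "emeasure lebesgue {t. 0 < t \<and> ennreal t < c} = c"
proof (cases c)
  case (real r)
  then have "{t. 0 < t \<and> ennreal t < c} = {0<..<r}" by (auto simp: ennreal_less_iff)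
  then show ?thesis using real by (simp add: emeasure_completion)
next
  case top
  have "of_nat n \<le> emeasure lebesgue {0::real<..}" for n
  proof -
    have "of_nat n = emeasure lebesgue {0<..<real n}" by (simp add: emeasure_completion ennreal_of_nat_eq_real_of_nat)
    also have "\<dots> \<le> emeasure lebesgue {0::real<..}" by (intro emeasure_mono) auto
    finally show ?thesis .
  qed
  then have "emeasure lebesgue {0::real<..} = top" by (rule ennreal_ge_nat_imp_top)
  moreover have "{t. 0 < t \<and> ennreal t < c} = {0<..}" using top by auto
  ultimately show ?thesis using top by simp
qed

lemma measurable_rearr [measurable]:
  assumes "f \<in> borel_measurable M"
  shows "rearr M f \<in> borel_measurable halfline"
proof (rule borel_measurableI_greater)
  fix y
  have "{t \<in> space halfline. y < rearr M f t} = {t. 0 < t \<and> ennreal t < distr_fun M f y}"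
    using rearr_less_iff[OF assms] by auto
  also have "\<dots> \<in> sets halfline"
  proof -
    have "{t \<in> space borel. 0 < t \<and> ennreal t < distr_fun M f y} \<in> sets borel" by measurable
    then show ?thesis unfolding sets_halfline by auto
  qed
  finally show "{t \<in> space halfline. y < rearr M f t} \<in> sets halfline" .
qed

lemma distr_fun_rearr:
  assumes "f \<in> borel_measurable M"
  shows "distr_fun halfline (rearr M f) y = distr_fun M f y"
proof -
  have "{t \<in> space halfline. y < rearr M f t} = {t. 0 < t \<and> ennreal t < distr_fun M f y}"
    using rearr_less_iff[OF assms] by auto
  then have "distr_fun halfline (rearr M f) y = emeasure lebesgue {t. 0 < t \<and> ennreal t < distr_fun M f y}"
    unfolding distr_fun_def[of halfline] by (simp add: emeasure_halfline subset_iff)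
  then show ?thesis by (simp add: emeasure_halfline_initial)
qed

text \<open>Continuity from above along superlevel sets, which decrease to the null set where f is
  infinite; the level y of finite measure makes this applicable.\<close>

lemma distr_fun_tendsto_infinity_set:
  assumes [measurable]: "f \<in> borel_measurable M" and fin: "distr_fun M f (ennreal y) < top" and inf: "AE x in M. f x < top" and t: "0 < t"
  obtains z :: real where "0 \<le> z" "distr_fun M f (ennreal z) \<le> ennreal t"
proof -
  define A where "A k = {x \<in> space M. ennreal (max 0 y + real k) < f x}" for k
  have [measurable]: "A k \<in> sets M" for k unfolding A_def by measurable
  have "(\<lambda>k. emeasure M (A k)) \<longlonglongrightarrow> emeasure M (\<Inter>k. A k)"
  proof (rule Lim_emeasure_decseq)
    show "decseq A" unfolding A_def decseq_def
      by (auto simp del: ennreal_plus elim!: le_less_trans[rotated] intro!: ennreal_leI)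
    fix k
    have "emeasure M (A k) \<le> distr_fun M f (ennreal y)"
      unfolding distr_fun_def A_def
      by (intro emeasure_mono) (auto simp del: ennreal_plus elim!: le_less_trans[rotated] intro!: ennreal_leI)
    then show "emeasure M (A k) \<noteq> \<infinity>" using fin by auto
  qed auto
  moreover have "emeasure M (\<Inter>k. A k) = 0"
  proof -
    have "(\<Inter>k. A k) \<subseteq> {x \<in> space M. \<not> f x < top}"
    proof
      fix x assume x: "x \<in> (\<Inter>k. A k)"
      have "\<not> f x < top"
      proof
        assume "f x < top"
        then obtain r where r: "f x = ennreal r" "0 \<le> r" by (cases "f x") auto
        obtain k where "r < real k" using reals_Archimedean2 by blast
        then have "ennreal r \<le> ennreal (max 0 y + real k)" by (intro ennreal_leI) auto
        moreover have "x \<in> A k" using x by blast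
        ultimately show False using r by (auto simp: A_def)
      qed
      then show "x \<in> {x \<in> space M. \<not> f x < top}" using x by (auto simp: A_def)
    qed
    moreover have "{x \<in> space M. \<not> f x < top} \<in> null_sets M" using inf by (subst (asm) AE_iff_null) auto
    ultimately show ?thesis by (metis emeasure_eq_0 null_setsD1 null_setsD2)
  qed
  ultimately have "\<forall>\<^sub>F k in sequentially. emeasure M (A k) < ennreal t"
    using t by (intro order_tendstoD) auto
  then obtain k where "emeasure M (A k) < ennreal t" by (auto simp: eventually_sequentially)
  then show ?thesis using that[of "max 0 y + real k"] by (auto simp: A_def distr_fun_def)
qed

section \<open>Rearrangement invariant norms and the transfer to the half line\<close>

text \<open>Both sides of the representation, Euclidean space and the half line, are instances. The
  sets \<open>A\<close> witness sigma-finiteness explicitly.\<close>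

locale ri_space =
  fixes M :: "'a measure" and \<rho> :: "('a \<Rightarrow> ennreal) \<Rightarrow> ennreal" and A :: "nat \<Rightarrow> 'a set"
  assumes ri: "ri_norm M \<rho>"
    and exhaust: "\<And>k. A k \<in> sets M" "\<And>k. emeasure M (A k) < \<infinity>" "(\<Union>k. A k) = space M"
    and nontrivial: "emeasure M (space M) \<noteq> 0"
begin

lemma fn: "function_norm M \<rho>" using ri by (simp add: ri_norm_def)

lemma norm_mono_AE: "f \<in> borel_measurable M \<Longrightarrow> g \<in> borel_measurable M \<Longrightarrow> AE x in M. g x \<le> f x \<Longrightarrow> \<rho> g \<le> \<rho> f"
  using fn by (simp add: function_norm_def)

lemma norm_mono: "f \<in> borel_measurable M \<Longrightarrow> g \<in> borel_measurable M \<Longrightarrow> (\<And>x. x \<in> space M \<Longrightarrow> g x \<le> f x) \<Longrightarrow> \<rho> g \<le> \<rho> f"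
  by (intro norm_mono_AE) auto

lemma norm_cmult: "f \<in> borel_measurable M \<Longrightarrow> 0 \<le> a \<Longrightarrow> \<rho> (\<lambda>x. ennreal a * f x) = ennreal a * \<rho> f"
  using fn by (simp add: function_norm_def)

lemma norm_add: "f \<in> borel_measurable M \<Longrightarrow> g \<in> borel_measurable M \<Longrightarrow> \<rho> (\<lambda>x. f x + g x) \<le> \<rho> f + \<rho> g"
  using fn by (simp add: function_norm_def)

lemma norm_eq_0_iff: "f \<in> borel_measurable M \<Longrightarrow> \<rho> f = 0 \<longleftrightarrow> (AE x in M. f x = 0)"
  using fn by (simp add: function_norm_def)

lemma norm_indicator_finite: "E \<in> sets M \<Longrightarrow> emeasure M E < \<infinity> \<Longrightarrow> \<rho> (indicator E) < \<infinity>"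
  using fn by (simp add: function_norm_def)

lemma norm_indicator_pos: "E \<in> sets M \<Longrightarrow> 0 < emeasure M E \<Longrightarrow> 0 < \<rho> (indicator E)"
proof (rule ccontr)
  assume E: "E \<in> sets M" "0 < emeasure M E" "\<not> 0 < \<rho> (indicator E)"
  then have "AE x in M. (indicator E x :: ennreal) = 0" using norm_eq_0_iff[of "indicator E"] by auto
  then have "AE x in M. x \<notin> E" by (auto simp: indicator_def elim: eventually_mono)
  then show False using AE_iff_null_sets[OF E(1)] E(2) by auto
qed

text \<open>A finite norm forces integrability on each exhausting set and hence finiteness almost
  everywhere. This matters because the invariance axiom concerns almost everywhere finite functions,
  whereas rearrangements may a priori be infinite.\<close>

lemma norm_infinite:
  assumes [measurable]: "f \<in> borel_measurable M" and "\<not> (AE x in M. f x < \<infinity>)"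
  shows "\<rho> f = \<infinity>"
proof (rule ccontr)
  assume fin: "\<rho> f \<noteq> \<infinity>"
  have "AE x in M. x \<in> A k \<longrightarrow> f x < \<infinity>" for k
  proof -
    have "\<exists>C>0::real. \<forall>f\<in>borel_measurable M. (\<integral>\<^sup>+x\<in>A k. f x \<partial>M) \<le> ennreal C * \<rho> f"
      using fn exhaust(1,2)[of k] by (simp add: function_norm_def)
    then obtain C :: real where C: "\<forall>f\<in>borel_measurable M. (\<integral>\<^sup>+x\<in>A k. f x \<partial>M) \<le> ennreal C * \<rho> f" by blast
    have [measurable]: "A k \<in> sets M" by (rule exhaust)
    have "(\<integral>\<^sup>+x\<in>A k. f x \<partial>M) \<le> ennreal C * \<rho> f" using C assms(1) by blast
    also have "\<dots> < \<infinity>" using fin by (simp add: ennreal_mult_less_top less_top)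
    finally have "(\<integral>\<^sup>+x\<in>A k. f x \<partial>M) \<noteq> \<infinity>" by simp
    then have "AE x in M. f x * indicator (A k) x \<noteq> \<infinity>" by (intro nn_integral_PInf_AE) auto
    then show ?thesis by eventually_elim (auto simp: less_top[symmetric])
  qed
  then have "AE x in M. \<forall>k. x \<in> A k \<longrightarrow> f x < \<infinity>" unfolding AE_all_countable by blast
  then have "AE x in M. f x < \<infinity>"
    using AE_space[of M]
  proof eventually_elim
    case (elim x)
    then show ?case using exhaust(3) by blast
  qed
  with assms(2) show False by simp
qed

lemma exists_finite_positive_set: obtains Q where "Q \<in> sets M" "0 < emeasure M Q" "emeasure M Q < \<infinity>"
proof -
  have "\<exists>k. emeasure M (A k) \<noteq> 0"
  proof (rule ccontr)
    assume "\<not> ?thesis"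
    then have "emeasure M (\<Union>k. A k) = 0" using exhaust(1) by (intro emeasure_UN_eq_0) auto
    then show False using nontrivial exhaust(3) by simp
  qed
  then obtain k where "emeasure M (A k) \<noteq> 0" by blast
  then show ?thesis using that[of "A k"] exhaust(1,2)[of k] by (simp add: zero_less_iff_neq_zero)
qed

text \<open>Raising \<open>f\<close> to \<open>N\<close> on a set of finite measure does not change a distribution function that
  is infinite everywhere.\<close>

lemma norm_infinite_distr:
  assumes f [measurable]: "f \<in> borel_measurable M" and "\<And>y::real. 0 \<le> y \<Longrightarrow> distr_fun M f (ennreal y) = \<infinity>"
  shows "\<rho> f = \<infinity>"
proof (cases "AE x in M. f x < \<infinity>")
  case False
  then show ?thesis by (rule norm_infinite[OF f])
next
  case True
  obtain Q where Q [measurable]: "Q \<in> sets M" and Qm: "0 < emeasure M Q" "emeasure M Q < \<infinity>" by (rule exists_finite_positive_set)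
  have "of_nat N \<le> \<rho> f / \<rho> (indicator Q)" for N
  proof -
    define g where "g x = max (f x) (of_nat N * indicator Q x)" for x
    have g [measurable]: "g \<in> borel_measurable M" unfolding g_def by measurable
    have "AE x in M. g x < \<infinity>" using True
      by eventually_elim (auto simp: g_def max_def indicator_def less_top[symmetric])
    moreover have "distr_fun M f (ennreal y) = distr_fun M g (ennreal y)" if "0 \<le> y" for y
    proof -
      have "distr_fun M f (ennreal y) \<le> distr_fun M g (ennreal y)"
        unfolding distr_fun_def g_def by (intro emeasure_mono) (auto simp: less_max_iff_disj)
      then show ?thesis using assms(2)[OF that] by (simp add: top_unique)
    qed
    ultimately have "\<rho> f = \<rho> g"
      using ri True unfolding ri_norm_def ae_finite_measurable_def by auto
    moreover have "\<rho> (\<lambda>x. ennreal (real N) * indicator Q x) \<le> \<rho> g"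
      by (intro norm_mono) (auto simp: g_def ennreal_of_nat_eq_real_of_nat)
    ultimately have "of_nat N * \<rho> (indicator Q) \<le> \<rho> f"
      by (simp add: norm_cmult ennreal_of_nat_eq_real_of_nat)
    then have "of_nat N * \<rho> (indicator Q) / \<rho> (indicator Q) \<le> \<rho> f / \<rho> (indicator Q)"
      by (rule divide_right_mono_ennreal)
    then show ?thesis
      using norm_indicator_pos[OF Q Qm(1)] norm_indicator_finite[OF Q Qm(2)]
      by (subst (asm) ennreal_mult_divide_eq) auto
  qed
  then have "\<rho> f / \<rho> (indicator Q) = top" by (rule ennreal_ge_nat_imp_top)
  then show ?thesis using norm_indicator_pos[OF Q Qm(1)] by (auto simp: ennreal_divide_eq_top_iff)
qed

lemma distr_infinite_or:
  assumes "f \<in> borel_measurable M" "\<rho> f < \<infinity>"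
  obtains y :: real where "0 \<le> y" "distr_fun M f (ennreal y) < \<infinity>"
proof -
  have "\<exists>y\<ge>0. distr_fun M f (ennreal y) \<noteq> \<infinity>"
    using norm_infinite_distr[OF assms(1)] assms(2) by (metis less_irrefl)
  then show ?thesis using that by (auto simp: less_top)
qed

end

lemma ri_space_lebesgue: "ri_norm lebesgue \<rho> \<Longrightarrow> ri_space lebesgue \<rho> (\<lambda>k. cball (0 :: 'a :: euclidean_space) (real k))"
proof
  show "emeasure lebesgue (cball (0 :: 'a) (real k)) < \<infinity>" for k
    using emeasure_lborel_cball_finite[of "0::'a" "real k"] by (simp add: emeasure_completion)
  show "(\<Union>k. cball (0 :: 'a) (real k)) = space lebesgue"
    using real_arch_simple by (auto simp: dist_norm)
  show "emeasure lebesgue (space lebesgue :: 'a set) \<noteq> 0" by (simp add: emeasure_completion)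
qed auto

lemma ri_space_halfline: "ri_norm halfline \<sigma> \<Longrightarrow> ri_space halfline \<sigma> (\<lambda>k. {0<..<real k})"
proof
  show "{0<..<real k} \<in> sets halfline" for k by (auto simp: sets_halfline)
  show "emeasure halfline {0<..<real k} < \<infinity>" for k by (subst emeasure_halfline) (auto simp: emeasure_completion)
  show "(\<Union>k. {0<..<real k}) = space halfline"
    using reals_Archimedean2 by auto
  have "emeasure lebesgue {0<..<1::real} \<le> emeasure halfline (space halfline)"
    by (simp add: emeasure_halfline) (intro emeasure_mono, auto)
  then show "emeasure halfline (space halfline) \<noteq> 0" by (auto simp: emeasure_completion)
qed auto

lemma rearr_finite:
  assumes "f \<in> borel_measurable M" "distr_fun M f (ennreal y) < top" "AE x in M. f x < top" "0 < t"
  shows "rearr M f t < top"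
proof -
  obtain z where z: "0 \<le> z" "distr_fun M f (ennreal z) \<le> ennreal t"
    using distr_fun_tendsto_infinity_set[OF assms] by blast
  then have "rearr M f t \<le> ennreal z" unfolding rearr_def by (intro Inf_lower) auto
  then show ?thesis by (rule le_less_trans) simp
qed

text \<open>A measure preserving map onto the half line, invariant under \<open>x \<mapsto> - x\<close>.\<close>

definition radial :: "real ^ 'n \<Rightarrow> real"
  where "radial x = measure lborel (ball (0 :: real ^ 'n) 1) * norm x ^ CARD('n)"

lemma unit_ball_measure_pos: "0 < measure lborel (ball (0 :: real ^ 'n) 1)"
  by (simp add: content_ball_pos)

lemma radial_uminus [simp]: "radial (- x) = radial x"
  by (simp add: radial_def)

lemma radial_nonneg: "0 \<le> radial x"
  by (simp add: radial_def)

lemma radial_pos_iff: "0 < radial x \<longleftrightarrow> x \<noteq> 0"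
  using unit_ball_measure_pos[where 'n = 'a] by (auto simp: radial_def zero_less_mult_iff zero_power)

lemma borel_measurable_radial [measurable]: "radial \<in> borel_measurable borel"
  unfolding radial_def by measurable

lemma emeasure_radial_le: "emeasure lborel {x :: real ^ 'n. radial x \<le> s} = ennreal s"
proof (cases "0 \<le> s")
  case False
  then have "{x :: real ^ 'n. radial x \<le> s} = {}" using radial_nonneg[where 'a = 'n] by (auto simp: not_le intro: less_le_trans)
  then show ?thesis using False by (simp add: ennreal_neg)
next
  case True
  define v where "v = measure lborel (ball (0 :: real ^ 'n) 1)"
  define r where "r = root CARD('n) (s / v)"
  have v: "0 < v" unfolding v_def by (rule unit_ball_measure_pos)
  have r: "0 \<le> r" "r ^ CARD('n) = s / v" using True v by (auto simp: r_def)
  have "radial x \<le> s \<longleftrightarrow> norm x \<le> r" for x :: "real ^ 'n"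
  proof -
    have "radial x \<le> s \<longleftrightarrow> norm x ^ CARD('n) \<le> r ^ CARD('n)"
      using v by (simp add: radial_def v_def[symmetric] r(2) field_simps)
    also have "\<dots> \<longleftrightarrow> norm x \<le> r" using r(1) by (simp add: power_mono_iff)
    finally show ?thesis .
  qed
  then have "{x :: real ^ 'n. radial x \<le> s} = cball 0 r" by (simp only:) (simp add: cball_def)
  moreover have "emeasure lborel (cball (0 :: real ^ 'n) r) = ennreal s"
  proof -
    have "cball (0 :: real ^ 'n) r = ball 0 r \<union> sphere 0 r" by auto
    moreover have "sphere (0 :: real ^ 'n) r \<in> null_sets lebesgue"
      using negligible_sphere[of "0 :: real ^ 'n" r] by (simp add: negligible_iff_null_sets)
    ultimately have "emeasure lebesgue (cball (0 :: real ^ 'n) r) = emeasure lebesgue (ball (0 :: real ^ 'n) r)"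
      by (metis emeasure_Un_null_set lmeasurable_ball fmeasurableD)
    also have "\<dots> = ennreal (r ^ CARD('n)) * emeasure lebesgue (ball (0 :: real ^ 'n) 1)"
      using emeasure_lebesgue_ball_conv_unit_ball[OF r(1), of "0 :: real ^ 'n"] by simp
    also have "emeasure lebesgue (ball (0 :: real ^ 'n) 1) = ennreal v"
      using emeasure_lborel_ball_finite[of "0 :: real ^ 'n" 1] unfolding v_def
      by (subst emeasure_eq_ennreal_measure[symmetric]) (auto simp: emeasure_completion)
    also have "ennreal (r ^ CARD('n)) * ennreal v = ennreal s" using r v True by (simp add: ennreal_mult[symmetric])
    finally show ?thesis by (simp add: emeasure_completion)
  qed
  ultimately show ?thesis by simp
qed

lemma distr_lborel_radial:
  "distr (lborel :: (real ^ 'n) measure) borel radial = density lborel (indicator {0<..})"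
proof -
  let ?N = "distr (lborel :: (real ^ 'n) measure) borel radial" and ?D = "density lborel (indicator {0<..}) :: real measure"
  show ?thesis
  proof (rule measure_eqI_generator_eq[where E = "range (\<lambda>(a, b). {a<..b :: real})" and \<Omega> = UNIV and A = "\<lambda>k. {- real k <.. real k}"])
    show "Int_stable (range (\<lambda>(a, b). {a<..b :: real}))"
    proof (rule Int_stableI)
      fix X Y assume "X \<in> range (\<lambda>(a, b). {a<..b :: real})" "Y \<in> range (\<lambda>(a, b). {a<..b :: real})"
      then obtain a b c d where "X = {a<..b}" "Y = {c<..d}" by auto
      then have "X \<inter> Y = (\<lambda>(a, b). {a<..b}) (max a c, min b d)" by auto
      then show "X \<inter> Y \<in> range (\<lambda>(a, b). {a<..b :: real})" by blast
    qed
    fix X assume "X \<in> range (\<lambda>(a, b). {a<..b :: real})"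
    then obtain a b where X: "X = {a<..b}" by auto
    show "emeasure ?N X = emeasure ?D X"
    proof (cases "a < b")
      case True
      have "radial -` X = {x :: real ^ 'n. radial x \<le> b} - {x. radial x \<le> a}" using X by auto
      then have "emeasure ?N X = emeasure lborel ({x :: real ^ 'n. radial x \<le> b} - {x. radial x \<le> a})"
        using X by (simp add: emeasure_distr)
      also have "\<dots> = ennreal b - ennreal a"
        using True by (subst emeasure_Diff) (auto simp: emeasure_radial_le)
      also have "\<dots> = emeasure lborel ({0<..} \<inter> X)"
      proof (cases "0 \<le> a")
        case True
        then have "{0<..} \<inter> X = {a<..b}" using X by auto
        then show ?thesis using True \<open>a < b\<close> by (simp add: ennreal_minus)
      next
        case False
        then have "{0<..} \<inter> X = {0<..b}" using X by auto
        then show ?thesis using False by (cases "0 \<le> b") (auto simp: ennreal_neg)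
      qed
      also have "\<dots> = emeasure ?D X"
        using X by (simp add: emeasure_density indicator_inter_arith[symmetric])
      finally show ?thesis .
    qed (simp add: X)
  next
    show "sets ?N = sigma_sets UNIV (range (\<lambda>(a, b). {a<..b :: real}))"
      "sets ?D = sigma_sets UNIV (range (\<lambda>(a, b). {a<..b :: real}))"
      by (simp_all add: borel_sigma_sets_Ioc)
    show "(\<Union>k. {- real k<..real k}) = UNIV"
    proof safe
      fix x :: real
      obtain k where "\<bar>x\<bar> < real k" using reals_Archimedean2 by blast
      then show "x \<in> (\<Union>k. {- real k<..real k})" by (auto intro!: exI[of _ k])
    qed simp
    show "emeasure ?N {- real k<..real k} \<noteq> \<infinity>" for k
    proof -
      have "emeasure ?N {- real k<..real k} \<le> emeasure lborel {x :: real ^ 'n. radial x \<le> real k}"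
        by (subst emeasure_distr) (auto intro!: emeasure_mono)
      then show ?thesis by (auto simp: emeasure_radial_le top_unique)
    qed
  qed auto
qed

lemma emeasure_radial_vimage_borel:
  assumes "A \<in> sets borel"
  shows "emeasure lborel {x :: real ^ 'n. radial x \<in> A} = emeasure lborel (A \<inter> {0<..})"
proof -
  have "emeasure lborel {x :: real ^ 'n. radial x \<in> A} = emeasure (distr (lborel :: (real ^ 'n) measure) borel radial) A"
    using assms by (subst emeasure_distr) (auto simp: vimage_def)
  also have "\<dots> = emeasure lborel (A \<inter> {0<..})"
    unfolding distr_lborel_radial using assms by (simp add: emeasure_density indicator_inter_arith[symmetric] Int_commute)
  finally show ?thesis .
qed

text \<open>With completed measures on both sides Borel measurability does not suffice; preimages of
  null sets must be null, which measure preservation provides.\<close>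

lemma measurable_radial_lebesgue [measurable]: "(radial :: real ^ 'n \<Rightarrow> real) \<in> lebesgue \<rightarrow>\<^sub>M lebesgue"
proof (rule completion.measurable_completion2)
  show "radial \<in> (lebesgue :: (real ^ 'n) measure) \<rightarrow>\<^sub>M lborel"
    using borel_measurable_radial by (simp add: measurable_completion)
  show "null_sets lborel \<subseteq> null_sets (distr (lebesgue :: (real ^ 'n) measure) lborel radial)"
  proof
    fix A :: "real set" assume A: "A \<in> null_sets lborel"
    then have "emeasure lborel {x :: real ^ 'n. radial x \<in> A} = 0"
      using emeasure_radial_vimage_borel[of A, where 'n = 'n] null_sets.Int[of A lborel] by (auto simp: null_sets_def intro!: emeasure_eq_0[of A])
    then have "emeasure (distr (lebesgue :: (real ^ 'n) measure) lborel radial) A = 0"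
      using A by (subst emeasure_distr) (auto simp: vimage_def emeasure_completion measurable_completion)
    then show "A \<in> null_sets (distr (lebesgue :: (real ^ 'n) measure) lborel radial)"
      using A by (auto simp: null_sets_def)
  qed
qed

lemma emeasure_radial_vimage:
  assumes "A \<in> sets lebesgue" "A \<subseteq> {0<..}"
  shows "emeasure lebesgue {x :: real ^ 'n. radial x \<in> A} = emeasure lebesgue A"
proof -
  obtain B N N' where B: "A = B \<union> N" "N \<subseteq> N'" "N' \<in> null_sets lborel" "B \<in> sets lborel"
    using assms(1) by (auto elim: sets_completionE)
  have null: "{x :: real ^ 'n. radial x \<in> N} \<in> null_sets lebesgue"
  proof -
    have "emeasure lborel {x :: real ^ 'n. radial x \<in> N'} = 0"
      using emeasure_radial_vimage_borel[of N', where 'n = 'n] B(3) by (auto simp: null_sets_def intro!: emeasure_eq_0[of N'])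
    moreover have "{x :: real ^ 'n. radial x \<in> N'} \<in> sets borel"
      using measurable_sets[OF borel_measurable_radial, of N'] B(3) by (auto simp: null_sets_def vimage_def)
    ultimately have "{x :: real ^ 'n. radial x \<in> N'} \<in> null_sets lebesgue" by (auto simp: null_sets_def emeasure_completion)
    moreover have "{x :: real ^ 'n. radial x \<in> N} \<subseteq> {x. radial x \<in> N'}" using B by auto
    ultimately show ?thesis by (metis negligible_iff_null_sets negligible_subset)
  qed
  have Bm: "{x :: real ^ 'n. radial x \<in> B} \<in> sets borel"
    using measurable_sets[OF borel_measurable_radial, of B] B(4) by (auto simp: vimage_def)
  have "{x :: real ^ 'n. radial x \<in> A} = {x. radial x \<in> B} \<union> {x. radial x \<in> N}" using B(1) by auto
  then have "emeasure lebesgue {x :: real ^ 'n. radial x \<in> A} = emeasure lebesgue {x :: real ^ 'n. radial x \<in> B}"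
    using null Bm by (simp add: emeasure_Un_null_set)
  also have "\<dots> = emeasure lborel (B \<inter> {0<..})"
    using B Bm emeasure_radial_vimage_borel[of B, where 'n = 'n] by (simp add: emeasure_completion)
  also have "B \<inter> {0<..} = B" using assms(2) B(1) by auto
  also have "emeasure lborel B = emeasure lebesgue (B \<union> N)"
  proof -
    have "N \<in> null_sets lebesgue" using B(2,3) null_sets_completionI negligible_subset unfolding negligible_iff_null_sets[symmetric]
      by (metis negligible_iff_null_sets)
    then show ?thesis using B(4) by (simp add: emeasure_Un_null_set emeasure_completion)
  qed
  finally show ?thesis using B(1) by simp
qed

text \<open>The indicator discards the origin, where the argument would leave the open half line and
  h may take arbitrary values.\<close>

definition lift_radial :: "(real \<Rightarrow> ennreal) \<Rightarrow> real ^ 'n \<Rightarrow> ennreal"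
  where "lift_radial h x = h (radial x) * indicator {0<..} (radial x)"

lemma measurable_lift_radial [measurable]:
  assumes "h \<in> borel_measurable halfline"
  shows "(lift_radial h :: real ^ 'n \<Rightarrow> ennreal) \<in> borel_measurable lebesgue"
proof -
  have "(\<lambda>s. h s * indicator {0<..} s) \<in> borel_measurable lebesgue"
    using assms by (subst (asm) borel_measurable_restrict_space_iff_ennreal) auto
  from measurable_compose[OF measurable_radial_lebesgue this] show ?thesis
    unfolding lift_radial_def[abs_def] .
qed

lemma emeasure_radial_vimage_halfline:
  "B \<in> sets halfline \<Longrightarrow> emeasure lebesgue {x :: real ^ 'n. radial x \<in> B} = emeasure halfline B"
  by (simp add: sets_halfline emeasure_radial_vimage emeasure_halfline)

lemma sets_radial_vimage: "B \<in> sets lebesgue \<Longrightarrow> {x :: real ^ 'n. radial x \<in> B} \<in> sets lebesgue"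
  using measurable_sets[OF measurable_radial_lebesgue, of B] by (simp add: vimage_def)

lemma distr_fun_lift_radial:
  assumes [measurable]: "h \<in> borel_measurable halfline"
  shows "distr_fun lebesgue (lift_radial h :: real ^ 'n \<Rightarrow> ennreal) y = distr_fun halfline h y"
proof -
  have "{s \<in> space halfline. y < h s} \<in> sets halfline" by measurable
  then have "distr_fun halfline h y = emeasure lebesgue {x :: real ^ 'n. radial x \<in> {s \<in> space halfline. y < h s}}"
    unfolding distr_fun_def by (rule emeasure_radial_vimage_halfline[symmetric])
  also have "{x :: real ^ 'n. radial x \<in> {s \<in> space halfline. y < h s}} = {x \<in> space lebesgue. y < lift_radial h x}"
    by (auto simp: lift_radial_def indicator_def)
  finally show ?thesis by (simp add: distr_fun_def)
qed

lemma AE_lift_radial: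
  assumes "AE s in halfline. P s"
  shows "AE x in (lebesgue :: (real ^ 'n) measure). 0 < radial x \<longrightarrow> P (radial x)"
proof -
  obtain N where N: "{s \<in> space halfline. \<not> P s} \<subseteq> N" "emeasure halfline N = 0" "N \<in> sets halfline"
    using assms by (rule AE_E)
  have "{x :: real ^ 'n. radial x \<in> N} \<in> null_sets lebesgue"
    using N emeasure_radial_vimage_halfline[OF N(3), where 'n = 'n] sets_radial_vimage[of N, where 'n = 'n] by (auto simp: null_sets_def sets_halfline)
  then have "AE x in lebesgue. x \<notin> {x :: real ^ 'n. radial x \<in> N}" by (rule AE_not_in)
  then show ?thesis by eventually_elim (use N(1) in auto)
qed

lemma distr_lebesgue_radial:
  "distr (lebesgue :: (real ^ 'n) measure) lebesgue radial = density lebesgue (indicator {0<..})"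
proof (rule measure_eqI)
  fix A assume "A \<in> sets (distr (lebesgue :: (real ^ 'n) measure) lebesgue radial)"
  then have A [measurable]: "A \<in> sets lebesgue" by simp
  have "emeasure (distr (lebesgue :: (real ^ 'n) measure) lebesgue radial) A = emeasure lebesgue {x :: real ^ 'n. radial x \<in> A}"
    by (simp add: emeasure_distr vimage_def)
  also have "\<dots> = emeasure lebesgue {x :: real ^ 'n. radial x \<in> A \<inter> {0<..}}"
  proof (rule emeasure_eq_AE)
    have "AE x in lebesgue. x \<noteq> (0 :: real ^ 'n)"
      using AE_not_in[of "{0}" "lebesgue :: (real ^ 'n) measure"] negligible_sing[of "0 :: real ^ 'n"]
      by (simp add: negligible_iff_null_sets)
    then show "AE x in lebesgue. (x :: real ^ 'n) \<in> {x. radial x \<in> A} \<longleftrightarrow> x \<in> {x. radial x \<in> A \<inter> {0<..}}"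
      by eventually_elim (auto simp: radial_pos_iff)
    show "{x :: real ^ 'n. radial x \<in> A} \<in> sets lebesgue" by (rule sets_radial_vimage[OF A])
    show "{x :: real ^ 'n. radial x \<in> A \<inter> {0<..}} \<in> sets lebesgue" by (intro sets_radial_vimage sets.Int A) simp
  qed
  also have "\<dots> = emeasure lebesgue (A \<inter> {0<..})" by (rule emeasure_radial_vimage) auto
  also have "\<dots> = (\<integral>\<^sup>+x. indicator (A \<inter> {0<..}) x \<partial>lebesgue)"
    by (intro nn_integral_indicator[symmetric] sets.Int A) simp
  also have "\<dots> = emeasure (density lebesgue (indicator {0<..})) A"
  proof (subst emeasure_density)
    show "indicator {0::real<..} \<in> borel_measurable lebesgue" by (rule borel_measurable_indicator) simp
    show "(\<integral>\<^sup>+x. indicator (A \<inter> {0<..}) x \<partial>lebesgue) = (\<integral>\<^sup>+x. indicator {0<..} x * indicator A x \<partial>lebesgue)"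
      by (intro nn_integral_cong) (auto simp: indicator_def)
  qed (rule A)
  finally show "emeasure (distr (lebesgue :: (real ^ 'n) measure) lebesgue radial) A = emeasure (density lebesgue (indicator {0<..})) A" .
qed simp

lemma nn_integral_lift_radial:
  assumes "h \<in> borel_measurable halfline"
  shows "(\<integral>\<^sup>+x. lift_radial h (x :: real ^ 'n) \<partial>lebesgue) = (\<integral>\<^sup>+s. h s \<partial>halfline)"
proof -
  have [measurable]: "(\<lambda>s. h s * indicator {0<..} s) \<in> borel_measurable lebesgue"
    using assms by (subst (asm) borel_measurable_restrict_space_iff_ennreal) auto
  have [measurable]: "{0::real<..} \<in> sets lebesgue" by simp
  have "(\<integral>\<^sup>+x. lift_radial h (x :: real ^ 'n) \<partial>lebesgue) = (\<integral>\<^sup>+s. h s * indicator {0<..} s \<partial>distr (lebesgue :: (real ^ 'n) measure) lebesgue radial)"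
    by (subst nn_integral_distr) (auto simp: lift_radial_def[abs_def])
  also have "\<dots> = (\<integral>\<^sup>+s. indicator {0<..} s * (h s * indicator {0<..} s) \<partial>lebesgue)"
    unfolding distr_lebesgue_radial by (subst nn_integral_density) auto
  also have "\<dots> = (\<integral>\<^sup>+s. h s * indicator {0<..} s \<partial>lebesgue)"
    by (intro nn_integral_cong) (auto simp: indicator_def)
  also have "\<dots> = (\<integral>\<^sup>+s. h s \<partial>halfline)" by (simp add: nn_integral_restrict_space)
  finally show ?thesis .
qed

lemma lift_radial_eq_0: "\<not> 0 < radial x \<Longrightarrow> lift_radial h x = 0"
  and lift_radial_eq: "0 < radial x \<Longrightarrow> lift_radial h x = h (radial x)"
  by (auto simp: lift_radial_def)

lemma lift_radial_ae_finite:
  assumes "h \<in> ae_finite_measurable halfline"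
  shows "(lift_radial h :: real ^ 'n \<Rightarrow> ennreal) \<in> ae_finite_measurable lebesgue"
proof -
  have h: "h \<in> borel_measurable halfline" "AE s in halfline. h s < \<infinity>"
    using assms by (simp_all add: ae_finite_measurable_def)
  from AE_lift_radial[OF h(2), where 'n = 'n]
  have "AE x in lebesgue. lift_radial h (x :: real ^ 'n) < \<infinity>"
  proof eventually_elim
    case (elim x)
    then show ?case by (cases "0 < radial x") (simp_all add: lift_radial_eq lift_radial_eq_0)
  qed
  then show ?thesis using measurable_lift_radial[OF h(1)] by (simp add: ae_finite_measurable_def)
qed

lemma (in ri_space) norm_monotone_convergence:
  assumes "\<And>k::nat. F k \<in> borel_measurable M" "f \<in> borel_measurable M"
    "AE x in M. incseq (\<lambda>k. F k x) \<and> (\<lambda>k. F k x) \<longlonglongrightarrow> f x"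
  shows "incseq (\<lambda>k. \<rho> (F k)) \<and> (\<lambda>k. \<rho> (F k)) \<longlonglongrightarrow> \<rho> f"
proof -
  have "\<forall>F f. (\<forall>k::nat. F k \<in> borel_measurable M) \<longrightarrow> f \<in> borel_measurable M \<longrightarrow>
       (AE x in M. incseq (\<lambda>k. F k x) \<and> (\<lambda>k. F k x) \<longlonglongrightarrow> f x) \<longrightarrow>
       incseq (\<lambda>k. \<rho> (F k)) \<and> (\<lambda>k. \<rho> (F k)) \<longlonglongrightarrow> \<rho> f"
    using fn unfolding function_norm_def by (elim conjE)
  from this[rule_format, OF assms] show ?thesis .
qed

text \<open>The half line carries a norm pulled back along \<open>radial\<close>: this map preserves
  measure, so each axiom on the half line becomes the same axiom on Euclidean space.\<close>

lemma ri_norm_lift_radial: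
  assumes ri: "ri_norm (lebesgue :: (real ^ 'n) measure) \<rho>"
  shows "ri_norm halfline (\<lambda>h. \<rho> (lift_radial h))"
proof -
  interpret ri_space lebesgue \<rho> "\<lambda>k. cball (0 :: real ^ 'n) (real k)" by (rule ri_space_lebesgue[OF ri])
  let ?L = "lift_radial :: (real \<Rightarrow> ennreal) \<Rightarrow> real ^ 'n \<Rightarrow> ennreal"
  have p1: "\<rho> (?L f) = 0 \<longleftrightarrow> (AE x in halfline. f x = 0)" if [measurable]: "f \<in> borel_measurable halfline" for f
  proof -
    have p1: "\<rho> (?L f) = 0 \<longleftrightarrow> (AE x in lebesgue. ?L f x = 0)" by (rule norm_eq_0_iff) measurable
    also have "\<dots> \<longleftrightarrow> (\<integral>\<^sup>+x. ?L f x \<partial>lebesgue) = 0" by (subst nn_integral_0_iff_AE) auto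
    also have "\<dots> \<longleftrightarrow> (\<integral>\<^sup>+s. f s \<partial>halfline) = 0" by (simp add: nn_integral_lift_radial)
    also have "\<dots> \<longleftrightarrow> (AE x in halfline. f x = 0)" by (subst nn_integral_0_iff_AE) auto
    finally show ?thesis .
  qed
  have p2: "\<rho> (?L (\<lambda>x. ennreal a * f x)) = ennreal a * \<rho> (?L f)" if "f \<in> borel_measurable halfline" "0 \<le> a" for f a
  proof -
    have "?L (\<lambda>x. ennreal a * f x) = (\<lambda>x. ennreal a * ?L f x)" by (simp add: lift_radial_def mult.assoc fun_eq_iff)
    then show ?thesis using that by (simp add: norm_cmult measurable_lift_radial)
  qed
  have p3: "\<rho> (?L (\<lambda>x. f x + g x)) \<le> \<rho> (?L f) + \<rho> (?L g)" if "f \<in> borel_measurable halfline" "g \<in> borel_measurable halfline" for f g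
  proof -
    have "?L (\<lambda>x. f x + g x) = (\<lambda>x. ?L f x + ?L g x)" by (simp add: lift_radial_def distrib_right fun_eq_iff)
    then show ?thesis using that by (simp add: norm_add measurable_lift_radial)
  qed
  have p4: "\<rho> (?L g) \<le> \<rho> (?L f)" if "f \<in> borel_measurable halfline" "g \<in> borel_measurable halfline" "AE x in halfline. g x \<le> f x" for f g
    using AE_lift_radial[OF that(3), where 'n = 'n] that(1,2)
    by (intro norm_mono_AE measurable_lift_radial) (auto elim!: eventually_mono simp: lift_radial_def indicator_def)
  have p5: "incseq (\<lambda>k. \<rho> (?L (F k))) \<and> (\<lambda>k. \<rho> (?L (F k))) \<longlonglongrightarrow> \<rho> (?L f)"
    if "\<forall>k::nat. F k \<in> borel_measurable halfline" "f \<in> borel_measurable halfline"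
      "AE x in halfline. incseq (\<lambda>k. F k x) \<and> (\<lambda>k. F k x) \<longlonglongrightarrow> f x" for F f
  proof -
    have "AE x in lebesgue. incseq (\<lambda>k. ?L (F k) x) \<and> (\<lambda>k. ?L (F k) x) \<longlonglongrightarrow> ?L f x"
      using AE_lift_radial[OF that(3), where 'n = 'n]
    proof eventually_elim
      case (elim x)
      then show ?case by (cases "0 < radial x") (simp_all add: lift_radial_eq lift_radial_eq_0)
    qed
    then show ?thesis using that(1,2)
      by (intro norm_monotone_convergence measurable_lift_radial) auto
  qed
  have ind: "?L (indicator E) = indicator {x. radial x \<in> E}" "{x :: real ^ 'n. radial x \<in> E} \<in> sets lebesgue"
    "emeasure lebesgue {x :: real ^ 'n. radial x \<in> E} = emeasure halfline E" if "E \<in> sets halfline" for E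
    using that sets_radial_vimage[of E, where 'n = 'n] emeasure_radial_vimage_halfline[OF that, where 'n = 'n]
    by (auto simp: lift_radial_def indicator_def fun_eq_iff sets_halfline)
  have p6: "\<rho> (?L (indicator E)) < \<infinity>" if "E \<in> sets halfline" "emeasure halfline E < \<infinity>" for E
    unfolding ind(1)[OF that(1)] using ind(2,3)[OF that(1)] that(2) by (intro norm_indicator_finite) auto
  have p7: "\<exists>C>0::real. \<forall>f\<in>borel_measurable halfline. (\<integral>\<^sup>+x\<in>E. f x \<partial>halfline) \<le> ennreal C * \<rho> (?L f)"
    if "E \<in> sets halfline" "emeasure halfline E < \<infinity>" for E
  proof -
    note [measurable] = that(1)
    have "\<exists>C>0::real. \<forall>f\<in>borel_measurable lebesgue. (\<integral>\<^sup>+x\<in>{x. radial x \<in> E}. f x \<partial>lebesgue) \<le> ennreal C * \<rho> f"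
      using fn ind(2,3)[OF that(1)] that(2) by (simp add: function_norm_def)
    then obtain C :: real where C: "0 < C" "\<forall>f\<in>borel_measurable lebesgue. (\<integral>\<^sup>+x\<in>{x. radial x \<in> E}. f x \<partial>lebesgue) \<le> ennreal C * \<rho> f" by blast
    have "(\<integral>\<^sup>+x\<in>E. f x \<partial>halfline) \<le> ennreal C * \<rho> (?L f)" if [measurable]: "f \<in> borel_measurable halfline" for f
    proof -
      have "(\<integral>\<^sup>+x\<in>E. f x \<partial>halfline) = (\<integral>\<^sup>+x. ?L (\<lambda>s. f s * indicator E s) x \<partial>lebesgue)"
        by (rule nn_integral_lift_radial[symmetric]) measurable
      also have "\<dots> = (\<integral>\<^sup>+x\<in>{x. radial x \<in> E}. ?L f x \<partial>lebesgue)"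
        by (intro nn_integral_cong) (auto simp: lift_radial_def indicator_def)
      also have "\<dots> \<le> ennreal C * \<rho> (?L f)" using C(2) by simp
      finally show ?thesis .
    qed
    then show ?thesis using C(1) by blast
  qed
  have fnL: "function_norm halfline (\<lambda>h. \<rho> (?L h))"
    unfolding function_norm_def
    by (intro conjI ballI allI impI) (rule p1 p2 p3 p4 p5[THEN conjunct1] p5[THEN conjunct2] p6 p7; assumption)+
  have "\<rho> (?L f) = \<rho> (?L g)" if "f \<in> ae_finite_measurable halfline" "g \<in> ae_finite_measurable halfline"
    "\<forall>y::real. y \<ge> 0 \<longrightarrow> distr_fun halfline f (ennreal y) = distr_fun halfline g (ennreal y)" for f g
  proof -
    have fg: "f \<in> borel_measurable halfline" "g \<in> borel_measurable halfline" using that(1,2) by (auto simp: ae_finite_measurable_def)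
    have "\<forall>y::real. y \<ge> 0 \<longrightarrow> distr_fun lebesgue (?L f) (ennreal y) = distr_fun lebesgue (?L g) (ennreal y)"
      using that(3) fg by (simp add: distr_fun_lift_radial)
    then show ?thesis using ri lift_radial_ae_finite[OF that(1), where 'n = 'n] lift_radial_ae_finite[OF that(2), where 'n = 'n]
      unfolding ri_norm_def by blast
  qed
  with fnL show ?thesis unfolding ri_norm_def by blast
qed

context ri_space
begin

text \<open>Invariance holds without assuming f finite in advance: if f were infinite on a set of
  measure greater than t > 0, all its superlevel sets would be that large, while those of g, which
  is finite almost everywhere with some superlevel set of finite measure, eventually drop to
  t.\<close>

lemma norm_distr_cong_finite:
  assumes f [measurable]: "f \<in> borel_measurable M" and g [measurable]: "g \<in> borel_measurable M"
    and d: "\<And>y::real. 0 \<le> y \<Longrightarrow> distr_fun M f (ennreal y) = distr_fun M g (ennreal y)" and fin: "\<rho> g < \<infinity>"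
  shows "\<rho> f = \<rho> g"
proof -
  have gfin: "AE x in M. g x < \<infinity>" using norm_infinite[OF g] fin by (metis less_irrefl)
  obtain y :: real where y: "0 \<le> y" "distr_fun M g (ennreal y) < \<infinity>" by (rule distr_infinite_or[OF g fin])
  have "AE x in M. f x < \<infinity>"
  proof (rule ccontr)
    assume "\<not> ?thesis"
    then have "{x \<in> space M. \<not> f x < \<infinity>} \<notin> null_sets M" by (subst (asm) AE_iff_null) auto
    then have pos: "0 < emeasure M {x \<in> space M. \<not> f x < \<infinity>}" by (auto simp: null_sets_def zero_less_iff_neq_zero)
    obtain t :: real where t: "0 < t" "ennreal t < emeasure M {x \<in> space M. \<not> f x < \<infinity>}"
    proof -
      obtain r where r: "0 < ennreal (real_of_rat r)" "ennreal (real_of_rat r) < emeasure M {x \<in> space M. \<not> f x < \<infinity>}"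
        using ennreal_rat_dense[OF pos] by blast
      then have "0 < real_of_rat r" using ennreal_neg not_less by fastforce
      then show ?thesis using r that by blast
    qed
    obtain z :: real where z: "0 \<le> z" "distr_fun M g (ennreal z) \<le> ennreal t"
      using distr_fun_tendsto_infinity_set[OF g, of y t] y gfin t(1) by auto
    have "emeasure M {x \<in> space M. \<not> f x < \<infinity>} \<le> distr_fun M f (ennreal z)"
      unfolding distr_fun_def by (intro emeasure_mono) (auto simp: less_top[symmetric])
    then show False using d[OF z(1)] z(2) t(2) by order
  qed
  then show ?thesis using ri gfin d f g unfolding ri_norm_def ae_finite_measurable_def by auto
qed

lemma norm_distr_cong:
  assumes "f \<in> borel_measurable M" "g \<in> borel_measurable M"
    and "\<And>y::real. 0 \<le> y \<Longrightarrow> distr_fun M f (ennreal y) = distr_fun M g (ennreal y)"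
  shows "\<rho> f = \<rho> g"
proof -
  consider "\<rho> f = \<infinity>" "\<rho> g = \<infinity>" | "\<rho> g < \<infinity>" | "\<rho> f < \<infinity>"
    using less_top[of "\<rho> f"] less_top[of "\<rho> g"] by (metis infinity_ennreal_def)
  then show ?thesis
  proof cases
    case 2
    then show ?thesis using norm_distr_cong_finite[OF assms] by simp
  next
    case 3
    then show ?thesis using norm_distr_cong_finite[OF assms(2,1) assms(3)[symmetric]] by simp
  qed simp
qed

end

text \<open>The Luxemburg representation: composition with the map \<^const>\<open>radial\<close>.\<close>

theorem rep_norm_spec:
  assumes ri: "ri_norm (lebesgue :: (real ^ 'n) measure) \<rho>"
  shows "ri_norm halfline (rep_norm \<rho>)"
    "\<And>f. f \<in> ae_finite_measurable lebesgue \<Longrightarrow> \<rho> f = rep_norm \<rho> (rearr lebesgue f)"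
proof -
  interpret ri_space lebesgue \<rho> "\<lambda>k. cball (0 :: real ^ 'n) (real k)" by (rule ri_space_lebesgue[OF ri])
  have "\<rho> f = \<rho> (lift_radial (rearr lebesgue f))" if "f \<in> ae_finite_measurable lebesgue" for f
  proof (rule norm_distr_cong)
    show "f \<in> borel_measurable lebesgue" using that by (simp add: ae_finite_measurable_def)
    then show "lift_radial (rearr lebesgue f) \<in> borel_measurable lebesgue" by (intro measurable_lift_radial measurable_rearr)
    show "distr_fun lebesgue f (ennreal y) = distr_fun lebesgue (lift_radial (rearr lebesgue f) :: real ^ 'n \<Rightarrow> ennreal) (ennreal y)" for y
      using \<open>f \<in> borel_measurable lebesgue\<close> by (simp add: distr_fun_lift_radial distr_fun_rearr measurable_rearr)
  qed
  then have "\<exists>\<sigma>. ri_norm halfline \<sigma> \<and> (\<forall>f\<in>ae_finite_measurable lebesgue. \<rho> f = \<sigma> (rearr lebesgue f))"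
    using ri_norm_lift_radial[OF ri] by (intro exI[of _ "\<lambda>h. \<rho> (lift_radial h)"]) auto
  from someI_ex[OF this] show "ri_norm halfline (rep_norm \<rho>)"
    "\<And>f. f \<in> ae_finite_measurable lebesgue \<Longrightarrow> \<rho> f = rep_norm \<rho> (rearr lebesgue f)"
    unfolding rep_norm_def by auto
qed

section \<open>Dilations and the Boyd indices\<close>

lemma measurable_dilate [measurable]:
  fixes f :: "real \<Rightarrow> ennreal"
  assumes "f \<in> borel_measurable halfline" "0 < t"
  shows "(\<lambda>s. f (s / t)) \<in> borel_measurable halfline"
proof -
  have "(\<lambda>s. f s * indicator {0<..} s) \<in> borel_measurable lebesgue"
    using assms(1) by (subst (asm) borel_measurable_restrict_space_iff_ennreal) auto
  from measurable_compose[OF lebesgue_measurable_scaling[of "1 / t"] this]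
  have "(\<lambda>s. f (s / t) * indicator {0<..} s) \<in> borel_measurable lebesgue"
    using assms(2) by (simp add: indicator_def field_simps)
  then show ?thesis by (subst borel_measurable_restrict_space_iff_ennreal) auto
qed

lemma distr_fun_dilate:
  assumes [measurable]: "f \<in> borel_measurable halfline" and t: "0 < t"
  shows "distr_fun halfline (\<lambda>s. f (s / t)) y = ennreal t * distr_fun halfline f y"
proof -
  have *: "distr_fun halfline g y = (\<integral>\<^sup>+s. indicator {s. 0 < s \<and> y < g s} s \<partial>lebesgue)" "{s. 0 < s \<and> y < g s} \<in> sets lebesgue"
    if [measurable]: "g \<in> borel_measurable halfline" for g
  proof -
    have "{s \<in> space halfline. y < g s} \<in> sets halfline" by measurable
    moreover have eq: "{s \<in> space halfline. y < g s} = {s. 0 < s \<and> y < g s}" by auto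
    ultimately have "{s. 0 < s \<and> y < g s} \<in> sets halfline" by simp
    then show S: "{s. 0 < s \<and> y < g s} \<in> sets lebesgue" using sets_halfline by blast
    have "distr_fun halfline g y = emeasure halfline {s. 0 < s \<and> y < g s}" unfolding distr_fun_def eq ..
    also have "\<dots> = emeasure lebesgue {s. 0 < s \<and> y < g s}" by (rule emeasure_halfline) auto
    finally show "distr_fun halfline g y = (\<integral>\<^sup>+s. indicator {s. 0 < s \<and> y < g s} s \<partial>lebesgue)"
      using S by (simp only: nn_integral_indicator)
  qed
  define S where "S = {s. 0 < s \<and> y < f (s / t)}"
  have "(\<lambda>s. f (s / t)) \<in> borel_measurable halfline" using t by measurable
  from *[OF this] have D: "distr_fun halfline (\<lambda>s. f (s / t)) y = (\<integral>\<^sup>+s. indicator S s \<partial>lebesgue)" "S \<in> sets lebesgue"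
    unfolding S_def by blast+
  note D(1)
  also have "(\<integral>\<^sup>+s. indicator S s \<partial>lebesgue) = ennreal \<bar>t\<bar> * (\<integral>\<^sup>+s. indicator S (0 + t * s) \<partial>lebesgue)"
    using t by (intro nn_integral_real_affine_lebesgue borel_measurable_indicator D(2)) simp
  also have "(\<integral>\<^sup>+s. indicator S (0 + t * s) \<partial>lebesgue) = (\<integral>\<^sup>+s. indicator {s. 0 < s \<and> y < f s} s \<partial>lebesgue)"
    using t by (intro nn_integral_cong) (simp add: S_def indicator_def zero_less_mult_iff)
  also have "\<dots> = distr_fun halfline f y" by (rule *(1)[OF assms(1), symmetric])
  finally show ?thesis using t by simp
qed

locale rep_space =
  fixes \<rho> :: "(real ^ 'n \<Rightarrow> ennreal) \<Rightarrow> ennreal"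
  assumes ri: "ri_norm lebesgue \<rho>"
begin

abbreviation "\<sigma> \<equiv> rep_norm \<rho>"
abbreviation "h \<equiv> dilation_norm \<rho>"

lemma ri_sigma: "ri_norm halfline \<sigma>" and rep: "f \<in> ae_finite_measurable lebesgue \<Longrightarrow> \<rho> f = \<sigma> (rearr lebesgue f)"
  using rep_norm_spec[OF ri] by auto

sublocale X: ri_space lebesgue \<rho> "\<lambda>k. cball (0 :: real ^ 'n) (real k)"
  by (rule ri_space_lebesgue[OF ri])

sublocale S: ri_space halfline \<sigma> "\<lambda>k. {0<..<real k}"
  by (rule ri_space_halfline[OF ri_sigma])

lemma norm_rearr_eq: "f \<in> borel_measurable halfline \<Longrightarrow> \<sigma> (rearr halfline f) = \<sigma> f"
  by (intro S.norm_distr_cong measurable_rearr) (simp_all add: distr_fun_rearr)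

lemma dilate_le:
  assumes f [measurable]: "f \<in> borel_measurable halfline" and fin: "\<sigma> f < \<infinity>" and t: "0 < t"
  shows "\<sigma> (\<lambda>s. f (s / t)) \<le> h t * \<sigma> f"
proof (cases "\<sigma> f = 0")
  case True
  then have ae: "AE s in halfline. f s = 0" using S.norm_eq_0_iff[OF f] by simp
  have "distr_fun halfline f y = 0" for y
  proof -
    have "{x \<in> space halfline. y < f x} \<in> sets halfline" by measurable
    moreover have "AE s in halfline. s \<notin> {x \<in> space halfline. y < f x}" using ae by eventually_elim auto
    ultimately show ?thesis unfolding distr_fun_def using AE_iff_null_sets by blast
  qed
  then have "\<sigma> (\<lambda>s. f (s / t)) = \<sigma> f"
    using t by (intro S.norm_distr_cong measurable_dilate f) (simp_all add: distr_fun_dilate[OF f t])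
  then show ?thesis using True by simp
next
  case False
  then obtain c where c: "\<sigma> f = ennreal c" "0 < c" using fin by (cases "\<sigma> f") (auto simp: less_le)
  have fm: "(\<lambda>s. f (s / t)) \<in> borel_measurable halfline" using t by (intro measurable_dilate f)
  have "\<sigma> (\<lambda>s. ennreal (1 / c) * f s) = 1"
    using c by (subst S.norm_cmult) (auto simp: ennreal_mult[symmetric])
  then have "\<sigma> (\<lambda>s. ennreal (1 / c) * f (s / t)) \<le> h t"
    unfolding dilation_norm_def by (intro SUP_upper2[of "\<lambda>s. ennreal (1 / c) * f s"]) auto
  then have "ennreal (1 / c) * \<sigma> (\<lambda>s. f (s / t)) \<le> h t"
    using c fm by (subst (asm) S.norm_cmult) auto
  then have "ennreal (1 / c) * \<sigma> (\<lambda>s. f (s / t)) * ennreal c \<le> h t * ennreal c" by (rule mult_right_mono) simp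
  moreover have "ennreal (1 / c) * \<sigma> (\<lambda>s. f (s / t)) * ennreal c = \<sigma> (\<lambda>s. f (s / t))"
  proof -
    have "ennreal (1 / c) * ennreal c = 1" using c by (subst ennreal_mult[symmetric]) auto
    then show ?thesis by (metis mult.assoc mult.commute mult.left_neutral)
  qed
  ultimately show ?thesis using c by simp
qed

text \<open>For the decreasing rearrangement a compression moves the argument to the right, where
  the function is smaller; equimeasurability transfers this to arbitrary f.\<close>

lemma dilation_norm_le_1:
  assumes t: "0 < t" "t \<le> 1"
  shows "h t \<le> 1"
  unfolding dilation_norm_def
proof (rule SUP_least, clarify)
  fix f assume f: "f \<in> borel_measurable halfline" and le: "\<sigma> f \<le> 1"
  have r: "rearr halfline f \<in> borel_measurable halfline" by (rule measurable_rearr[OF f])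
  have "\<sigma> (\<lambda>s. f (s / t)) = \<sigma> (\<lambda>s. rearr halfline f (s / t))"
    by (intro S.norm_distr_cong measurable_dilate f r t) (simp add: distr_fun_dilate f r t distr_fun_rearr)
  also have "\<dots> \<le> \<sigma> (rearr halfline f)"
  proof (intro S.norm_mono measurable_dilate r t rearr_antimono)
    fix s assume "s \<in> space halfline"
    then have "s * t \<le> s * 1" using t by (intro mult_left_mono) auto
    then show "s \<le> s / t" using t by (simp add: pos_le_divide_eq)
  qed
  also have "\<dots> \<le> 1" using le norm_rearr_eq[OF f] by simp
  finally show "\<sigma> (\<lambda>s. f (s / t)) \<le> 1" .
qed

end

lemma emeasure_reflected_half:
  fixes C :: "(real ^ 'n) set"
  assumes C: "C \<in> sets borel" and sym: "\<And>x. x \<in> C \<Longrightarrow> - x \<in> C"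
  shows "emeasure lebesgue (C \<inter> {x. 0 < x $ i}) = emeasure lebesgue (C \<inter> {x. x $ i < 0})"
    "emeasure lebesgue C = 2 * emeasure lebesgue (C \<inter> {x. 0 < x $ i})"
proof -
  have [measurable]: "{x :: real ^ 'n. 0 < x $ i} \<in> sets borel" "{x :: real ^ 'n. x $ i < 0} \<in> sets borel"
    by (auto intro!: borel_open open_halfspace_component_gt_cart open_halfspace_component_lt_cart)
  note C [measurable]
  have "emeasure lborel (C \<inter> {x. 0 < x $ i}) = emeasure (density (distr lborel borel (\<lambda>x. 0 + (- 1) *\<^sub>R x)) (\<lambda>_. (\<bar>- 1 :: real\<bar> ^ DIM(real ^ 'n)))) (C \<inter> {x. 0 < x $ i})"
    by (subst lborel_affine[of "- 1" "0 :: real ^ 'n"]) auto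
  also have "\<dots> = emeasure lborel ((\<lambda>x. - x) -` (C \<inter> {x. 0 < x $ i}))"
    by (subst emeasure_density) (auto simp: emeasure_distr)
  also have "(\<lambda>x. - x) -` (C \<inter> {x. 0 < x $ i}) = C \<inter> {x. x $ i < 0}"
    using sym by (auto, metis minus_minus)
  finally show eq: "emeasure lebesgue (C \<inter> {x. 0 < x $ i}) = emeasure lebesgue (C \<inter> {x. x $ i < 0})"
    by (simp add: emeasure_completion)
  have null: "{x :: real ^ 'n. x $ i = 0} \<in> null_sets lebesgue"
    using negligible_standard_hyperplane_cart[of i] by (simp add: negligible_iff_null_sets)
  have "emeasure lebesgue C = emeasure lebesgue ((C \<inter> {x. 0 < x $ i}) \<union> (C \<inter> {x. x $ i < 0}))"
  proof (rule emeasure_eq_AE)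
    show "AE x in lebesgue. x \<in> C \<longleftrightarrow> x \<in> (C \<inter> {x. 0 < x $ i}) \<union> (C \<inter> {x. x $ i < 0})"
      using AE_not_in[OF null] by eventually_elim auto
  qed auto
  also have "\<dots> = emeasure lebesgue (C \<inter> {x. 0 < x $ i}) + emeasure lebesgue (C \<inter> {x. x $ i < 0})"
    by (rule plus_emeasure[symmetric]) auto
  finally show "emeasure lebesgue C = 2 * emeasure lebesgue (C \<inter> {x. 0 < x $ i})"
    by (simp add: eq[symmetric] mult_2)
qed

context rep_space
begin

text \<open>The dilate by 2 is realised on \<open>\<real>\<^sup>n\<close> as a sum of two equimeasurable copies, supported in
  complementary half-spaces.\<close>

lemma dilation_norm_2: "h 2 \<le> 2"
  unfolding dilation_norm_def
proof (rule SUP_least, clarify)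
  fix f assume f: "f \<in> borel_measurable halfline" and le: "\<sigma> f \<le> 1"
  define i :: 'n where "i = undefined"
  have fin: "\<sigma> f < \<infinity>" using le by (rule le_less_trans) simp
  obtain y0 :: real where y0: "0 \<le> y0" "distr_fun halfline f (ennreal y0) < \<infinity>" by (rule S.distr_infinite_or[OF f fin])
  have aef: "AE s in halfline. f s < top" using S.norm_infinite[OF f] fin by (metis infinity_ennreal_def less_irrefl)
  define k where "k = rearr halfline f"
  have k_fin: "k t < top" if "0 < t" for t unfolding k_def by (rule rearr_finite[OF f _ aef that]) (use y0 in auto)
  \<comment> \<open>A level set of the decreasing rearrangement of f composed with half of
    \<open>radial\<close>. Its volume is twice that of the corresponding level set of f, and being
    invariant under reflection it is cut into equal halves by a coordinate hyperplane.\<close>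
  define C where "C y = {x :: real ^ 'n. 0 < radial x \<and> ennreal (radial x / 2) < distr_fun halfline f y}" for y
  have C: "C y \<in> sets borel" "\<And>x. x \<in> C y \<Longrightarrow> - x \<in> C y" for y
  proof -
    have "{x \<in> space borel. 0 < radial x \<and> ennreal (radial (x :: real ^ 'n) / 2) < distr_fun halfline f y} \<in> sets borel" by measurable
    then show "C y \<in> sets borel" by (simp add: C_def)
  qed (simp add: C_def)
  have C2: "emeasure lebesgue (C y) = 2 * distr_fun halfline f y" for y
  proof -
    have "{s \<in> space borel. 0 < s \<and> ennreal (s / 2) < distr_fun halfline f y} \<in> sets borel" by measurable
    then have B: "{s. 0 < s \<and> ennreal (s / 2) < distr_fun halfline f y} \<in> sets borel" by simp
    have "emeasure lebesgue (C y) = emeasure lborel {x :: real ^ 'n. radial x \<in> {s. 0 < s \<and> ennreal (s / 2) < distr_fun halfline f y}}"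
      using C(1)[of y] by (simp add: C_def emeasure_completion)
    also have "\<dots> = emeasure lborel ({s. 0 < s \<and> ennreal (s / 2) < distr_fun halfline f y} \<inter> {0<..})"
      by (rule emeasure_radial_vimage_borel[OF B])
    also have "{s. 0 < s \<and> ennreal (s / 2) < distr_fun halfline f y} \<inter> {0<..} = {s. 0 < s \<and> ennreal s < 2 * distr_fun halfline f y}"
    proof -
      have "ennreal (s / 2) < d \<longleftrightarrow> ennreal s < 2 * d" if "0 < s" for s and d :: ennreal
        using that by (cases d) (auto simp: ennreal_less_iff ennreal_mult_top ennreal_mult[symmetric] simp flip: ennreal_numeral)
      then show ?thesis by auto
    qed
    also have "emeasure lborel {s. 0 < s \<and> ennreal s < 2 * distr_fun halfline f y} = emeasure lebesgue {s. 0 < s \<and> ennreal s < 2 * distr_fun halfline f y}"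
    proof -
      have "{s \<in> space borel. 0 < s \<and> ennreal s < 2 * distr_fun halfline f y} \<in> sets borel" by measurable
      then show ?thesis by (simp add: emeasure_completion)
    qed
    also have "\<dots> = 2 * distr_fun halfline f y" by (rule emeasure_halfline_initial)
    finally show ?thesis .
  qed
  have Ck: "x \<in> C y \<longleftrightarrow> 0 < radial x \<and> y < k (radial x / 2)" for x y
    unfolding C_def k_def using rearr_less_iff[OF f] by simp
  \<comment> \<open>The restriction of this radial function to H. For each of the two half-spaces it
    is equimeasurable with f, so both restrictions have norm at most 1.\<close>
  define G where "G H x = k (radial x / 2) * indicator {0<..} (radial x) * indicator H x" for H and x :: "real ^ 'n"
  have lev: "{x. y < G H x} = C y \<inter> H" for y H
    by (auto simp: G_def Ck indicator_def split: if_splits)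
  let ?H1 = "{x :: real ^ 'n. 0 < x $ i}" and ?H2 = "{x :: real ^ 'n. x $ i < 0}"
  have H: "?H1 \<in> sets borel" "?H2 \<in> sets borel"
    by (auto intro!: borel_open open_halfspace_component_gt_cart open_halfspace_component_lt_cart)
  have Gm: "G H \<in> borel_measurable lebesgue" if "H \<in> sets borel" for H
  proof (rule borel_measurableI_greater)
    fix y
    have "C y \<inter> H \<in> sets borel" using C(1)[of y] that by auto
    then show "{x \<in> space lebesgue. y < G H x} \<in> sets lebesgue" by (simp add: lev)
  qed
  have Gfin: "G H x < top" for H x using k_fin[of "radial x / 2"] by (auto simp: G_def indicator_def ennreal_mult_less_top)
  have dG: "distr_fun lebesgue (G ?H1) y = distr_fun halfline f y" "distr_fun lebesgue (G ?H2) y = distr_fun halfline f y" for y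
  proof -
    have "2 * emeasure lebesgue (C y \<inter> ?H1) = 2 * distr_fun halfline f y"
      using emeasure_reflected_half(2)[OF C, of y i] C2[of y] by simp
    then have "emeasure lebesgue (C y \<inter> ?H1) = distr_fun halfline f y"
      by (subst (asm) ennreal_mult_cancel_left) auto
    then show "distr_fun lebesgue (G ?H1) y = distr_fun halfline f y" "distr_fun lebesgue (G ?H2) y = distr_fun halfline f y"
      using emeasure_reflected_half(1)[OF C, of y i] by (simp_all add: distr_fun_def lev)
  qed
  have \<rho>G: "\<rho> (G ?H1) \<le> 1" "\<rho> (G ?H2) \<le> 1"
  proof -
    have "\<rho> (G H) = \<sigma> f" if "H \<in> sets borel" "\<And>y. distr_fun lebesgue (G H) y = distr_fun halfline f y" for H
    proof -
      have "\<rho> (G H) = \<sigma> (rearr lebesgue (G H))" using Gm[OF that(1)] Gfin by (intro rep) (auto simp: ae_finite_measurable_def)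
      also have "rearr lebesgue (G H) = rearr halfline f" by (rule rearr_cong[OF that(2)])
      finally show ?thesis by (simp add: norm_rearr_eq[OF f])
    qed
    then show "\<rho> (G ?H1) \<le> 1" "\<rho> (G ?H2) \<le> 1" using dG H le by simp_all
  qed
  define g where "g x = G ?H1 x + G ?H2 x" for x
  have gm: "g \<in> borel_measurable lebesgue" unfolding g_def using Gm[OF H(1)] Gm[OF H(2)] by measurable
  have g_fin: "g \<in> ae_finite_measurable lebesgue" using gm Gfin by (auto simp: ae_finite_measurable_def g_def)
  have dg: "distr_fun lebesgue g y = 2 * distr_fun halfline f y" for y
  proof -
    have "{x. y < g x} = (C y \<inter> ?H1) \<union> (C y \<inter> ?H2)"
    proof -
      have "g x = (if x \<in> ?H1 then G ?H1 x else G ?H2 x)" for x by (auto simp: g_def G_def indicator_def)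
      then show ?thesis using lev[of y ?H1] lev[of y ?H2] by (auto simp: set_eq_iff split: if_splits)
    qed
    moreover have "emeasure lebesgue ((C y \<inter> ?H1) \<union> (C y \<inter> ?H2)) = emeasure lebesgue (C y \<inter> ?H1) + emeasure lebesgue (C y \<inter> ?H2)"
      using C(1)[of y] H by (intro plus_emeasure[symmetric]) auto
    ultimately show ?thesis using dG[of y] by (simp add: distr_fun_def lev mult_2)
  qed
  have "\<sigma> (\<lambda>s. f (s / 2)) = \<sigma> (rearr lebesgue g)"
  proof (rule S.norm_distr_cong)
    show "(\<lambda>s. f (s / 2)) \<in> borel_measurable halfline" by (intro measurable_dilate f) simp
    show "rearr lebesgue g \<in> borel_measurable halfline" by (rule measurable_rearr[OF gm])
    show "distr_fun halfline (\<lambda>s. f (s / 2)) (ennreal y) = distr_fun halfline (rearr lebesgue g) (ennreal y)" for y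
      by (simp add: distr_fun_dilate[OF f] distr_fun_rearr[OF gm] dg)
  qed
  also have "\<dots> = \<rho> g" by (rule rep[OF g_fin, symmetric])
  also have "\<dots> \<le> \<rho> (G ?H1) + \<rho> (G ?H2)" unfolding g_def using Gm[OF H(1)] Gm[OF H(2)] by (rule X.norm_add)
  also have "\<dots> \<le> 1 + 1" by (intro add_mono \<rho>G)
  finally show "\<sigma> (\<lambda>s. f (s / 2)) \<le> 2" by simp
qed

lemma dilation_norm_submult:
  assumes st: "0 < s" "0 < t" and fin: "h t < \<infinity>"
  shows "h (s * t) \<le> h s * h t"
proof -
  have "\<sigma> (\<lambda>x. f (x / (s * t))) \<le> h s * h t" if f: "f \<in> borel_measurable halfline" and le: "\<sigma> f \<le> 1" for f
  proof -
    have "\<sigma> (\<lambda>x. f (x / t)) \<le> h t" unfolding dilation_norm_def using f le by (intro SUP_upper) auto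
    have "\<sigma> (\<lambda>x. (\<lambda>x. f (x / t)) (x / s)) \<le> h s * \<sigma> (\<lambda>x. f (x / t))"
      using \<open>\<sigma> (\<lambda>x. f (x / t)) \<le> h t\<close> fin st by (intro dilate_le measurable_dilate f) auto
    also have "\<dots> \<le> h s * h t" using \<open>\<sigma> (\<lambda>x. f (x / t)) \<le> h t\<close> by (rule mult_left_mono) simp
    finally show ?thesis by (simp add: divide_divide_eq_left)
  qed
  then show ?thesis unfolding dilation_norm_def[of \<rho> "s * t"] by (intro SUP_least) auto
qed

text \<open>Powers of 2 follow from \<open>dilation_norm_2\<close> by submultiplicativity; any other
  t is such a power times a factor at most 1, which does not increase norms.\<close>

lemma dilation_norm_finite: "0 < t \<Longrightarrow> h t < \<infinity>"
proof -
  assume t: "0 < t"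
  have p: "h (2 ^ k) < \<infinity>" for k
  proof (induction k)
    case 0
    show ?case using dilation_norm_le_1[of 1] by (simp add: le_less_trans)
  next
    case (Suc k)
    have "h (2 * 2 ^ k) \<le> h 2 * h (2 ^ k)" using Suc by (intro dilation_norm_submult) auto
    also have "\<dots> \<le> 2 * h (2 ^ k)" by (intro mult_right_mono dilation_norm_2) simp
    also have "\<dots> < \<infinity>" using Suc by (simp add: ennreal_mult_less_top)
    finally show ?case by simp
  qed
  obtain k where k: "t < 2 ^ k" using real_arch_pow[of 2 t] by auto
  have "h (t / 2 ^ k * 2 ^ k) \<le> h (t / 2 ^ k) * h (2 ^ k)" using t p by (intro dilation_norm_submult) auto
  also have "\<dots> \<le> 1 * h (2 ^ k)" using t k by (intro mult_right_mono dilation_norm_le_1) auto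
  finally show ?thesis using p[of k] by (auto intro: le_less_trans)
qed

lemma dilation_norm_mono: "0 < s \<Longrightarrow> s \<le> t \<Longrightarrow> h s \<le> h t"
proof -
  assume st: "0 < s" "s \<le> t"
  have "h (s / t * t) \<le> h (s / t) * h t" using st dilation_norm_finite by (intro dilation_norm_submult) auto
  also have "\<dots> \<le> 1 * h t" using st by (intro mult_right_mono dilation_norm_le_1) auto
  finally show ?thesis using st by simp
qed

text \<open>The fundamental function computed on the half line with the concrete set (0, s), in
  place of the arbitrary choice made in \<open>fundamental_fun\<close>; monotonicity and dilation
  estimates become visible in this form.\<close>

definition "\<phi> s = \<sigma> (indicator {0<..<s})"

lemma sets_initial: "{0<..<s} \<in> sets halfline" by (auto simp: sets_halfline)

lemma phi_pos: "0 < s \<Longrightarrow> 0 < \<phi> s" and phi_finite: "\<phi> s < \<infinity>"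
proof -
  have e: "emeasure halfline {0<..<s} = emeasure lborel {0<..<s}"
    by (subst emeasure_halfline) (auto simp: emeasure_completion)
  show "0 < s \<Longrightarrow> 0 < \<phi> s"
    unfolding \<phi>_def by (intro S.norm_indicator_pos sets_initial) (simp add: e)
  have "emeasure lborel {0<..<s} < top" by (cases "0 \<le> s") auto
  then show "\<phi> s < \<infinity>"
    unfolding \<phi>_def by (intro S.norm_indicator_finite sets_initial) (simp add: e)
qed

lemma phi_mono: "s \<le> t \<Longrightarrow> \<phi> s \<le> \<phi> t"
  unfolding \<phi>_def by (intro S.norm_mono borel_measurable_indicator sets_initial) (auto simp: indicator_def)

lemma phi_dilate: "0 < u \<Longrightarrow> 0 < s \<Longrightarrow> \<phi> (u * s) \<le> h u * \<phi> s"
proof -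
  assume us: "0 < u" "0 < s"
  have "(\<lambda>x. indicator {0<..<s} (x / u)) = (indicator {0<..<u * s} :: real \<Rightarrow> ennreal)"
    using us by (auto simp: indicator_def fun_eq_iff zero_less_divide_iff pos_divide_less_eq mult.commute)
  then have "\<phi> (u * s) = \<sigma> (\<lambda>x. indicator {0<..<s} (x / u))" by (simp add: \<phi>_def)
  also have "\<dots> \<le> h u * \<phi> s"
    unfolding \<phi>_def using phi_finite[of s] us by (intro dilate_le borel_measurable_indicator sets_initial) (auto simp: \<phi>_def)
  finally show ?thesis .
qed

lemma dilation_norm_pos: "0 < t \<Longrightarrow> 0 < h t"
  using phi_dilate[of t 1] phi_pos[of t] phi_pos[of 1] by (auto simp: zero_less_iff_neq_zero)

lemma fundamental_fun_eq:
  assumes t: "0 < t"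
  shows "fundamental_fun \<rho> t = \<phi> t"
proof -
  define E :: "(real ^ 'n) set" where "E = (SOME E. E \<in> sets lebesgue \<and> emeasure lebesgue E = ennreal t)"
  have "\<exists>E :: (real ^ 'n) set. E \<in> sets lebesgue \<and> emeasure lebesgue E = ennreal t"
    using t by (intro exI[of _ "cube 0 (root CARD('n) t)"]) (simp add: emeasure_cube)
  from someI_ex[OF this] have E: "E \<in> sets lebesgue" "emeasure lebesgue E = ennreal t" unfolding E_def by auto
  have Em: "indicator E \<in> borel_measurable lebesgue" using E(1) by (rule borel_measurable_indicator)
  have "\<rho> (indicator E) = \<sigma> (rearr lebesgue (indicator E))"
    using Em by (intro rep) (auto simp: ae_finite_measurable_def indicator_def)
  also have "\<dots> = \<phi> t"
    unfolding \<phi>_def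
  proof (intro S.norm_distr_cong measurable_rearr Em borel_measurable_indicator sets_initial)
    fix y :: real assume "0 \<le> y"
    have "{x \<in> space lebesgue. ennreal y < indicator E x} = (if y < 1 then E else {})" "{x \<in> space halfline. ennreal y < indicator {0<..<t} x} = (if y < 1 then {0<..<t} else {})"
      using \<open>0 \<le> y\<close> by (auto simp: indicator_def ennreal_less_one_iff split: if_splits)
    then show "distr_fun halfline (rearr lebesgue (indicator E)) (ennreal y) = distr_fun halfline (indicator {0<..<t}) (ennreal y)"
      using E t by (subst distr_fun_rearr[OF Em]) (auto simp: distr_fun_def emeasure_halfline emeasure_completion[of "{0<..<t}"] subset_iff)
  qed
  finally show ?thesis by (simp add: fundamental_fun_def E_def)
qed

end

section \<open>Fekete's lemma and power bounds from the Boyd indices\<close>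

text \<open>Fekete's lemma for a real variable, the limit being the infimum over x >= 1. The linear
  lower bound keeps the infimum finite, and the local upper bound controls the remainder after
  splitting off multiples of a nearly optimal x0.\<close>

lemma subadditive_limit:
  fixes c :: "real \<Rightarrow> real"
  assumes sub: "\<And>x y. 0 \<le> x \<Longrightarrow> 0 \<le> y \<Longrightarrow> c (x + y) \<le> c x + c y"
    and bd: "\<And>z. \<exists>B. \<forall>r. 0 \<le> r \<longrightarrow> r \<le> z \<longrightarrow> c r \<le> B"
    and low: "\<And>x. 1 \<le> x \<Longrightarrow> L * x \<le> c x"
  obtains \<alpha> where "((\<lambda>x. c x / x) \<longlongrightarrow> \<alpha>) at_top"
proof -
  define S where "S = (\<lambda>x. c x / x) ` {1..}"
  have bdd: "bdd_below S"
    by (rule bdd_belowI[of _ L]) (use low in \<open>auto simp: S_def pos_le_divide_eq\<close>)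
  have ne: "S \<noteq> {}" by (auto simp: S_def)
  have "((\<lambda>x. c x / x) \<longlongrightarrow> Inf S) at_top"
  proof (rule order_tendstoI)
    fix b assume b: "b < Inf S"
    show "\<forall>\<^sub>F x in at_top. b < c x / x"
      using eventually_ge_at_top[of 1]
    proof eventually_elim
      case (elim x)
      then have "Inf S \<le> c x / x" by (intro cInf_lower bdd) (auto simp: S_def)
      with b show ?case by simp
    qed
  next
    fix b assume b: "Inf S < b"
    then obtain x0 where x0: "1 \<le> x0" "c x0 / x0 < b"
      using cInf_lessD[OF ne b] by (auto simp: S_def)
    obtain B where B: "\<And>r. 0 \<le> r \<Longrightarrow> r \<le> x0 \<Longrightarrow> c r \<le> B" using bd by metis
    have iter: "c (real n * x0 + r) \<le> real n * c x0 + c r" if "0 \<le> r" for n r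
    proof (induction n)
      case (Suc n)
      have "c (x0 + (real n * x0 + r)) \<le> c x0 + c (real n * x0 + r)" using x0 that by (intro sub) auto
      with Suc show ?case by (simp add: algebra_simps)
    qed simp
    have bound: "c x / x \<le> c x0 / x0 + (\<bar>c x0\<bar> + \<bar>B\<bar>) / x" if x: "1 \<le> x" for x
    proof -
      define n where "n = nat \<lfloor>x / x0\<rfloor>"
      define r where "r = x - real n * x0"
      have "real n \<le> x / x0" "x / x0 < real n + 1" using x x0 by (auto simp: n_def)
      then have r: "0 \<le> r" "r \<le> x0" using x0 by (auto simp: r_def field_simps)
      have "c x = c (real n * x0 + r)" by (simp add: r_def)
      also have "\<dots> \<le> real n * c x0 + c r" by (rule iter[OF r(1)])
      also have "real n * c x0 = c x0 / x0 * (x - r)" using x0 by (simp add: r_def)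
      also have "c x0 / x0 * (x - r) + c r \<le> c x0 / x0 * x + (\<bar>c x0\<bar> + \<bar>B\<bar>)"
      proof -
        have "\<bar>c x0 / x0 * r\<bar> \<le> \<bar>c x0 / x0\<bar> * x0" unfolding abs_mult using r by (intro mult_left_mono) auto
        also have "\<dots> = \<bar>c x0\<bar>" using x0 by (simp add: abs_divide)
        finally have "- (c x0 / x0 * r) \<le> \<bar>c x0\<bar>" by linarith
        moreover have "c r \<le> \<bar>B\<bar>" using B[OF r] by linarith
        ultimately show ?thesis by (simp only: right_diff_distrib)
      qed
      finally have "c x \<le> c x0 / x0 * x + (\<bar>c x0\<bar> + \<bar>B\<bar>)" .
      then have "c x / x \<le> (c x0 / x0 * x + (\<bar>c x0\<bar> + \<bar>B\<bar>)) / x" using x by (intro divide_right_mono) auto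
      also have "\<dots> = c x0 / x0 + (\<bar>c x0\<bar> + \<bar>B\<bar>) / x" using x by (simp add: add_divide_distrib)
      finally show ?thesis .
    qed
    define d where "d = b - c x0 / x0"
    have d: "0 < d" using x0 by (simp add: d_def)
    show "\<forall>\<^sub>F x in at_top. c x / x < b"
      using eventually_ge_at_top[of 1] eventually_gt_at_top[of "(\<bar>c x0\<bar> + \<bar>B\<bar>) / d"]
    proof eventually_elim
      case (elim x)
      then have "(\<bar>c x0\<bar> + \<bar>B\<bar>) / x < d" using d by (simp add: pos_divide_less_eq mult.commute)
      then show ?case using bound[OF elim(1)] by (simp add: d_def)
    qed
  qed
  then show ?thesis using that by blast
qed

text \<open>The case distinction imitates the convention in \<open>boyd_quotient\<close> that a
  vanishing logarithm gives the value infinity. Nonnegativity excludes divergence to minus infinity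
  when the limit is 0.\<close>

lemma tendsto_ereal_inverse_at_top:
  fixes g :: "real \<Rightarrow> real"
  assumes g: "(g \<longlongrightarrow> \<alpha>) at_top" and nonneg: "\<forall>\<^sub>F t in at_top. 0 \<le> g t"
  shows "((\<lambda>t. if g t = 0 then \<infinity> else ereal (1 / g t)) \<longlongrightarrow> (if \<alpha> = 0 then \<infinity> else ereal (1 / \<alpha>))) at_top"
proof (cases "\<alpha> = 0")
  case False
  have "\<forall>\<^sub>F t in at_top. g t \<noteq> 0" using tendsto_imp_eventually_ne[OF g False] .
  then have ev: "\<forall>\<^sub>F t in at_top. ereal (1 / g t) = (if g t = 0 then \<infinity> else ereal (1 / g t))"
    by eventually_elim simp
  have "((\<lambda>t. ereal (1 / g t)) \<longlongrightarrow> ereal (1 / \<alpha>)) at_top"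
    using False by (intro tendsto_intros g)
  then show ?thesis using False by (simp add: tendsto_cong[OF ev])
next
  case True
  have "((\<lambda>t. if g t = 0 then \<infinity> else ereal (1 / g t)) \<longlongrightarrow> \<infinity>) at_top"
    unfolding tendsto_PInfty
  proof
    fix r :: real
    have "0 < 1 / (\<bar>r\<bar> + 1)" by simp
    then have "\<forall>\<^sub>F t in at_top. g t < 1 / (\<bar>r\<bar> + 1)" using g True by (intro order_tendstoD) auto
    with nonneg show "\<forall>\<^sub>F t in at_top. ereal r < (if g t = 0 then \<infinity> else ereal (1 / g t))"
    proof eventually_elim
      case (elim t)
      show ?case
      proof (cases "g t = 0")
        case False
        then have "\<bar>r\<bar> + 1 < 1 / g t" using elim by (simp add: field_simps)
        then show ?thesis using False by simp
      qed simp
    qed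
  qed
  then show ?thesis using True by simp
qed

context rep_space
begin

definition "H t = enn2real (h t)"

lemma h_eq_H: "0 < t \<Longrightarrow> h t = ennreal (H t)"
  using dilation_norm_finite[of t] by (simp add: H_def)

lemma H_pos: "0 < t \<Longrightarrow> 0 < H t"
  using dilation_norm_finite[of t] dilation_norm_pos[of t] by (simp add: H_def enn2real_positive_iff)

lemma H_submult: "0 < s \<Longrightarrow> 0 < t \<Longrightarrow> H (s * t) \<le> H s * H t"
  using dilation_norm_submult[of s t] dilation_norm_finite[of t] H_pos[of s] H_pos[of t]
  by (simp add: h_eq_H ennreal_mult[symmetric])

lemma H_mono: "0 < s \<Longrightarrow> s \<le> t \<Longrightarrow> H s \<le> H t"
  using dilation_norm_mono[of s t] H_pos[of t] by (simp add: h_eq_H)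

lemma H_le_1: "0 < t \<Longrightarrow> t \<le> 1 \<Longrightarrow> H t \<le> 1"
  using dilation_norm_le_1[of t] by (simp add: h_eq_H)

lemma H_ge_1: "1 \<le> t \<Longrightarrow> 1 \<le> H t"
proof -
  assume "1 \<le> t"
  have "1 * H 1 \<le> H 1 * H 1" using H_submult[of 1 1] by simp
  then have "1 \<le> H 1" using H_pos[OF zero_less_one] by (rule mult_right_le_imp_le)
  also have "H 1 \<le> H t" using \<open>1 \<le> t\<close> by (intro H_mono) auto
  finally show ?thesis .
qed

text \<open>On the logarithmic scale submultiplicativity becomes subadditivity, and a Boyd index
  becomes the reciprocal of an asymptotic slope.\<close>

definition "lnH x = ln (H (exp x))"

lemma lnH_add: "lnH (x + y) \<le> lnH x + lnH y"
proof -
  have "lnH (x + y) \<le> ln (H (exp x) * H (exp y))"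
    unfolding lnH_def using H_submult[of "exp x" "exp y"] H_pos[of "exp x * exp y"] H_pos[of "exp x"] H_pos[of "exp y"]
    by (subst ln_le_cancel_iff) (auto simp: exp_add)
  then show ?thesis using H_pos[of "exp x"] H_pos[of "exp y"] by (simp add: lnH_def ln_mult)
qed

lemma lnH_mono: "x \<le> y \<Longrightarrow> lnH x \<le> lnH y"
  unfolding lnH_def using H_mono[of "exp x" "exp y"] H_pos[of "exp x"] H_pos[of "exp y"] by simp

lemma lnH_nonneg: "0 \<le> x \<Longrightarrow> 0 \<le> lnH x"
  unfolding lnH_def using H_ge_1[of "exp x"] by simp

lemma lnH_nonpos: "x \<le> 0 \<Longrightarrow> lnH x \<le> 0"
  unfolding lnH_def using H_le_1[of "exp x"] H_pos[of "exp x"] by simp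

text \<open>Subadditivity over integers; the factor 2 covers rounding up, as x >= 1. Through lnH(x)
  + lnH(-x) >= lnH(0) >= 0 this yields the lower bound that Fekete's lemma requires at minus
  infinity.\<close>

lemma lnH_le_linear: "1 \<le> x \<Longrightarrow> lnH x \<le> 2 * lnH 1 * x"
proof -
  assume x: "1 \<le> x"
  have n: "lnH (real n) \<le> real n * lnH 1" for n
  proof (induction n)
    case (Suc n)
    have "lnH (1 + real n) \<le> lnH 1 + lnH (real n)" by (rule lnH_add)
    with Suc show ?case by (simp add: algebra_simps)
  qed (simp add: lnH_nonpos)
  have "lnH x \<le> lnH (real (nat \<lceil>x\<rceil>))" by (rule lnH_mono) linarith
  also have "\<dots> \<le> real (nat \<lceil>x\<rceil>) * lnH 1" by (rule n)
  also have "\<dots> \<le> (2 * x) * lnH 1" using x lnH_nonneg[of 1] by (intro mult_right_mono) linarith+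
  finally show ?thesis by (simp add: mult_ac)
qed

text \<open>As \<open>Lim\<close> carries information only when the limit exists, Fekete's lemma is
  applied first; it identifies 1/P with the slope of \<open>lnH\<close>. A slope below r gives the
  power bound beyond some T, and monotonicity covers the range from 1 to T with the constant
  \<open>H T\<close>.\<close>

lemma boyd_p_bound:
  assumes P: "boyd_p \<rho> = ereal P" "0 < P" and r: "1 / P < r"
  obtains C where "1 \<le> C" "\<And>u. 1 \<le> u \<Longrightarrow> H u \<le> C * u powr r"
proof -
  have bd: "\<exists>B. \<forall>r. 0 \<le> r \<longrightarrow> r \<le> z \<longrightarrow> lnH r \<le> B" for z using lnH_mono by blast
  have low: "0 * x \<le> lnH x" if "1 \<le> x" for x using lnH_nonneg[of x] that by simp
  obtain \<alpha> where "((\<lambda>x. lnH x / x) \<longlongrightarrow> \<alpha>) at_top"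
    using subadditive_limit[of lnH, OF lnH_add bd low] by blast
  from filterlim_compose[OF this ln_at_top]
  have lim: "((\<lambda>t. lnH (ln t) / ln t) \<longlongrightarrow> \<alpha>) at_top" .
  have g: "\<forall>\<^sub>F t in at_top. 0 \<le> lnH (ln t) / ln t"
    using eventually_gt_at_top[of 1] by eventually_elim (simp add: lnH_nonneg)
  have eq: "\<forall>\<^sub>F t in at_top. (if lnH (ln t) / ln t = 0 then \<infinity> else ereal (1 / (lnH (ln t) / ln t))) = boyd_quotient \<rho> t"
    using eventually_gt_at_top[of 1]
  proof eventually_elim
    case (elim t)
    then have "ln t \<noteq> 0" "lnH (ln t) = ln (H t)" by (auto simp: lnH_def)
    then show ?case by (simp add: boyd_quotient_def Let_def H_def)
  qed
  have "(boyd_quotient \<rho> \<longlongrightarrow> (if \<alpha> = 0 then \<infinity> else ereal (1 / \<alpha>))) at_top"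
    using tendsto_ereal_inverse_at_top[OF lim g] unfolding tendsto_cong[OF eq] .
  then have "boyd_p \<rho> = (if \<alpha> = 0 then \<infinity> else ereal (1 / \<alpha>))"
    unfolding boyd_p_def by (intro tendsto_Lim) auto
  then have \<alpha>: "\<alpha> < r" using P r by (auto split: if_splits)
  have r0: "0 < r" using r P(2) by (meson less_trans zero_less_divide_1_iff)
  have "\<forall>\<^sub>F t in at_top. lnH (ln t) / ln t < r \<and> 1 < t"
    using order_tendstoD(2)[OF lim \<alpha>] eventually_gt_at_top[of 1] by eventually_elim simp
  then obtain T where T: "\<And>t. T \<le> t \<Longrightarrow> lnH (ln t) / ln t < r \<and> 1 < t" by (auto simp: eventually_at_top_linorder)
  then have T1: "1 < T" by blast
  show ?thesis
  proof (rule that[of "H T"])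
    show "1 \<le> H T" using T1 by (intro H_ge_1) simp
    fix u :: real assume u: "1 \<le> u"
    show "H u \<le> H T * u powr r"
    proof (cases "u \<le> T")
      case True
      have "H u * 1 \<le> H T * u powr r"
        using u True r0 H_pos[of T] T1 by (intro mult_mono H_mono ge_one_powr_ge_zero) auto
      then show ?thesis by simp
    next
      case False
      then have t: "lnH (ln u) / ln u < r" "1 < u" using T[of u] by auto
      then have "ln (H u) < r * ln u" by (simp add: lnH_def pos_divide_less_eq)
      then have "ln (H u) < ln (u powr r)" using t(2) by (simp add: ln_powr)
      then have "H u \<le> u powr r" using H_pos[of u] t(2) by (subst (asm) ln_less_cancel_iff) auto
      also have "\<dots> \<le> H T * u powr r" using H_ge_1[of T] T1 by (simp add: mult_le_cancel_right1)
      finally show ?thesis .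
    qed
  qed
qed

text \<open>The same argument for small arguments, after the substitution of 1/t. Between 1/T and 1
  the bound H <= 1 is enough, because T^r u^r >= 1 there.\<close>

lemma boyd_q_bound:
  assumes Q: "boyd_q \<rho> = ereal P" "0 < P" and r: "0 \<le> r" "r < 1 / P"
  obtains C where "1 \<le> C" "\<And>u. 0 < u \<Longrightarrow> u \<le> 1 \<Longrightarrow> H u \<le> C * u powr r"
proof -
  have bd: "\<exists>B. \<forall>r. 0 \<le> r \<longrightarrow> r \<le> z \<longrightarrow> lnH (- r) \<le> B" for z :: real
    using lnH_nonpos by (intro exI[of _ 0]) auto
  have low: "- (2 * lnH 1) * x \<le> lnH (- x)" if "1 \<le> x" for x
    using lnH_add[of x "- x"] lnH_nonneg[of 0] lnH_le_linear[OF that] by simp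
  have sub: "lnH (- (x + y)) \<le> lnH (- x) + lnH (- y)" for x y using lnH_add[of "- x" "- y"] by simp
  obtain \<beta> where "((\<lambda>x. lnH (- x) / x) \<longlongrightarrow> \<beta>) at_top"
    using subadditive_limit[of "\<lambda>x. lnH (- x)", OF sub bd low] by blast
  from tendsto_minus[OF filterlim_compose[OF this ln_at_top]]
  have lim: "((\<lambda>t. - (lnH (- ln t) / ln t)) \<longlongrightarrow> - \<beta>) at_top" .
  have g: "\<forall>\<^sub>F t in at_top. 0 \<le> - (lnH (- ln t) / ln t)"
    using eventually_gt_at_top[of 1] by eventually_elim (simp add: lnH_nonpos divide_nonpos_pos)
  have eq: "\<forall>\<^sub>F t in at_top. (if - (lnH (- ln t) / ln t) = 0 then \<infinity> else ereal (1 / (- (lnH (- ln t) / ln t)))) = boyd_quotient \<rho> (inverse t)"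
    using eventually_gt_at_top[of 1]
  proof eventually_elim
    case (elim t)
    then have t: "ln t \<noteq> 0" "lnH (- ln t) = ln (H (inverse t))" "ln (inverse t) = - ln t"
      by (auto simp: lnH_def exp_minus ln_inverse)
    then show ?case by (simp add: boyd_quotient_def Let_def H_def)
  qed
  have "(boyd_quotient \<rho> \<longlongrightarrow> (if - \<beta> = 0 then \<infinity> else ereal (1 / - \<beta>))) (at_right 0)"
    using tendsto_ereal_inverse_at_top[OF lim g] unfolding tendsto_cong[OF eq] filterlim_at_right_to_top .
  then have "boyd_q \<rho> = (if - \<beta> = 0 then \<infinity> else ereal (1 / - \<beta>))"
    unfolding boyd_q_def by (intro tendsto_Lim) auto
  then have "\<beta> \<noteq> 0" "P = 1 / - \<beta>" using Q(1) by (auto split: if_splits)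
  then have \<beta>: "r < - \<beta>" using Q r by simp
  have "\<forall>\<^sub>F t in at_top. r < - (lnH (- ln t) / ln t) \<and> 1 < t"
    using order_tendstoD(1)[OF lim \<beta>] eventually_gt_at_top[of 1] by eventually_elim simp
  then obtain T where T: "\<And>t. T \<le> t \<Longrightarrow> r < - (lnH (- ln t) / ln t) \<and> 1 < t" by (auto simp: eventually_at_top_linorder)
  then have T1: "1 < T" by blast
  show ?thesis
  proof (rule that[of "T powr r"])
    show C: "1 \<le> T powr r" using T1 r by (intro ge_one_powr_ge_zero) auto
    fix u :: real assume u: "0 < u" "u \<le> 1"
    show "H u \<le> T powr r * u powr r"
    proof (cases "T \<le> 1 / u")
      case False
      then have "1 < T * u" using u by (simp add: not_le pos_divide_less_eq mult.commute)
      then have "1 \<le> (T * u) powr r" using r by (intro ge_one_powr_ge_zero) auto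
      then show ?thesis using H_le_1[OF u] u T1 by (simp add: powr_mult)
    next
      case True
      then have t: "r < - (lnH (- ln (1 / u)) / ln (1 / u))" "1 < 1 / u" using T by blast+
      have ln: "ln (1 / u) = - ln u" using u by (simp add: ln_div)
      have "0 < ln (1 / u)" by (rule ln_gt_zero[OF t(2)])
      then have lu: "ln u < 0" using ln by simp
      have "lnH (- ln (1 / u)) = ln (H u)" using u by (simp add: lnH_def ln)
      then have "r < ln (H u) / ln u" using t(1) by (simp add: ln)
      then have "ln (H u) < r * ln u" using lu by (simp add: neg_less_divide_eq)
      then have "ln (H u) < ln (u powr r)" using u by (simp add: ln_powr)
      then have "H u \<le> 1 * u powr r" using H_pos[of u] u by (subst (asm) ln_less_cancel_iff) auto
      also have "\<dots> \<le> T powr r * u powr r" using C by (intro mult_right_mono) auto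
      finally show ?thesis .
    qed
  qed
qed

end

section \<open>Extrapolation to Marcinkiewicz spaces\<close>

text \<open>\<open>locally_bounded\<close> controls the function on open intervals starting at 0
  only, so the Muckenhoupt constant inserted into it has to be strictly positive.\<close>

lemma Ap_norm_pos:
  assumes v: "v \<in> Ap p"
  shows "0 < Ap_norm p (v :: real ^ 'n \<Rightarrow> real)"
proof -
  have w: "weight v" using v by (simp add: Ap_def)
  then have [measurable]: "v \<in> borel_measurable lebesgue" and pos: "AE x in lebesgue. 0 < v x" by (auto simp: weight_def)
  define Q :: "(real ^ 'n) set" where "Q = cube 0 1"
  have Q: "Q \<in> cubes" by (auto simp: Q_def)
  have Qm: "Q \<in> sets lebesgue" using Q by simp
  have a: "0 < avg Q (\<lambda>x. ennreal (v x))" by (rule weight_avg_pos[OF w Q])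
  show ?thesis
  proof (cases "p = 1")
    case True
    have "0 < esssup (lebesgue_on Q) (\<lambda>x. inverse (ennreal (v x)))"
    proof (rule ccontr)
      assume "\<not> ?thesis"
      then have "AE x in lebesgue_on Q. inverse (ennreal (v x)) \<le> 0"
        using esssup_AE[of "\<lambda>x. inverse (ennreal (v x))" "lebesgue_on Q"] by (simp add: not_less)
      then have "AE x in lebesgue. x \<in> Q \<longrightarrow> inverse (ennreal (v x)) \<le> 0"
        using Qm by (subst (asm) AE_restrict_space_iff) auto
      then have "AE x in lebesgue. x \<notin> Q" by eventually_elim (auto simp: ennreal_inverse_eq_0_iff)
      then have "Q \<in> null_sets lebesgue" using AE_iff_null_sets[OF Qm] by simp
      then show False using emeasure_cubes_pos[OF Q] by (simp add: null_sets_def)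
    qed
    then have "0 < avg Q (\<lambda>x. ennreal (v x)) * esssup (lebesgue_on Q) (\<lambda>x. inverse (ennreal (v x)))"
      using a by (simp add: ennreal_zero_less_mult_iff)
    also have "\<dots> \<le> Ap_norm p v" unfolding Ap_norm_def using True Q by (auto intro: SUP_upper)
    finally show ?thesis .
  next
    case False
    have "0 < avg Q (\<lambda>x. ennreal (v x powr (- 1 / (p - 1))))"
      by (rule avg_pos[OF Q]) (measurable, use pos in eventually_elim, simp)
    then have "0 < avg Q (\<lambda>x. ennreal (v x)) * enn_powr (avg Q (\<lambda>x. ennreal (v x powr (- 1 / (p - 1))))) (p - 1)"
      using a by (simp add: ennreal_zero_less_mult_iff)
    also have "\<dots> \<le> Ap_norm p v" unfolding Ap_norm_def using False Q by (auto intro: SUP_upper)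
    finally show ?thesis .
  qed
qed

lemma nn_integral_inverse_power:
  assumes "0 < e" "e < 1" "0 < t"
  shows "(\<integral>\<^sup>+s\<in>{0<..<t}. ennreal ((t / s) powr e) \<partial>lebesgue) \<le> ennreal (t / (1 - e))"
proof -
  have "((\<lambda>x. x powr (- e)) has_integral (t powr (- e + 1) / (- e + 1))) {0..t}"
    using assms by (intro has_integral_powr_from_0) auto
  then have "((\<lambda>x. t powr e * x powr (- e)) has_integral (t powr e * (t powr (- e + 1) / (- e + 1)))) {0..t}"
    by (rule has_integral_mult_right)
  also have "t powr e * (t powr (- e + 1) / (- e + 1)) = t / (1 - e)"
    using assms by (simp add: powr_add[symmetric])
  finally have "integral\<^sup>N lborel (\<lambda>x. ennreal (t powr e * x powr (- e)) * indicator {0..t} x) = ennreal (t / (1 - e))"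
    by (rule nn_integral_has_integral_lebesgue'[rotated]) simp
  then have I: "integral\<^sup>N lebesgue (\<lambda>x. ennreal (t powr e * x powr (- e)) * indicator {0..t} x) = ennreal (t / (1 - e))"
    by (simp add: nn_integral_completion)
  have "(\<integral>\<^sup>+s\<in>{0<..<t}. ennreal ((t / s) powr e) \<partial>lebesgue) \<le> integral\<^sup>N lebesgue (\<lambda>x. ennreal (t powr e * x powr (- e)) * indicator {0..t} x)"
  proof (intro nn_integral_mono)
    fix x
    show "ennreal ((t / x) powr e) * indicator {0<..<t} x \<le> ennreal (t powr e * x powr (- e)) * indicator {0..t} x"
      using assms by (cases "x \<in> {0<..<t}") (simp_all add: powr_divide powr_minus field_simps)
  qed
  then show ?thesis using I by simp
qed

lemma weak_Lp_norm_bound: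
  assumes p: "0 < p" and y: "0 < y" and E: "E \<subseteq> {x \<in> space M. ennreal y < g x}" "g \<in> borel_measurable M"
    and le: "weak_Lp_norm M p g \<le> c * Lp_norm M p f"
  shows "ennreal (y powr p) * emeasure M E \<le> enn_powr c p * (\<integral>\<^sup>+x. enn_powr (f x) p \<partial>M)"
proof -
  note E(2) [measurable]
  have "ennreal y * enn_powr (distr_fun M g (ennreal y)) (1 / p) \<le> weak_Lp_norm M p g"
    unfolding weak_Lp_norm_def using y by (intro SUP_upper) auto
  also note le
  finally have "enn_powr (ennreal y * enn_powr (distr_fun M g (ennreal y)) (1 / p)) p \<le> enn_powr (c * Lp_norm M p f) p"
    using p by (intro enn_powr_mono) auto
  then have "ennreal (y powr p) * distr_fun M g (ennreal y) \<le> enn_powr c p * (\<integral>\<^sup>+x. enn_powr (f x) p \<partial>M)"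
    using p y by (simp add: enn_powr_mult enn_powr_powr enn_powr_ennreal Lp_norm_def)
  moreover have "emeasure M E \<le> distr_fun M g (ennreal y)"
    unfolding distr_fun_def using E by (intro emeasure_mono) auto
  ultimately show ?thesis by (meson mult_left_mono order_trans zero_le)
qed

text \<open>A superlevel set of g may have infinite weight. Intersecting it with growing cubes, on
  which w is integrable, keeps the weight finite but still above s.\<close>

lemma exists_finite_subset_weighted:
  fixes w :: "real ^ 'n \<Rightarrow> real"
  assumes w: "weight w" and g: "g \<in> borel_measurable lebesgue" and s: "s < distr_fun (weighted w) g y"
  obtains E where "E \<in> sets lebesgue" "E \<subseteq> {x. y < g x}" "s < emeasure (weighted w) E" "emeasure (weighted w) E < \<infinity>"
proof -
  define Q :: "nat \<Rightarrow> (real ^ 'n) set" where "Q k = cube (\<chi> i. - (real k + 1)) (2 * (real k + 1))" for k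
  have Q: "Q k \<in> cubes" for k by (auto simp: Q_def)
  define E where "E k = {x. y < g x} \<inter> Q k" for k
  have "g -` {y<..} \<inter> space lebesgue \<in> sets lebesgue" using g by (rule measurable_sets) simp
  also have "g -` {y<..} \<inter> space lebesgue = {x. y < g x}" by auto
  finally have Em: "E k \<in> sets lebesgue" for k using sets_cubes[OF Q[of k]] unfolding E_def by (rule sets.Int)
  have memQ: "x \<in> Q k \<longleftrightarrow> (\<forall>i. \<bar>x $ i\<bar> \<le> real k + 1)" for x k
    unfolding Q_def mem_cube by (auto simp: abs_le_iff algebra_simps) (smt (verit))+
  have "distr_fun (weighted w) g y = emeasure (weighted w) (\<Union>k. E k)"
  proof -
    have "{x. y < g x} = (\<Union>k. E k)"
    proof safe
      fix x assume x: "y < g x"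
      obtain k where k: "norm x \<le> real k" using real_arch_simple by blast
      have "\<bar>x $ i\<bar> \<le> real k + 1" for i using component_le_norm_cart[of x i] k by linarith
      then have "x \<in> E k" using x by (simp add: E_def memQ)
      then show "x \<in> (\<Union>k. E k)" by blast
    qed (auto simp: E_def)
    then show ?thesis by (simp add: distr_fun_def)
  qed
  also have "\<dots> = (SUP k. emeasure (weighted w) (E k))"
  proof (rule SUP_emeasure_incseq[symmetric])
    show "incseq E" unfolding E_def incseq_def by (auto simp: memQ) (rule order_trans, erule spec, simp)
  qed (use Em in auto)
  finally obtain k where k: "s < emeasure (weighted w) (E k)" using s by (auto simp: less_SUP_iff)
  have wm: "w \<in> borel_measurable lebesgue" using w by (simp add: weight_def)
  have "emeasure (weighted w) (E k) \<le> emeasure (weighted w) (Q k)"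
    using Q[of k] by (intro emeasure_mono) (auto simp: E_def)
  also have "\<dots> = (\<integral>\<^sup>+x\<in>Q k. ennreal (w x) \<partial>lebesgue)"
    unfolding weighted_def using wm Q[of k] by (intro emeasure_density) auto
  also have "\<dots> < \<infinity>" using w Q[of k] by (auto simp: weight_def)
  finally have fin: "emeasure (weighted w) (E k) < \<infinity>" .
  have "E k \<subseteq> {x. y < g x}" by (simp add: E_def)
  then show ?thesis using that[OF Em _ k fin] by simp
qed

context rep_space
begin

text \<open>The step of height y on (0, s) lies below the weighted rearrangement of f; this is the
  weak type embedding of X in terms of its fundamental function.\<close>

lemma phi_le_X_norm:
  assumes f: "f \<in> borel_measurable lebesgue" and w: "weight w" and y: "0 \<le> y" and s: "ennreal s \<le> distr_fun (weighted w) f (ennreal y)"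
  shows "ennreal y * \<phi> s \<le> X_norm \<rho> w f"
proof -
  have fw: "f \<in> borel_measurable (weighted w)" using f by simp
  have "ennreal y * \<phi> s = \<sigma> (\<lambda>x. ennreal y * indicator {0<..<s} x)"
    unfolding \<phi>_def using y by (intro S.norm_cmult[symmetric] borel_measurable_indicator sets_initial)
  also have "\<dots> \<le> \<sigma> (rearr (weighted w) f)"
  proof (intro S.norm_mono measurable_rearr fw)
    show "(\<lambda>x. ennreal y * indicator {0<..<s} x) \<in> borel_measurable halfline"
      by (intro borel_measurable_times_ennreal borel_measurable_const borel_measurable_indicator sets_initial)
    fix x assume "x \<in> space halfline"
    show "ennreal y * indicator {0<..<s} x \<le> rearr (weighted w) f x"
    proof (cases "x \<in> {0<..<s}")
      case True
      then have "ennreal x < ennreal s" by (auto simp: ennreal_less_iff)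
      with s have "ennreal x < distr_fun (weighted w) f (ennreal y)" by order
      then have "ennreal y < rearr (weighted w) f x" by (simp only: rearr_less_iff[OF fw])
      then show ?thesis using True by simp
    qed simp
  qed
  finally show ?thesis by (simp add: X_norm_def)
qed

text \<open>If a level set exceeded the claimed size s, the weak type embedding together with the
  comparison of the fundamental function at t and at s would give D z <= H(t/s), against the power
  bounds from the Boyd indices. The normalising factor c/(x D) is chosen so that the tail constant
  is exactly t.\<close>

lemma two_tail_of_X_norm:
  assumes p: "0 < p" "p \<le> q" and D: "1 \<le> D"
    and HD: "\<And>u. 1 \<le> u \<Longrightarrow> H u \<le> D * u powr (1 / p)" "\<And>u. 0 < u \<Longrightarrow> u \<le> 1 \<Longrightarrow> H u \<le> D * u powr (1 / q)"
    and f: "f \<in> borel_measurable lebesgue" and w: "weight w" and X: "X_norm \<rho> w f \<le> ennreal x" "0 < x" and t: "0 < t"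
    and c: "\<phi> t = ennreal c" "0 < c"
  shows "two_tail (weighted w) (\<lambda>z. ennreal (c / (x * D)) * f z) (ennreal t) p q"
  unfolding two_tail_def
proof (intro allI impI)
  fix z :: real assume z: "0 < z"
  define L where "L = x * D / c"
  have L: "0 < L" using X c D by (simp add: L_def)
  have lev: "distr_fun (weighted w) (\<lambda>z. ennreal (c / (x * D)) * f z) (ennreal z) = distr_fun (weighted w) f (ennreal (L * z))"
  proof -
    have "(ennreal z < ennreal (c / (x * D)) * u) = (ennreal (L * z) < u)" for u
    proof (cases u)
      case (real r)
      have "z < c / (x * D) * r \<longleftrightarrow> L * z < r" using X c D by (simp add: L_def field_simps)
      then show ?thesis using real X c D z L by (simp add: ennreal_mult[symmetric] ennreal_less_iff)
    next
      case top
      then show ?thesis using X c D by (auto simp: ennreal_mult_top)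
    qed
    then show ?thesis by (simp add: distr_fun_def)
  qed
  show "distr_fun (weighted w) (\<lambda>z. ennreal (c / (x * D)) * f z) (ennreal z) \<le> ennreal t * ennreal (z powr - p + z powr - q)"
  proof (rule ccontr)
    define s where "s = t * (z powr - p + z powr - q)"
    have s: "0 < s" using t z by (simp add: s_def add_pos_pos)
    assume "\<not> ?thesis"
    then have "ennreal s \<le> distr_fun (weighted w) f (ennreal (L * z))"
      using t by (simp add: lev s_def ennreal_mult[symmetric] del: ennreal_plus)
    then have "ennreal (L * z) * \<phi> s \<le> ennreal x"
      using phi_le_X_norm[OF f w, of "L * z" s] X(1) L z by (meson less_imp_le mult_pos_pos order_trans)
    moreover obtain d where d: "\<phi> s = ennreal d" "0 < d"
      using phi_pos[OF s] phi_finite[of s] by (cases "\<phi> s") (auto simp: less_le)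
    ultimately have 1: "L * z * d \<le> x" using L z X by (simp add: ennreal_mult[symmetric])
    have "\<phi> (t / s * s) \<le> h (t / s) * \<phi> s" using t s by (intro phi_dilate) auto
    then have 2: "c \<le> H (t / s) * d" using c d s t H_pos[of "t / s"] by (simp add: h_eq_H ennreal_mult[symmetric])
    have "x * D * z * d \<le> x * c" using 1 c by (simp add: L_def field_simps)
    then have "D * z * d \<le> c" using X(2) by (simp add: mult.assoc)
    with 2 have "D * z * d \<le> H (t / s) * d" by simp
    then have Hz: "D * z \<le> H (t / s)" using d(2) by simp
    have ts: "t / s = 1 / (z powr - p + z powr - q)" using t by (simp add: s_def)
    show False
    \<comment> \<open>In either range the power bound for H makes one power of z times the full sum
      at most 1. The matching summand alone already contributes 1, so the other, positive one is the
      contradiction.\<close>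
    proof (cases "1 \<le> t / s")
      case True
      have "D * z \<le> D * (t / s) powr (1 / p)" using Hz HD(1)[OF True] by simp
      then have "z \<le> (t / s) powr (1 / p)" using D by simp
      then have "z powr p \<le> ((t / s) powr (1 / p)) powr p" using z p by (intro powr_mono2) auto
      then have "z powr p \<le> t / s" using p t s by (simp add: powr_powr)
      then have "z powr p * (z powr - p + z powr - q) \<le> 1" using ts z by (simp add: pos_le_divide_eq add_pos_pos)
      moreover have "z powr p * (z powr - p + z powr - q) = 1 + z powr (p - q)" using z by (simp add: distrib_left powr_add[symmetric])
      moreover have "0 < z powr (p - q)" using z by simp
      ultimately show False by simp
    next
      case False
      have q: "0 < q" using p by simp
      have "D * z \<le> D * (t / s) powr (1 / q)" using Hz HD(2)[of "t / s"] False t s by simp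
      then have "z \<le> (t / s) powr (1 / q)" using D by simp
      then have "z powr q \<le> ((t / s) powr (1 / q)) powr q" using z q by (intro powr_mono2) auto
      then have "z powr q \<le> t / s" using q t s by (simp add: powr_powr)
      then have "z powr q * (z powr - p + z powr - q) \<le> 1" using ts z by (simp add: pos_le_divide_eq add_pos_pos)
      moreover have "z powr q * (z powr - p + z powr - q) = 1 + z powr (q - p)" using z by (simp add: distrib_left powr_add[symmetric])
      moreover have "0 < z powr (q - p)" using z by simp
      ultimately show False by simp
    qed
  qed
qed

text \<open>Here the lower Boyd index has to exceed 1.\<close>

lemma Marcinkiewicz_norm_le:
  assumes p: "1 < p" and D: "1 \<le> D" and HD: "\<And>u. 1 \<le> u \<Longrightarrow> H u \<le> D * u powr (1 / p)" and A: "0 < A"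
    and g: "g \<in> borel_measurable lebesgue"
    and weak: "\<And>y s. 0 < y \<Longrightarrow> 0 < s \<Longrightarrow> ennreal s < distr_fun (weighted w) g (ennreal y) \<Longrightarrow> ennreal y * \<phi> s \<le> ennreal A"
  shows "Marcinkiewicz_norm \<rho> w g \<le> ennreal (D / (1 - 1 / p) * A)"
  unfolding Marcinkiewicz_norm_def
proof (rule SUP_least)
  fix t :: real assume "t \<in> {0<..}"
  then have t: "0 < t" by simp
  have gw: "g \<in> borel_measurable (weighted w)" using g by simp
  obtain c where c: "\<phi> t = ennreal c" "0 < c" using phi_pos[OF t] phi_finite[of t] by (cases "\<phi> t") (auto simp: less_le)
  have pt: "rearr (weighted w) g s \<le> ennreal (A * D / c) * ennreal ((t / s) powr (1 / p))" if s: "0 < s" "s < t" for s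
  proof (rule ccontr)
    obtain d where d: "\<phi> s = ennreal d" "0 < d" using phi_pos[OF s(1)] phi_finite[of s] by (cases "\<phi> s") (auto simp: less_le)
    define b where "b = A * D / c * (t / s) powr (1 / p)"
    have b: "0 < b" using A D c s t by (simp add: b_def)
    assume "\<not> ?thesis"
    then have "ennreal b < rearr (weighted w) g s"
      using A D c by (simp add: b_def ennreal_mult[symmetric])
    then have "ennreal s < distr_fun (weighted w) g (ennreal b)" by (simp only: rearr_less_iff[OF gw])
    \<comment> \<open>A level strictly above b makes the final chain A <= b d < y d strict, against
      y d <= A.\<close>
    then obtain y where y: "b < y" "ennreal s < distr_fun (weighted w) g (ennreal y)"
    proof -
      obtain r where r: "ennreal b < ennreal (real_of_rat r)" "ennreal (real_of_rat r) < rearr (weighted w) g s"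
        using ennreal_rat_dense[OF \<open>ennreal b < rearr (weighted w) g s\<close>] by blast
      have "b < real_of_rat r" using r(1) b by (simp add: ennreal_less_iff)
      moreover have "ennreal s < distr_fun (weighted w) g (ennreal (real_of_rat r))" using r(2) by (simp only: rearr_less_iff[OF gw])
      ultimately show ?thesis by (rule that)
    qed
    have "ennreal y * \<phi> s \<le> ennreal A" using y b s by (intro weak) auto
    then have yd: "y * d \<le> A" using d y b A by (simp add: ennreal_mult[symmetric])
    have "\<phi> (t / s * s) \<le> h (t / s) * \<phi> s" using t s by (intro phi_dilate) auto
    then have "c \<le> H (t / s) * d" using c d s t H_pos[of "t / s"] by (simp add: h_eq_H ennreal_mult[symmetric])
    also have "\<dots> \<le> D * (t / s) powr (1 / p) * d" using HD[of "t / s"] s d by (intro mult_right_mono) auto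
    finally have "c * A \<le> D * (t / s) powr (1 / p) * d * A" using A by simp
    then have "A \<le> b * d" using c by (simp add: b_def field_simps)
    also have "\<dots> < y * d" using y d by simp
    finally show False using yd by simp
  qed
  have "(\<integral>\<^sup>+s\<in>{0<..<t}. rearr (weighted w) g s \<partial>lebesgue) \<le> (\<integral>\<^sup>+s. ennreal (A * D / c) * (ennreal ((t / s) powr (1 / p)) * indicator {0<..<t} s) \<partial>lebesgue)"
    using pt by (intro nn_integral_mono) (auto simp: indicator_def)
  also have "\<dots> = ennreal (A * D / c) * (\<integral>\<^sup>+s\<in>{0<..<t}. ennreal ((t / s) powr (1 / p)) \<partial>lebesgue)"
  proof (rule nn_integral_cmult)
    have "(\<lambda>s. ennreal ((t / s) powr (1 / p)) * indicator {0<..<t} s) \<in> borel_measurable borel" by measurable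
    then show "(\<lambda>s. ennreal ((t / s) powr (1 / p)) * indicator {0<..<t} s) \<in> borel_measurable lebesgue"
      by (simp add: measurable_completion)
  qed
  also have "\<dots> \<le> ennreal (A * D / c) * ennreal (t / (1 - 1 / p))"
    using p t by (intro mult_left_mono nn_integral_inverse_power) auto
  finally have "\<phi> t * rearr_avg (weighted w) g t \<le> ennreal c * (ennreal (1 / t) * (ennreal (A * D / c) * ennreal (t / (1 - 1 / p))))"
    unfolding rearr_avg_def c(1) by (intro mult_left_mono) auto
  also have "\<dots> = ennreal (D / (1 - 1 / p) * A)"
    using c t A D p by (simp add: ennreal_mult[symmetric] field_simps)
  finally show "fundamental_fun \<rho> t * rearr_avg (weighted w) g t \<le> ennreal (D / (1 - 1 / p) * A)"
    by (simp add: fundamental_fun_eq[OF t])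
qed

text \<open>One constant for all weights whose A_P norm is at most K; the function of the norm in
  the final statement arises by letting K vary.\<close>

lemma extrapolation_bound:
  assumes p0: "1 \<le> p\<^sub>0" and lb: "locally_bounded \<Phi>" and P: "boyd_p \<rho> = ereal P" "1 < P" and Q: "boyd_q \<rho> = ereal Q" "P \<le> Q" and K: "1 \<le> K"
  shows "\<exists>C>0. \<forall>f g. f \<in> borel_measurable lebesgue \<longrightarrow> g \<in> borel_measurable lebesgue \<longrightarrow>
    (\<forall>w\<in>Ap p\<^sub>0. weak_Lp_norm (weighted w) p\<^sub>0 g \<le> \<Phi> (enn2real (Ap_norm p\<^sub>0 w)) * Lp_norm (weighted w) p\<^sub>0 f) \<longrightarrow>
    (\<forall>w\<in>Ap P. Ap_norm P w \<le> ennreal K \<longrightarrow> Marcinkiewicz_norm \<rho> w g \<le> ennreal C * X_norm \<rho> w f)"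
proof -
  define q where "q = Q + 1"
  have q: "P \<le> q" "0 < Q" "Q < q" using P Q by (auto simp: q_def)
  show ?thesis
  proof (rule weighted_extrapolation[OF P(2) q(1) p0 K, where 'n = 'n])
    fix p2 K0 :: real
    assume p2: "1 < p2" "p2 < P" and K0: "0 < K0"
      and core: "\<And>B N. 0 < B \<Longrightarrow> 0 \<le> N \<Longrightarrow> \<exists>C>0. \<forall>(w :: real ^ 'n \<Rightarrow> real) f E y. weight w \<longrightarrow> ap_bound P (ennreal K) w \<longrightarrow>
        f \<in> borel_measurable lebesgue \<longrightarrow> E \<in> sets lebesgue \<longrightarrow>
        0 < emeasure (weighted w) E \<longrightarrow> emeasure (weighted w) E < top \<longrightarrow>
        two_tail (weighted w) f (ennreal B * emeasure (weighted w) E) p2 q \<longrightarrow> 0 < y \<longrightarrow>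
        (\<forall>v\<in>Ap p\<^sub>0. Ap_norm p\<^sub>0 v \<le> ennreal K0 \<longrightarrow>
          ennreal (y powr p\<^sub>0) * emeasure (weighted v) E \<le> ennreal N * (\<integral>\<^sup>+x. enn_powr (f x) p\<^sub>0 \<partial>weighted v)) \<longrightarrow>
        y \<le> C"
    have P0: "0 < P" using P by simp
    have "1 / P < 1 / p2" using p2 by (intro divide_strict_left_mono) auto
    then obtain D1 where D1: "1 \<le> D1" "\<And>u. 1 \<le> u \<Longrightarrow> H u \<le> D1 * u powr (1 / p2)" using boyd_p_bound[OF P(1) P0] by blast
    have "0 \<le> 1 / q" "1 / q < 1 / Q" using q by (auto intro!: divide_strict_left_mono)
    then obtain D2 where D2: "1 \<le> D2" "\<And>u. 0 < u \<Longrightarrow> u \<le> 1 \<Longrightarrow> H u \<le> D2 * u powr (1 / q)" using boyd_q_bound[OF Q(1) q(2)] by blast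
    define D where "D = max D1 D2"
    have D: "1 \<le> D" using D1(1) by (simp add: D_def)
    have HD1: "H u \<le> D * u powr (1 / p2)" if "1 \<le> u" for u
      by (rule order_trans[OF D1(2)[OF that]]) (auto simp: D_def intro: mult_right_mono)
    have HD2: "H u \<le> D * u powr (1 / q)" if "0 < u" "u \<le> 1" for u
      by (rule order_trans[OF D2(2)[OF that]]) (auto simp: D_def intro: mult_right_mono)
    \<comment> \<open>All test weights have norm at most K0. The interval is open, so it is extended
      to K0 + 1 in order to include K0 itself.\<close>
    define B\<Phi> where "B\<Phi> = (SUP t\<in>{0<..<K0 + 1}. \<Phi> t)"
    have "B\<Phi> < \<infinity>" using lb K0 by (simp add: locally_bounded_def B\<Phi>_def)
    then obtain N where N: "enn_powr B\<Phi> p\<^sub>0 = ennreal N" "0 \<le> N" by (cases "enn_powr B\<Phi> p\<^sub>0") (auto simp: less_top[symmetric])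
    obtain C where C: "0 < C" and core1: "\<And>(w :: real ^ 'n \<Rightarrow> real) f E y. weight w \<Longrightarrow> ap_bound P (ennreal K) w \<Longrightarrow>
        f \<in> borel_measurable lebesgue \<Longrightarrow> E \<in> sets lebesgue \<Longrightarrow>
        0 < emeasure (weighted w) E \<Longrightarrow> emeasure (weighted w) E < top \<Longrightarrow>
        two_tail (weighted w) f (ennreal 1 * emeasure (weighted w) E) p2 q \<Longrightarrow> 0 < y \<Longrightarrow>
        (\<forall>v\<in>Ap p\<^sub>0. Ap_norm p\<^sub>0 v \<le> ennreal K0 \<longrightarrow>
          ennreal (y powr p\<^sub>0) * emeasure (weighted v) E \<le> ennreal N * (\<integral>\<^sup>+x. enn_powr (f x) p\<^sub>0 \<partial>weighted v)) \<Longrightarrow>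
        y \<le> C"
      using core[of 1 N] N(2) by auto
    define CC where "CC = D / (1 - 1 / p2) * (C * D)"
    have CC: "0 < CC" using C D p2 by (simp add: CC_def)
    have "Marcinkiewicz_norm \<rho> w g \<le> ennreal CC * X_norm \<rho> w f"
      if f [measurable]: "f \<in> borel_measurable lebesgue" and g [measurable]: "g \<in> borel_measurable lebesgue"
        and hyp: "\<forall>w\<in>Ap p\<^sub>0. weak_Lp_norm (weighted w) p\<^sub>0 g \<le> \<Phi> (enn2real (Ap_norm p\<^sub>0 w)) * Lp_norm (weighted w) p\<^sub>0 f"
        and wA: "w \<in> Ap P" and wK: "Ap_norm P w \<le> ennreal K" for f g :: "real ^ 'n \<Rightarrow> ennreal" and w
    proof -
      have w: "weight w" using wA by (simp add: Ap_def)
      have ap: "ap_bound P (ennreal K) w" using ap_bound_le[OF ap_bound_Ap_norm wK] P by simp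
      \<comment> \<open>The estimate is proved for every positive x above the norm. This permits the
        division by x in the normalisation, and letting x tend to 0 settles the case of norm
        zero.\<close>
      have bound: "Marcinkiewicz_norm \<rho> w g \<le> ennreal (CC * x)" if x: "0 < x" "X_norm \<rho> w f \<le> ennreal x" for x
      proof -
        have weak: "ennreal y * \<phi> s \<le> ennreal (C * D * x)"
          if y: "0 < y" and s: "0 < s" and lt: "ennreal s < distr_fun (weighted w) g (ennreal y)" for y s
        proof -
          obtain E where E: "E \<in> sets lebesgue" "E \<subseteq> {x. ennreal y < g x}" "ennreal s < emeasure (weighted w) E" "emeasure (weighted w) E < \<infinity>"
            by (rule exists_finite_subset_weighted[OF w g lt])
          obtain t where t: "emeasure (weighted w) E = ennreal t" "0 \<le> t" using E(4) by (cases "emeasure (weighted w) E") auto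
          have st: "s < t" using E(3) t s by (simp add: ennreal_less_iff)
          have t0: "0 < t" using st s by simp
          obtain c where c: "\<phi> t = ennreal c" "0 < c" using phi_pos[OF t0] phi_finite[of t] by (cases "\<phi> t") (auto simp: less_le)
          define k where "k = c / (x * D)"
          have k: "0 < k" using c x D by (simp add: k_def)
          \<comment> \<open>The core estimate is used for k f at level y k. The hypothesis is
            homogeneous: both of its sides are multiplied by the power \<open>p\<^sub>0\<close> of
            k.\<close>
          have "y * k \<le> C"
          proof (rule core1[OF w ap _ E(1)])
            show "(\<lambda>z. ennreal k * f z) \<in> borel_measurable lebesgue" by measurable
            show "0 < emeasure (weighted w) E" "emeasure (weighted w) E < top" using t t0 by auto
            show "two_tail (weighted w) (\<lambda>z. ennreal k * f z) (ennreal 1 * emeasure (weighted w) E) p2 q"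
              unfolding t(1) k_def using two_tail_of_X_norm[OF _ _ D HD1 HD2 f w x(2,1) t0 c] p2 q by simp
            show "0 < y * k" using y k by simp
            show "\<forall>v\<in>Ap p\<^sub>0. Ap_norm p\<^sub>0 v \<le> ennreal K0 \<longrightarrow>
              ennreal ((y * k) powr p\<^sub>0) * emeasure (weighted v) E \<le> ennreal N * (\<integral>\<^sup>+x. enn_powr (ennreal k * f x) p\<^sub>0 \<partial>weighted v)"
            proof (intro ballI impI)
              fix v :: "real ^ 'n \<Rightarrow> real" assume v: "v \<in> Ap p\<^sub>0" "Ap_norm p\<^sub>0 v \<le> ennreal K0"
              have vm: "v \<in> borel_measurable lebesgue" using v by (simp add: Ap_def weight_def)
              have "0 < enn2real (Ap_norm p\<^sub>0 v)" "enn2real (Ap_norm p\<^sub>0 v) \<le> K0"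
                using Ap_norm_pos[OF v(1)] v(2) K0 by (auto simp: enn2real_positive_iff enn2real_leI intro: le_less_trans)
              then have "\<Phi> (enn2real (Ap_norm p\<^sub>0 v)) \<le> B\<Phi>" unfolding B\<Phi>_def by (intro SUP_upper) auto
              then have "enn_powr (\<Phi> (enn2real (Ap_norm p\<^sub>0 v))) p\<^sub>0 \<le> ennreal N" unfolding N(1)[symmetric] using p0 by (intro enn_powr_mono) auto
              moreover have "ennreal (y powr p\<^sub>0) * emeasure (weighted v) E \<le> enn_powr (\<Phi> (enn2real (Ap_norm p\<^sub>0 v))) p\<^sub>0 * (\<integral>\<^sup>+x. enn_powr (f x) p\<^sub>0 \<partial>weighted v)"
                using p0 y E(2) hyp v(1) by (intro weak_Lp_norm_bound[of _ _ _ _ g]) auto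
              ultimately have "ennreal (y powr p\<^sub>0) * emeasure (weighted v) E \<le> ennreal N * (\<integral>\<^sup>+x. enn_powr (f x) p\<^sub>0 \<partial>weighted v)"
                by (meson mult_right_mono order_trans zero_le)
              then have "ennreal (k powr p\<^sub>0) * (ennreal (y powr p\<^sub>0) * emeasure (weighted v) E) \<le> ennreal (k powr p\<^sub>0) * (ennreal N * (\<integral>\<^sup>+x. enn_powr (f x) p\<^sub>0 \<partial>weighted v))"
                by (rule mult_left_mono) simp
              moreover have "ennreal ((y * k) powr p\<^sub>0) = ennreal (k powr p\<^sub>0) * ennreal (y powr p\<^sub>0)"
                using y k by (simp add: powr_mult ennreal_mult mult.commute)
              moreover have "(\<integral>\<^sup>+x. enn_powr (ennreal k * f x) p\<^sub>0 \<partial>weighted v) = ennreal (k powr p\<^sub>0) * (\<integral>\<^sup>+x. enn_powr (f x) p\<^sub>0 \<partial>weighted v)"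
                using p0 k by (simp add: enn_powr_mult enn_powr_ennreal nn_integral_cmult)
              ultimately show "ennreal ((y * k) powr p\<^sub>0) * emeasure (weighted v) E \<le> ennreal N * (\<integral>\<^sup>+x. enn_powr (ennreal k * f x) p\<^sub>0 \<partial>weighted v)"
                by (simp add: mult_ac)
            qed
          qed
          then have "y * c \<le> C * D * x" using x D by (simp add: k_def field_simps)
          then have "ennreal y * \<phi> t \<le> ennreal (C * D * x)" using c y by (simp add: ennreal_mult[symmetric] ennreal_leI)
          moreover have "ennreal y * \<phi> s \<le> ennreal y * \<phi> t" using st by (intro mult_left_mono phi_mono) auto
          ultimately show ?thesis by order
        qed
        have "Marcinkiewicz_norm \<rho> w g \<le> ennreal (D / (1 - 1 / p2) * (C * D * x))"
          using C D x weak by (intro Marcinkiewicz_norm_le p2 HD1 g) auto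
        then show ?thesis by (simp add: CC_def mult.assoc)
      qed
      show ?thesis
      proof (cases "X_norm \<rho> w f")
        case top
        then show ?thesis using CC by (simp add: ennreal_mult_top)
      next
        case (real x)
        show ?thesis
        proof (cases "x = 0")
          case False
          then show ?thesis using bound[of x] real CC by (simp add: ennreal_mult)
        next
          case True
          have "Marcinkiewicz_norm \<rho> w g \<le> 0"
          proof (rule ennreal_le_epsilon)
            fix e :: real assume "0 < e"
            then show "Marcinkiewicz_norm \<rho> w g \<le> 0 + ennreal e" using bound[of "e / CC"] real True CC by simp
          qed
          then show ?thesis by (simp add: real True)
        qed
      qed
    qed
    then show ?thesis using CC by blast
  qed
qed

end

theorem theorem3p17:
  fixes p\<^sub>0 :: real and \<phi> :: "real \<Rightarrow> ennreal"
    and \<rho> :: "(real ^ 'n \<Rightarrow> ennreal) \<Rightarrow> ennreal"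
  assumes "1 \<le> p\<^sub>0"
    and "locally_bounded \<phi>"
    and "ri_norm lebesgue \<rho>"
    and "1 < boyd_p \<rho>" and "boyd_p \<rho> \<le> boyd_q \<rho>" and "boyd_q \<rho> < \<infinity>"
  shows "\<exists>C :: real \<Rightarrow> real. (\<forall>t. 0 < C t) \<and>
    (\<forall>f g :: real ^ 'n \<Rightarrow> ennreal.
       f \<in> borel_measurable lebesgue \<longrightarrow> g \<in> borel_measurable lebesgue \<longrightarrow>
       (\<forall>w\<in>Ap p\<^sub>0. weak_Lp_norm (weighted w) p\<^sub>0 g
          \<le> \<phi> (enn2real (Ap_norm p\<^sub>0 w)) * Lp_norm (weighted w) p\<^sub>0 f) \<longrightarrow>
       (\<forall>w\<in>Ap (real_of_ereal (boyd_p \<rho>)).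
          Marcinkiewicz_norm \<rho> w g
            \<le> ennreal (C (enn2real (Ap_norm (real_of_ereal (boyd_p \<rho>)) w))) * X_norm \<rho> w f))"
proof -
  interpret rep_space \<rho> by unfold_locales (rule assms(3))
  obtain P where P: "boyd_p \<rho> = ereal P" "1 < P"
    using assms(4,5,6) by (cases "boyd_p \<rho>") auto
  obtain Q where Q: "boyd_q \<rho> = ereal Q" "P \<le> Q"
    using assms(5,6) P by (cases "boyd_q \<rho>") auto
  \<comment> \<open>The bound K is required to be at least 1, hence the maximum; it also makes the
    constant function total and positive for all real t before choice is applied.\<close>
  have "\<forall>t. \<exists>C>0. \<forall>f g. f \<in> borel_measurable lebesgue \<longrightarrow> g \<in> borel_measurable lebesgue \<longrightarrow>
    (\<forall>w\<in>Ap p\<^sub>0. weak_Lp_norm (weighted w) p\<^sub>0 g \<le> \<phi> (enn2real (Ap_norm p\<^sub>0 w)) * Lp_norm (weighted w) p\<^sub>0 f) \<longrightarrow>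
    (\<forall>w\<in>Ap P. Ap_norm P w \<le> ennreal (max 1 t) \<longrightarrow> Marcinkiewicz_norm \<rho> w g \<le> ennreal C * X_norm \<rho> w f)"
    using extrapolation_bound[OF assms(1,2) P Q] by simp
  from choice[OF this] obtain C where C: "\<And>t. 0 < C t" "\<And>t f g w. f \<in> borel_measurable lebesgue \<Longrightarrow> g \<in> borel_measurable lebesgue \<Longrightarrow>
    \<forall>w\<in>Ap p\<^sub>0. weak_Lp_norm (weighted w) p\<^sub>0 g \<le> \<phi> (enn2real (Ap_norm p\<^sub>0 w)) * Lp_norm (weighted w) p\<^sub>0 f \<Longrightarrow>
    w \<in> Ap P \<Longrightarrow> Ap_norm P w \<le> ennreal (max 1 t) \<Longrightarrow> Marcinkiewicz_norm \<rho> w g \<le> ennreal (C t) * X_norm \<rho> w f"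
    by blast
  have le: "Ap_norm P w \<le> ennreal (max 1 (enn2real (Ap_norm P w)))" if "w \<in> Ap P" for w :: "real ^ 'n \<Rightarrow> real"
  proof -
    have "Ap_norm P w = ennreal (enn2real (Ap_norm P w))" using that by (simp add: Ap_def)
    also have "\<dots> \<le> ennreal (max 1 (enn2real (Ap_norm P w)))" by (intro ennreal_leI) simp
    finally show ?thesis .
  qed
  show ?thesis
    using C le by (intro exI[of _ C]) (simp add: P(1))
qed

end
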